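(* Let $\nu\ge 1$ and let $X$ be the random grain model on $\mathbb{R}^\nu$ with generic grain $\Xi$. Let $1<\alpha<2$ and assume that: (a) $\mathrm{P}(\mathrm{Leb}_\nu(\Xi)>x)\sim c_\Xi\, x^{-\alpha}$ as $x\to\infty$, for some constant $c_\Xi>0$; (b) $\mathrm{E}\,\mathrm{Leb}_\nu\big(\Xi\cap\{\boldsymbol{t}\in\mathbb{R}^\nu:|\boldsymbol{t}|>\lambda\}\big)=o\big(\lambda^{(1-\alpha)\nu/\alpha}\big)$ as $\lambda\to\infty$. Then for any $\phi\in\Phi:=L^1(\mathbb{R}^\nu)\cap L^\infty(\mathbb{R}^\nu)$, as $\lambda\to\infty$, $$\lambda^{-\nu/\alpha}\big(X_\lambda(\phi)-\mathrm{E}X_\lambda(\phi)\big)\ \stackrel{d}{\longrightarrow}\ L_\alpha(\phi)$$ and $$\Big\{\lambda^{-\nu/\alpha}\big(\widehat X_{\lambda,k}(\phi)-\mathrm{E}\widehat X_{\lambda,k}(\phi)\big);\ k\ge1\Big\}\ \stackrel{fdd}{\longrightarrow}\ \Big\{\mathrm{e}^{-\mu}\frac{\mu^{k-1}}{(k-1)!}\,L_\alpha(\phi);\ k\ge 1\Big\},$$ where $\mu=\mathrm{E}\,\mathrm{Leb}_\nu(\Xi)$ and $L_\alpha(\phi)$ is an $\alpha$-stable random variable (the same one for all $k$) with log-characteristic function $$\log\mathrm{E}\,\mathrm{e}^{\mathrm{i}\theta L_\alpha(\phi)}=\mathrm{i}\,c_\Xi\int_{\mathbb{R}^\nu}\t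heta\phi(\boldsymbol{s})\Big\{\int_0^\infty\big(\mathrm{e}^{\mathrm{i}\theta\phi(\boldsymbol{s})x}-1\big)x^{-\alpha}\,\mathrm{d}x\Big\}\mathrm{d}\boldsymbol{s},\qquad\theta\in\mathbb{R}.$$
   Context: $\mathrm{Leb}_\nu$ is Lebesgue measure on $\mathbb{R}^\nu$, $|\cdot|$ the Euclidean norm, $\mathbb{I}$ an indicator. A random closed set is a measurable map from a complete probability space into the space of closed subsets of $\mathbb{R}^\nu$ with the Borel $\sigma$-algebra of the Fell topology. A random grain is a random closed set $\Xi\subset\mathbb{R}^\nu$ with $\mu:=\mathrm{E}\,\mathrm{Leb}_\nu(\Xi)<\infty$. Random grain model: let $\{\boldsymbol{u}_j;j\ge1\}$ be a stationary Poisson point process on $\mathbb{R}^\nu$ with unit intensity and let $\{\Xi,\Xi_j;j\ge1\}$ be i.i.d. random grains, independent of $\{\boldsymbol{u}_j\}$. The random grain model with generic grain $\Xi$ is $$X(\boldsymbol{t})=\sum_{j=1}^\infty\mathbb{I}\big(\boldsymbol{t}\in(\boldsymbol{u}_j+\Xi_j)\big),\qquad\boldsymbol{t}\in\mathbb{R}^\nu .$$ For $k\ge1$ set $\widehat X_k(\boldsymbol{t})=\mathbb{I}(X(\boldsymbol{t})\ge k)$. For $\lambda>0$ and real-valued $\phi\in L^1(\mathbb{R}^\nu)\cap L^\infty(\mathbb{R}^\nu)$, $$X_\lambda(\phi)=\int_{\mathbb{R}^\nu}\phi(\boldsymbol{t}/\lambda)X(\boldsymbol{t})\,\mathrm{d}\boldsymbol{t},\qquad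 \widehat X_{\lambda,k}(\phi)=\int_{\mathbb{R}^\nu}\phi(\boldsymbol{t}/\lambda)\widehat X_k(\boldsymbol{t})\,\mathrm{d}\boldsymbol{t}.$$ $\stackrel{d}{\to}$ denotes convergence in distribution and $\stackrel{fdd}{\to}$ convergence of finite-dimensional distributions (for every finite set of indices $k$, joint convergence in distribution of the corresponding vectors). *)

theory Defs
  imports "HOL-Probability.Probability" "HOL-Library.Landau_Symbols"
begin

section \<open>Random closed sets\<close>

text \<open>The points of the Fell topology are the closed subsets (the empty one included). Its subbase
  consists of the families of closed sets missing a given compact set and of those hitting a given
  open set.\<close>

definition fell_topology :: "'a::topological_space set topology" where
  "fell_topology = topology_generated_by
     ({{F. closed F \<and> F \<inter> K = {}} | K. compact K} \<union> {{F. closed F \<and> F \<inter> G \<noteq> {}} | G. open G})"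

lemma topspace_fell_topology [simp]: "topspace fell_topology = {F. closed F}"
proof -
  have "{F::'a set. closed F} = {F. closed F \<and> F \<inter> {} = {}}" by simp
  then have "{F::'a set. closed F} \<in> {{F. closed F \<and> F \<inter> K = {}} | K. compact K}"
    using compact_empty by blast
  then show ?thesis
    unfolding fell_topology_def topology_generated_by_topspace by blast
qed

definition borel_of :: "'a topology \<Rightarrow> 'a measure" where
  "borel_of T = sigma (topspace T) {U. openin T U}"

definition random_closed_set :: "'w measure \<Rightarrow> ('w \<Rightarrow> 'a::topological_space set) \<Rightarrow> bool" where
  "random_closed_set M \<Xi> \<longleftrightarrow> \<Xi> \<in> measurable M (borel_of fell_topology)"

definition random_grain :: "'w measure \<Rightarrow> ('w \<Rightarrow> 'a::euclidean_space set) \<Rightarrow> bool" where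
  "random_grain M \<Xi> \<longleftrightarrow>
     random_closed_set M \<Xi> \<and> (\<integral>\<^sup>+ \<omega>. emeasure lborel (\<Xi> \<omega>) \<partial>M) < \<infinity>"

definition mean_volume :: "'w measure \<Rightarrow> ('w \<Rightarrow> 'a::euclidean_space set) \<Rightarrow> real" where
  "mean_volume M \<Xi> = enn2real (\<integral>\<^sup>+ \<omega>. emeasure lborel (\<Xi> \<omega>) \<partial>M)"


section \<open>Poisson point processes\<close>

text \<open>A point process is given by an enumeration of its points; points are counted with
  multiplicity.\<close>

definition point_count :: "(nat \<Rightarrow> 'w \<Rightarrow> 'a) \<Rightarrow> 'a set \<Rightarrow> 'w \<Rightarrow> ennreal" where
  "point_count u A \<omega> = (\<Sum>j. indicator A (u j \<omega>))"

text \<open>A stationary Poisson process of unit intensity on a Euclidean space is the case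
  \<open>\<Lambda> = lborel\<close>.\<close>

definition (in prob_space) poisson_point_process :: "'b measure \<Rightarrow> (nat \<Rightarrow> 'a \<Rightarrow> 'b) \<Rightarrow> bool" where
  "poisson_point_process \<Lambda> u \<longleftrightarrow>
     (\<forall>j. random_variable \<Lambda> (u j)) \<and>
     (\<forall>A\<in>sets \<Lambda>. emeasure \<Lambda> A < \<infinity> \<longrightarrow>
        (\<forall>n. prob {\<omega> \<in> space M. point_count u A \<omega> = of_nat n}
             = exp (- measure \<Lambda> A) * measure \<Lambda> A ^ n / fact n)) \<and>
     (\<forall>(A :: nat \<Rightarrow> 'b set) m. range A \<subseteq> sets \<Lambda> \<and> disjoint_family A \<longrightarrow>
        indep_vars (\<lambda>_. borel) (\<lambda>i. point_count u (A i)) {..<m})"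


section \<open>The random grain model\<close>

text \<open>The generic grain is \<open>\<Xi>\<close>; the points \<open>u j\<close> and the grains \<open>\<Xi>s j\<close> are numbered from 0. The
  family \<open>case_nat \<Xi> \<Xi>s\<close> is the sequence \<open>\<Xi>, \<Xi>s 0, \<Xi>s 1, \<dots>\<close>. The last assumption states that the
  \<open>\<sigma>\<close>-algebras generated by all the grains and by all the points are independent.\<close>

locale random_grain_model = prob_space M + complete_measure M
  for M :: "'w measure"
    and u :: "nat \<Rightarrow> 'w \<Rightarrow> 'a::euclidean_space"
    and \<Xi> :: "'w \<Rightarrow> 'a set"
    and \<Xi>s :: "nat \<Rightarrow> 'w \<Rightarrow> 'a set" +
  assumes points: "poisson_point_process lborel u"
    and generic_grain: "random_grain M \<Xi>"
    and grains: "\<And>j. random_grain M (\<Xi>s j)"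
    and grains_identically_distributed:
      "\<And>j. distr M (borel_of fell_topology) (\<Xi>s j) = distr M (borel_of fell_topology) \<Xi>"
    and grains_independent:
      "indep_vars (\<lambda>_. borel_of fell_topology) (case_nat \<Xi> \<Xi>s) UNIV"
    and grains_points_independent:
      "indep_set
         (sets (vimage_algebra (space M) (\<lambda>\<omega> i. case_nat \<Xi> \<Xi>s i \<omega>)
            (Pi\<^sub>M UNIV (\<lambda>_. borel_of fell_topology))))
         (sets (vimage_algebra (space M) (\<lambda>\<omega> j. u j \<omega>) (Pi\<^sub>M UNIV (\<lambda>_. borel))))"

definition grain_field ::
    "(nat \<Rightarrow> 'w \<Rightarrow> 'a::euclidean_space) \<Rightarrow> (nat \<Rightarrow> 'w \<Rightarrow> 'a set) \<Rightarrow> 'w \<Rightarrow> 'a \<Rightarrow> ennreal" where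
  "grain_field u \<Xi>s \<omega> t = (\<Sum>j. indicator ((+) (u j \<omega>) ` \<Xi>s j \<omega>) t)"

definition excess_field ::
    "(nat \<Rightarrow> 'w \<Rightarrow> 'a::euclidean_space) \<Rightarrow> (nat \<Rightarrow> 'w \<Rightarrow> 'a set) \<Rightarrow> nat \<Rightarrow> 'w \<Rightarrow> 'a \<Rightarrow> real" where
  "excess_field u \<Xi>s k \<omega> t = of_bool (grain_field u \<Xi>s \<omega> t \<ge> of_nat k)"

text \<open>For every \<open>t\<close> the sum defining \<open>grain_field\<close> has mean \<open>mean_volume M \<Xi>\<close> and hence is almost
  surely finite, so the convention \<open>enn2real \<infinity> = 0\<close> only matters on a null set.\<close>

definition scaled_integral ::
    "(nat \<Rightarrow> 'w \<Rightarrow> 'a::euclidean_space) \<Rightarrow> (nat \<Rightarrow> 'w \<Rightarrow> 'a set) \<Rightarrow> real \<Rightarrow> ('a \<Rightarrow> real) \<Rightarrow> 'w \<Rightarrow> real" where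
  "scaled_integral u \<Xi>s l \<phi> \<omega> =
     (\<integral>t. \<phi> (t /\<^sub>R l) * enn2real (grain_field u \<Xi>s \<omega> t) \<partial>lebesgue)"

definition scaled_excess_integral ::
    "(nat \<Rightarrow> 'w \<Rightarrow> 'a::euclidean_space) \<Rightarrow> (nat \<Rightarrow> 'w \<Rightarrow> 'a set) \<Rightarrow> real \<Rightarrow> nat \<Rightarrow> ('a \<Rightarrow> real) \<Rightarrow> 'w \<Rightarrow> real" where
  "scaled_excess_integral u \<Xi>s l k \<phi> \<omega> =
     (\<integral>t. \<phi> (t /\<^sub>R l) * excess_field u \<Xi>s k \<omega> t \<partial>lebesgue)"

definition L1_Linf :: "('a::euclidean_space \<Rightarrow> real) set" where
  "L1_Linf = {\<phi>. integrable lebesgue \<phi> \<and> (\<exists>C. AE t in lebesgue. \<bar>\<phi> t\<bar> \<le> C)}"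


section \<open>Convergence in distribution and stable laws\<close>

text \<open>Random elements \<open>Y l\<close> of \<open>T\<close> on \<open>M\<close> converge in distribution along the filter \<open>F\<close> to the
  random element \<open>L\<close>, which may live on another probability space \<open>N\<close>.\<close>

definition converges_in_distribution ::
    "'l filter \<Rightarrow> 'b topology \<Rightarrow> 'w measure \<Rightarrow> ('l \<Rightarrow> 'w \<Rightarrow> 'b) \<Rightarrow> 'v measure \<Rightarrow> ('v \<Rightarrow> 'b) \<Rightarrow> bool" where
  "converges_in_distribution F T M Y N L \<longleftrightarrow>
     (\<forall>\<^sub>F l in F. Y l \<in> measurable M (borel_of T)) \<and>
     L \<in> measurable N (borel_of T) \<and>
     (\<forall>f. continuous_map T euclideanreal f \<and> bounded (f ` topspace T) \<longrightarrow>
        ((\<lambda>l. \<integral>\<omega>. f (Y l \<omega>) \<partial>M) \<longlongrightarrow> (\<integral>v. f (L v) \<partial>N)) F)"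

text \<open>For finite \<open>K\<close>, the space \<open>powertop_real K\<close> of extensional functions on \<open>K\<close> is the Euclidean
  space with coordinates indexed by \<open>K\<close>.\<close>

definition fdd_converges ::
    "'l filter \<Rightarrow> 'i set \<Rightarrow> 'w measure \<Rightarrow> ('l \<Rightarrow> 'i \<Rightarrow> 'w \<Rightarrow> real) \<Rightarrow>
     'v measure \<Rightarrow> ('i \<Rightarrow> 'v \<Rightarrow> real) \<Rightarrow> bool" where
  "fdd_converges F I M Y N L \<longleftrightarrow>
     (\<forall>K. finite K \<and> K \<subseteq> I \<longrightarrow>
        converges_in_distribution F (powertop_real K)
          M (\<lambda>l \<omega>. \<lambda>k\<in>K. Y l k \<omega>) N (\<lambda>v. \<lambda>k\<in>K. L k v))"

text \<open>A law \<open>P\<close> on the line is \<open>\<alpha>\<close>-stable if, for independent \<open>X\<close> and \<open>Y\<close> with law \<open>P\<close> and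
  \<open>a, b > 0\<close>, the variable \<open>a X + b Y\<close> has the law of \<open>c X + d\<close>, where
  \<open>c\<^sup>\<alpha> = a\<^sup>\<alpha> + b\<^sup>\<alpha>\<close>. Degenerate laws are not excluded; they occur for \<open>\<phi> = 0\<close>.\<close>

definition stable_law :: "real \<Rightarrow> real measure \<Rightarrow> bool" where
  "stable_law \<alpha> P \<longleftrightarrow>
     (\<forall>a>0. \<forall>b>0. \<exists>d.
        distr (P \<Otimes>\<^sub>M P) borel (\<lambda>(x, y). a * x + b * y)
        = distr P borel (\<lambda>x. (a powr \<alpha> + b powr \<alpha>) powr (1 / \<alpha>) * x + d))"

definition log_char_limit :: "real \<Rightarrow> real \<Rightarrow> ('a::euclidean_space \<Rightarrow> real) \<Rightarrow> real \<Rightarrow> complex" where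
  "log_char_limit \<alpha> c \<phi> \<theta> =
     \<i> * of_real c * (\<integral>s. of_real (\<theta> * \<phi> s) *
        (LINT x:{0<..}|lebesgue. (iexp (\<theta> * \<phi> s * x) - 1) * of_real (x powr (- \<alpha>))) \<partial>lebesgue)"

end

theory Submission
  imports Defs
begin

text \<open>
  Attach to every Poisson point its grain. The pairs (position, grain) form a Poisson process with
  intensity \<open>lborel \<Otimes>\<^sub>M grain_law\<close>, so the centred integral of \<open>\<phi> (t /\<^sub>R l)\<close> against
  the field is a compensated Poisson integral. The logarithm of its characteristic function is the
  integral of \<open>e\<^sup>i\<^sup>x - 1 - i x\<close> over this intensity, taken at the \<open>\<phi>\<close>-weighted mass of the shifted grain
  (\<open>char_centred_field_integral\<close>). In the coordinates \<open>t = l v\<close> a grain of volume \<open>V\<close> attached to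
  \<open>l v\<close> has mass close to \<open>\<phi> v * V\<close>. For the part of the grain within distance \<open>e l\<close> of its germ this is
  continuity of translations in \<open>L\<^sup>1\<close>, and the mass of the rest is small by the localization
  hypothesis (\<open>exponent_compare\<close>). What remains depends on the volume alone, and
  \<open>l\<^sup>d P (l\<^sup>-\<^sup>d\<^sup>/\<^sup>\<alpha> V > x)\<close> tends to \<open>c x\<^sup>-\<^sup>\<alpha>\<close>. This gives the stable exponent
  (\<open>stable_exponent_limit\<close>, \<open>exponent_limit\<close>), whose homogeneity of degree \<open>\<alpha>\<close> expresses stability.

  For the excess field, the numbers of grains over two points \<open>t\<close> and \<open>s\<close> are \<open>C + A\<close> and \<open>C + B\<close> with
  independent Poisson variables, where \<open>C\<close> counts the grains that cover both points and has mean
  \<open>r = overlap t s\<close>. In the Poisson-Charlier expansion of the indicator of \<open>X \<ge> k\<close> the coefficient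
  of the linear term is \<open>P (X = k - 1) = exp (- \<mu>) * \<mu> ^ (k - 1) / fact (k - 1)\<close>. Once this multiple of
  \<open>X\<close> is subtracted, the covariance of the remainder at \<open>t\<close> and \<open>s\<close> is of order \<open>r\<^sup>2\<close> and no longer of
  order \<open>r\<close> (\<open>poisson_residual_covariance\<close>, \<open>residual_covariance\<close>). Localization bounds \<open>r\<close> by
  \<open>o (norm (t - s) powr (- q))\<close> with \<open>q = (\<alpha> - 1) d / \<alpha>\<close>, and \<open>2 q < d\<close> since \<open>\<alpha> < 2\<close>. Thus \<open>r\<^sup>2\<close> has a
  locally integrable bound, and the variance of the normalized integral of the remainder tends to 0
  (\<open>residual_integral_negligible\<close>). The two fluctuations are therefore asymptotically proportional,
  and a Slutsky argument (\<open>fdd_converges_slutsky\<close>) carries the limit over to all \<open>k\<close> jointly, with the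
  same limit variable. The limit law itself is produced by the continuity theorem of Levy, for which
  only the limit of the characteristic functions is needed (\<open>converges_in_distribution_of_char\<close>).
\<close>

section \<open>Measurability of membership in a random closed set\<close>

abbreviation fell :: "'a::euclidean_space set measure" where
  "fell \<equiv> borel_of fell_topology"

lemma sets_borel_of: "sets (borel_of T) = sigma_sets (topspace T) {U. openin T U}"
  and space_borel_of: "space (borel_of T) = topspace T"
proof -
  have "{U. openin T U} \<subseteq> Pow (topspace T)" using openin_subset by blast
  then show "sets (borel_of T) = sigma_sets (topspace T) {U. openin T U}" "space (borel_of T) = topspace T"
    by (simp_all add: borel_of_def)
qed

lemma openin_in_sets_borel_of: "openin T U \<Longrightarrow> U \<in> sets (borel_of T)"
  by (auto simp: sets_borel_of intro: sigma_sets.Basic)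

lemma space_fell [simp]: "space fell = {F. closed F}"
  by (simp add: space_borel_of)

lemma miss_compact_sets_fell:
  assumes "compact K"
  shows "{F. closed F \<and> F \<inter> K = {}} \<in> sets fell"
  using assms unfolding fell_topology_def
  by (intro openin_in_sets_borel_of topology_generated_by_Basis) blast

text \<open>The complement is a countable union of rectangles: if \<open>t\<close> lies outside a closed set \<open>F\<close>, some
  member of a countable base contains \<open>t\<close> and has compact closure missing \<open>F\<close>, and missing a
  compact set is a Fell-open condition on \<open>F\<close>.\<close>

lemma mem_measurable_fell [measurable]: "{p \<in> space (borel \<Otimes>\<^sub>M fell). fst p \<in> snd p} \<in> sets (borel \<Otimes>\<^sub>M (fell :: 'a::euclidean_space set measure))"
proof -
  obtain \<B> :: "'a set set" where B: "countable \<B>" "topological_basis \<B>" using ex_countable_basis by blast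
  have Bopen: "b \<in> sets borel" if "b \<in> \<B>" for b
    using topological_basis_open[OF B(2) that] by simp
  let ?\<C> = "{b \<in> \<B>. compact (closure b)}"
  let ?U = "\<Union>b\<in>?\<C>. b \<times> {F. closed F \<and> F \<inter> closure b = {}}"
  have "?U \<in> sets (borel \<Otimes>\<^sub>M fell)"
  proof (intro sets.countable_UN'' pair_measureI)
    show "countable ?\<C>" using B(1) by auto
  next
    fix b assume "b \<in> ?\<C>"
    then show "b \<in> sets borel" "{F. closed F \<and> F \<inter> closure b = {}} \<in> sets fell"
      using Bopen miss_compact_sets_fell by blast+
  qed
  moreover have "{p \<in> space (borel \<Otimes>\<^sub>M fell). fst p \<in> snd p} = space (borel \<Otimes>\<^sub>M fell) - ?U"
  proof safe
    fix t :: 'a and F b assume "b \<in> \<B>" "t \<in> b" "F \<inter> closure b = {}" "fst (t, F) \<in> snd (t, F)"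
    then show False using closure_subset by auto
  next
    fix t :: 'a and F :: "'a set" assume sp: "(t, F) \<in> space (borel \<Otimes>\<^sub>M fell)" and nU: "(t, F) \<notin> ?U"
    show "fst (t, F) \<in> snd (t, F)"
    proof (rule ccontr)
      assume "fst (t, F) \<notin> snd (t, F)"
      then have "t \<in> - F" "open (- F)" using sp by (auto simp: space_pair_measure)
      then obtain r where r: "0 < r" "cball t r \<subseteq> - F" using open_contains_cball by blast
      obtain b where b: "b \<in> \<B>" "t \<in> b" "b \<subseteq> ball t r"
        using topological_basisE[OF B(2), of "ball t r" t] r(1) by auto
      have cl: "closure b \<subseteq> cball t r" using b(3) closure_minimal[of b "cball t r"] ball_subset_cball by blast
      then have "compact (closure b)" using bounded_subset[OF bounded_cball] closed_closure compact_eq_bounded_closed by blast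
      moreover have "F \<inter> closure b = {}" using cl r(2) by blast
      ultimately show False using nU b sp by (auto simp: space_pair_measure)
    qed
  qed
  ultimately show ?thesis by auto
qed

lemma measurable_mem_fell:
  assumes f: "f \<in> borel_measurable N" and g: "g \<in> measurable N fell"
  shows "Measurable.pred N (\<lambda>x. (f x :: 'a::euclidean_space) \<in> g x)"
proof -
  have "(\<lambda>x. (f x, g x)) \<in> measurable N (borel \<Otimes>\<^sub>M fell)" using f g by measurable
  from measurable_sets[OF this mem_measurable_fell]
  have "(\<lambda>x. (f x, g x)) -` {p \<in> space (borel \<Otimes>\<^sub>M fell). fst p \<in> snd p} \<inter> space N \<in> sets N" .
  also have "(\<lambda>x. (f x, g x)) -` {p \<in> space (borel \<Otimes>\<^sub>M fell). fst p \<in> snd p} \<inter> space N = {x \<in> space N. f x \<in> g x}"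
    using measurable_space[OF g] by (auto simp: space_pair_measure)
  finally show ?thesis by (simp add: pred_def)
qed

lemma nn_integral_lborel_affine:
  fixes f :: "'a::euclidean_space \<Rightarrow> ennreal"
  assumes [measurable]: "f \<in> borel_measurable borel" and c: "c \<noteq> 0"
  shows "(\<integral>\<^sup>+x. f x \<partial>lborel) = ennreal (\<bar>c\<bar> ^ DIM('a)) * (\<integral>\<^sup>+x. f (t + c *\<^sub>R x) \<partial>lborel)"
  by (subst lborel_affine[OF c, of t])
     (simp add: nn_integral_density nn_integral_distr nn_integral_cmult)

lemma nn_integral_reflect:
  fixes f :: "'a::euclidean_space \<Rightarrow> ennreal"
  assumes "f \<in> borel_measurable borel"
  shows "(\<integral>\<^sup>+x. f (t - x) \<partial>lborel) = (\<integral>\<^sup>+x. f x \<partial>lborel)"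
  using nn_integral_lborel_affine[OF assms, of "-1" t] by simp

lemma integral_lborel_affine:
  fixes f :: "'a::euclidean_space \<Rightarrow> 'b::{banach, second_countable_topology}"
  assumes [measurable]: "f \<in> borel_measurable borel" and c: "c \<noteq> 0"
  shows "(\<integral>x. f x \<partial>lborel) = \<bar>c\<bar> ^ DIM('a) *\<^sub>R (\<integral>x. f (t + c *\<^sub>R x) \<partial>lborel)"
  by (subst lborel_affine[OF c, of t])
     (simp add: integral_density integral_distr)

lemma integrable_lborel_affine:
  fixes f :: "'a::euclidean_space \<Rightarrow> 'b::{banach, second_countable_topology}"
  assumes f: "integrable lborel f" and c: "c \<noteq> 0"
  shows "integrable lborel (\<lambda>x. f (t + c *\<^sub>R x))"
proof -
  have [measurable]: "f \<in> borel_measurable borel" using f by auto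
  have "integrable (density (distr lborel borel (\<lambda>x. t + c *\<^sub>R x)) (\<lambda>_. ennreal (\<bar>c\<bar> ^ DIM('a)))) f"
    using f lborel_affine[OF c, of t] by simp
  then have "integrable lborel (\<lambda>x. \<bar>c\<bar> ^ DIM('a) *\<^sub>R f (t + c *\<^sub>R x))"
    by (simp add: integrable_density integrable_distr_eq)
  from integrable_scaleR_right[OF this, of "inverse (\<bar>c\<bar> ^ DIM('a))"] show ?thesis using c by simp
qed

lemma integrable_pair_mult:
  fixes f g :: "_ \<Rightarrow> real"
  assumes "sigma_finite_measure M2" and f: "integrable M1 f" and g: "integrable M2 g"
  shows "integrable (M1 \<Otimes>\<^sub>M M2) (\<lambda>(x, y). f x * g y)"
proof -
  interpret M2: sigma_finite_measure M2 by fact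
  have [measurable]: "f \<in> borel_measurable M1" "g \<in> borel_measurable M2"
    using f g by auto
  have "(\<integral>\<^sup>+p. ennreal (norm ((\<lambda>(x, y). f x * g y) p)) \<partial>(M1 \<Otimes>\<^sub>M M2))
     = (\<integral>\<^sup>+x. \<integral>\<^sup>+y. ennreal \<bar>f x\<bar> * ennreal \<bar>g y\<bar> \<partial>M2 \<partial>M1)"
    by (subst M2.nn_integral_fst[symmetric]) (simp_all add: abs_mult ennreal_mult split_beta')
  also have "\<dots> = (\<integral>\<^sup>+x. ennreal \<bar>f x\<bar> \<partial>M1) * (\<integral>\<^sup>+y. ennreal \<bar>g y\<bar> \<partial>M2)"
    by (simp add: nn_integral_cmult nn_integral_multc)
  also have "\<dots> < \<infinity>"
    using f g by (simp add: integrable_iff_bounded ennreal_mult_less_top)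
  finally show ?thesis by (intro integrableI_bounded) auto
qed

section \<open>Poisson laws and the generating functional of a Poisson process\<close>

text \<open>Counts are defined as extended sums; this is the bridge to cardinalities, on which generating
  functions such as \<open>z ^ card S\<close> make sense.\<close>

lemma suminf_indicator_eq_card:
  "(\<Sum>j. indicator S j :: ennreal) = (if finite S then of_nat (card S) else \<infinity>)"
proof -
  have "(\<Sum>j. indicator S j :: ennreal) = (\<integral>\<^sup>+ j. indicator S j \<partial>count_space UNIV)"
    by (simp add: nn_integral_count_space_nat)
  also have "\<dots> = emeasure (count_space UNIV) S" by simp
  finally show ?thesis by (simp add: emeasure_count_space)
qed

lemma point_count_eq_card:
  "point_count u A \<omega> = (if finite {j. u j \<omega> \<in> A} then of_nat (card {j. u j \<omega> \<in> A}) else \<infinity>)"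
proof -
  have "point_count u A \<omega> = (\<Sum>j. indicator {j. u j \<omega> \<in> A} j)"
    unfolding point_count_def by (intro suminf_cong) (auto simp: indicator_def)
  then show ?thesis by (simp add: suminf_indicator_eq_card)
qed

definition poisson_weight :: "real \<Rightarrow> nat \<Rightarrow> real" where
  "poisson_weight m n = exp (- m) * m ^ n / fact n"

definition poisson_law :: "real \<Rightarrow> nat measure" where
  "poisson_law m = density (count_space UNIV) (\<lambda>n. ennreal (poisson_weight m n))"

lemma poisson_weight_nonneg: "0 \<le> m \<Longrightarrow> 0 \<le> poisson_weight m n"
  by (simp add: poisson_weight_def)

text \<open>Shifting the index trades a factor \<open>n\<close> for the mean; the mean and the factorial moments of the
  Poisson law all come from this recursion.\<close>

lemma poisson_weight_Suc: "real (Suc n) * poisson_weight m (Suc n) = m * poisson_weight m n"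
  by (simp add: poisson_weight_def field_simps del: of_nat_Suc)

lemma poisson_weight_pgf:
  fixes z :: "'a::{real_normed_field,banach}"
  shows "(\<lambda>n. of_real (poisson_weight m n) * z ^ n) sums exp (of_real m * (z - 1))"
proof -
  have "(\<lambda>n. of_real (exp (- m)) * ((of_real m * z) ^ n /\<^sub>R fact n)) sums (of_real (exp (- m)) * exp (of_real m * z))"
    by (intro sums_mult exp_converges)
  moreover have "of_real (exp (- m)) * exp (of_real m * z) = exp (of_real m * (z - 1))"
  proof -
    have "of_real (exp (- m)) = exp (- of_real m :: 'a)" by (metis exp_of_real of_real_minus)
    then show ?thesis by (simp add: exp_add[symmetric] algebra_simps)
  qed
  moreover have "of_real (exp (- m)) * ((of_real m * z) ^ n /\<^sub>R fact n) = of_real (poisson_weight m n) * z ^ n" for n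
    by (simp add: poisson_weight_def scaleR_conv_of_real power_mult_distrib field_simps)
  ultimately show ?thesis by simp
qed

lemma poisson_weight_sums: "poisson_weight m sums 1"
  using poisson_weight_pgf[of m "1::real"] by simp

lemma poisson_weight_mean: "(\<lambda>n. real n * poisson_weight m n) sums m"
proof -
  have "(\<lambda>n. real (Suc n) * poisson_weight m (Suc n)) sums m"
    unfolding poisson_weight_Suc using sums_mult[OF poisson_weight_sums[of m], of m] by simp
  then show ?thesis by (subst (asm) sums_Suc_iff) simp
qed

lemma sets_poisson_law [simp, measurable_cong]: "sets (poisson_law m) = UNIV"
  and space_poisson_law [simp]: "space (poisson_law m) = UNIV"
  by (simp_all add: poisson_law_def)

lemma nn_integral_poisson_law:
  "(\<integral>\<^sup>+n. f n \<partial>poisson_law m) = (\<Sum>n. ennreal (poisson_weight m n) * f n)"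
  by (simp add: poisson_law_def nn_integral_density nn_integral_count_space_nat)

lemma emeasure_poisson_law_singleton: "emeasure (poisson_law m) {n} = ennreal (poisson_weight m n)"
proof -
  have "(\<Sum>k. ennreal (poisson_weight m k) * indicator {n} k) = (\<Sum>k\<in>{n}. ennreal (poisson_weight m k) * indicator {n} k)"
    by (intro suminf_finite) auto
  then show ?thesis using nn_integral_poisson_law[of m "indicator {n}"] by simp
qed

lemma prob_space_poisson_law: "0 \<le> m \<Longrightarrow> prob_space (poisson_law m)"
proof
  assume "0 \<le> m"
  then have "(\<Sum>n. ennreal (poisson_weight m n)) = ennreal 1"
    by (intro suminf_ennreal_eq poisson_weight_sums poisson_weight_nonneg)
  then show "emeasure (poisson_law m) (space (poisson_law m)) = 1"
    using nn_integral_poisson_law[of m "\<lambda>_. 1"] by (simp del: nn_integral_const add: nn_integral_indicator[symmetric])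
qed

lemma
  fixes h :: "nat \<Rightarrow> 'c::{banach, second_countable_topology}"
  assumes m: "0 \<le> m" and sm: "summable (\<lambda>n. poisson_weight m n * norm (h n))"
  shows integrable_poisson_law: "integrable (poisson_law m) h"
    and integral_poisson_law: "(\<integral>n. h n \<partial>poisson_law m) = (\<Sum>n. poisson_weight m n *\<^sub>R h n)"
proof -
  have i: "integrable (count_space UNIV) (\<lambda>n. poisson_weight m n *\<^sub>R h n)"
    using sm by (simp add: integrable_count_space_nat_iff poisson_weight_nonneg[OF m])
  then show "integrable (poisson_law m) h"
    unfolding poisson_law_def by (subst integrable_density) (auto simp: poisson_weight_nonneg[OF m])
  show "(\<integral>n. h n \<partial>poisson_law m) = (\<Sum>n. poisson_weight m n *\<^sub>R h n)"
    unfolding poisson_law_def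
    by (subst integral_density) (auto simp: poisson_weight_nonneg[OF m] integral_count_space_nat[OF i])
qed

lemma (in prob_space) distr_eq_poisson_law:
  assumes [measurable]: "K \<in> measurable M (count_space UNIV)" and m: "0 \<le> m"
    and p: "\<And>n. prob {\<omega> \<in> space M. K \<omega> = n} = poisson_weight m n"
  shows "distr M (count_space UNIV) K = poisson_law m"
proof (rule measure_eqI_countable[of _ UNIV])
  fix n :: nat
  have "K -` {n} \<inter> space M = {\<omega> \<in> space M. K \<omega> = n}" by auto
  then have "emeasure (distr M (count_space UNIV) K) {n} = ennreal (poisson_weight m n)"
    using p[of n] by (simp add: emeasure_distr emeasure_eq_measure)
  then show "emeasure (distr M (count_space UNIV) K) {n} = emeasure (poisson_law m) {n}"
    by (simp add: emeasure_poisson_law_singleton)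
qed auto

locale poisson_process = prob_space M + intensity: sigma_finite_measure \<Lambda>
  for M :: "'a measure" and \<Lambda> :: "'b measure" and u :: "nat \<Rightarrow> 'a \<Rightarrow> 'b" +
  assumes ppp: "poisson_point_process \<Lambda> u"
begin

lemma poisson_point_measurable [measurable]: "u j \<in> measurable M \<Lambda>"
  using ppp by (auto simp: poisson_point_process_def)

lemma point_count_measurable [measurable]:
  "A \<in> sets \<Lambda> \<Longrightarrow> point_count u A \<in> borel_measurable M"
  unfolding point_count_def[abs_def]
  by (intro borel_measurable_suminf_order measurable_compose[OF poisson_point_measurable] borel_measurable_indicator)

lemma point_card_measurable [measurable]:
  assumes [measurable]: "A \<in> sets \<Lambda>"
  shows "(\<lambda>\<omega>. card {j. u j \<omega> \<in> A}) \<in> measurable M (count_space UNIV)"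
proof -
  have "(\<lambda>\<omega>. card {j. u j \<omega> \<in> A}) = (\<lambda>\<omega>. nat \<lfloor>enn2real (point_count u A \<omega>)\<rfloor>)"
    by (auto simp: point_count_eq_card)
  then show ?thesis by simp
qed

lemma point_count_prob:
  "A \<in> sets \<Lambda> \<Longrightarrow> emeasure \<Lambda> A < \<infinity> \<Longrightarrow>
    prob {\<omega> \<in> space M. point_count u A \<omega> = of_nat n} = poisson_weight (measure \<Lambda> A) n"
  using ppp by (auto simp: poisson_point_process_def poisson_weight_def)

lemma point_count_AE_finite:
  assumes [measurable]: "A \<in> sets \<Lambda>" and fin: "emeasure \<Lambda> A < \<infinity>"
  shows "AE \<omega> in M. finite {j. u j \<omega> \<in> A}"
proof -
  let ?E = "\<lambda>n. {\<omega> \<in> space M. point_count u A \<omega> = of_nat n}"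
  have "(\<lambda>n. prob (?E n)) sums prob (\<Union>n. ?E n)"
    by (intro finite_measure_UNION) (auto simp: disjoint_family_on_def)
  moreover have "(\<lambda>n. prob (?E n)) sums 1"
    unfolding point_count_prob[OF assms] by (rule poisson_weight_sums)
  ultimately have "prob (\<Union>n. ?E n) = 1" by (rule sums_unique2)
  then have "AE \<omega> in M. \<omega> \<in> (\<Union>n. ?E n)"
    by (rule AE_prob_1)
  then show ?thesis
    by eventually_elim (auto simp: point_count_eq_card split: if_splits)
qed

text \<open>The law is prescribed for extended counts; almost surely the count is finite, so that the
  cardinality, which is 0 on infinite sets, has the same law.\<close>

lemma distr_point_card:
  assumes [measurable]: "A \<in> sets \<Lambda>" and fin: "emeasure \<Lambda> A < \<infinity>"
  shows "distr M (count_space UNIV) (\<lambda>\<omega>. card {j. u j \<omega> \<in> A}) = poisson_law (measure \<Lambda> A)"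
proof (rule distr_eq_poisson_law)
  fix n
  have "prob {\<omega> \<in> space M. card {j. u j \<omega> \<in> A} = n} = prob {\<omega> \<in> space M. point_count u A \<omega> = of_nat n}"
  proof (rule measure_eq_AE)
    show "AE \<omega> in M. (\<omega> \<in> {\<omega> \<in> space M. card {j. u j \<omega> \<in> A} = n}) = (\<omega> \<in> {\<omega> \<in> space M. point_count u A \<omega> = of_nat n})"
      using point_count_AE_finite[OF assms] by eventually_elim (auto simp: point_count_eq_card)
  qed auto
  then show "prob {\<omega> \<in> space M. card {j. u j \<omega> \<in> A} = n} = poisson_weight (measure \<Lambda> A) n"
    using point_count_prob[OF assms] by simp
qed auto

lemma expectation_point_card_power:
  fixes z :: complex
  assumes A[measurable]: "A \<in> sets \<Lambda>" and fin: "emeasure \<Lambda> A < \<infinity>" and z: "norm z \<le> 1"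
  shows "expectation (\<lambda>\<omega>. z ^ card {j. u j \<omega> \<in> A}) = exp (of_real (measure \<Lambda> A) * (z - 1))"
proof -
  let ?m = "measure \<Lambda> A"
  have "expectation (\<lambda>\<omega>. z ^ card {j. u j \<omega> \<in> A}) = (\<integral>n. z ^ n \<partial>poisson_law ?m)"
    unfolding distr_point_card[OF A fin, symmetric] by (subst integral_distr) auto
  also have "\<dots> = (\<Sum>n. poisson_weight ?m n *\<^sub>R z ^ n)"
  proof (rule integral_poisson_law)
    show "summable (\<lambda>n. poisson_weight ?m n * norm (z ^ n))"
      using z by (intro summable_comparison_test[OF _ sums_summable[OF poisson_weight_sums[of ?m]]] exI[of _ 0])
        (auto simp: norm_power power_le_one poisson_weight_nonneg abs_mult intro!: mult_left_le)
  qed simp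
  also have "\<dots> = exp (of_real ?m * (z - 1))"
    using sums_unique[OF poisson_weight_pgf[of ?m z]] by (simp add: scaleR_conv_of_real)
  finally show ?thesis .
qed

lemma nn_integral_point_count_finite:
  assumes A[measurable]: "A \<in> sets \<Lambda>" and fin: "emeasure \<Lambda> A < \<infinity>"
  shows "(\<integral>\<^sup>+\<omega>. point_count u A \<omega> \<partial>M) = emeasure \<Lambda> A"
proof -
  let ?m = "measure \<Lambda> A"
  have "(\<integral>\<^sup>+\<omega>. point_count u A \<omega> \<partial>M) = (\<integral>\<^sup>+\<omega>. of_nat (card {j. u j \<omega> \<in> A}) \<partial>M)"
    using point_count_AE_finite[OF A fin] by (intro nn_integral_cong_AE) (auto simp: point_count_eq_card)
  also have "\<dots> = (\<integral>\<^sup>+n. of_nat n \<partial>poisson_law ?m)"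
    unfolding distr_point_card[OF A fin, symmetric] by (subst nn_integral_distr) auto
  also have "\<dots> = (\<Sum>n. ennreal (real n * poisson_weight ?m n))"
    unfolding nn_integral_poisson_law
    by (intro suminf_cong) (simp add: ennreal_of_nat_eq_real_of_nat ennreal_mult'[symmetric] mult.commute)
  also have "\<dots> = ennreal ?m"
    by (intro suminf_ennreal_eq poisson_weight_mean) (simp add: poisson_weight_nonneg)
  also have "\<dots> = emeasure \<Lambda> A" using fin by (simp add: emeasure_eq_ennreal_measure)
  finally show ?thesis .
qed

text \<open>The definition prescribes counts only for sets of finite intensity. A general set is cut into
  countably many such pieces.\<close>

lemma nn_integral_point_count:
  assumes A[measurable]: "A \<in> sets \<Lambda>"
  shows "(\<integral>\<^sup>+\<omega>. point_count u A \<omega> \<partial>M) = emeasure \<Lambda> A"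
proof -
  obtain B :: "nat \<Rightarrow> 'b set" where B: "range B \<subseteq> sets \<Lambda>" "(\<Union>i. B i) = space \<Lambda>"
     "\<And>i. emeasure \<Lambda> (B i) \<noteq> \<infinity>" "disjoint_family B"
    using intensity.sigma_finite_disjoint by metis
  have [measurable]: "A \<inter> B i \<in> sets \<Lambda>" for i using B(1) A by blast
  have fin: "emeasure \<Lambda> (A \<inter> B i) < \<infinity>" for i
    proof -
    have "emeasure \<Lambda> (A \<inter> B i) \<le> emeasure \<Lambda> (B i)" using B(1) by (intro emeasure_mono) auto
    also have "\<dots> < \<infinity>" using B(3)[of i] by (simp add: less_top)
    finally show ?thesis .
  qed
  have un: "A = (\<Union>i. A \<inter> B i)" using sets.sets_into_space[OF A] B(2) by blast
  have dis: "disjoint_family (\<lambda>i. A \<inter> B i)" using B(4) by (auto simp: disjoint_family_on_def)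
  have "(\<Sum>i. indicator (A \<inter> B i) x) = (indicator A x :: ennreal)" for x
    using suminf_indicator[OF dis, of x] un by simp
  then have "point_count u A \<omega> = (\<Sum>j. \<Sum>i. indicator (A \<inter> B i) (u j \<omega>))" for \<omega>
    unfolding point_count_def by simp
  moreover have "\<dots> \<omega> = (\<Sum>i. point_count u (A \<inter> B i) \<omega>)" for \<omega>
  proof -
    interpret pair_sigma_finite "count_space (UNIV :: nat set)" "count_space (UNIV :: nat set)"
      by (intro pair_sigma_finite.intro sigma_finite_measure_count_space)
    show ?thesis unfolding point_count_def
      using Fubini'[of "\<lambda>j i. indicator (A \<inter> B i) (u j \<omega>)"]
      by (simp add: nn_integral_count_space_nat pair_measure_countable)
  qed
  ultimately have "(\<integral>\<^sup>+\<omega>. point_count u A \<omega> \<partial>M) = (\<integral>\<^sup>+\<omega>. (\<Sum>i. point_count u (A \<inter> B i) \<omega>) \<partial>M)" by simp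
  also have "\<dots> = (\<Sum>i. emeasure \<Lambda> (A \<inter> B i))"
    by (subst nn_integral_suminf) (simp_all add: nn_integral_point_count_finite[OF _ fin])
  also have "\<dots> = emeasure \<Lambda> A"
  proof -
    have "range (\<lambda>i. A \<inter> B i) \<subseteq> sets \<Lambda>" by auto
    from suminf_emeasure[OF this dis] un show ?thesis by simp
  qed
  finally show ?thesis .
qed

text \<open>Campbell's formula, here for the enumerated points: the intensity measure is the sum of the
  laws of the individual points. Standard induction starting from the mean count of a set.\<close>

lemma campbell:
  assumes f[measurable]: "f \<in> borel_measurable \<Lambda>"
  shows "(\<Sum>j. \<integral>\<^sup>+\<omega>. f (u j \<omega>) \<partial>M) = (\<integral>\<^sup>+x. f x \<partial>\<Lambda>)"
  using f
proof (induction f rule: borel_measurable_induct)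
  case (cong f g)
  then have "f (u j \<omega>) = g (u j \<omega>)" if "\<omega> \<in> space M" for j \<omega>
    using measurable_space[OF poisson_point_measurable that] by simp
  then show ?case using cong(3,4) by (simp cong: nn_integral_cong)
next
  case (set A)
  show ?case
  proof -
    note [measurable] = set
    have "(\<Sum>j. \<integral>\<^sup>+\<omega>. indicator A (u j \<omega>) \<partial>M) = (\<integral>\<^sup>+\<omega>. point_count u A \<omega> \<partial>M)"
      unfolding point_count_def
      by (rule nn_integral_suminf[symmetric])
         (rule measurable_compose[OF poisson_point_measurable borel_measurable_indicator[OF set]])
    then show ?thesis using nn_integral_point_count[OF set] set by simp
  qed
next
  case (mult g c)
  then show ?case by (simp add: nn_integral_cmult)
next
  case (add g h)
  then show ?case by (simp add: nn_integral_add suminf_add[symmetric])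
next
  case (seq U)
  have [measurable]: "\<And>i. U i \<in> borel_measurable \<Lambda>" using seq by auto
  have mono: "U m x \<le> U n x" if "m \<le> n" for m n x using seq(3) that by (auto simp: incseq_def le_fun_def)
  then have "incseq (\<lambda>i \<omega>. U i (u j \<omega>))" for j by (auto simp: incseq_def le_fun_def)
  then have "(\<integral>\<^sup>+\<omega>. (SUP i. U i) (u j \<omega>) \<partial>M) = (SUP i. \<integral>\<^sup>+\<omega>. U i (u j \<omega>) \<partial>M)" for j
    by (subst nn_integral_monotone_convergence_SUP[symmetric]) (auto simp: image_comp)
  then have "(\<Sum>j. \<integral>\<^sup>+\<omega>. (SUP i. U i) (u j \<omega>) \<partial>M) = (\<Sum>j. SUP i. \<integral>\<^sup>+\<omega>. U i (u j \<omega>) \<partial>M)" by simp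
  also have "\<dots> = (SUP i. \<Sum>j. \<integral>\<^sup>+\<omega>. U i (u j \<omega>) \<partial>M)"
    by (intro ennreal_suminf_SUP_eq) (auto simp: incseq_def intro!: nn_integral_mono mono)
  also have "\<dots> = (SUP i. \<integral>\<^sup>+x. U i x \<partial>\<Lambda>)" using seq by simp
  also have "\<dots> = (\<integral>\<^sup>+x. (SUP i. U i) x \<partial>\<Lambda>)"
    using nn_integral_monotone_convergence_SUP[of U \<Lambda>] seq(3) by (simp add: image_comp)
  finally show ?case .
qed

text \<open>The infinite product over the points is an eventually constant sequence of partial products when
  only finitely many factors differ from 1; grouping equal factors turns it into powers of counts.\<close>

lemma prod_lessThan_eq_prod_power_card:
  fixes d :: "nat \<Rightarrow> complex" and e :: "nat \<Rightarrow> complex"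
  assumes e: "inj_on e {..<m}" and d: "\<And>j. d j \<noteq> 1 \<Longrightarrow> d j \<in> e ` {..<m}"
    and fin: "\<And>i. i < m \<Longrightarrow> finite {j. d j = e i}"
  shows "\<forall>\<^sub>F n in sequentially. (\<Prod>j<n. d j) = (\<Prod>i<m. e i ^ card {j. d j = e i})"
proof -
  let ?J = "\<Union>i<m. {j. d j = e i}"
  have finJ: "finite ?J" using fin by auto
  then obtain n0 where n0: "?J \<subseteq> {..<n0}" using finite_nat_iff_bounded by blast
  have "(\<Prod>j<n. d j) = (\<Prod>i<m. e i ^ card {j. d j = e i})" if "n0 \<le> n" for n
  proof -
    have "(\<Prod>j<n. d j) = (\<Prod>j\<in>?J. d j)"
      using n0 that d by (intro prod.mono_neutral_right) (fastforce+)
    also have "\<dots> = (\<Prod>i<m. \<Prod>j\<in>{j. d j = e i}. d j)"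
      using e fin by (intro prod.UNION_disjoint) (auto simp: inj_on_def)
    also have "\<dots> = (\<Prod>i<m. e i ^ card {j. d j = e i})" by simp
    finally show ?thesis .
  qed
  then show ?thesis by (auto simp: eventually_sequentially)
qed

text \<open>On the level sets of a simple function the points are counted by independent Poisson variables,
  whose generating functions multiply to the exponential of a sum.\<close>

lemma pgfl_simple:
  fixes D :: "'b \<Rightarrow> complex"
  assumes D: "simple_function \<Lambda> D" and le1: "\<And>x. x \<in> space \<Lambda> \<Longrightarrow> norm (D x) \<le> 1"
    and int: "integrable \<Lambda> (\<lambda>x. D x - 1)"
  shows "(\<lambda>n. expectation (\<lambda>\<omega>. \<Prod>j<n. D (u j \<omega>))) \<longlonglongrightarrow> exp (\<integral>x. D x - 1 \<partial>\<Lambda>)"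
proof -
  have [measurable]: "D \<in> borel_measurable \<Lambda>" using D by (rule borel_measurable_simple_function)
  have finV: "finite (D ` space \<Lambda> - {1})" using D by (auto simp: simple_function_def)
  from ex_bij_betw_nat_finite[OF this] obtain e where
    e: "bij_betw e {..<card (D ` space \<Lambda> - {1})} (D ` space \<Lambda> - {1})" by (auto simp: atLeast0LessThan)
  define m where "m = card (D ` space \<Lambda> - {1})"
  have einj: "inj_on e {..<m}" and eim: "e ` {..<m} = D ` space \<Lambda> - {1}"
    using e by (auto simp: bij_betw_def m_def)
  define A where "A i = (if i < m then D -` {e i} \<inter> space \<Lambda> else {})" for i
  have [measurable]: "A i \<in> sets \<Lambda>" for i by (auto simp: A_def)
  have enorm: "norm (e i) \<le> 1" "e i \<noteq> 1" if "i < m" for i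
    using that eim le1 by (metis DiffD1 imageE imageI lessThan_iff, metis DiffD2 imageI insertI1 lessThan_iff)
  have Afin: "emeasure \<Lambda> (A i) < \<infinity>" for i
  proof (cases "i < m")
    case True
    have "ennreal (norm (e i - 1)) * emeasure \<Lambda> (A i) = (\<integral>\<^sup>+x. ennreal (norm (e i - 1)) * indicator (A i) x \<partial>\<Lambda>)"
      by (simp add: nn_integral_cmult_indicator)
    also have "\<dots> \<le> (\<integral>\<^sup>+x. ennreal (norm (D x - 1)) \<partial>\<Lambda>)"
      by (intro nn_integral_mono) (auto simp: A_def indicator_def)
    also have "\<dots> < \<infinity>" using int by (simp add: integrable_iff_bounded)
    finally show ?thesis using enorm[OF True] by (auto simp: ennreal_mult_less_top)
  qed (simp add: A_def)
  have dis: "disjoint_family A"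
    using einj by (auto simp: disjoint_family_on_def A_def inj_on_def)
  let ?K = "\<lambda>i \<omega>. card {j. u j \<omega> \<in> A i}"
  have lim: "AE \<omega> in M. (\<lambda>n. \<Prod>j<n. D (u j \<omega>)) \<longlonglongrightarrow> (\<Prod>i<m. e i ^ ?K i \<omega>)"
  proof -
    have "AE \<omega> in M. \<forall>i\<in>{..<m}. finite {j. u j \<omega> \<in> A i}"
      using Afin by (intro AE_finite_allI point_count_AE_finite) auto
    then show ?thesis using AE_space
    proof eventually_elim
      case (elim \<omega>)
      have sp: "u j \<omega> \<in> space \<Lambda>" for j using measurable_space[OF poisson_point_measurable elim(2)] .
      have Aeq: "{j. u j \<omega> \<in> A i} = {j. D (u j \<omega>) = e i}" if "i < m" for i using that sp by (auto simp: A_def)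
      have "\<forall>\<^sub>F n in sequentially. (\<Prod>j<n. D (u j \<omega>)) = (\<Prod>i<m. e i ^ card {j. D (u j \<omega>) = e i})"
        using sp elim(1) by (intro prod_lessThan_eq_prod_power_card[OF einj]) (auto simp: eim Aeq)
      then have "\<forall>\<^sub>F n in sequentially. (\<Prod>j<n. D (u j \<omega>)) = (\<Prod>i<m. e i ^ ?K i \<omega>)"
        by (simp add: Aeq)
      then show ?case by (rule tendsto_eventually)
    qed
  qed
  have "(\<lambda>n. expectation (\<lambda>\<omega>. \<Prod>j<n. D (u j \<omega>))) \<longlonglongrightarrow> expectation (\<lambda>\<omega>. \<Prod>i<m. e i ^ ?K i \<omega>)"
  proof (rule integral_dominated_convergence[where w="\<lambda>_. 1"])
    show "AE \<omega> in M. norm (\<Prod>j<n. D (u j \<omega>)) \<le> 1" for n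
      using AE_space
    proof eventually_elim
      case (elim \<omega>)
      have "norm (D (u j \<omega>)) \<le> 1" for j using le1 measurable_space[OF poisson_point_measurable elim] .
      then show ?case unfolding prod_norm[symmetric] by (intro prod_le_1) auto
    qed
    show "(\<lambda>\<omega>. \<Prod>i<m. e i ^ ?K i \<omega>) \<in> borel_measurable M"
      by (intro borel_measurable_prod measurable_compose[OF point_card_measurable]) auto
    show "(\<lambda>\<omega>. \<Prod>j<n. D (u j \<omega>)) \<in> borel_measurable M" for n
      by (intro borel_measurable_prod measurable_compose[OF poisson_point_measurable]) auto
  qed (use lim in auto)
  also have "expectation (\<lambda>\<omega>. \<Prod>i<m. e i ^ ?K i \<omega>) = (\<Prod>i<m. expectation (\<lambda>\<omega>. e i ^ ?K i \<omega>))"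
  proof (rule indep_vars_lebesgue_integral)
    have "indep_vars (\<lambda>_. borel) (\<lambda>i. point_count u (A i)) {..<m}"
    proof -
      have "range A \<subseteq> sets \<Lambda>" by auto
      then show ?thesis using ppp dis unfolding poisson_point_process_def by blast
    qed
    then have "indep_vars (\<lambda>_. borel) (\<lambda>i \<omega>. e i ^ nat \<lfloor>enn2real (point_count u (A i) \<omega>)\<rfloor>) {..<m}"
      by (rule indep_vars_compose2) measurable
    moreover have "nat \<lfloor>enn2real (point_count u (A i) \<omega>)\<rfloor> = ?K i \<omega>" for i \<omega>
      by (simp add: point_count_eq_card)
    ultimately show "indep_vars (\<lambda>_. borel) (\<lambda>i \<omega>. e i ^ ?K i \<omega>) {..<m}" by simp
    show "integrable M (\<lambda>\<omega>. e i ^ ?K i \<omega>)" if "i \<in> {..<m}" for i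
      using that enorm(1)[of i]
      by (intro integrable_const_bound[where B=1] measurable_compose[OF point_card_measurable])
         (auto simp: norm_power power_le_one)
  qed auto
  also have "\<dots> = (\<Prod>i<m. exp (of_real (measure \<Lambda> (A i)) * (e i - 1)))"
    by (intro prod.cong expectation_point_card_power) (use Afin enorm in auto)
  also have "\<dots> = exp (\<Sum>i<m. of_real (measure \<Lambda> (A i)) * (e i - 1))"
    by (simp add: exp_sum)
  also have "(\<Sum>i<m. of_real (measure \<Lambda> (A i)) * (e i - 1)) = (\<integral>x. (\<Sum>i<m. indicator (A i) x *\<^sub>R (e i - 1)) \<partial>\<Lambda>)"
    using Afin by (subst Bochner_Integration.integral_sum) (auto simp: scaleR_conv_of_real)
  also have "\<dots> = (\<integral>x. D x - 1 \<partial>\<Lambda>)"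
  proof (rule Bochner_Integration.integral_cong)
    fix x assume x: "x \<in> space \<Lambda>"
    show "(\<Sum>i<m. indicator (A i) x *\<^sub>R (e i - 1)) = D x - 1"
    proof (cases "D x = 1")
      case True
      then have "\<And>i. x \<notin> A i" using enorm(2) by (auto simp: A_def)
      then show ?thesis using True by simp
    next
      case False
      then obtain k where k: "k < m" "D x = e k"
      proof -
        have "D x \<in> e ` {..<m}" using eim x False by simp
        then show ?thesis using that by auto
      qed
      have "x \<in> A i \<longleftrightarrow> i = k" if "i < m" for i
        using k that x einj by (auto simp: A_def inj_on_def)
      then have "(\<Sum>i<m. indicat_real (A i) x *\<^sub>R (e i - 1)) = (\<Sum>i<m. if i = k then e i - 1 else 0)"
        by (intro sum.cong) auto
      then show ?thesis using k by simp
    qed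
  qed simp
  finally show ?thesis .
qed

text \<open>The generating functional. It is stated through the means of the partial products, which spares a
  separate discussion of the infinite product. A general integrand is approximated
  by simple functions projected to the unit disc. The error is controlled uniformly in the
  number of factors, since \<open>campbell\<close> bounds the sum of the errors over all points by an
  \<open>L\<^sup>1\<close> distance.\<close>

theorem pgfl:
  fixes D :: "'b \<Rightarrow> complex"
  assumes D[measurable]: "D \<in> borel_measurable \<Lambda>" and le1: "\<And>x. x \<in> space \<Lambda> \<Longrightarrow> norm (D x) \<le> 1"
    and int: "integrable \<Lambda> (\<lambda>x. D x - 1)"
  shows "(\<lambda>n. expectation (\<lambda>\<omega>. \<Prod>j<n. D (u j \<omega>))) \<longlonglongrightarrow> exp (\<integral>x. D x - 1 \<partial>\<Lambda>)"
proof -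
  obtain F where F: "\<And>i. simple_function \<Lambda> (F i)"
    "\<And>x. x \<in> space \<Lambda> \<Longrightarrow> (\<lambda>i. F i x) \<longlonglongrightarrow> D x"
    "\<And>i x. x \<in> space \<Lambda> \<Longrightarrow> dist (F i x) 1 \<le> 2 * dist (D x) 1"
    using borel_measurable_implies_sequence_metric[OF D, of 1] by blast
  \<comment> \<open>the nearest-point projection keeps simple approximants in the unit disc without increasing distances\<close>
  define P where "P = closest_point (cball (0::complex) 1)"
  have P_lip: "dist (P x) (P y) \<le> dist x y" for x y
    unfolding P_def by (rule closest_point_lipschitz) auto
  have P_id: "P x = x" if "norm x \<le> 1" for x using that by (simp add: P_def closest_point_self)
  have P_le: "norm (P x) \<le> 1" for x
    using closest_point_in_set[of "cball (0::complex) 1" x] by (simp add: P_def)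
  define G where "G i x = P (F i x)" for i x
  have G_le: "norm (G i x) \<le> 1" for i x by (simp add: G_def P_le)
  have Gs: "simple_function \<Lambda> (G i)" for i
    using simple_function_compose[OF F(1), of P i] by (simp add: G_def[abs_def] comp_def)
  then have [measurable]: "G i \<in> borel_measurable \<Lambda>" for i by (rule borel_measurable_simple_function)
  have Glim: "(\<lambda>i. G i x) \<longlonglongrightarrow> D x" if x: "x \<in> space \<Lambda>" for x
  proof (rule tendsto_dist_iff[THEN iffD2], rule tendsto_sandwich[where f="\<lambda>_. 0" and h="\<lambda>i. dist (F i x) (D x)"])
    show "\<forall>\<^sub>F i in sequentially. dist (G i x) (D x) \<le> dist (F i x) (D x)"
      using P_lip[of "F _ x" "D x"] P_id[OF le1[OF x]] by (simp add: G_def)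
    show "(\<lambda>i. dist (F i x) (D x)) \<longlonglongrightarrow> 0" using F(2)[OF x] by (simp add: tendsto_dist_iff[symmetric])
  qed auto
  have Gbd: "norm (G i x - 1) \<le> 2 * norm (D x - 1)" if x: "x \<in> space \<Lambda>" for i x
    using P_lip[of "F i x" 1] P_id[of 1] F(3)[OF x, of i] by (simp add: G_def dist_norm)
  have Gint: "integrable \<Lambda> (\<lambda>x. G i x - 1)" for i
    by (rule Bochner_Integration.integrable_bound[OF integrable_mult_right[OF integrable_norm[OF int], of 2]])
       (auto intro!: AE_I2 simp: Gbd)
  have diff_int: "integrable \<Lambda> (\<lambda>x. norm (D x - G i x))" for i
    using integrable_norm[OF Bochner_Integration.integrable_diff[OF int Gint[of i]]] by simp
  have L1: "(\<lambda>i. \<integral>x. norm (D x - G i x) \<partial>\<Lambda>) \<longlonglongrightarrow> (\<integral>x. 0 \<partial>\<Lambda>)"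
  proof (rule integral_dominated_convergence[where w="\<lambda>x. 3 * norm (D x - 1)"])
    show "AE x in \<Lambda>. (\<lambda>i. norm (D x - G i x)) \<longlonglongrightarrow> 0"
    proof (rule AE_I2)
      fix x assume x: "x \<in> space \<Lambda>"
      show "(\<lambda>i. norm (D x - G i x)) \<longlonglongrightarrow> 0"
        using tendsto_norm[OF tendsto_diff[OF tendsto_const[of "D x"] Glim[OF x]]] by simp
    qed
    show "AE x in \<Lambda>. norm (norm (D x - G i x)) \<le> 3 * norm (D x - 1)" for i
    proof (rule AE_I2)
      fix x assume x: "x \<in> space \<Lambda>"
      have "norm (D x - G i x) \<le> norm (D x - 1) + norm (G i x - 1)"
        using norm_triangle_ineq4[of "D x - 1" "G i x - 1"] by simp
      then show "norm (norm (D x - G i x)) \<le> 3 * norm (D x - 1)" using Gbd[OF x, of i] by simp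
    qed
  qed (use int in auto)
  have Elim: "(\<lambda>i. exp (\<integral>x. G i x - 1 \<partial>\<Lambda>)) \<longlonglongrightarrow> exp (\<integral>x. D x - 1 \<partial>\<Lambda>)"
  proof (intro tendsto_exp integral_dominated_convergence[where w="\<lambda>x. 2 * norm (D x - 1)"])
    show "AE x in \<Lambda>. (\<lambda>i. G i x - 1) \<longlonglongrightarrow> D x - 1"
      using Glim by (intro AE_I2 tendsto_intros)
  qed (use int Gbd in \<open>auto intro!: AE_I2\<close>)
  have close: "norm (expectation (\<lambda>\<omega>. \<Prod>j<n. D (u j \<omega>)) - expectation (\<lambda>\<omega>. \<Prod>j<n. G i (u j \<omega>)))
      \<le> (\<integral>x. norm (D x - G i x) \<partial>\<Lambda>)" for n i
  proof -
    have le: "norm (\<Prod>j<n. H (u j \<omega>)) \<le> 1" if "\<And>x. x \<in> space \<Lambda> \<Longrightarrow> norm (H x) \<le> 1" "\<omega> \<in> space M" for H :: "'b \<Rightarrow> complex" and \<omega>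
    proof -
      have "norm (H (u j \<omega>)) \<le> 1" for j using that(1) measurable_space[OF poisson_point_measurable that(2)] .
      then show ?thesis unfolding prod_norm[symmetric] by (intro prod_le_1) auto
    qed
    have m: "(\<lambda>\<omega>. \<Prod>j<n. H (u j \<omega>)) \<in> borel_measurable M" if [measurable]: "H \<in> borel_measurable \<Lambda>" for H :: "'b \<Rightarrow> complex"
      by (intro borel_measurable_prod measurable_compose[OF poisson_point_measurable]) auto
    have i1: "integrable M (\<lambda>\<omega>. \<Prod>j<n. D (u j \<omega>))"
      by (rule integrable_const_bound[where B=1]) (auto intro!: AE_I2 le le1 m)
    have i2: "integrable M (\<lambda>\<omega>. \<Prod>j<n. G i (u j \<omega>))"
      by (rule integrable_const_bound[where B=1]) (auto intro!: AE_I2 le m G_le)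
    have "ennreal (norm (expectation (\<lambda>\<omega>. \<Prod>j<n. D (u j \<omega>)) - expectation (\<lambda>\<omega>. \<Prod>j<n. G i (u j \<omega>))))
        = ennreal (norm (expectation (\<lambda>\<omega>. (\<Prod>j<n. D (u j \<omega>)) - (\<Prod>j<n. G i (u j \<omega>)))))"
      using i1 i2 by simp
    also have "\<dots> \<le> (\<integral>\<^sup>+\<omega>. norm ((\<Prod>j<n. D (u j \<omega>)) - (\<Prod>j<n. G i (u j \<omega>))) \<partial>M)"
      using i1 i2 by (intro integral_norm_bound_ennreal) auto
    also have "\<dots> \<le> (\<integral>\<^sup>+\<omega>. (\<Sum>j<n. ennreal (norm (D (u j \<omega>) - G i (u j \<omega>)))) \<partial>M)"
    proof (rule nn_integral_mono)
      fix \<omega> assume w: "\<omega> \<in> space M"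
      have "norm ((\<Prod>j<n. D (u j \<omega>)) - (\<Prod>j<n. G i (u j \<omega>))) \<le> (\<Sum>j<n. norm (D (u j \<omega>) - G i (u j \<omega>)))"
        using le1 measurable_space[OF poisson_point_measurable w] by (intro norm_prod_diff) (auto simp: G_def P_le)
      then show "ennreal (norm ((\<Prod>j<n. D (u j \<omega>)) - (\<Prod>j<n. G i (u j \<omega>)))) \<le> (\<Sum>j<n. ennreal (norm (D (u j \<omega>) - G i (u j \<omega>))))"
        by (subst sum_ennreal) (auto intro: ennreal_leI)
    qed
    also have "\<dots> = (\<Sum>j<n. \<integral>\<^sup>+\<omega>. norm (D (u j \<omega>) - G i (u j \<omega>)) \<partial>M)"
      by (intro nn_integral_sum measurable_compose[OF poisson_point_measurable, of "\<lambda>x. ennreal (norm (D x - G i x))"]) measurable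
    also have "\<dots> \<le> (\<Sum>j. \<integral>\<^sup>+\<omega>. norm (D (u j \<omega>) - G i (u j \<omega>)) \<partial>M)"
      by (intro sum_le_suminf) auto
    also have "\<dots> = (\<integral>\<^sup>+x. norm (D x - G i x) \<partial>\<Lambda>)"
      using campbell[of "\<lambda>x. ennreal (norm (D x - G i x))"] by simp
    also have "\<dots> = ennreal (\<integral>x. norm (D x - G i x) \<partial>\<Lambda>)"
      using diff_int by (intro nn_integral_eq_integral) auto
    finally show ?thesis by (subst (asm) ennreal_le_iff) auto
  qed
  show ?thesis
  proof (rule LIMSEQ_I)
    fix r :: real assume r: "0 < r"
    have "\<forall>\<^sub>F i in sequentially. (\<integral>x. norm (D x - G i x) \<partial>\<Lambda>) < r/3 \<and> dist (exp (\<integral>x. G i x - 1 \<partial>\<Lambda>)) (exp (\<integral>x. D x - 1 \<partial>\<Lambda>)) < r/3"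
      using r by (intro eventually_conj order_tendstoD(2)[OF L1] tendstoD[OF Elim]) auto
    then obtain i where i: "(\<integral>x. norm (D x - G i x) \<partial>\<Lambda>) < r/3" "dist (exp (\<integral>x. G i x - 1 \<partial>\<Lambda>)) (exp (\<integral>x. D x - 1 \<partial>\<Lambda>)) < r/3"
      using eventually_happens'[OF sequentially_bot] by blast
    have "(\<lambda>n. expectation (\<lambda>\<omega>. \<Prod>j<n. G i (u j \<omega>))) \<longlonglongrightarrow> exp (\<integral>x. G i x - 1 \<partial>\<Lambda>)"
      by (intro pgfl_simple Gs Gint) (simp add: G_def P_le)
    from LIMSEQ_D[OF this, of "r/3"] r obtain n0 where
      n0: "\<And>n. n \<ge> n0 \<Longrightarrow> norm (expectation (\<lambda>\<omega>. \<Prod>j<n. G i (u j \<omega>)) - exp (\<integral>x. G i x - 1 \<partial>\<Lambda>)) < r/3" by auto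
    show "\<exists>n0. \<forall>n\<ge>n0. norm (expectation (\<lambda>\<omega>. \<Prod>j<n. D (u j \<omega>)) - exp (\<integral>x. D x - 1 \<partial>\<Lambda>)) < r"
    proof (intro exI allI impI)
      fix n assume "n0 \<le> n"
      then show "norm (expectation (\<lambda>\<omega>. \<Prod>j<n. D (u j \<omega>)) - exp (\<integral>x. D x - 1 \<partial>\<Lambda>)) < r"
        using n0[of n] close[of n i] i norm_triangle_ineq[of "expectation (\<lambda>\<omega>. \<Prod>j<n. D (u j \<omega>)) - expectation (\<lambda>\<omega>. \<Prod>j<n. G i (u j \<omega>))"
            "expectation (\<lambda>\<omega>. \<Prod>j<n. G i (u j \<omega>)) - exp (\<integral>x. D x - 1 \<partial>\<Lambda>)"]
          norm_triangle_ineq[of "expectation (\<lambda>\<omega>. \<Prod>j<n. G i (u j \<omega>)) - exp (\<integral>x. G i x - 1 \<partial>\<Lambda>)" "exp (\<integral>x. G i x - 1 \<partial>\<Lambda>) - exp (\<integral>x. D x - 1 \<partial>\<Lambda>)"]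
        by (simp add: dist_norm)
    qed
  qed
qed

end

section \<open>The Poisson process of positions and grains\<close>

text \<open>The point \<open>x = 0\<close> is left out of the hypothesis so that it passes to the shifted series, which is
  obtained by division by \<open>x\<close>.\<close>

lemma powser_eq_0_imp:
  fixes d :: "nat \<Rightarrow> real"
  assumes "\<And>x. x \<noteq> 0 \<Longrightarrow> \<bar>x\<bar> < 1 \<Longrightarrow> (\<lambda>n. d n * x ^ n) sums 0"
  shows "d n = 0"
  using assms
proof (induction n arbitrary: d)
  have d0: "d 0 = 0" if "\<And>x. x \<noteq> 0 \<Longrightarrow> \<bar>x\<bar> < 1 \<Longrightarrow> (\<lambda>n. d n * x ^ n) sums 0" for d :: "nat \<Rightarrow> real"
    using powser_limit_0_strong[of 1 d "\<lambda>_. 0"] that by (auto simp: tendsto_const_iff)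
  case 0
  then show ?case by (rule d0)
  case (Suc n)
  show ?case
  proof (rule Suc.IH[of "\<lambda>n. d (Suc n)"])
    fix x :: real assume x: "x \<noteq> 0" "\<bar>x\<bar> < 1"
    have "(\<lambda>n. d (Suc n) * x ^ Suc n) sums 0"
      using Suc.prems[OF x] d0[OF Suc.prems] by (subst sums_Suc_iff) simp
    from sums_mult[OF this, of "1 / x"] x show "(\<lambda>n. d (Suc n) * x ^ n) sums 0" by simp
  qed
qed

text \<open>Inversion of a Poisson generating function in the presence of a bounded factor \<open>W\<close>. The
  factor makes the lemma applicable to several variables one after the other, each time absorbing
  the remaining ones into \<open>W\<close>.\<close>

lemma (in prob_space) poisson_weight_of_pgf:
  fixes W :: "'a \<Rightarrow> real"
  assumes [measurable]: "K \<in> measurable M (count_space UNIV)" "W \<in> borel_measurable M"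
    and W: "\<And>\<omega>. \<bar>W \<omega>\<bar> \<le> 1"
    and pgf: "\<And>x. \<bar>x\<bar> \<le> 1 \<Longrightarrow> expectation (\<lambda>\<omega>. x ^ K \<omega> * W \<omega>) = exp (m * (x - 1)) * w"
  shows "expectation (\<lambda>\<omega>. of_bool (K \<omega> = n) * W \<omega>) = poisson_weight m n * w"
proof -
  define a where "a n = expectation (\<lambda>\<omega>. of_bool (K \<omega> = n) * W \<omega>)" for n
  have a_sums: "(\<lambda>n. a n * x ^ n) sums (exp (m * (x - 1)) * w)" if x: "\<bar>x\<bar> < 1" for x
  proof -
    have split: "(\<lambda>n. of_bool (K \<omega> = n) * W \<omega> * x ^ n) sums (x ^ K \<omega> * W \<omega>)" for \<omega>
      using sums_single[of "K \<omega>" "\<lambda>n. x ^ n * W \<omega>"] by (rule sums_cong[THEN iffD1, rotated]) auto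
    have "(\<lambda>n. expectation (\<lambda>\<omega>. of_bool (K \<omega> = n) * W \<omega> * x ^ n)) sums expectation (\<lambda>\<omega>. \<Sum>n. of_bool (K \<omega> = n) * W \<omega> * x ^ n)"
    proof (rule sums_integral)
      show i: "integrable M (\<lambda>\<omega>. of_bool (K \<omega> = n) * W \<omega> * x ^ n)" for n
        using W by (intro integrable_const_bound[where B="\<bar>x\<bar> ^ n"]) (auto intro!: mult_left_le_one_le simp: abs_mult power_abs)
      show "AE \<omega> in M. summable (\<lambda>n. norm (of_bool (K \<omega> = n) * W \<omega> * x ^ n))"
        by (intro AE_I2 summable_finite[of "{K _}"]) auto
      have "expectation (\<lambda>\<omega>. norm (of_bool (K \<omega> = n) * W \<omega> * x ^ n)) \<le> \<bar>x\<bar> ^ n" for n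
      proof -
        have "expectation (\<lambda>\<omega>. norm (of_bool (K \<omega> = n) * W \<omega> * x ^ n)) \<le> expectation (\<lambda>\<omega>. \<bar>x\<bar> ^ n)"
          using W by (intro integral_mono integrable_norm i) (auto intro!: mult_left_le_one_le simp: abs_mult power_abs)
        then show ?thesis by (simp add: prob_space)
      qed
      then show "summable (\<lambda>n. expectation (\<lambda>\<omega>. norm (of_bool (K \<omega> = n) * W \<omega> * x ^ n)))"
        using x by (intro summable_comparison_test[OF _ summable_geometric[of "\<bar>x\<bar>"]]) auto
    qed
    moreover have "(\<Sum>n. of_bool (K \<omega> = n) * W \<omega> * x ^ n) = x ^ K \<omega> * W \<omega>" for \<omega>
      using sums_unique[OF split] by simp
    ultimately show ?thesis using pgf[of x] x by (simp add: a_def)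
  qed
  have "a n - poisson_weight m n * w = 0"
  proof (rule powser_eq_0_imp)
    fix x :: real assume x: "\<bar>x\<bar> < 1"
    have "(\<lambda>n. poisson_weight m n * x ^ n * w) sums (exp (m * (x - 1)) * w)"
      using sums_mult2[OF poisson_weight_pgf[of m x], of w] by simp
    from sums_diff[OF a_sums[OF x] this]
    show "(\<lambda>n. (a n - poisson_weight m n * w) * x ^ n) sums 0" by (simp add: algebra_simps)
  qed
  then show ?thesis by (simp add: a_def)
qed

sublocale random_grain_model \<subseteq> ground: poisson_process M lborel u
proof (intro poisson_process.intro poisson_process_axioms.intro)
  show "sigma_finite_measure lborel" by unfold_locales
qed (use points prob_space_axioms in auto)

context random_grain_model
begin

abbreviation grain_law :: "'a set measure" where
  "grain_law \<equiv> distr M fell \<Xi>"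

lemma grain_measurable [measurable]: "\<Xi> \<in> measurable M fell" "\<Xi>s j \<in> measurable M fell"
  using generic_grain grains by (auto simp: random_grain_def random_closed_set_def)

lemma grain_closed: "\<omega> \<in> space M \<Longrightarrow> closed (\<Xi> \<omega>)" "\<omega> \<in> space M \<Longrightarrow> closed (\<Xi>s j \<omega>)"
  using measurable_space[OF grain_measurable(1)] measurable_space[OF grain_measurable(2)] by auto

lemma point_measurable [measurable]: "u j \<in> borel_measurable M"
  using ground.poisson_point_measurable[of j] by simp

lemma prob_space_grain_law: "prob_space grain_law"
  by (rule prob_space_distr) measurable

abbreviation "all_grains \<equiv> (\<lambda>\<omega> i. case_nat \<Xi> \<Xi>s i \<omega>)"
abbreviation "all_points \<equiv> (\<lambda>\<omega> j. u j \<omega>)"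

lemma all_grains_measurable [measurable]: "all_grains \<in> measurable M (Pi\<^sub>M UNIV (\<lambda>_. fell))"
proof (rule measurable_PiM_single')
  show "(\<lambda>\<omega>. case_nat \<Xi> \<Xi>s i \<omega>) \<in> measurable M fell" for i by (cases i) auto
qed (auto simp: grain_closed split: nat.split)

lemma all_points_measurable [measurable]: "all_points \<in> measurable M (Pi\<^sub>M UNIV (\<lambda>_. borel))"
  by (rule measurable_PiM_single') auto

text \<open>Independence is given for the generated \<open>\<sigma>\<close>-algebras; as a product law it allows integrating
  over the grains with the points held fixed.\<close>

lemma distr_grains_points:
  "distr M (Pi\<^sub>M UNIV (\<lambda>_. fell) \<Otimes>\<^sub>M Pi\<^sub>M UNIV (\<lambda>_. borel)) (\<lambda>\<omega>. (all_grains \<omega>, all_points \<omega>))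
    = distr M (Pi\<^sub>M UNIV (\<lambda>_. fell)) all_grains \<Otimes>\<^sub>M distr M (Pi\<^sub>M UNIV (\<lambda>_. borel)) all_points"
  (is "distr M (?S \<Otimes>\<^sub>M ?T) ?XY = ?PX \<Otimes>\<^sub>M ?PY")
proof (rule pair_measure_eqI[symmetric])
  interpret G: prob_space ?PX by (rule prob_space_distr) measurable
  interpret P: prob_space ?PY by (rule prob_space_distr) measurable
  show "sigma_finite_measure ?PX" "sigma_finite_measure ?PY" by unfold_locales
  show "sets (?PX \<Otimes>\<^sub>M ?PY) = sets (distr M (?S \<Otimes>\<^sub>M ?T) ?XY)"
    by (simp cong: sets_pair_measure_cong)
  fix A B assume "A \<in> sets ?PX" "B \<in> sets ?PY"
  then have [measurable]: "A \<in> sets ?S" "B \<in> sets ?T" by auto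
  have "prob ((all_grains -` A \<inter> space M) \<inter> (all_points -` B \<inter> space M))
      = prob (all_grains -` A \<inter> space M) * prob (all_points -` B \<inter> space M)"
    by (rule indep_setD[OF grains_points_independent]) (auto simp: sets_vimage_algebra intro!: sigma_sets.Basic)
  moreover have "?XY -` (A \<times> B) \<inter> space M = (all_grains -` A \<inter> space M) \<inter> (all_points -` B \<inter> space M)" by auto
  ultimately show "emeasure ?PX A * emeasure ?PY B = emeasure (distr M (?S \<Otimes>\<^sub>M ?T) ?XY) (A \<times> B)"
    by (simp add: emeasure_distr emeasure_eq_measure ennreal_mult)
qed

lemma freeze_points_nn:
  assumes [measurable]: "h \<in> borel_measurable (Pi\<^sub>M UNIV (\<lambda>_. fell) \<Otimes>\<^sub>M Pi\<^sub>M UNIV (\<lambda>_. borel))"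
  shows "(\<integral>\<^sup>+\<omega>. h (all_grains \<omega>, all_points \<omega>) \<partial>M) = (\<integral>\<^sup>+\<omega>'. \<integral>\<^sup>+\<omega>. h (all_grains \<omega>, all_points \<omega>') \<partial>M \<partial>M)"
proof -
  let ?S = "Pi\<^sub>M UNIV (\<lambda>_::nat. fell :: 'a set measure)" and ?T = "Pi\<^sub>M UNIV (\<lambda>_::nat. borel :: 'a measure)"
  interpret G: prob_space "distr M ?S all_grains" by (rule prob_space_distr) measurable
  interpret P: prob_space "distr M ?T all_points" by (rule prob_space_distr) measurable
  interpret GP: pair_prob_space "distr M ?S all_grains" "distr M ?T all_points" ..
  have "(\<integral>\<^sup>+\<omega>. h (all_grains \<omega>, all_points \<omega>) \<partial>M) = (\<integral>\<^sup>+p. h p \<partial>distr M (?S \<Otimes>\<^sub>M ?T) (\<lambda>\<omega>. (all_grains \<omega>, all_points \<omega>)))"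
    by (subst nn_integral_distr) auto
  also have "distr M (?S \<Otimes>\<^sub>M ?T) (\<lambda>\<omega>. (all_grains \<omega>, all_points \<omega>)) = distr M ?S all_grains \<Otimes>\<^sub>M distr M ?T all_points"
    by (rule distr_grains_points)
  also have "(\<integral>\<^sup>+p. h p \<partial>(distr M ?S all_grains \<Otimes>\<^sub>M distr M ?T all_points))
      = (\<integral>\<^sup>+v. \<integral>\<^sup>+x. h (x, v) \<partial>distr M ?S all_grains \<partial>distr M ?T all_points)"
    by (subst GP.nn_integral_snd[symmetric]) auto
  also have "\<dots> = (\<integral>\<^sup>+\<omega>'. \<integral>\<^sup>+\<omega>. h (all_grains \<omega>, all_points \<omega>') \<partial>M \<partial>M)"
    proof -
    have "(\<lambda>x. h (x, v)) \<in> borel_measurable ?S" for v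
      by (rule measurable_compose[OF measurable_Pair2' assms]) (simp add: space_PiM)
    then show ?thesis by (simp add: nn_integral_distr)
  qed
  finally show ?thesis .
qed

lemma freeze_points:
  fixes h :: "_ \<Rightarrow> complex"
  assumes [measurable]: "h \<in> borel_measurable (Pi\<^sub>M UNIV (\<lambda>_. fell) \<Otimes>\<^sub>M Pi\<^sub>M UNIV (\<lambda>_. borel))"
    and bd: "\<And>\<omega> \<omega>'. \<omega> \<in> space M \<Longrightarrow> \<omega>' \<in> space M \<Longrightarrow> norm (h (all_grains \<omega>, all_points \<omega>')) \<le> 1"
  shows "expectation (\<lambda>\<omega>. h (all_grains \<omega>, all_points \<omega>)) = expectation (\<lambda>\<omega>'. expectation (\<lambda>\<omega>. h (all_grains \<omega>, all_points \<omega>')))"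
proof -
  let ?S = "Pi\<^sub>M UNIV (\<lambda>_::nat. fell :: 'a set measure)" and ?T = "Pi\<^sub>M UNIV (\<lambda>_::nat. borel :: 'a measure)"
  interpret G: prob_space "distr M ?S all_grains" by (rule prob_space_distr) measurable
  interpret P: prob_space "distr M ?T all_points" by (rule prob_space_distr) measurable
  interpret GP: pair_prob_space "distr M ?S all_grains" "distr M ?T all_points" ..
  note eq = distr_grains_points
  have "integrable (distr M (?S \<Otimes>\<^sub>M ?T) (\<lambda>\<omega>. (all_grains \<omega>, all_points \<omega>))) h"
    by (subst integrable_distr_eq) (auto intro!: integrable_const_bound[where B=1] AE_I2 bd)
  then have int: "integrable (distr M ?S all_grains \<Otimes>\<^sub>M distr M ?T all_points) (\<lambda>(x, v). h (x, v))"
    by (simp add: eq)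
  have "expectation (\<lambda>\<omega>. h (all_grains \<omega>, all_points \<omega>)) = (\<integral>p. h p \<partial>distr M (?S \<Otimes>\<^sub>M ?T) (\<lambda>\<omega>. (all_grains \<omega>, all_points \<omega>)))"
    by (subst integral_distr) auto
  also have "\<dots> = (\<integral>p. (\<lambda>(x, v). h (x, v)) p \<partial>(distr M ?S all_grains \<Otimes>\<^sub>M distr M ?T all_points))"
    by (simp add: eq)
  also have "\<dots> = (\<integral>v. \<integral>x. h (x, v) \<partial>distr M ?S all_grains \<partial>distr M ?T all_points)"
    using GP.integral_snd[OF int] by simp
  also have "\<dots> = expectation (\<lambda>\<omega>'. expectation (\<lambda>\<omega>. h (all_grains \<omega>, all_points \<omega>')))"
    proof -
    have "(\<lambda>x. h (x, v)) \<in> borel_measurable ?S" for v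
      by (rule measurable_compose[OF measurable_Pair2' assms(1)]) (simp add: space_PiM)
    then show ?thesis by (simp add: integral_distr)
  qed
  finally show ?thesis .
qed

lemma integral_grain_law:
  fixes f :: "'a set \<Rightarrow> 'b::{banach, second_countable_topology}"
  assumes [measurable]: "f \<in> borel_measurable fell"
  shows "(\<integral>F. f F \<partial>grain_law) = expectation (\<lambda>\<omega>. f (\<Xi>s j \<omega>))"
  by (subst grains_identically_distributed[of j, symmetric]) (simp add: integral_distr)

lemma nn_integral_grain_law:
  assumes [measurable]: "f \<in> borel_measurable fell"
  shows "(\<integral>\<^sup>+F. f F \<partial>grain_law) = (\<integral>\<^sup>+\<omega>. f (\<Xi>s j \<omega>) \<partial>M)"
  by (subst grains_identically_distributed[of j, symmetric]) (simp add: nn_integral_distr)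

text \<open>With the points frozen, the factors depend on different grains and are independent, so each grain
  is integrated out separately. The index shift by one skips the generic grain at index 0.\<close>

lemma expectation_prod_marked:
  fixes D :: "'a \<times> 'a set \<Rightarrow> complex"
  assumes [measurable]: "D \<in> borel_measurable (borel \<Otimes>\<^sub>M fell)" and le1: "\<And>t F. closed F \<Longrightarrow> norm (D (t, F)) \<le> 1"
  shows "expectation (\<lambda>\<omega>. \<Prod>j<n. D (u j \<omega>, \<Xi>s j \<omega>)) = expectation (\<lambda>\<omega>. \<Prod>j<n. \<integral>F. D (u j \<omega>, F) \<partial>grain_law)"
proof -
  define h where "h p = (\<Prod>j<n. D (snd p j, fst p (Suc j)))" for p :: "(nat \<Rightarrow> 'a set) \<times> (nat \<Rightarrow> 'a)"
  have "h \<in> borel_measurable (Pi\<^sub>M UNIV (\<lambda>_. fell) \<Otimes>\<^sub>M Pi\<^sub>M UNIV (\<lambda>_. borel))"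
    unfolding h_def[abs_def] by measurable
  moreover have "norm (h (all_grains \<omega>, all_points \<omega>')) \<le> 1" if "\<omega> \<in> space M" for \<omega> \<omega>'
    unfolding h_def prod_norm[symmetric] by (intro prod_le_1) (auto simp: le1 grain_closed[OF that])
  ultimately have "expectation (\<lambda>\<omega>. h (all_grains \<omega>, all_points \<omega>)) = expectation (\<lambda>\<omega>'. expectation (\<lambda>\<omega>. h (all_grains \<omega>, all_points \<omega>')))"
    by (rule freeze_points)
  moreover have "expectation (\<lambda>\<omega>. h (all_grains \<omega>, all_points \<omega>')) = (\<Prod>j<n. \<integral>F. D (u j \<omega>', F) \<partial>grain_law)" for \<omega>'
  proof -
    have Dm [measurable]: "(\<lambda>F. D (t, F)) \<in> borel_measurable fell" for t by measurable
    have "indep_vars (\<lambda>_. fell) (case_nat \<Xi> \<Xi>s) (Suc ` {..<n})"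
      using grains_independent by (rule indep_vars_subset) auto
    then have ind: "indep_vars (\<lambda>_. borel) (\<lambda>i \<omega>. D (u (i - 1) \<omega>', case_nat \<Xi> \<Xi>s i \<omega>)) (Suc ` {..<n})"
      by (rule indep_vars_compose2) measurable
    have "expectation (\<lambda>\<omega>. \<Prod>i\<in>Suc ` {..<n}. D (u (i - 1) \<omega>', case_nat \<Xi> \<Xi>s i \<omega>))
        = (\<Prod>i\<in>Suc ` {..<n}. expectation (\<lambda>\<omega>. D (u (i - 1) \<omega>', case_nat \<Xi> \<Xi>s i \<omega>)))"
      by (rule indep_vars_lebesgue_integral[OF _ ind])
         (auto intro!: integrable_const_bound[where B=1] AE_I2 le1 grain_closed)
    then have "expectation (\<lambda>\<omega>. \<Prod>j<n. D (u j \<omega>', \<Xi>s j \<omega>)) = (\<Prod>j<n. expectation (\<lambda>\<omega>. D (u j \<omega>', \<Xi>s j \<omega>)))"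
      by (simp add: prod.reindex)
    also have "\<dots> = (\<Prod>j<n. \<integral>F. D (u j \<omega>', F) \<partial>grain_law)"
      by (intro prod.cong integral_grain_law[symmetric]) auto
    finally show ?thesis by (simp add: h_def)
  qed
  ultimately show ?thesis by (simp add: h_def)
qed

abbreviation marked_intensity :: "('a \<times> 'a set) measure" where
  "marked_intensity \<equiv> lborel \<Otimes>\<^sub>M grain_law"

lemma marked_pair_sigma_finite: "pair_sigma_finite lborel grain_law"
proof -
  interpret Q: prob_space grain_law by (rule prob_space_grain_law)
  show ?thesis ..
qed

text \<open>Integrating out the grains replaces \<open>D\<close> by its mean over the grain, to which the
  functional of the point process applies. The outcome is the generating functional of a
  Poisson process with the product intensity.\<close>

theorem marked_pgfl:
  fixes D :: "'a \<times> 'a set \<Rightarrow> complex"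
  assumes [measurable]: "D \<in> borel_measurable (borel \<Otimes>\<^sub>M fell)" and le1: "\<And>t F. closed F \<Longrightarrow> norm (D (t, F)) \<le> 1"
    and int: "integrable marked_intensity (\<lambda>p. D p - 1)"
  shows "(\<lambda>n. expectation (\<lambda>\<omega>. \<Prod>j<n. D (u j \<omega>, \<Xi>s j \<omega>))) \<longlonglongrightarrow> exp (\<integral>p. D p - 1 \<partial>marked_intensity)"
proof -
  interpret Q: prob_space grain_law by (rule prob_space_grain_law)
  interpret pair_sigma_finite lborel grain_law by (rule marked_pair_sigma_finite)
  have Di: "integrable grain_law (\<lambda>F. D (t, F))" for t
    by (intro Q.integrable_const_bound[where B=1] AE_I2) (auto simp: le1)
  have D1: "(\<integral>F. D (t, F) - 1 \<partial>grain_law) = (\<integral>F. D (t, F) \<partial>grain_law) - 1" for t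
    by (subst Bochner_Integration.integral_diff[OF Di]) (simp, simp only: lebesgue_integral_const Q.prob_space scaleR_one)
  have "(\<lambda>n. expectation (\<lambda>\<omega>. \<Prod>j<n. \<integral>F. D (u j \<omega>, F) \<partial>grain_law)) \<longlonglongrightarrow> exp (\<integral>t. (\<integral>F. D (t, F) \<partial>grain_law) - 1 \<partial>lborel)"
  proof (rule ground.pgfl)
    show "(\<lambda>t. \<integral>F. D (t, F) \<partial>grain_law) \<in> borel_measurable lborel" by measurable
    show "norm (\<integral>F. D (t, F) \<partial>grain_law) \<le> 1" for t
    proof -
      have "norm (\<integral>F. D (t, F) \<partial>grain_law) \<le> (\<integral>F. norm (D (t, F)) \<partial>grain_law)" by (rule integral_norm_bound)
      also have "\<dots> \<le> (\<integral>F. 1 \<partial>grain_law)" by (intro integral_mono integrable_norm Di) (auto simp: le1)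
      also have "\<dots> = 1" by (simp only: lebesgue_integral_const Q.prob_space scaleR_one)
      finally show ?thesis .
    qed
    show "integrable lborel (\<lambda>t. (\<integral>F. D (t, F) \<partial>grain_law) - 1)"
      using integrable_fst'[OF int] by (simp add: D1)
  qed
  moreover have "expectation (\<lambda>\<omega>. \<Prod>j<n. D (u j \<omega>, \<Xi>s j \<omega>)) = expectation (\<lambda>\<omega>. \<Prod>j<n. \<integral>F. D (u j \<omega>, F) \<partial>grain_law)" for n
    by (rule expectation_prod_marked[OF assms(1) le1])
  moreover have "(\<integral>t. (\<integral>F. D (t, F) \<partial>grain_law) - 1 \<partial>lborel) = (\<integral>p. D p - 1 \<partial>marked_intensity)"
    unfolding D1[symmetric] using integral_fst'[OF int] by simp
  ultimately show ?thesis by (simp only:)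
qed

lemma marked_campbell:
  fixes f :: "'a \<times> 'a set \<Rightarrow> ennreal"
  assumes [measurable]: "f \<in> borel_measurable (borel \<Otimes>\<^sub>M fell)"
  shows "(\<Sum>j. \<integral>\<^sup>+\<omega>. f (u j \<omega>, \<Xi>s j \<omega>) \<partial>M) = (\<integral>\<^sup>+p. f p \<partial>marked_intensity)"
proof -
  interpret Q: prob_space grain_law by (rule prob_space_grain_law)
  interpret pair_sigma_finite lborel grain_law by (rule marked_pair_sigma_finite)
  have fm [measurable]: "(\<lambda>F. f (t, F)) \<in> borel_measurable fell" for t by measurable
  have "(\<integral>\<^sup>+\<omega>. f (u j \<omega>, \<Xi>s j \<omega>) \<partial>M) = (\<integral>\<^sup>+\<omega>. \<integral>\<^sup>+F. f (u j \<omega>, F) \<partial>grain_law \<partial>M)" for j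
  proof -
    have "(\<integral>\<^sup>+\<omega>. f (u j \<omega>, \<Xi>s j \<omega>) \<partial>M) = (\<integral>\<^sup>+\<omega>'. \<integral>\<^sup>+\<omega>. f (u j \<omega>', \<Xi>s j \<omega>) \<partial>M \<partial>M)"
      using freeze_points_nn[of "\<lambda>p. f (snd p j, fst p (Suc j))"] by simp
    then show ?thesis by (simp add: nn_integral_grain_law[OF fm, of _ j])
  qed
  then have "(\<Sum>j. \<integral>\<^sup>+\<omega>. f (u j \<omega>, \<Xi>s j \<omega>) \<partial>M) = (\<Sum>j. \<integral>\<^sup>+\<omega>. \<integral>\<^sup>+F. f (u j \<omega>, F) \<partial>grain_law \<partial>M)" by simp
  also have "\<dots> = (\<integral>\<^sup>+t. \<integral>\<^sup>+F. f (t, F) \<partial>grain_law \<partial>lborel)"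
    by (rule ground.campbell) measurable
  also have "\<dots> = (\<integral>\<^sup>+p. f p \<partial>marked_intensity)"
    by (rule Q.nn_integral_fst) measurable
  finally show ?thesis .
qed

definition marked_card :: "('a \<times> 'a set) set \<Rightarrow> 'w \<Rightarrow> nat" where
  "marked_card A \<omega> = card {j. (u j \<omega>, \<Xi>s j \<omega>) \<in> A}"

lemma marked_AE_finite:
  assumes [measurable]: "A \<in> sets (borel \<Otimes>\<^sub>M fell)" and fin: "emeasure marked_intensity A < \<infinity>"
  shows "AE \<omega> in M. finite {j. (u j \<omega>, \<Xi>s j \<omega>) \<in> A}"
proof -
  have A': "A \<in> sets marked_intensity" by (simp cong: sets_pair_measure_cong)
  have "(\<integral>\<^sup>+\<omega>. (\<Sum>j. indicator A (u j \<omega>, \<Xi>s j \<omega>)) \<partial>M) = (\<Sum>j. \<integral>\<^sup>+\<omega>. indicator A (u j \<omega>, \<Xi>s j \<omega>) \<partial>M)"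
    by (rule nn_integral_suminf) measurable
  also have "\<dots> < \<infinity>"
    using marked_campbell[of "indicator A"] fin A' by simp
  finally have "AE \<omega> in M. (\<Sum>j. indicator A (u j \<omega>, \<Xi>s j \<omega>)) \<noteq> (\<infinity>::ennreal)"
    by (intro nn_integral_PInf_AE) auto
  then show ?thesis
  proof eventually_elim
    case (elim \<omega>)
    have "(\<Sum>j. indicator A (u j \<omega>, \<Xi>s j \<omega>)) = (\<Sum>j. indicator {j. (u j \<omega>, \<Xi>s j \<omega>) \<in> A} j :: ennreal)"
      by (intro suminf_cong) (auto simp: indicator_def)
    then show ?case using elim by (auto simp: suminf_indicator_eq_card split: if_splits)
  qed
qed

lemma marked_card_measurable [measurable]:
  assumes [measurable]: "A \<in> sets (borel \<Otimes>\<^sub>M fell)"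
  shows "marked_card A \<in> measurable M (count_space UNIV)"
proof -
  have "marked_card A = (\<lambda>\<omega>. nat \<lfloor>enn2real (\<Sum>j. indicator A (u j \<omega>, \<Xi>s j \<omega>))\<rfloor>)"
  proof
    fix \<omega>
    have "(\<Sum>j. indicator A (u j \<omega>, \<Xi>s j \<omega>)) = (\<Sum>j. indicator {j. (u j \<omega>, \<Xi>s j \<omega>) \<in> A} j :: ennreal)"
      by (intro suminf_cong) (auto simp: indicator_def)
    then show "marked_card A \<omega> = nat \<lfloor>enn2real (\<Sum>j. indicator A (u j \<omega>, \<Xi>s j \<omega>))\<rfloor>"
      by (auto simp: suminf_indicator_eq_card marked_card_def)
  qed
  then show ?thesis by simp
qed

lemma prod_power_card_tendsto:
  fixes x :: complex
  assumes "finite J"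
  shows "(\<lambda>n. \<Prod>j<n. if j \<in> J then x else 1) \<longlonglongrightarrow> x ^ card J"
proof -
  obtain n0 where n0: "J \<subseteq> {..<n0}" using assms finite_nat_iff_bounded by blast
  have "(\<Prod>j<n. if j \<in> J then x else 1) = x ^ card J" if "n0 \<le> n" for n
  proof -
    have "(\<Prod>j<n. if j \<in> J then x else 1) = (\<Prod>j\<in>J. if j \<in> J then x else 1)"
      using n0 that by (intro prod.mono_neutral_right) auto
    then show ?thesis by simp
  qed
  then show ?thesis by (intro tendsto_eventually) (auto simp: eventually_sequentially)
qed

text \<open>A multiplicative functional that takes the values \<open>x\<close>, \<open>y\<close>, \<open>z\<close> on three disjoint sets turns
  \<open>marked_pgfl\<close> into a joint generating function.\<close>

lemma marked_card_pgf:
  fixes x y z :: complex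
  assumes [measurable]: "A \<in> sets (borel \<Otimes>\<^sub>M fell)" "B \<in> sets (borel \<Otimes>\<^sub>M fell)" "C \<in> sets (borel \<Otimes>\<^sub>M fell)"
    and fin: "emeasure marked_intensity A < \<infinity>" "emeasure marked_intensity B < \<infinity>" "emeasure marked_intensity C < \<infinity>"
    and dis: "A \<inter> B = {}" "A \<inter> C = {}" "B \<inter> C = {}"
    and le1: "norm x \<le> 1" "norm y \<le> 1" "norm z \<le> 1"
  shows "expectation (\<lambda>\<omega>. x ^ marked_card A \<omega> * y ^ marked_card B \<omega> * z ^ marked_card C \<omega>)
    = exp (of_real (measure marked_intensity A) * (x - 1) + of_real (measure marked_intensity B) * (y - 1) + of_real (measure marked_intensity C) * (z - 1))"
proof -
  have sets: "sets marked_intensity = sets (borel \<Otimes>\<^sub>M fell)" by (simp cong: sets_pair_measure_cong)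
  define D where "D p = (if p \<in> A then x else 1) * (if p \<in> B then y else 1) * (if p \<in> C then z else 1)" for p :: "'a \<times> 'a set"
  have D1: "D p - 1 = indicat_real A p *\<^sub>R (x - 1) + indicat_real B p *\<^sub>R (y - 1) + indicat_real C p *\<^sub>R (z - 1)" for p
    using dis by (auto simp: D_def indicator_def)
  have D_le: "norm (D p) \<le> 1" for p
    using le1 by (auto simp: D_def norm_mult intro!: mult_le_one)
  have m: "D \<in> borel_measurable (borel \<Otimes>\<^sub>M fell)" unfolding D_def[abs_def] by measurable
  have ind: "integrable marked_intensity (\<lambda>p. indicat_real S p *\<^sub>R (w::complex))" "(\<integral>p. indicat_real S p *\<^sub>R (w::complex) \<partial>marked_intensity) = of_real (measure marked_intensity S) * w"
    if "S \<in> sets (borel \<Otimes>\<^sub>M fell)" "emeasure marked_intensity S < \<infinity>" for S w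
    using that by (auto simp: sets scaleR_conv_of_real)
  have "(\<lambda>n. expectation (\<lambda>\<omega>. \<Prod>j<n. D (u j \<omega>, \<Xi>s j \<omega>))) \<longlonglongrightarrow> exp (\<integral>p. D p - 1 \<partial>marked_intensity)"
    by (rule marked_pgfl[OF m]) (auto simp: D_le D1 intro!: Bochner_Integration.integrable_add ind fin)
  also have "(\<integral>p. D p - 1 \<partial>marked_intensity) = of_real (measure marked_intensity A) * (x - 1) + of_real (measure marked_intensity B) * (y - 1) + of_real (measure marked_intensity C) * (z - 1)"
    unfolding D1 using fin by (simp add: ind scaleR_conv_of_real)
  finally have 1: "(\<lambda>n. expectation (\<lambda>\<omega>. \<Prod>j<n. D (u j \<omega>, \<Xi>s j \<omega>))) \<longlonglongrightarrow> exp \<dots>" .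
  have 2: "(\<lambda>n. expectation (\<lambda>\<omega>. \<Prod>j<n. D (u j \<omega>, \<Xi>s j \<omega>))) \<longlonglongrightarrow> expectation (\<lambda>\<omega>. x ^ marked_card A \<omega> * y ^ marked_card B \<omega> * z ^ marked_card C \<omega>)"
  proof (rule integral_dominated_convergence[where w="\<lambda>_. 1"])
    show "AE \<omega> in M. norm (\<Prod>j<n. D (u j \<omega>, \<Xi>s j \<omega>)) \<le> 1" for n
      unfolding prod_norm[symmetric] by (intro AE_I2 prod_le_1) (auto simp: D_le)
    show "AE \<omega> in M. (\<lambda>n. \<Prod>j<n. D (u j \<omega>, \<Xi>s j \<omega>)) \<longlonglongrightarrow> x ^ marked_card A \<omega> * y ^ marked_card B \<omega> * z ^ marked_card C \<omega>"
      using marked_AE_finite[OF assms(1) fin(1)] marked_AE_finite[OF assms(2) fin(2)] marked_AE_finite[OF assms(3) fin(3)]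
    proof eventually_elim
      case (elim \<omega>)
      show ?case
        using tendsto_mult[OF tendsto_mult[OF prod_power_card_tendsto[OF elim(1), of x] prod_power_card_tendsto[OF elim(2), of y]] prod_power_card_tendsto[OF elim(3), of z]]
        by (simp add: D_def marked_card_def prod.distrib)
    qed
  qed (use m in auto)
  from LIMSEQ_unique[OF 2 1] show ?thesis .
qed

lemma marked_card_joint_prob:
  assumes m [measurable]: "A \<in> sets (borel \<Otimes>\<^sub>M fell)" "B \<in> sets (borel \<Otimes>\<^sub>M fell)" "C \<in> sets (borel \<Otimes>\<^sub>M fell)"
    and fin: "emeasure marked_intensity A < \<infinity>" "emeasure marked_intensity B < \<infinity>" "emeasure marked_intensity C < \<infinity>"
    and dis: "A \<inter> B = {}" "A \<inter> C = {}" "B \<inter> C = {}"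
  shows "prob {\<omega> \<in> space M. marked_card A \<omega> = a \<and> marked_card B \<omega> = b \<and> marked_card C \<omega> = c}
    = poisson_weight (measure marked_intensity A) a * poisson_weight (measure marked_intensity B) b * poisson_weight (measure marked_intensity C) c"
proof -
  let ?A = "marked_card A" and ?B = "marked_card B" and ?C = "marked_card C"
  let ?a = "measure marked_intensity A" and ?b = "measure marked_intensity B" and ?c = "measure marked_intensity C"
  have pgf: "expectation (\<lambda>\<omega>. x ^ ?A \<omega> * (y ^ ?B \<omega> * z ^ ?C \<omega>)) = exp (?a * (x - 1)) * exp (?b * (y - 1) + ?c * (z - 1))"
    if "\<bar>x\<bar> \<le> 1" "\<bar>y\<bar> \<le> 1" "\<bar>z\<bar> \<le> 1" for x y z :: real
  proof -
    have "complex_of_real (expectation (\<lambda>\<omega>. x ^ ?A \<omega> * (y ^ ?B \<omega> * z ^ ?C \<omega>)))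
       = expectation (\<lambda>\<omega>. of_real x ^ ?A \<omega> * of_real y ^ ?B \<omega> * of_real z ^ ?C \<omega>)"
      by (simp add: integral_complex_of_real[symmetric] mult.assoc)
    also have "\<dots> = exp (of_real ?a * (of_real x - 1) + of_real ?b * (of_real y - 1) + of_real ?c * (of_real z - 1))"
      using that by (intro marked_card_pgf m fin dis) auto
    also have "\<dots> = of_real (exp (?a * (x - 1)) * exp (?b * (y - 1) + ?c * (z - 1)))"
      by (simp add: exp_of_real[symmetric] exp_add[symmetric] add.assoc)
    finally show ?thesis by (simp only: of_real_eq_iff)
  qed
  have 1: "expectation (\<lambda>\<omega>. of_bool (?A \<omega> = a) * (y ^ ?B \<omega> * z ^ ?C \<omega>)) = poisson_weight ?a a * exp (?b * (y - 1) + ?c * (z - 1))"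
    if "\<bar>y\<bar> \<le> 1" "\<bar>z\<bar> \<le> 1" for y z :: real
    by (rule poisson_weight_of_pgf) (use that in \<open>auto simp: abs_mult power_abs power_le_one intro!: mult_le_one pgf\<close>)
  have 2: "expectation (\<lambda>\<omega>. of_bool (?B \<omega> = b) * (of_bool (?A \<omega> = a) * z ^ ?C \<omega>)) = poisson_weight ?b b * (poisson_weight ?a a * exp (?c * (z - 1)))"
    if "\<bar>z\<bar> \<le> 1" for z :: real
  proof (rule poisson_weight_of_pgf)
    fix y :: real assume "\<bar>y\<bar> \<le> 1"
    from 1[OF this that] show "expectation (\<lambda>\<omega>. y ^ ?B \<omega> * (of_bool (?A \<omega> = a) * z ^ ?C \<omega>)) = exp (?b * (y - 1)) * (poisson_weight ?a a * exp (?c * (z - 1)))"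
      by (simp add: exp_add mult_ac)
  qed (use that in \<open>auto simp: abs_mult power_abs power_le_one\<close>)
  have 3: "expectation (\<lambda>\<omega>. of_bool (?C \<omega> = c) * (of_bool (?A \<omega> = a) * of_bool (?B \<omega> = b))) = poisson_weight ?c c * (poisson_weight ?a a * poisson_weight ?b b)"
  proof (rule poisson_weight_of_pgf)
    fix z :: real assume "\<bar>z\<bar> \<le> 1"
    from 2[OF this] show "expectation (\<lambda>\<omega>. z ^ ?C \<omega> * (of_bool (?A \<omega> = a) * of_bool (?B \<omega> = b))) = exp (?c * (z - 1)) * (poisson_weight ?a a * poisson_weight ?b b)"
      by (simp add: mult_ac)
  qed auto
  have "expectation (\<lambda>\<omega>. of_bool (?C \<omega> = c) * (of_bool (?A \<omega> = a) * of_bool (?B \<omega> = b)) :: real)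
     = expectation (indicator {\<omega> \<in> space M. ?A \<omega> = a \<and> ?B \<omega> = b \<and> ?C \<omega> = c})"
    by (intro Bochner_Integration.integral_cong) (auto simp: indicator_def)
  also have "\<dots> = prob {\<omega> \<in> space M. ?A \<omega> = a \<and> ?B \<omega> = b \<and> ?C \<omega> = c}" by simp
  finally show ?thesis using 3 by (simp add: mult_ac)
qed

text \<open>The order of the components is that of the later application: the first one counts the
  grains covering both of two points, the others those covering just one of them.\<close>

theorem marked_card_joint_law:
  assumes m [measurable]: "A \<in> sets (borel \<Otimes>\<^sub>M fell)" "B \<in> sets (borel \<Otimes>\<^sub>M fell)" "C \<in> sets (borel \<Otimes>\<^sub>M fell)"
    and fin: "emeasure marked_intensity A < \<infinity>" "emeasure marked_intensity B < \<infinity>" "emeasure marked_intensity C < \<infinity>"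
    and dis: "A \<inter> B = {}" "A \<inter> C = {}" "B \<inter> C = {}"
  shows "distr M (count_space UNIV \<Otimes>\<^sub>M (count_space UNIV \<Otimes>\<^sub>M count_space UNIV))
      (\<lambda>\<omega>. (marked_card C \<omega>, marked_card A \<omega>, marked_card B \<omega>))
    = poisson_law (measure marked_intensity C) \<Otimes>\<^sub>M
        (poisson_law (measure marked_intensity A) \<Otimes>\<^sub>M poisson_law (measure marked_intensity B))"
    (is "distr M ?N ?K = ?PC \<Otimes>\<^sub>M (?PA \<Otimes>\<^sub>M ?PB)")
proof (rule measure_eqI_countable[of _ UNIV])
  have N: "count_space (UNIV :: nat set) \<Otimes>\<^sub>M (count_space (UNIV :: nat set) \<Otimes>\<^sub>M count_space (UNIV :: nat set)) = count_space UNIV" by (simp add: pair_measure_countable)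
  interpret PA: prob_space ?PA by (rule prob_space_poisson_law) simp
  interpret PB: prob_space ?PB by (rule prob_space_poisson_law) simp
  interpret PC: prob_space ?PC by (rule prob_space_poisson_law) simp
  interpret PAB: pair_prob_space ?PA ?PB ..
  interpret PCAB: pair_prob_space ?PC "?PA \<Otimes>\<^sub>M ?PB" ..
  have "sets (?PA \<Otimes>\<^sub>M ?PB) = sets (count_space (UNIV :: nat set) \<Otimes>\<^sub>M count_space (UNIV :: nat set))"
    by (intro sets_pair_measure_cong) auto
  also have "count_space (UNIV :: nat set) \<Otimes>\<^sub>M count_space (UNIV :: nat set) = count_space UNIV"
    by (simp add: pair_measure_countable)
  finally have sA: "sets (?PA \<Otimes>\<^sub>M ?PB) = UNIV" by simp
  have "sets (?PC \<Otimes>\<^sub>M (?PA \<Otimes>\<^sub>M ?PB)) = sets (count_space (UNIV :: nat set) \<Otimes>\<^sub>M (count_space (UNIV :: nat set) \<Otimes>\<^sub>M count_space (UNIV :: nat set)))"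
    by (intro sets_pair_measure_cong) auto
  also have "\<dots> = Pow UNIV" unfolding N by simp
  finally show "sets (?PC \<Otimes>\<^sub>M (?PA \<Otimes>\<^sub>M ?PB)) = Pow UNIV" .
  show "sets (distr M ?N ?K) = Pow UNIV" by (simp add: N)
  fix p :: "nat \<times> nat \<times> nat"
  obtain c a b where p: "p = (c, a, b)" by (cases p)
  have [measurable]: "?K \<in> measurable M ?N" by measurable
  have "?K -` {p} \<inter> space M = {\<omega> \<in> space M. marked_card A \<omega> = a \<and> marked_card B \<omega> = b \<and> marked_card C \<omega> = c}"
    by (auto simp: p)
  then have "emeasure (distr M ?N ?K) {p} = ennreal (poisson_weight (measure marked_intensity A) a * poisson_weight (measure marked_intensity B) b * poisson_weight (measure marked_intensity C) c)"
    by (subst emeasure_distr) (unfold N, simp_all add: emeasure_eq_measure marked_card_joint_prob[OF m fin dis])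
  also have "\<dots> = emeasure ?PC {c} * (emeasure ?PA {a} * emeasure ?PB {b})"
    by (simp add: emeasure_poisson_law_singleton poisson_weight_nonneg ennreal_mult[symmetric] mult_ac)
  also have "emeasure ?PA {a} * emeasure ?PB {b} = emeasure (?PA \<Otimes>\<^sub>M ?PB) ({a} \<times> {b})"
    by (rule PB.emeasure_pair_measure_Times[symmetric]) auto
  also have "emeasure ?PC {c} * \<dots> = emeasure (?PC \<Otimes>\<^sub>M (?PA \<Otimes>\<^sub>M ?PB)) ({c} \<times> ({a} \<times> {b}))"
    by (rule PAB.emeasure_pair_measure_Times[symmetric]) (auto simp: sA)
  finally show "emeasure (distr M ?N ?K) {p} = emeasure (?PC \<Otimes>\<^sub>M (?PA \<Otimes>\<^sub>M ?PB)) {p}" by (simp add: p)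
qed simp

end

section \<open>Second-order behaviour of functions of two overlapping Poisson counts\<close>

lemma poisson_weight_le_1: "0 \<le> m \<Longrightarrow> poisson_weight m n \<le> 1"
  using sum_le_suminf[OF sums_summable[OF poisson_weight_sums[of m]], of "{n}"] sums_unique[OF poisson_weight_sums[of m]]
  by (auto simp: poisson_weight_nonneg)

text \<open>The derivative in the mean is a difference of two neighbouring weights, both in the unit interval.\<close>

lemma poisson_weight_lipschitz:
  assumes "0 \<le> m" "0 \<le> r"
  shows "\<bar>poisson_weight (m + r) n - poisson_weight m n\<bar> \<le> r"
proof -
  define d where "d x = (if n = 0 then 0 else poisson_weight x (n - 1)) - poisson_weight x n" for x
  have D: "((\<lambda>x. poisson_weight x n) has_real_derivative d x) (at x)" for x
  proof (cases n)
    case 0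
    then show ?thesis unfolding d_def poisson_weight_def by (auto intro!: derivative_eq_intros)
  next
    case (Suc k)
    have "((\<lambda>x. exp (- x) * x ^ Suc k / fact (Suc k)) has_real_derivative (exp (- x) * (real (Suc k) * x ^ k) - exp (- x) * x ^ Suc k) / fact (Suc k)) (at x)"
      by (auto intro!: derivative_eq_intros simp del: power_Suc fact_Suc)
    moreover have "(exp (- x) * (real (Suc k) * x ^ k) - exp (- x) * x ^ Suc k) / fact (Suc k) = d x"
    proof -
      have "exp (- x) * (real (Suc k) * x ^ k) / fact (Suc k) = exp (- x) * x ^ k / fact k"
        by (simp add: fact_Suc del: of_nat_Suc)
      then show ?thesis by (simp add: d_def Suc poisson_weight_def diff_divide_distrib del: fact_Suc power_Suc)
    qed
    ultimately show ?thesis by (simp add: poisson_weight_def Suc)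
  qed
  have db: "\<bar>d x\<bar> \<le> 1" if "0 \<le> x" for x
    using poisson_weight_le_1[OF that, of n] poisson_weight_le_1[OF that, of "n - 1"]
      poisson_weight_nonneg[OF that, of n] poisson_weight_nonneg[OF that, of "n - 1"]
    by (auto simp: d_def)
  show ?thesis
  proof (cases "r = 0")
    case False
    then have "m < m + r" using assms by simp
    from MVT2[OF this, of "\<lambda>x. poisson_weight x n" d] D obtain z where
      z: "m < z" "poisson_weight (m + r) n - poisson_weight m n = r * d z" by auto
    then show ?thesis using db[of z] assms mult_left_mono[of "\<bar>d z\<bar>" 1 r] by (simp add: abs_mult)
  qed simp
qed

lemma poisson_weight_factorial_moment: "(\<lambda>n. real n * (real n - 1) * poisson_weight m n) sums m\<^sup>2"
proof -
  have "real (Suc n) * (real (Suc n) - 1) * poisson_weight m (Suc n) = m * (real n * poisson_weight m n)" for n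
  proof -
    have "real (Suc n) * (real (Suc n) - 1) * poisson_weight m (Suc n) = real n * (real (Suc n) * poisson_weight m (Suc n))"
      by simp
    then show ?thesis unfolding poisson_weight_Suc by simp
  qed
  then have "(\<lambda>n. real (Suc n) * (real (Suc n) - 1) * poisson_weight m (Suc n)) sums (m * m)"
    by (simp only:) (intro sums_mult poisson_weight_mean)
  then show ?thesis by (subst (asm) sums_Suc_iff) (simp add: power2_eq_square)
qed

lemma poisson_law_moments:
  assumes m: "0 \<le> m"
  shows "integrable (poisson_law m) (\<lambda>n. real n * (real n - 1))" "(\<integral>n. real n * (real n - 1) \<partial>poisson_law m) = m\<^sup>2"
    and "integrable (poisson_law m) real" "integrable (poisson_law m) (\<lambda>n. (real n)\<^sup>2)"
proof -
  have "real n * (real n - 1) \<ge> 0" for n by (cases n) auto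
  then have eq: "poisson_weight m n * norm (real n * (real n - 1)) = real n * (real n - 1) * poisson_weight m n" for n
    by simp
  have sm: "summable (\<lambda>n. poisson_weight m n * norm (real n * (real n - 1)))"
    unfolding eq by (rule sums_summable[OF poisson_weight_factorial_moment])
  show 1: "integrable (poisson_law m) (\<lambda>n. real n * (real n - 1))" by (rule integrable_poisson_law[OF m sm])
  show "(\<integral>n. real n * (real n - 1) \<partial>poisson_law m) = m\<^sup>2"
    unfolding integral_poisson_law[OF m sm] using sums_unique[OF poisson_weight_factorial_moment[of m]] by (simp add: mult_ac)
  show 2: "integrable (poisson_law m) real"
    using sums_summable[OF poisson_weight_mean[of m]] by (intro integrable_poisson_law[OF m]) (simp add: mult_ac)
  have "(\<lambda>n. (real n)\<^sup>2) = (\<lambda>n. real n * (real n - 1) + real n)" by (auto simp: power2_eq_square algebra_simps)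
  then show "integrable (poisson_law m) (\<lambda>n. (real n)\<^sup>2)" using Bochner_Integration.integrable_add[OF 1 2] by simp
qed

text \<open>The indicator of \<open>k \<le> n\<close> with its linear term in the Poisson-Charlier expansion subtracted: for a
  Poisson variable \<open>N\<close> of mean \<open>\<mu>\<close> the slope \<open>E (N - \<mu>) 1(N \<ge> k) / \<mu>\<close> equals
  \<open>poisson_weight \<mu> (k - 1)\<close>.\<close>

definition poisson_residual :: "real \<Rightarrow> nat \<Rightarrow> nat \<Rightarrow> real" where
  "poisson_residual \<mu> k n = of_bool (k \<le> n) - poisson_weight \<mu> (k - 1) * real n"

lemma poisson_residual_bound: "0 \<le> \<mu> \<Longrightarrow> \<bar>poisson_residual \<mu> k n\<bar> \<le> 1 + real n"
proof -
  assume "0 \<le> \<mu>"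
  then have "poisson_weight \<mu> (k - 1) * real n \<le> real n" "0 \<le> poisson_weight \<mu> (k - 1) * real n"
    using poisson_weight_le_1[of \<mu> "k - 1"] poisson_weight_nonneg[of \<mu> "k - 1"] by (auto intro: mult_left_le_one_le)
  then show ?thesis by (auto simp: poisson_residual_def)
qed

lemma (in prob_space) variance_le_shift:
  fixes G :: "'a \<Rightarrow> real"
  assumes "integrable M G" "integrable M (\<lambda>x. (G x)\<^sup>2)"
  shows "0 \<le> expectation (\<lambda>x. (G x)\<^sup>2) - (expectation G)\<^sup>2"
    and "expectation (\<lambda>x. (G x)\<^sup>2) - (expectation G)\<^sup>2 \<le> expectation (\<lambda>x. (G x - g)\<^sup>2)"
proof -
  have "variance G = expectation (\<lambda>x. (G x)\<^sup>2) - (expectation G)\<^sup>2" using assms by (rule variance_eq)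
  moreover have "0 \<le> variance G" by simp
  ultimately show "0 \<le> expectation (\<lambda>x. (G x)\<^sup>2) - (expectation G)\<^sup>2" by simp
  have "expectation (\<lambda>x. (G x - g)\<^sup>2) = expectation (\<lambda>x. (G x)\<^sup>2 - 2 * g * G x + g\<^sup>2)"
    by (simp add: power2_diff algebra_simps)
  also have "\<dots> = expectation (\<lambda>x. (G x)\<^sup>2) - 2 * g * expectation G + g\<^sup>2"
    using assms by (simp add: prob_space)
  finally show "expectation (\<lambda>x. (G x)\<^sup>2) - (expectation G)\<^sup>2 \<le> expectation (\<lambda>x. (G x - g)\<^sup>2)"
    using zero_le_power2[of "expectation G - g"] by (simp add: power2_diff mult_ac)
qed

text \<open>The variable \<open>c\<close> counts what the two sums have in common, so the covariance of the two values
  is the variance of the conditional mean \<open>G c\<close> given \<open>c\<close>. An increment of \<open>G\<close> is a Poisson weight of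
  mean \<open>m\<close> (or 0) minus the subtracted slope, which is a Poisson weight of mean \<open>m + r\<close>. The first
  increment is therefore at most \<open>r\<close>, and all are at most 1. As \<open>c = 1\<close> has probability at most
  \<open>r\<close> and the second factorial moment of \<open>c\<close> is \<open>r\<^sup>2\<close>, the variance is quadratic in \<open>r\<close>.\<close>

lemma
  fixes m r :: real and k :: nat
  assumes m: "0 \<le> m" and r: "0 \<le> r" and k: "1 \<le> k"
  defines "PQ \<equiv> poisson_law r \<Otimes>\<^sub>M (poisson_law m \<Otimes>\<^sub>M poisson_law m)"
    and "g \<equiv> poisson_residual (m + r) k"
  shows poisson_residual_integrable: "integrable PQ (\<lambda>(c, a, b). g (c + a))"
    and poisson_residual_mean: "(\<integral>(c, a, b). g (c + b) \<partial>PQ) = (\<integral>(c, a, b). g (c + a) \<partial>PQ)"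
    and poisson_residual_product_integrable: "integrable PQ (\<lambda>(c, a, b). g (c + a) * g (c + b))"
    and poisson_residual_covariance:
      "\<bar>(\<integral>(c, a, b). g (c + a) * g (c + b) \<partial>PQ) - (\<integral>(c, a, b). g (c + a) \<partial>PQ)\<^sup>2\<bar> \<le> (r + 2) * r\<^sup>2"
proof -
  interpret A: prob_space "poisson_law m" using m by (rule prob_space_poisson_law)
  interpret C: prob_space "poisson_law r" using r by (rule prob_space_poisson_law)
  interpret AA: pair_prob_space "poisson_law m" "poisson_law m" ..
  interpret CAA: pair_prob_space "poisson_law r" "poisson_law m \<Otimes>\<^sub>M poisson_law m" ..
  let ?P = "poisson_law m" and ?C = "poisson_law r"
  have m_one: "integrable ?P (\<lambda>a. 1 + real a)" using poisson_law_moments(3)[OF m] by simp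
  have c_one: "integrable ?C (\<lambda>c. 1 + real c)" "integrable ?C (\<lambda>c. (1 + real c)\<^sup>2)"
    using poisson_law_moments(3,4)[OF r] by (simp_all add: power2_sum)
  have gb: "\<bar>g n\<bar> \<le> 1 + real n" for n unfolding g_def using m r by (intro poisson_residual_bound) simp
  have gb': "\<bar>g (c + a)\<bar> \<le> (1 + real c) * (1 + real a)" for c a
  proof -
    have "1 + real (c + a) \<le> (1 + real c) * (1 + real a)" by (simp add: algebra_simps)
    then show ?thesis using gb[of "c + a"] by linarith
  qed
  have sets: "sets (?P \<Otimes>\<^sub>M ?P) = sets (count_space (UNIV :: nat set) \<Otimes>\<^sub>M count_space (UNIV :: nat set))"
    by (intro sets_pair_measure_cong) auto
  also have eq2: "count_space (UNIV :: nat set) \<Otimes>\<^sub>M count_space (UNIV :: nat set) = count_space UNIV" by (simp add: pair_measure_countable)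
  finally have s2: "sets (?P \<Otimes>\<^sub>M ?P) = UNIV" by simp
  have "sets PQ = sets (count_space (UNIV :: nat set) \<Otimes>\<^sub>M count_space (UNIV :: (nat \<times> nat) set))"
    unfolding PQ_def by (intro sets_pair_measure_cong) (auto simp: s2)
  also have "count_space (UNIV :: nat set) \<Otimes>\<^sub>M count_space (UNIV :: (nat \<times> nat) set) = count_space UNIV" by (simp add: pair_measure_countable)
  finally have s3: "sets PQ = UNIV" by simp
  have meas3: "f \<in> borel_measurable PQ" for f :: "_ \<Rightarrow> real" by (rule measurableI) (auto simp: s3)
  have meas1: "f \<in> borel_measurable (poisson_law x)" for f :: "_ \<Rightarrow> real" and x by (rule measurableI) auto
  have ab_one: "integrable (?P \<Otimes>\<^sub>M ?P) (\<lambda>(a, b). (1 + real a) * (1 + real b))"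
    by (rule integrable_pair_mult[OF A.sigma_finite_measure_axioms m_one m_one])
  have b3: "integrable PQ (\<lambda>(c, a, b). (1 + real c)\<^sup>2 * ((1 + real a) * (1 + real b)))"
    using integrable_pair_mult[OF AA.sigma_finite_measure_axioms c_one(2) ab_one] unfolding PQ_def by (simp add: split_beta')
  have le_b3: "\<bar>g (c + a)\<bar> * \<bar>g (c + b)\<bar> \<le> (1 + real c)\<^sup>2 * ((1 + real a) * (1 + real b))" for c a b
    using mult_mono[OF gb'[of c a] gb'[of c b]] by (simp add: power2_eq_square mult_ac)
  have le_b3': "1 + real c + real a \<le> (1 + real c)\<^sup>2 * ((1 + real a) * (1 + real b))" for c a b
  proof -
    have "1 + real c + real a \<le> (1 + real c) * (1 + real a)" by (simp add: algebra_simps)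
    also have "\<dots> \<le> ((1 + real c) * (1 + real c)) * ((1 + real a) * (1 + real b))"
    proof (rule mult_mono)
      show "1 + real c \<le> (1 + real c) * (1 + real c)" "1 + real a \<le> (1 + real a) * (1 + real b)" by (simp_all add: algebra_simps)
    qed auto
    finally show ?thesis by (simp add: power2_eq_square)
  qed
  show i1: "integrable PQ (\<lambda>(c, a, b). g (c + a))"
    by (rule Bochner_Integration.integrable_bound[OF b3 meas3])
       (auto intro!: AE_I2 order_trans[OF gb] order_trans[OF _ le_b3'] order_trans[OF _ abs_ge_self])
  show i2: "integrable PQ (\<lambda>(c, a, b). g (c + a) * g (c + b))"
    by (rule Bochner_Integration.integrable_bound[OF b3 meas3])
       (auto intro!: AE_I2 order_trans[OF _ abs_ge_self] le_b3 simp del: of_nat_Suc simp: abs_mult[of "g _"])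
  have i1': "integrable PQ (\<lambda>(c, a, b). g (c + b))"
  proof (rule Bochner_Integration.integrable_bound[OF b3 meas3], rule AE_I2, clarify)
    fix c a b
    have "\<bar>g (c + b)\<bar> \<le> (1 + real c)\<^sup>2 * ((1 + real a) * (1 + real b))"
      using gb[of "c + b"] le_b3'[of c b a] by (simp add: mult.commute[of "1 + real b"])
    then show "norm (g (c + b)) \<le> norm ((1 + real c)\<^sup>2 * ((1 + real a) * (1 + real b)))" by simp
  qed
  have A1: "A.prob UNIV = 1" using A.prob_space by simp
  define G where "G c = (\<integral>a. g (c + a) \<partial>?P)" for c
  have gi: "integrable ?P (\<lambda>a. g (c + a))" for c
    by (rule Bochner_Integration.integrable_bound[OF integrable_mult_right[OF m_one, of "1 + real c"] meas1])
       (auto intro!: AE_I2 order_trans[OF gb'])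
  have Gle: "\<bar>G c\<bar> \<le> (1 + real c) * (\<integral>a. 1 + real a \<partial>?P)" for c
  proof -
    have "\<bar>G c\<bar> \<le> (\<integral>a. (1 + real c) * (1 + real a) \<partial>?P)"
      unfolding G_def by (rule integral_abs_bound[THEN order_trans]) (intro integral_mono integrable_abs gi integrable_mult_right m_one gb')
    then show ?thesis by simp
  qed
  have inner1: "(\<integral>q. (case q of (a, b) \<Rightarrow> g (c + a)) \<partial>(?P \<Otimes>\<^sub>M ?P)) = G c"
    "(\<integral>q. (case q of (a, b) \<Rightarrow> g (c + b)) \<partial>(?P \<Otimes>\<^sub>M ?P)) = G c"
    "(\<integral>q. (case q of (a, b) \<Rightarrow> g (c + a) * g (c + b)) \<partial>(?P \<Otimes>\<^sub>M ?P)) = (G c)\<^sup>2" for c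
  proof -
    have a1: "integrable (?P \<Otimes>\<^sub>M ?P) (\<lambda>(a, b). g (c + a) * g (c + b))"
      by (rule integrable_pair_mult[OF A.sigma_finite_measure_axioms gi gi])
    have a2: "integrable (?P \<Otimes>\<^sub>M ?P) (\<lambda>(a, b). g (c + a))" "integrable (?P \<Otimes>\<^sub>M ?P) (\<lambda>(a, b). g (c + b))"
      using integrable_pair_mult[OF A.sigma_finite_measure_axioms gi[of c], of "\<lambda>_. 1"]
        integrable_pair_mult[OF A.sigma_finite_measure_axioms _ gi[of c], of ?P "\<lambda>_. 1"] by auto
    note i = a1 a2
    show "(\<integral>q. (case q of (a, b) \<Rightarrow> g (c + a)) \<partial>(?P \<Otimes>\<^sub>M ?P)) = G c"
      using AA.integral_fst[OF i(2)] by (simp add: G_def A1)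
    show "(\<integral>q. (case q of (a, b) \<Rightarrow> g (c + b)) \<partial>(?P \<Otimes>\<^sub>M ?P)) = G c"
      using AA.integral_fst[OF i(3)] by (simp add: G_def A1)
    show "(\<integral>q. (case q of (a, b) \<Rightarrow> g (c + a) * g (c + b)) \<partial>(?P \<Otimes>\<^sub>M ?P)) = (G c)\<^sup>2"
      using AA.integral_fst[OF i(1)] by (simp add: G_def power2_eq_square)
  qed
  have e1: "(\<integral>(c, a, b). g (c + a) \<partial>PQ) = C.expectation G"
    using CAA.integral_fst'[of "\<lambda>(c, a, b). g (c + a)"] i1 inner1(1) by (simp add: PQ_def split_beta')
  have e1': "(\<integral>(c, a, b). g (c + b) \<partial>PQ) = C.expectation G"
    using CAA.integral_fst'[of "\<lambda>(c, a, b). g (c + b)"] i1' inner1(2) by (simp add: PQ_def split_beta')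
  have e2: "(\<integral>(c, a, b). g (c + a) * g (c + b) \<partial>PQ) = C.expectation (\<lambda>c. (G c)\<^sup>2)"
    using CAA.integral_fst'[of "\<lambda>(c, a, b). g (c + a) * g (c + b)"] i2 inner1(3) by (simp add: PQ_def split_beta')
  show "(\<integral>(c, a, b). g (c + b) \<partial>PQ) = (\<integral>(c, a, b). g (c + a) \<partial>PQ)" by (simp only: e1 e1')
  have iG: "integrable ?C G"
    by (rule Bochner_Integration.integrable_bound[OF integrable_mult_left[OF c_one(1), of "\<integral>a. 1 + real a \<partial>?P"] meas1])
       (auto intro!: AE_I2 order_trans[OF Gle] abs_ge_self)
  have iG2: "integrable ?C (\<lambda>c. (G c)\<^sup>2)"
  proof (rule Bochner_Integration.integrable_bound[OF integrable_mult_left[OF c_one(2), of "(\<integral>a. 1 + real a \<partial>?P)\<^sup>2"] meas1], rule AE_I2)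
    fix c
    have "\<bar>G c\<bar>\<^sup>2 \<le> ((1 + real c) * (\<integral>a. 1 + real a \<partial>?P))\<^sup>2" by (rule power_mono[OF Gle]) simp
    then show "norm ((G c)\<^sup>2) \<le> norm ((1 + real c)\<^sup>2 * (\<integral>a. 1 + real a \<partial>?P)\<^sup>2)" by (simp add: power_mult_distrib)
  qed
  \<comment> \<open>one more common point switches the indicator on exactly when the count before was \<open>k - 1\<close>\<close>
  let ?w = "poisson_weight (m + r) (k - 1)"
  have w01: "0 \<le> ?w" "?w \<le> 1" using m r by (auto intro: poisson_weight_nonneg poisson_weight_le_1)
  have step: "G (Suc c) - G c = A.prob {a. c + a = k - 1} - ?w" for c
  proof -
    have "g (Suc c + a) - g (c + a) = indicator {a. c + a = k - 1} a - ?w" for a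
      using k by (auto simp: g_def poisson_residual_def algebra_simps indicator_def)
    then have "G (Suc c) - G c = (\<integral>a. indicator {a. c + a = k - 1} a - ?w \<partial>?P)"
      unfolding G_def Bochner_Integration.integral_diff[OF gi gi, symmetric] by (simp only:)
    also have "\<dots> = A.prob {a. c + a = k - 1} - ?w"
      using A1 by (subst Bochner_Integration.integral_diff) (auto intro!: integrable_real_indicator simp: A.emeasure_eq_measure)
    finally show ?thesis .
  qed
  have step_le: "\<bar>G (Suc c) - G c\<bar> \<le> 1" for c
    using w01 A.prob_le_1[of "{a. c + a = k - 1}"] measure_nonneg[of ?P "{a. c + a = k - 1}"]
    unfolding step abs_le_iff by linarith
  have dist_le: "\<bar>G c - G 0\<bar> \<le> real c" for c
  proof (induction c)
    case (Suc c)
    then show ?case using step_le[of c] by simp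
  qed simp
  have first: "\<bar>G 1 - G 0\<bar> \<le> r"
  proof -
    have "A.prob {a. 0 + a = k - 1} = poisson_weight m (k - 1)"
    proof -
      show ?thesis by (simp add: measure_def emeasure_poisson_law_singleton poisson_weight_nonneg[OF m])
    qed
    then show ?thesis using step[of 0] poisson_weight_lipschitz[OF m r, of "k - 1"] by (simp add: abs_minus_commute)
  qed
  \<comment> \<open>the increments give \<open>c\<^sup>2\<close>, and \<open>c\<^sup>2 \<le> 2 * c * (c - 1)\<close> for \<open>c \<ge> 2\<close>\<close>
  have sq: "(G c - G 0)\<^sup>2 \<le> r\<^sup>2 * indicator {1} c + 2 * (real c * (real c - 1))" for c
  proof -
    consider "c = 0" | "c = 1" | "2 \<le> c" by linarith
    then show ?thesis
    proof cases
      case 2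
      have "\<bar>G 1 - G 0\<bar>\<^sup>2 \<le> r\<^sup>2" by (rule power_mono[OF first]) simp
      then show ?thesis using 2 by simp
    next
      case 3
      have "\<bar>G c - G 0\<bar>\<^sup>2 \<le> (real c)\<^sup>2" by (rule power_mono[OF dist_le]) simp
      also have "\<dots> \<le> 2 * (real c * (real c - 1))"
      proof -
        have "real c * real c \<le> real c * (2 * (real c - 1))" using 3 by (intro mult_left_mono) auto
        then show ?thesis by (simp add: power2_eq_square algebra_simps)
      qed
      finally show ?thesis using 3 by simp
    qed simp
  qed
  have "C.expectation (\<lambda>c. (G c - G 0)\<^sup>2) \<le> C.expectation (\<lambda>c. r\<^sup>2 * indicator {1} c + 2 * (real c * (real c - 1)))"
  proof (rule integral_mono)
    show "integrable ?C (\<lambda>c. (G c - G 0)\<^sup>2)" using iG iG2 by (simp add: power2_diff)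
    show "integrable ?C (\<lambda>c. r\<^sup>2 * indicator {1} c + 2 * (real c * (real c - 1)))"
      using poisson_law_moments(1)[OF r] by (intro Bochner_Integration.integrable_add integrable_mult_right) (auto intro!: integrable_real_indicator simp: C.emeasure_eq_measure)
  qed (rule sq)
  also have "\<dots> = r\<^sup>2 * C.prob {1} + 2 * r\<^sup>2"
    using poisson_law_moments(1,2)[OF r] by (subst Bochner_Integration.integral_add) (auto intro!: integrable_real_indicator simp: C.emeasure_eq_measure)
  also have "C.prob {1} = poisson_weight r 1"
    by (simp add: measure_def emeasure_poisson_law_singleton poisson_weight_nonneg[OF r])
  also have "r\<^sup>2 * poisson_weight r 1 + 2 * r\<^sup>2 \<le> r\<^sup>2 * r + 2 * r\<^sup>2"
    using r by (simp add: poisson_weight_def mult_left_le_one_le mult_left_mono)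
  finally have "C.expectation (\<lambda>c. (G c - G 0)\<^sup>2) \<le> (r + 2) * r\<^sup>2" 
    using r by (simp add: algebra_simps)
  then show "\<bar>(\<integral>(c, a, b). g (c + a) * g (c + b) \<partial>PQ) - (\<integral>(c, a, b). g (c + a) \<partial>PQ)\<^sup>2\<bar> \<le> (r + 2) * r\<^sup>2"
    unfolding e1 e2 using C.variance_le_shift(1)[OF iG iG2] C.variance_le_shift(2)[OF iG iG2, of "G 0"] by simp
qed

section \<open>Continuity of translations in the mean\<close>

lemma integrable_lborel_shift:
  fixes f :: "'a::euclidean_space \<Rightarrow> 'b::{banach, second_countable_topology}"
  shows "integrable lborel f \<Longrightarrow> integrable lborel (\<lambda>x. f (x + h))"
  using integrable_lborel_affine[of f 1 h] by (simp add: add.commute)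

lemma integral_lborel_shift:
  fixes f :: "'a::euclidean_space \<Rightarrow> 'b::{banach, second_countable_topology}"
  shows "f \<in> borel_measurable borel \<Longrightarrow> (\<integral>x. f (x + h) \<partial>lborel) = (\<integral>x. f x \<partial>lborel)"
  using integral_lborel_affine[of f 1 h] by (simp add: add.commute)

lemma L1_triangle:
  fixes f g :: "'a::euclidean_space \<Rightarrow> real"
  assumes f: "integrable lborel f" and g: "integrable lborel g"
  shows "(\<integral>x. \<bar>f (x + h) - f x\<bar> \<partial>lborel) \<le> 2 * (\<integral>x. \<bar>f x - g x\<bar> \<partial>lborel) + (\<integral>x. \<bar>g (x + h) - g x\<bar> \<partial>lborel)"
proof -
  have [measurable]: "f \<in> borel_measurable borel" "g \<in> borel_measurable borel" using f g by auto
  note [simp] = integrable_lborel_shift[OF f] integrable_lborel_shift[OF g] f g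
  have "(\<integral>x. \<bar>f (x + h) - f x\<bar> \<partial>lborel) \<le> (\<integral>x. \<bar>f (x + h) - g (x + h)\<bar> + \<bar>g (x + h) - g x\<bar> + \<bar>f x - g x\<bar> \<partial>lborel)"
    by (rule integral_mono) auto
  also have "\<dots> = (\<integral>x. \<bar>f (x + h) - g (x + h)\<bar> \<partial>lborel) + (\<integral>x. \<bar>g (x + h) - g x\<bar> \<partial>lborel) + (\<integral>x. \<bar>f x - g x\<bar> \<partial>lborel)"
    by simp
  also have "(\<integral>x. \<bar>f (x + h) - g (x + h)\<bar> \<partial>lborel) = (\<integral>x. \<bar>f x - g x\<bar> \<partial>lborel)"
    by (rule integral_lborel_shift[of "\<lambda>x. \<bar>f x - g x\<bar>"]) measurable
  finally show ?thesis by simp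
qed

text \<open>Openness makes the indicator lower semicontinuous, so the overlap of \<open>U\<close> with its translate tends
  to the full measure of \<open>U\<close> by dominated convergence.\<close>

lemma L1_translation_open:
  fixes U :: "'a::euclidean_space set"
  assumes U: "open U" and fin: "emeasure lborel U < \<infinity>" and h: "h \<longlonglongrightarrow> 0"
  shows "(\<lambda>n. \<integral>x. \<bar>indicat_real U (x + h n) - indicat_real U x\<bar> \<partial>lborel) \<longlonglongrightarrow> 0"
proof -
  have [measurable]: "U \<in> sets borel" using U by simp
  have iU: "integrable lborel (indicat_real U)" using fin by simp
  have iUh: "integrable lborel (\<lambda>x. indicat_real U (x + h n))" for n by (rule integrable_lborel_shift[OF iU])
  have ip: "integrable lborel (\<lambda>x. indicat_real U x * indicat_real U (x + h n))" for n
    by (rule Bochner_Integration.integrable_bound[OF iU]) (auto simp: indicator_def)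
  have lim: "(\<lambda>n. \<integral>x. indicat_real U x * indicat_real U (x + h n) \<partial>lborel) \<longlonglongrightarrow> (\<integral>x. indicat_real U x \<partial>lborel)"
  proof (rule integral_dominated_convergence[where w="indicat_real U"])
    show "AE x in lborel. (\<lambda>n. indicat_real U x * indicat_real U (x + h n)) \<longlonglongrightarrow> indicat_real U x"
    proof (rule AE_I2)
      fix x :: 'a
      show "(\<lambda>n. indicat_real U x * indicat_real U (x + h n)) \<longlonglongrightarrow> indicat_real U x"
      proof (cases "x \<in> U")
        case True
        have "(\<lambda>n. x + h n) \<longlonglongrightarrow> x" using tendsto_add[OF tendsto_const h, of x] by simp
        then have "\<forall>\<^sub>F n in sequentially. x + h n \<in> U" using U True by (rule topological_tendstoD)
        then show ?thesis by (intro tendsto_eventually) (auto simp: True elim!: eventually_mono)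
      qed simp
    qed
  qed (use iU in \<open>auto simp: indicator_def\<close>)
  have "(\<integral>x. \<bar>indicat_real U (x + h n) - indicat_real U x\<bar> \<partial>lborel)
      = 2 * (\<integral>x. indicat_real U x \<partial>lborel) - 2 * (\<integral>x. indicat_real U x * indicat_real U (x + h n) \<partial>lborel)" for n
  proof -
    have "(\<integral>x. \<bar>indicat_real U (x + h n) - indicat_real U x\<bar> \<partial>lborel)
      = (\<integral>x. indicat_real U (x + h n) + indicat_real U x - 2 * (indicat_real U x * indicat_real U (x + h n)) \<partial>lborel)"
      by (rule Bochner_Integration.integral_cong) (auto simp: indicator_def)
    also have "\<dots> = (\<integral>x. indicat_real U (x + h n) \<partial>lborel) + (\<integral>x. indicat_real U x \<partial>lborel) - 2 * (\<integral>x. indicat_real U x * indicat_real U (x + h n) \<partial>lborel)"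
      using iU iUh ip by simp
    also have "(\<integral>x. indicat_real U (x + h n) \<partial>lborel) = (\<integral>x. indicat_real U x \<partial>lborel)"
      by (rule integral_lborel_shift) simp
    finally show ?thesis by simp
  qed
  then show ?thesis
    using tendsto_diff[OF tendsto_const[of "2 * (\<integral>x. indicat_real U x \<partial>lborel)"] tendsto_mult[OF tendsto_const[of 2] lim]]
    by simp
qed

lemma tendsto_zero_approx:
  fixes a :: "nat \<Rightarrow> real"
  assumes "\<And>e. 0 < e \<Longrightarrow> \<exists>b. b \<longlonglongrightarrow> 0 \<and> (\<forall>n. \<bar>a n\<bar> \<le> e + b n)"
  shows "a \<longlonglongrightarrow> 0"
proof (rule LIMSEQ_I)
  fix r :: real assume "0 < r"
  then obtain b where b: "b \<longlonglongrightarrow> 0" "\<And>n. \<bar>a n\<bar> \<le> r/2 + b n" using assms[of "r/2"] by auto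
  have "\<forall>\<^sub>F n in sequentially. b n < r/2" using order_tendstoD(2)[OF b(1), of "r/2"] \<open>0 < r\<close> by simp
  then have "\<forall>\<^sub>F n in sequentially. norm (a n - 0) < r"
  proof eventually_elim
    case (elim n)
    then show ?case using b(2)[of n] by simp
  qed
  then show "\<exists>n0. \<forall>n\<ge>n0. norm (a n - 0) < r" by (simp add: eventually_sequentially)
qed

text \<open>Translation is an isometry of \<open>L\<^sup>1\<close> (\<open>L1_triangle\<close>), so the property is stable under \<open>L\<^sup>1\<close> limits and
  reduces to indicators, which outer regularity reduces to open sets.\<close>

theorem L1_translation_continuous:
  fixes f :: "'a::euclidean_space \<Rightarrow> real"
  assumes "integrable lborel f" and h: "h \<longlonglongrightarrow> 0"
  shows "(\<lambda>n. \<integral>x. \<bar>f (x + h n) - f x\<bar> \<partial>lborel) \<longlonglongrightarrow> 0"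
  using assms(1)
proof (induction rule: integrable_induct)
  case (base A c)
  then have [measurable]: "A \<in> sets borel" and fin: "emeasure lborel A < \<infinity>" by auto
  have iA: "integrable lborel (indicat_real A)" using fin by simp
  have "(\<lambda>n. \<integral>x. \<bar>indicat_real A (x + h n) - indicat_real A x\<bar> \<partial>lborel) \<longlonglongrightarrow> 0"
  proof (rule tendsto_zero_approx)
    fix e :: real assume "0 < e"
    have "A \<in> sets lebesgue" "0 < e/2" using \<open>0 < e\<close> by auto
    then obtain U where U: "open U" "A \<subseteq> U" "U - A \<in> lmeasurable" "emeasure lebesgue (U - A) < ennreal (e/2)"
      by (rule sets_lebesgue_outer_open)
    have [measurable]: "U \<in> sets borel" using U(1) by simp
    have UA: "emeasure lborel (U - A) < ennreal (e/2)" using U(4) by simp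
    have "emeasure lborel U \<le> emeasure lborel A + emeasure lborel (U - A)"
      using emeasure_subadditive[of A lborel "U - A"] U(2) by (simp add: Un_absorb1)
    also have "\<dots> < \<infinity>" using fin UA by (auto simp: less_top[symmetric] top_unique)
    finally have finU: "emeasure lborel U < \<infinity>" .
    have iU: "integrable lborel (indicat_real U)" using finU by simp
    have "(\<integral>x. \<bar>indicat_real A x - indicat_real U x\<bar> \<partial>lborel) = (\<integral>x. indicat_real (U - A) x \<partial>lborel)"
      using U(2) by (intro Bochner_Integration.integral_cong) (auto simp: indicator_def)
    also have "\<dots> = measure lborel (U - A)" by simp
    also have "\<dots> \<le> e/2" unfolding measure_def using UA \<open>0 < e\<close> by (intro enn2real_leI) auto
    finally have close: "(\<integral>x. \<bar>indicat_real A x - indicat_real U x\<bar> \<partial>lborel) \<le> e/2" .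
    show "\<exists>b. b \<longlonglongrightarrow> 0 \<and> (\<forall>n. \<bar>\<integral>x. \<bar>indicat_real A (x + h n) - indicat_real A x\<bar> \<partial>lborel\<bar> \<le> e + b n)"
    proof (intro exI conjI allI)
      show "(\<lambda>n. \<integral>x. \<bar>indicat_real U (x + h n) - indicat_real U x\<bar> \<partial>lborel) \<longlonglongrightarrow> 0"
        by (rule L1_translation_open[OF U(1) finU h])
      show "\<bar>\<integral>x. \<bar>indicat_real A (x + h n) - indicat_real A x\<bar> \<partial>lborel\<bar> \<le> e + (\<integral>x. \<bar>indicat_real U (x + h n) - indicat_real U x\<bar> \<partial>lborel)" for n
        using L1_triangle[OF iA iU, of "h n"] close by simp
    qed
  qed
  moreover have "(\<integral>x. \<bar>indicat_real A (x + h n) *\<^sub>R c - indicat_real A x *\<^sub>R c\<bar> \<partial>lborel)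
      = \<bar>c\<bar> * (\<integral>x. \<bar>indicat_real A (x + h n) - indicat_real A x\<bar> \<partial>lborel)" for n
    unfolding integral_mult_right_zero[symmetric] abs_mult[symmetric]
    by (simp add: right_diff_distrib mult.commute)
  ultimately show ?case using tendsto_mult_right_zero[of _ sequentially "\<bar>c\<bar>"] by (simp only:)
next
  case (add f g)
  note f = add(1) and g = add(2)
  note [simp] = integrable_lborel_shift[OF f] integrable_lborel_shift[OF g] f g
  have "(\<integral>x. \<bar>(f (x + h n) + g (x + h n)) - (f x + g x)\<bar> \<partial>lborel) \<le>
    (\<integral>x. \<bar>f (x + h n) - f x\<bar> + \<bar>g (x + h n) - g x\<bar> \<partial>lborel)" for n
    by (rule integral_mono) auto
  then have le: "(\<integral>x. \<bar>(f (x + h n) + g (x + h n)) - (f x + g x)\<bar> \<partial>lborel) \<le>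
    (\<integral>x. \<bar>f (x + h n) - f x\<bar> \<partial>lborel) + (\<integral>x. \<bar>g (x + h n) - g x\<bar> \<partial>lborel)" for n
    by simp
  show ?case
    by (rule tendsto_sandwich[OF _ _ tendsto_const tendsto_add_zero[OF add(3) add(4)]]) (auto simp: le)
next
  case (lim f s)
  show ?case
  proof (rule tendsto_zero_approx)
    fix e :: real assume "0 < e"
    have "(\<lambda>i. \<integral>x. \<bar>f x - s i x\<bar> \<partial>lborel) \<longlonglongrightarrow> (\<integral>x. 0 \<partial>(lborel :: 'a measure))"
    proof (rule integral_dominated_convergence[where w="\<lambda>x. 3 * \<bar>f x\<bar>"])
      show "AE x in lborel. (\<lambda>i. \<bar>f x - s i x\<bar>) \<longlonglongrightarrow> 0"
      proof (rule AE_I2)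
        fix x :: 'a
        show "(\<lambda>i. \<bar>f x - s i x\<bar>) \<longlonglongrightarrow> 0"
          using tendsto_rabs[OF tendsto_diff[OF tendsto_const[of "f x"] lim(2)[of x]]] by simp
      qed
      show "AE x in lborel. norm \<bar>f x - s i x\<bar> \<le> 3 * \<bar>f x\<bar>" for i
      proof (rule AE_I2)
        fix x :: 'a show "norm \<bar>f x - s i x\<bar> \<le> 3 * \<bar>f x\<bar>" using lim(3)[of x i] by simp
      qed
    qed (use lim in auto)
    then have "\<forall>\<^sub>F i in sequentially. (\<integral>x. \<bar>f x - s i x\<bar> \<partial>lborel) < e/2"
      using \<open>0 < e\<close> by (intro order_tendstoD(2)) auto
    then obtain i where i: "(\<integral>x. \<bar>f x - s i x\<bar> \<partial>lborel) < e/2"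
      using eventually_happens'[OF sequentially_bot] by blast
    show "\<exists>b. b \<longlonglongrightarrow> 0 \<and> (\<forall>n. \<bar>\<integral>x. \<bar>f (x + h n) - f x\<bar> \<partial>lborel\<bar> \<le> e + b n)"
    proof (intro exI conjI allI)
      show "(\<lambda>n. \<integral>x. \<bar>s i (x + h n) - s i x\<bar> \<partial>lborel) \<longlonglongrightarrow> 0" by (rule lim(5))
      show "\<bar>\<integral>x. \<bar>f (x + h n) - f x\<bar> \<partial>lborel\<bar> \<le> e + (\<integral>x. \<bar>s i (x + h n) - s i x\<bar> \<partial>lborel)" for n
        using L1_triangle[OF lim(4) lim(1)[of i], of "h n"] i by simp
    qed
  qed
qed

lemma L1_translation_small:
  fixes f :: "'a::euclidean_space \<Rightarrow> real"
  assumes f: "integrable lborel f" and d: "0 < d"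
  obtains e where "0 < e" "\<And>h. norm h \<le> e \<Longrightarrow> (\<integral>x. \<bar>f (x + h) - f x\<bar> \<partial>lborel) \<le> d"
proof (rule ccontr)
  assume no: "\<not> thesis"
  have "\<exists>h. norm h \<le> inverse (real (Suc n)) \<and> d < (\<integral>x. \<bar>f (x + h) - f x\<bar> \<partial>lborel)" for n
  proof (rule ccontr)
    assume "\<not> ?thesis"
    then have "thesis" by (intro that[of "inverse (real (Suc n))"]) (auto simp: not_less)
    then show False using no by simp
  qed
  then obtain h where h: "\<And>n. norm (h n) \<le> inverse (real (Suc n))" "\<And>n. d < (\<integral>x. \<bar>f (x + h n) - f x\<bar> \<partial>lborel)" by metis
  have "h \<longlonglongrightarrow> 0"
    by (rule Lim_null_comparison[OF _ LIMSEQ_inverse_real_of_nat]) (simp add: h(1) del: of_nat_Suc)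
  from L1_translation_continuous[OF f this] have "\<forall>\<^sub>F n in sequentially. (\<integral>x. \<bar>f (x + h n) - f x\<bar> \<partial>lborel) < d"
    using d by (rule order_tendstoD(2))
  then obtain n where "(\<integral>x. \<bar>f (x + h n) - f x\<bar> \<partial>lborel) < d" using eventually_happens'[OF sequentially_bot] by blast
  then show False using h(2)[of n] by simp
qed

section \<open>Compensated exponentials and heavy-tailed volumes\<close>

text \<open>The integrand of the exponent of a centred infinitely divisible law without truncation; the full
  linear compensation is possible as the volumes have finite mean.\<close>

definition compensated_exp :: "real \<Rightarrow> complex" where
  "compensated_exp x = iexp x - 1 - \<i> * of_real x"

lemma compensated_exp_measurable [measurable]: "compensated_exp \<in> borel_measurable borel"
  unfolding compensated_exp_def[abs_def] by measurable

lemma norm_iexp_minus_1: "norm (iexp x - 1) \<le> \<bar>x\<bar>" "norm (iexp x - 1) \<le> 2"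
  using iexp_approx1[of x 0] iexp_approx2[of x 0] by simp_all

lemma norm_compensated_exp_sq: "norm (compensated_exp x) \<le> x\<^sup>2 / 2"
  using iexp_approx1[of x 1] by (simp add: compensated_exp_def power2_eq_square diff_diff_eq)

text \<open>Both regimes of the minimum are needed. The bound with 1 controls large volumes; the one with
  \<open>k\<close>, quadratic near 0, makes the \<open>\<alpha>\<close>-heavy tail integrable against it as \<open>\<alpha> < 2\<close>.\<close>

lemma compensated_exp_diff:
  assumes "\<bar>x\<bar> \<le> k" "\<bar>y\<bar> \<le> k"
  shows "norm (compensated_exp x - compensated_exp y) \<le> 2 * \<bar>x - y\<bar> * min 1 k"
proof -
  have d: "iexp x - iexp y = iexp y * (iexp (x - y) - 1)"
    by (simp add: right_diff_distrib exp_add[symmetric] algebra_simps)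
  have "compensated_exp x - compensated_exp y = iexp y * (iexp (x - y) - 1) - \<i> * of_real (x - y)"
    unfolding compensated_exp_def using d by (simp add: algebra_simps)
  then have "norm (compensated_exp x - compensated_exp y) \<le> norm (iexp y * (iexp (x - y) - 1)) + norm (\<i> * of_real (x - y))"
    by (simp only: norm_triangle_ineq4)
  then have 1: "norm (compensated_exp x - compensated_exp y) \<le> 2 * \<bar>x - y\<bar>"
    using norm_iexp_minus_1(1)[of "x - y"] by (simp add: norm_mult del: of_real_diff)
  have "compensated_exp x - compensated_exp y
      = iexp y * compensated_exp (x - y) + \<i> * of_real (x - y) * (iexp y - 1)"
    using d unfolding compensated_exp_def by (simp add: algebra_simps)
  then have "norm (compensated_exp x - compensated_exp y) \<le> norm (iexp y * compensated_exp (x - y)) + norm (\<i> * of_real (x - y) * (iexp y - 1))"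
    by (simp only: norm_triangle_ineq)
  also have "norm (iexp y * compensated_exp (x - y)) \<le> \<bar>x - y\<bar> * \<bar>x - y\<bar> / 2"
    using norm_compensated_exp_sq[of "x - y"] by (simp add: norm_mult power2_eq_square abs_mult[symmetric] del: of_real_diff)
  also have "norm (\<i> * of_real (x - y) * (iexp y - 1)) \<le> \<bar>x - y\<bar> * k"
    using norm_iexp_minus_1(1)[of y] assms by (auto simp: norm_mult simp del: of_real_diff intro!: mult_left_mono)
  also have "\<bar>x - y\<bar> * \<bar>x - y\<bar> / 2 \<le> \<bar>x - y\<bar> * k"
  proof -
    have "\<bar>x - y\<bar> * (\<bar>x - y\<bar> / 2) \<le> \<bar>x - y\<bar> * k" using assms by (intro mult_left_mono) auto
    then show ?thesis by simp
  qed
  finally have "norm (compensated_exp x - compensated_exp y) \<le> 2 * \<bar>x - y\<bar> * k" by (simp add: mult_ac)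
  then show ?thesis using 1 by (simp add: min_def)
qed

lemma norm_compensated_exp_le: "norm (compensated_exp x) \<le> 2 * \<bar>x\<bar>"
  using compensated_exp_diff[of x "\<bar>x\<bar>" 0] mult_left_mono[of "min 1 \<bar>x\<bar>" 1 "2 * \<bar>x\<bar>"]
  by (simp add: compensated_exp_def)

text \<open>The derivative of \<open>compensated_exp (w * y)\<close> in \<open>y\<close>. Integrating by parts against the law of the
  volume replaces that law by its tail function, about which the hypothesis speaks.\<close>

definition levy_kernel :: "real \<Rightarrow> real \<Rightarrow> complex" where
  "levy_kernel w y = \<i> * of_real w * (iexp (w * y) - 1)"

lemma levy_kernel_measurable [measurable]: "(\<lambda>p. levy_kernel (fst p) (snd p)) \<in> borel_measurable (borel \<Otimes>\<^sub>M borel)"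
  unfolding levy_kernel_def by measurable

lemma levy_kernel_measurable' [measurable]: "levy_kernel w \<in> borel_measurable borel"
  unfolding levy_kernel_def[abs_def] by measurable

lemma norm_levy_kernel: "0 \<le> y \<Longrightarrow> norm (levy_kernel w y) \<le> \<bar>w\<bar> * min 2 (\<bar>w\<bar> * y)"
  using norm_iexp_minus_1[of "w * y"] by (auto simp: levy_kernel_def norm_mult abs_mult intro!: mult_left_mono)

lemma compensated_exp_integral:
  assumes "0 \<le> v"
  shows "compensated_exp (w * v) = (\<integral>y. (indicator {0<..} y * indicator {..<v} y) *\<^sub>R levy_kernel w y \<partial>lborel)"
proof -
  have "(\<integral>y. indicator {0..v} y *\<^sub>R levy_kernel w y \<partial>lborel) = compensated_exp (w * v) - compensated_exp (w * 0)"
  proof (rule integral_FTC_Icc[OF assms])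
    fix y
    have "((\<lambda>z. exp (\<i> * of_real w * z) - 1 - \<i> * of_real w * z) has_field_derivative (\<i> * of_real w * exp (\<i> * of_real w * of_real y) - \<i> * of_real w)) (at (of_real y))"
      by (auto intro!: derivative_eq_intros)
    from has_vector_derivative_real_field[OF this]
    have "((\<lambda>y. exp (\<i> * of_real w * of_real y) - 1 - \<i> * of_real w * of_real y) has_vector_derivative (\<i> * of_real w * exp (\<i> * of_real w * of_real y) - \<i> * of_real w)) (at y within {0..v})" .
    then show "((\<lambda>y. compensated_exp (w * y)) has_vector_derivative levy_kernel w y) (at y within {0..v})"
      by (simp add: compensated_exp_def levy_kernel_def algebra_simps)
    show "continuous_on {0..v} (levy_kernel w)"
      unfolding levy_kernel_def by (intro continuous_intros)
  qed
  moreover have "compensated_exp (w * 0) = 0" by (simp add: compensated_exp_def)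
  moreover have "(\<integral>y. indicator {0..v} y *\<^sub>R levy_kernel w y \<partial>lborel) = (\<integral>y. (indicator {0<..} y * indicator {..<v} y) *\<^sub>R levy_kernel w y \<partial>lborel)"
    using AE_lborel_singleton[of 0] AE_lborel_singleton[of v]
    by (intro integral_cong_AE) (auto simp: indicator_def elim: eventually_elim2)
  ultimately show ?thesis by simp
qed

lemma powr_kernel_nonneg: "0 \<le> \<kappa> \<Longrightarrow> 0 \<le> indicator {0<..} x * (min 2 (\<kappa> * x) * x powr (- \<alpha>))"
  for \<kappa> :: real by (cases "0 < x") auto

text \<open>The power \<open>x powr (- \<alpha>)\<close> is integrable at infinity because \<open>\<alpha> > 1\<close>, and \<open>x powr (1 - \<alpha>)\<close> is
  integrable at 0 because \<open>\<alpha> < 2\<close>.\<close>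

lemma integrable_powr_kernel:
  assumes \<alpha>: "1 < \<alpha>" "\<alpha> < (2::real)" and \<kappa>: "0 \<le> \<kappa>"
  shows "integrable lborel (\<lambda>x. indicator {0<..} x * (min 2 (\<kappa> * x) * x powr (- \<alpha>)))"
proof -
  have i: "integrable lborel (\<lambda>x. indicator S x * x powr e)" if "(\<lambda>x::real. x powr e) integrable_on S" "S \<in> sets borel" for S e
  proof -
    have "(\<lambda>x. x powr e) absolutely_integrable_on S"
      by (rule nonnegative_absolutely_integrable_1[OF that(1)]) simp
    then have "integrable lebesgue (\<lambda>x. indicator S x * x powr e)" by (simp add: set_integrable_def)
    then show ?thesis using that(2) by (subst (asm) integrable_completion) auto
  qed
  have 1: "integrable lborel (\<lambda>x::real. indicator {0..1} x * x powr (1 - \<alpha>))"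
    using has_integral_powr_from_0[of "1 - \<alpha>" 1] \<alpha> by (intro i) (auto simp: integrable_on_def)
  have 2: "integrable lborel (\<lambda>x::real. indicator {1..} x * x powr (- \<alpha>))"
    using has_integral_powr_to_inf[of "- \<alpha>" 1] \<alpha> by (intro i) (auto simp: integrable_on_def)
  have "integrable lborel (\<lambda>x. \<kappa> * (indicator {0..1} x * x powr (1 - \<alpha>)) + 2 * (indicator {1..} x * x powr (- \<alpha>)))"
    using 1 2 by simp
  then show ?thesis
  proof (rule Bochner_Integration.integrable_bound, goal_cases)
    case 2
    show ?case
    proof (rule AE_I2)
      fix x :: real
      have "min 2 (\<kappa> * x) * x powr (- \<alpha>) \<le> \<kappa> * x powr (1 - \<alpha>)" if "0 < x"
      proof -
        have "min 2 (\<kappa> * x) * x powr (- \<alpha>) \<le> \<kappa> * x * x powr (- \<alpha>)" by (intro mult_right_mono) auto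
        also have "\<dots> = \<kappa> * x powr (1 - \<alpha>)" using that by (simp add: powr_diff powr_minus field_simps)
        finally show ?thesis .
      qed
      moreover have "min 2 (\<kappa> * x) * x powr (- \<alpha>) \<le> 2 * x powr (- \<alpha>)" by (intro mult_right_mono) auto
      ultimately show "norm (indicator {0<..} x * (min 2 (\<kappa> * x) * x powr (- \<alpha>))) \<le> norm (\<kappa> * (indicator {0..1} x * x powr (1 - \<alpha>)) + 2 * (indicator {1..} x * x powr (- \<alpha>)))"
        using \<kappa> by (auto simp: indicator_def abs_mult)
    qed
  qed simp
qed

lemma filterlim_at_top_powr_pos: "0 < p \<Longrightarrow> filterlim (\<lambda>x. x powr p) at_top (at_top :: real filter)"
  unfolding filterlim_at_top
proof (intro allI)
  fix Z :: real assume p: "0 < p"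
  show "\<forall>\<^sub>F x in at_top. Z \<le> x powr p"
    using eventually_ge_at_top[of "max 1 Z powr (1 / p)"]
  proof eventually_elim
    case (elim x)
    have "Z \<le> (max 1 Z powr (1 / p)) powr p" using p by (simp add: powr_powr)
    also have "\<dots> \<le> x powr p" using elim p by (intro powr_mono2) auto
    finally show ?case .
  qed
qed

text \<open>The hypotheses on a single grain, separated from the point process, since the analysis of the limiting
  exponent involves the law of one grain only.\<close>

locale heavy_tailed_grain = prob_space M
  for M :: "'w measure" and \<Xi> :: "'w \<Rightarrow> 'a::euclidean_space set" and \<alpha> c :: real +
  assumes Xi_measurable [measurable]: "\<Xi> \<in> measurable M fell"
    and mean_finite: "(\<integral>\<^sup>+\<omega>. emeasure lborel (\<Xi> \<omega>) \<partial>M) < \<infinity>"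
    and alpha: "1 < \<alpha>" "\<alpha> < 2" and c_pos: "0 < c"
    and tail: "(\<lambda>x. prob {\<omega> \<in> space M. emeasure lborel (\<Xi> \<omega>) > ennreal x}) \<sim>[at_top] (\<lambda>x. c * x powr (- \<alpha>))"
    and localization:
      "(\<lambda>l. enn2real (\<integral>\<^sup>+ \<omega>. emeasure lborel (\<Xi> \<omega> \<inter> {t. norm t > l}) \<partial>M))
         \<in> o[at_top](\<lambda>l. l powr ((1 - \<alpha>) * DIM('a) / \<alpha>))"
begin

definition volume :: "'w \<Rightarrow> real" where "volume \<omega> = measure lborel (\<Xi> \<omega>)"
definition volume_tail :: "real \<Rightarrow> real" where "volume_tail y = prob {\<omega> \<in> space M. y < volume \<omega>}"
definition mass_outside :: "real \<Rightarrow> ennreal" where "mass_outside l = (\<integral>\<^sup>+ \<omega>. emeasure lborel (\<Xi> \<omega> \<inter> {t. norm t > l}) \<partial>M)"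
definition scaling :: "real \<Rightarrow> real" where "scaling l = l powr (- real DIM('a) / \<alpha>)"

lemma Xi_borel: "\<omega> \<in> space M \<Longrightarrow> \<Xi> \<omega> \<in> sets borel"
  using measurable_space[OF Xi_measurable] by auto

lemma emeasure_Xi_Int:
  assumes [measurable]: "S \<in> sets borel" and "\<omega> \<in> space M"
  shows "emeasure lborel (\<Xi> \<omega> \<inter> S) = (\<integral>\<^sup>+s. indicator (\<Xi> \<omega>) s * indicator S s \<partial>lborel)"
proof -
  have [measurable]: "\<Xi> \<omega> \<in> sets borel" using assms(2) by (rule Xi_borel)
  have "emeasure lborel (\<Xi> \<omega> \<inter> S) = (\<integral>\<^sup>+s. indicator (\<Xi> \<omega> \<inter> S) s \<partial>lborel)" by simp
  then show ?thesis by (simp add: indicator_inter_arith)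
qed

lemma mem_Xi_measurable [measurable (raw)]:
  "f \<in> borel_measurable N \<Longrightarrow> g \<in> measurable N M \<Longrightarrow> Measurable.pred N (\<lambda>x. f x \<in> \<Xi> (g x))"
  using measurable_mem_fell[OF _ measurable_compose[OF _ Xi_measurable]] .

lemma indicator_Xi_measurable [measurable (raw)]:
  "f \<in> borel_measurable N \<Longrightarrow> g \<in> measurable N M \<Longrightarrow> (\<lambda>x. indicator (\<Xi> (g x)) (f x) :: 'b::{zero_neq_one,topological_space}) \<in> borel_measurable N"
  unfolding indicator_def by measurable

lemma emeasure_Xi_Int_measurable [measurable]:
  assumes [measurable]: "S \<in> sets borel"
  shows "(\<lambda>\<omega>. emeasure lborel (\<Xi> \<omega> \<inter> S)) \<in> borel_measurable M"
proof -
  have "(\<lambda>\<omega>. \<integral>\<^sup>+s. indicator (\<Xi> \<omega>) s * indicator S s \<partial>lborel) \<in> borel_measurable M"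
    by (rule lborel.borel_measurable_nn_integral) (simp add: split_beta')
  then show ?thesis by (subst measurable_cong[OF emeasure_Xi_Int[OF assms]]) auto
qed

lemma emeasure_Xi_measurable [measurable]: "(\<lambda>\<omega>. emeasure lborel (\<Xi> \<omega>)) \<in> borel_measurable M"
  using emeasure_Xi_Int_measurable[of UNIV] by simp

lemma volume_measurable [measurable]: "volume \<in> borel_measurable M"
  unfolding volume_def[abs_def] measure_def by measurable

lemma volume_nonneg [simp]: "0 \<le> volume \<omega>" by (simp add: volume_def)

lemma AE_volume: "AE \<omega> in M. emeasure lborel (\<Xi> \<omega>) = ennreal (volume \<omega>)"
proof -
  have "AE \<omega> in M. emeasure lborel (\<Xi> \<omega>) \<noteq> \<infinity>"
    by (rule nn_integral_PInf_AE) (use mean_finite in auto)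
  then show ?thesis by eventually_elim (simp add: volume_def emeasure_eq_ennreal_measure)
qed

lemma nn_integral_volume: "(\<integral>\<^sup>+\<omega>. ennreal (volume \<omega>) \<partial>M) = (\<integral>\<^sup>+\<omega>. emeasure lborel (\<Xi> \<omega>) \<partial>M)"
  by (rule nn_integral_cong_AE) (use AE_volume in auto)

lemma integrable_volume: "integrable M volume"
  by (rule integrableI_bounded) (use mean_finite in \<open>simp_all add: nn_integral_volume\<close>)

lemma volume_tail_le_1: "volume_tail y \<le> 1" and volume_tail_nonneg: "0 \<le> volume_tail y"
  by (simp_all add: volume_tail_def)

lemma volume_tail_measurable [measurable]: "volume_tail \<in> borel_measurable borel"
proof -
  have "volume_tail = (\<lambda>y. enn2real (\<integral>\<^sup>+\<omega>. indicator {\<omega> \<in> space M. y < volume \<omega>} \<omega> \<partial>M))"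
    by (simp add: volume_tail_def measure_def fun_eq_iff)
  moreover have "(\<lambda>y. \<integral>\<^sup>+\<omega>. indicator {\<omega> \<in> space M. y < volume \<omega>} \<omega> \<partial>M) \<in> borel_measurable borel"
    by measurable
  ultimately show ?thesis by simp
qed

lemma volume_tail_limit: "((\<lambda>x. volume_tail x * x powr \<alpha>) \<longlongrightarrow> c) at_top"
proof -
  have "((\<lambda>x. prob {\<omega> \<in> space M. emeasure lborel (\<Xi> \<omega>) > ennreal x} / (c * x powr (- \<alpha>))) \<longlongrightarrow> 1) at_top"
    using c_pos by (intro asymp_equivD_strong[OF tail] eventually_mono[OF eventually_gt_at_top[of 0]]) auto
  from tendsto_mult[OF this tendsto_const[of c]]
  have "((\<lambda>x. prob {\<omega> \<in> space M. emeasure lborel (\<Xi> \<omega>) > ennreal x} / (c * x powr (- \<alpha>)) * c) \<longlongrightarrow> c) at_top" by simp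
  then show ?thesis
  proof (rule Lim_transform_eventually)
    show "\<forall>\<^sub>F x in at_top. prob {\<omega> \<in> space M. emeasure lborel (\<Xi> \<omega>) > ennreal x} / (c * x powr (- \<alpha>)) * c = volume_tail x * x powr \<alpha>"
      using eventually_gt_at_top[of 0]
    proof eventually_elim
      case (elim x)
      have "prob {\<omega> \<in> space M. emeasure lborel (\<Xi> \<omega>) > ennreal x} = volume_tail x"
        unfolding volume_tail_def
      proof (rule measure_eq_AE)
        show "AE \<omega> in M. (\<omega> \<in> {\<omega> \<in> space M. ennreal x < emeasure lborel (\<Xi> \<omega>)}) = (\<omega> \<in> {\<omega> \<in> space M. x < volume \<omega>})"
          using AE_volume by eventually_elim (use elim in \<open>auto simp: ennreal_less_iff\<close>)
      qed auto
      then show ?case using elim c_pos by (simp add: powr_minus field_simps)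
    qed
  qed
qed

lemma volume_tail_bound:
  obtains K where "0 < K" "\<And>x. 0 < x \<Longrightarrow> volume_tail x \<le> K * x powr (- \<alpha>)"
proof -
  have "\<forall>\<^sub>F x in at_top. volume_tail x * x powr \<alpha> < c + 1"
    using order_tendstoD(2)[OF volume_tail_limit, of "c + 1"] by simp
  then obtain x0 where x0: "\<And>x. x0 \<le> x \<Longrightarrow> volume_tail x * x powr \<alpha> < c + 1"
    by (auto simp: eventually_at_top_linorder)
  define K where "K = max (c + 1) (x0 powr \<alpha>)"
  show thesis
  proof (rule that[of K])
    show "0 < K" using c_pos by (simp add: K_def)
    fix x :: real assume x: "0 < x"
    have "volume_tail x * x powr \<alpha> \<le> K"
    proof (cases "x0 \<le> x")
      case True
      then show ?thesis using x0[OF True] by (simp add: K_def)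
    next
      case False
      have "volume_tail x * x powr \<alpha> \<le> 1 * x powr \<alpha>" by (intro mult_right_mono volume_tail_le_1) simp
      also have "\<dots> \<le> x0 powr \<alpha>" using False x alpha by (simp add: powr_mono2)
      finally show ?thesis by (simp add: K_def)
    qed
    then show "volume_tail x \<le> K * x powr (- \<alpha>)" using x by (simp add: powr_minus field_simps)
  qed
qed

lemma scaling_pos: "0 < l \<Longrightarrow> 0 < scaling l" by (simp add: scaling_def)

text \<open>The normalization is chosen so that the number of germs in a window of side \<open>l\<close> balances the tail
  of the volume.\<close>

lemma scaling_powr: "0 < l \<Longrightarrow> l ^ DIM('a) * scaling l powr \<alpha> = 1"
proof -
  assume l: "0 < l"
  have "scaling l powr \<alpha> = l powr (- real DIM('a))" using alpha by (simp add: scaling_def powr_powr)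
  then show ?thesis using l by (simp add: powr_realpow[symmetric] powr_add[symmetric])
qed

lemma scaled_tail_eq:
  assumes "0 < l" "0 < x"
  shows "l ^ DIM('a) * volume_tail (x / scaling l) = (volume_tail (x / scaling l) * (x / scaling l) powr \<alpha>) * x powr (- \<alpha>)"
proof -
  have "(x / scaling l) powr \<alpha> * x powr (- \<alpha>) = l ^ DIM('a)"
    using scaling_powr[OF assms(1)] scaling_pos[OF assms(1)] assms
    by (simp add: powr_divide powr_minus field_simps)
  then show ?thesis by (simp add: mult_ac)
qed

lemma filterlim_scaling: "0 < x \<Longrightarrow> filterlim (\<lambda>l. x / scaling l) at_top at_top"
proof -
  assume x: "0 < x"
  have "filterlim (\<lambda>l. x * l powr (real DIM('a) / \<alpha>)) at_top at_top"
    using x alpha by (intro filterlim_tendsto_pos_mult_at_top[OF tendsto_const] filterlim_at_top_powr_pos) auto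
  then show ?thesis by (simp add: scaling_def powr_minus divide_inverse)
qed

lemma scaled_tail_limit:
  assumes x: "0 < x"
  shows "((\<lambda>l. l ^ DIM('a) * volume_tail (x / scaling l)) \<longlongrightarrow> c * x powr (- \<alpha>)) at_top"
proof -
  have "((\<lambda>l. (volume_tail (x / scaling l) * (x / scaling l) powr \<alpha>) * x powr (- \<alpha>)) \<longlongrightarrow> c * x powr (- \<alpha>)) at_top"
    by (intro tendsto_mult tendsto_const filterlim_compose[OF volume_tail_limit filterlim_scaling] x)
  then show ?thesis
    using eventually_gt_at_top[of 0] by (rule Lim_transform_eventually[OF _ eventually_mono]) (simp add: scaled_tail_eq x)
qed

text \<open>One bound for all scales, which serves as a dominating function in the limits below.\<close>

lemma scaled_tail_bound:
  obtains K where "0 < K" "\<And>l x. 0 < l \<Longrightarrow> 0 < x \<Longrightarrow> l ^ DIM('a) * volume_tail (x / scaling l) \<le> K * x powr (- \<alpha>)"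
proof -
  obtain K where K: "0 < K" "\<And>x. 0 < x \<Longrightarrow> volume_tail x \<le> K * x powr (- \<alpha>)" using volume_tail_bound by blast
  show thesis
  proof (rule that[OF K(1)])
    fix l x :: real assume l: "0 < l" and x: "0 < x"
    have "volume_tail (x / scaling l) * (x / scaling l) powr \<alpha> \<le> K"
      using K(2)[of "x / scaling l"] x scaling_pos[OF l] by (simp add: powr_minus field_simps)
    then show "l ^ DIM('a) * volume_tail (x / scaling l) \<le> K * x powr (- \<alpha>)"
      unfolding scaled_tail_eq[OF l x] by (intro mult_right_mono) auto
  qed
qed

lemma localization_tendsto:
  "((\<lambda>l. l powr ((\<alpha> - 1) * real DIM('a) / \<alpha>) * enn2real (mass_outside l)) \<longlongrightarrow> 0) at_top"
proof -
  have "((\<lambda>l. enn2real (mass_outside l) / l powr ((1 - \<alpha>) * DIM('a) / \<alpha>)) \<longlongrightarrow> 0) at_top"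
    using smalloD_tendsto[OF localization] by (simp add: mass_outside_def)
  moreover have "(1 - \<alpha>) * DIM('a) / \<alpha> = - ((\<alpha> - 1) * DIM('a) / \<alpha>)" by (simp add: diff_divide_distrib algebra_simps)
  ultimately show ?thesis by (simp add: powr_minus divide_inverse mult.commute)
qed

lemma mass_outside_finite: "mass_outside l < \<infinity>"
proof -
  have "mass_outside l \<le> (\<integral>\<^sup>+\<omega>. emeasure lborel (\<Xi> \<omega>) \<partial>M)"
    unfolding mass_outside_def by (intro nn_integral_mono emeasure_mono) (auto simp: Xi_borel)
  then show ?thesis using mean_finite by (rule order_le_less_trans)
qed

end

section \<open>The exponent of a stable law as a limit\<close>

context heavy_tailed_grain
begin

text \<open>Fubini's theorem for \<open>compensated_exp_integral\<close>, the layer-cake form of integration by parts.\<close>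

lemma expectation_compensated:
  "expectation (\<lambda>\<omega>. compensated_exp (w * volume \<omega>))
    = (\<integral>y. indicator {0<..} y *\<^sub>R (of_real (volume_tail y) * levy_kernel w y) \<partial>lborel)"
proof -
  interpret P: pair_sigma_finite M lborel ..
  define f where "f \<omega> y = (indicat_real {0<..} y * indicat_real {..<volume \<omega>} y) *\<^sub>R levy_kernel w y" for \<omega> y
  have fm [measurable]: "(\<lambda>p. f (fst p) (snd p)) \<in> borel_measurable (M \<Otimes>\<^sub>M borel)"
  proof -
    have "(\<lambda>p. f (fst p) (snd p)) = (\<lambda>p. if 0 < snd p \<and> snd p < volume (fst p) then levy_kernel w (snd p) else 0)"
      by (auto simp: f_def fun_eq_iff indicator_def)
    then show ?thesis by simp
  qed
  have "(\<integral>\<^sup>+p. ennreal (norm (case p of (\<omega>, y) \<Rightarrow> f \<omega> y)) \<partial>(M \<Otimes>\<^sub>M lborel)) = (\<integral>\<^sup>+\<omega>. \<integral>\<^sup>+y. ennreal (norm (f \<omega> y)) \<partial>lborel \<partial>M)"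
    by (subst lborel.nn_integral_fst[symmetric]) (simp_all add: split_beta')
  also have "\<dots> \<le> (\<integral>\<^sup>+\<omega>. ennreal (2 * \<bar>w\<bar> * volume \<omega>) \<partial>M)"
  proof (rule nn_integral_mono)
    fix \<omega>
    have "(\<integral>\<^sup>+y. ennreal (norm (f \<omega> y)) \<partial>lborel) \<le> (\<integral>\<^sup>+y. ennreal (2 * \<bar>w\<bar>) * indicator {0<..<volume \<omega>} y \<partial>lborel)"
    proof (rule nn_integral_mono)
      fix y
      have "norm (levy_kernel w y) \<le> 2 * \<bar>w\<bar>" if "0 < y"
      proof -
        have "norm (levy_kernel w y) \<le> \<bar>w\<bar> * min 2 (\<bar>w\<bar> * y)" using that by (intro norm_levy_kernel) simp
        also have "\<dots> \<le> \<bar>w\<bar> * 2" by (intro mult_left_mono) auto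
        finally show ?thesis by simp
      qed
      then show "ennreal (norm (f \<omega> y)) \<le> ennreal (2 * \<bar>w\<bar>) * indicator {0<..<volume \<omega>} y"
        by (auto simp: f_def indicator_def intro!: ennreal_leI)
    qed
    also have "\<dots> = ennreal (2 * \<bar>w\<bar> * volume \<omega>)"
      by (simp add: nn_integral_cmult_indicator ennreal_mult)
    finally show "(\<integral>\<^sup>+y. ennreal (norm (f \<omega> y)) \<partial>lborel) \<le> ennreal (2 * \<bar>w\<bar> * volume \<omega>)" .
  qed
  also have "\<dots> < \<infinity>"
    using integrable_volume by (simp add: ennreal_mult nn_integral_cmult ennreal_mult_less_top nn_integral_volume mean_finite[unfolded infinity_ennreal_def])
  finally have int: "integrable (M \<Otimes>\<^sub>M lborel) (\<lambda>(\<omega>, y). f \<omega> y)"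
    by (intro integrableI_bounded) (auto simp: split_beta')
  have "expectation (\<lambda>\<omega>. compensated_exp (w * volume \<omega>)) = (\<integral>\<omega>. \<integral>y. f \<omega> y \<partial>lborel \<partial>M)"
    unfolding f_def by (simp add: compensated_exp_integral)
  also have "\<dots> = (\<integral>y. \<integral>\<omega>. f \<omega> y \<partial>M \<partial>lborel)"
    using P.Fubini_integral[OF int] by simp
  also have "(\<lambda>y. \<integral>\<omega>. f \<omega> y \<partial>M) = (\<lambda>y. indicator {0<..} y *\<^sub>R (of_real (volume_tail y) * levy_kernel w y))"
  proof
    fix y
    have "(\<integral>\<omega>. f \<omega> y \<partial>M) = (\<integral>\<omega>. indicat_real {\<omega> \<in> space M. y < volume \<omega>} \<omega> *\<^sub>R (indicat_real {0<..} y *\<^sub>R levy_kernel w y) \<partial>M)"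
      by (intro Bochner_Integration.integral_cong) (auto simp: f_def indicator_def)
    also have "\<dots> = volume_tail y *\<^sub>R (indicat_real {0<..} y *\<^sub>R levy_kernel w y)"
      by (subst integral_scaleR_left) (auto simp: volume_tail_def intro!: integrable_real_indicator simp: emeasure_eq_measure)
    finally show "(\<integral>\<omega>. f \<omega> y \<partial>M) = indicator {0<..} y *\<^sub>R (of_real (volume_tail y) * levy_kernel w y)"
      by (simp add: scaleR_conv_of_real)
  qed
  finally show ?thesis .
qed

lemma scaled_expectation:
  assumes l: "0 < l"
  shows "l ^ DIM('a) *\<^sub>R expectation (\<lambda>\<omega>. compensated_exp (w * (scaling l * volume \<omega>)))
    = (\<integral>x. indicator {0<..} x *\<^sub>R (of_real (l ^ DIM('a) * volume_tail (x / scaling l)) * levy_kernel w x) \<partial>lborel)"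
proof -
  let ?a = "scaling l"
  note a = scaling_pos[OF l]
  have "expectation (\<lambda>\<omega>. compensated_exp (w * (?a * volume \<omega>)))
    = (\<integral>y. indicator {0<..} y *\<^sub>R (of_real (volume_tail y) * levy_kernel (w * ?a) y) \<partial>lborel)"
    using expectation_compensated[of "w * ?a"] by (simp add: mult.assoc)
  also have "\<dots> = \<bar>1 / ?a\<bar> *\<^sub>R (\<integral>x. indicator {0<..} (0 + 1 / ?a * x) *\<^sub>R (of_real (volume_tail (0 + 1 / ?a * x)) * levy_kernel (w * ?a) (0 + 1 / ?a * x)) \<partial>lborel)"
    using a by (intro lborel_integral_real_affine) simp
  also have "\<dots> = (\<integral>x. \<bar>1 / ?a\<bar> *\<^sub>R (indicator {0<..} (0 + 1 / ?a * x) *\<^sub>R (of_real (volume_tail (0 + 1 / ?a * x)) * levy_kernel (w * ?a) (0 + 1 / ?a * x))) \<partial>lborel)"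
    by (rule integral_scaleR_right[symmetric])
  also have "\<dots> = (\<integral>x. indicator {0<..} x *\<^sub>R (of_real (volume_tail (x / ?a)) * levy_kernel w x) \<partial>lborel)"
  proof (rule Bochner_Integration.integral_cong)
    fix x
    have "indicat_real {0<..} (x / ?a) = indicator {0<..} x" using a by (simp add: indicator_def zero_less_divide_iff)
    moreover have "levy_kernel (w * ?a) (x / ?a) = of_real ?a * levy_kernel w x" using a by (simp add: levy_kernel_def)
    ultimately show "\<bar>1 / ?a\<bar> *\<^sub>R (indicator {0<..} (0 + 1 / ?a * x) *\<^sub>R (of_real (volume_tail (0 + 1 / ?a * x)) * levy_kernel (w * ?a) (0 + 1 / ?a * x)))
      = indicator {0<..} x *\<^sub>R (of_real (volume_tail (x / ?a)) * levy_kernel w x)"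
      using a by (simp add: scaleR_conv_of_real)
  qed simp
  finally have "l ^ DIM('a) *\<^sub>R expectation (\<lambda>\<omega>. compensated_exp (w * (scaling l * volume \<omega>)))
    = (\<integral>x. l ^ DIM('a) *\<^sub>R (indicator {0<..} x *\<^sub>R (of_real (volume_tail (x / ?a)) * levy_kernel w x)) \<partial>lborel)"
    by (simp only: integral_scaleR_right)
  then show ?thesis by (simp add: scaleR_conv_of_real mult_ac)
qed

text \<open>The logarithm of the characteristic function of a totally skewed, centred \<open>\<alpha>\<close>-stable law, in the
  form obtained by integration by parts.\<close>

definition stable_exponent :: "real \<Rightarrow> complex" where
  "stable_exponent w = (\<integral>x. indicator {0<..} x *\<^sub>R (of_real (c * x powr (- \<alpha>)) * levy_kernel w x) \<partial>lborel)"

lemma stable_exponent_measurable: "stable_exponent \<in> borel_measurable borel"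
proof -
  have "(\<lambda>p. indicator {0<..} (snd p) *\<^sub>R (of_real (c * snd p powr (- \<alpha>)) * levy_kernel (fst p) (snd p)))
      \<in> borel_measurable (borel \<Otimes>\<^sub>M lborel)"
    using levy_kernel_measurable by measurable
  then show ?thesis
    unfolding stable_exponent_def[abs_def] by (intro lborel.borel_measurable_lebesgue_integral) (simp add: split_beta')
qed

lemma levy_integrand_bound:
  assumes "\<bar>w\<bar> \<le> \<kappa>" "0 \<le> t" "t \<le> K * x powr (- \<alpha>)"
  shows "norm (indicator {0<..} x *\<^sub>R (of_real t * levy_kernel w x)) \<le> K * \<bar>w\<bar> * (indicator {0<..} x * (min 2 (\<kappa> * x) * x powr (- \<alpha>)))"
proof (cases "0 < x")
  case True
  have "norm (of_real t * levy_kernel w x) \<le> (K * x powr (- \<alpha>)) * (\<bar>w\<bar> * min 2 (\<bar>w\<bar> * x))"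
    using assms norm_levy_kernel[of x w] True unfolding norm_mult by (intro mult_mono) auto
  also have "\<dots> \<le> (K * x powr (- \<alpha>)) * (\<bar>w\<bar> * min 2 (\<kappa> * x))"
  proof (intro mult_left_mono)
    show "min 2 (\<bar>w\<bar> * x) \<le> min 2 (\<kappa> * x)" using assms(1) True by (intro min.mono mult_right_mono) auto
  qed (use assms in auto)
  finally show ?thesis using True by (simp add: mult_ac)
qed simp

lemma scaled_expectation_limit:
  "((\<lambda>l. l ^ DIM('a) *\<^sub>R expectation (\<lambda>\<omega>. compensated_exp (w * (scaling l * volume \<omega>)))) \<longlongrightarrow> stable_exponent w) at_top"
proof -
  obtain K where K: "0 < K" "\<And>l x. 0 < l \<Longrightarrow> 0 < x \<Longrightarrow> l ^ DIM('a) * volume_tail (x / scaling l) \<le> K * x powr (- \<alpha>)"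
    using scaled_tail_bound by blast
  have "((\<lambda>l. \<integral>x. indicator {0<..} x *\<^sub>R (of_real (l ^ DIM('a) * volume_tail (x / scaling l)) * levy_kernel w x) \<partial>lborel) \<longlongrightarrow> stable_exponent w) at_top"
    unfolding stable_exponent_def
  proof (rule integral_dominated_convergence_at_top)
    show "integrable lborel (\<lambda>x. K * \<bar>w\<bar> * (indicator {0<..} x * (min 2 (\<bar>w\<bar> * x) * x powr (- \<alpha>))))"
      by (intro integrable_mult_right integrable_powr_kernel alpha) auto
    show "\<forall>\<^sub>F l in at_top. AE x in lborel. norm (indicator {0<..} x *\<^sub>R (of_real (l ^ DIM('a) * volume_tail (x / scaling l)) * levy_kernel w x))
        \<le> K * \<bar>w\<bar> * (indicator {0<..} x * (min 2 (\<bar>w\<bar> * x) * x powr (- \<alpha>)))"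
      using eventually_gt_at_top[of 0]
    proof (eventually_elim, intro AE_I2)
      fix l x :: real assume l: "0 < l"
      show "norm (indicator {0<..} x *\<^sub>R (of_real (l ^ DIM('a) * volume_tail (x / scaling l)) * levy_kernel w x))
        \<le> K * \<bar>w\<bar> * (indicator {0<..} x * (min 2 (\<bar>w\<bar> * x) * x powr (- \<alpha>)))"
        using levy_integrand_bound[of w "\<bar>w\<bar>" "l ^ DIM('a) * volume_tail (x / scaling l)" K x] K(2)[OF l] l
        by (cases "0 < x") (auto simp: volume_tail_nonneg)
    qed
    show "AE x in lborel. ((\<lambda>l. indicator {0<..} x *\<^sub>R (of_real (l ^ DIM('a) * volume_tail (x / scaling l)) * levy_kernel w x))
        \<longlongrightarrow> indicator {0<..} x *\<^sub>R (of_real (c * x powr (- \<alpha>)) * levy_kernel w x)) at_top"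
    proof (rule AE_I2)
      fix x :: real
      show "((\<lambda>l. indicator {0<..} x *\<^sub>R (of_real (l ^ DIM('a) * volume_tail (x / scaling l)) * levy_kernel w x))
        \<longlongrightarrow> indicator {0<..} x *\<^sub>R (of_real (c * x powr (- \<alpha>)) * levy_kernel w x)) at_top"
      proof (cases "0 < x")
        case True
        then show ?thesis by (intro tendsto_intros scaled_tail_limit)
      qed simp
    qed
  qed measurable
  then show ?thesis
    using eventually_gt_at_top[of 0] by (rule Lim_transform_eventually[OF _ eventually_mono]) (simp add: scaled_expectation)
qed

lemma scaled_expectation_bound:
  assumes "0 \<le> \<kappa>"
  obtains B where "0 \<le> B" "\<And>l w. 0 < l \<Longrightarrow> \<bar>w\<bar> \<le> \<kappa> \<Longrightarrow> norm (l ^ DIM('a) *\<^sub>R expectation (\<lambda>\<omega>. compensated_exp (w * (scaling l * volume \<omega>)))) \<le> B * \<bar>w\<bar>"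
proof -
  obtain K where K: "0 < K" "\<And>l x. 0 < l \<Longrightarrow> 0 < x \<Longrightarrow> l ^ DIM('a) * volume_tail (x / scaling l) \<le> K * x powr (- \<alpha>)"
    using scaled_tail_bound by blast
  define B where "B = K * (\<integral>x. indicator {0<..} x * (min 2 (\<kappa> * x) * x powr (- \<alpha>)) \<partial>lborel)"
  show thesis
  proof (rule that[of B])
    show "0 \<le> B" unfolding B_def using K(1) assms by (intro mult_nonneg_nonneg integral_nonneg_AE AE_I2 powr_kernel_nonneg) auto
    fix l w :: real assume l: "0 < l" and w: "\<bar>w\<bar> \<le> \<kappa>"
    have "norm (l ^ DIM('a) *\<^sub>R expectation (\<lambda>\<omega>. compensated_exp (w * (scaling l * volume \<omega>))))
      \<le> (\<integral>x. K * \<bar>w\<bar> * (indicator {0<..} x * (min 2 (\<kappa> * x) * x powr (- \<alpha>))) \<partial>lborel)"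
      unfolding scaled_expectation[OF l]
    proof (rule order_trans[OF integral_norm_bound integral_mono[OF integrable_norm]])
      show i: "integrable lborel (\<lambda>x. K * \<bar>w\<bar> * (indicator {0<..} x * (min 2 (\<kappa> * x) * x powr (- \<alpha>))))"
        by (intro integrable_mult_right integrable_powr_kernel alpha assms)
      show b: "norm (indicator {0<..} x *\<^sub>R (of_real (l ^ DIM('a) * volume_tail (x / scaling l)) * levy_kernel w x))
        \<le> K * \<bar>w\<bar> * (indicator {0<..} x * (min 2 (\<kappa> * x) * x powr (- \<alpha>)))" for x
        using levy_integrand_bound[OF w, of "l ^ DIM('a) * volume_tail (x / scaling l)" K x] K(2)[OF l] l
        by (cases "0 < x") (auto simp: volume_tail_nonneg)
      show "integrable lborel (\<lambda>x. indicator {0<..} x *\<^sub>R (of_real (l ^ DIM('a) * volume_tail (x / scaling l)) * levy_kernel w x))"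
      proof (rule Bochner_Integration.integrable_bound[OF i])
        show "AE x in lborel. norm (indicator {0<..} x *\<^sub>R (of_real (l ^ DIM('a) * volume_tail (x / scaling l)) * levy_kernel w x))
          \<le> norm (K * \<bar>w\<bar> * (indicator {0<..} x * (min 2 (\<kappa> * x) * x powr (- \<alpha>))))"
          unfolding real_norm_def by (intro AE_I2 order_trans[OF b abs_ge_self])
      qed measurable
    qed
    then show "norm (l ^ DIM('a) *\<^sub>R expectation (\<lambda>\<omega>. compensated_exp (w * (scaling l * volume \<omega>)))) \<le> B * \<bar>w\<bar>"
      by (simp add: B_def mult_ac)
  qed
qed

lemma stable_exponent_limit:
  fixes \<phi> :: "'a \<Rightarrow> real"
  assumes phi: "integrable lborel \<phi>" and C: "\<And>v. \<bar>\<phi> v\<bar> \<le> C"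
  shows "((\<lambda>l. \<integral>v. l ^ DIM('a) *\<^sub>R expectation (\<lambda>\<omega>. compensated_exp (\<theta> * \<phi> v * (scaling l * volume \<omega>))) \<partial>lborel)
    \<longlongrightarrow> (\<integral>v. stable_exponent (\<theta> * \<phi> v) \<partial>lborel)) at_top"
proof -
  have [measurable]: "\<phi> \<in> borel_measurable borel" using phi by auto
  have bd: "\<bar>\<theta> * \<phi> v\<bar> \<le> \<bar>\<theta>\<bar> * C" for v using C[of v] by (simp add: abs_mult mult_left_mono)
  then have "0 \<le> \<bar>\<theta>\<bar> * C" using abs_ge_zero order_trans by blast
  from scaled_expectation_bound[OF this] obtain B where B: "0 \<le> B"
    "\<And>l w. 0 < l \<Longrightarrow> \<bar>w\<bar> \<le> \<bar>\<theta>\<bar> * C \<Longrightarrow> norm (l ^ DIM('a) *\<^sub>R expectation (\<lambda>\<omega>. compensated_exp (w * (scaling l * volume \<omega>)))) \<le> B * \<bar>w\<bar>"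
    by blast
  show ?thesis
  proof (rule integral_dominated_convergence_at_top)
    show "integrable lborel (\<lambda>v. B * \<bar>\<theta> * \<phi> v\<bar>)" using phi by simp
    show "\<forall>\<^sub>F l in at_top. AE v in lborel. norm (l ^ DIM('a) *\<^sub>R expectation (\<lambda>\<omega>. compensated_exp (\<theta> * \<phi> v * (scaling l * volume \<omega>)))) \<le> B * \<bar>\<theta> * \<phi> v\<bar>"
      using eventually_gt_at_top[of 0] by eventually_elim (intro AE_I2 B(2) bd)
    show "AE v in lborel. ((\<lambda>l. l ^ DIM('a) *\<^sub>R expectation (\<lambda>\<omega>. compensated_exp (\<theta> * \<phi> v * (scaling l * volume \<omega>)))) \<longlongrightarrow> stable_exponent (\<theta> * \<phi> v)) at_top"
      by (intro AE_I2 scaled_expectation_limit)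
    show "(\<lambda>v. stable_exponent (\<theta> * \<phi> v)) \<in> borel_measurable lborel"
      by (rule measurable_compose[OF _ stable_exponent_measurable]) measurable
  qed measurable
qed

text \<open>The scaled volumes have uniformly bounded integrals against \<open>u * min 1 (\<kappa> u)\<close>, the weight that
  \<open>compensated_exp_diff\<close> leaves in front of an error. It is bounded by an integral of
  \<open>min 1 (\<kappa> y)\<close> up to \<open>u\<close>, so that again only the tail enters.\<close>

lemma truncated_moment_bound:
  assumes \<kappa>: "0 \<le> \<kappa>"
  obtains K where "0 \<le> K" "\<And>l. 0 < l \<Longrightarrow>
    ennreal (l ^ DIM('a)) * (\<integral>\<^sup>+\<omega>. ennreal (scaling l * volume \<omega> * min 1 (\<kappa> * (scaling l * volume \<omega>))) \<partial>M) \<le> ennreal K"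
proof -
  obtain K where K: "0 < K" "\<And>l x. 0 < l \<Longrightarrow> 0 < x \<Longrightarrow> l ^ DIM('a) * volume_tail (x / scaling l) \<le> K * x powr (- \<alpha>)"
    using scaled_tail_bound by blast
  interpret P: pair_sigma_finite M lborel ..
  \<comment> \<open>integrate \<open>min 1 (\<kappa> * y)\<close> over the upper half of the interval from 0 to \<open>u\<close> only\<close>
  have key: "ennreal (u * min 1 (\<kappa> * u)) \<le> 4 * (\<integral>\<^sup>+y. ennreal (min 1 (\<kappa> * y)) * indicator {0<..<u} y \<partial>lborel)" if "0 \<le> u" for u
  proof -
    have "u * min 1 (\<kappa> * u) \<le> 4 * (min 1 (\<kappa> * (u / 2)) * (u / 2))"
    proof -
      have "min 1 (\<kappa> * u) \<le> 2 * min 1 (\<kappa> * (u / 2))" using \<kappa> that by (auto simp: min_def)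
      from mult_left_mono[OF this that] show ?thesis by (simp add: mult_ac)
    qed
    then have "ennreal (u * min 1 (\<kappa> * u)) \<le> ennreal (4 * (min 1 (\<kappa> * (u / 2)) * (u / 2)))" by (rule ennreal_leI)
    also have "\<dots> = 4 * (ennreal (min 1 (\<kappa> * (u / 2))) * ennreal (u / 2))"
      using \<kappa> that by (subst ennreal_mult, simp, simp, subst ennreal_mult) auto
    also have "ennreal (min 1 (\<kappa> * (u / 2))) * ennreal (u / 2) = (\<integral>\<^sup>+y. ennreal (min 1 (\<kappa> * (u / 2))) * indicator {u / 2<..<u} y \<partial>lborel)"
      using that by (subst nn_integral_cmult_indicator) auto
    also have "\<dots> \<le> (\<integral>\<^sup>+y. ennreal (min 1 (\<kappa> * y)) * indicator {0<..<u} y \<partial>lborel)"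
    proof (rule nn_integral_mono)
      fix y
      have "min 1 (\<kappa> * (u / 2)) \<le> min 1 (\<kappa> * y)" if "u / 2 < y" using \<kappa> that by (intro min.mono mult_left_mono) auto
      then show "ennreal (min 1 (\<kappa> * (u / 2))) * indicator {u / 2<..<u} y \<le> ennreal (min 1 (\<kappa> * y)) * indicator {0<..<u} y"
        using that by (auto simp: indicator_def intro!: ennreal_leI)
    qed
    finally show ?thesis by (simp add: mult_left_mono)
  qed
  define K' where "K' = 4 * (K * (\<integral>x. indicator {0<..} x * (min 2 (\<kappa> * x) * x powr (- \<alpha>)) \<partial>lborel))"
  show thesis
  proof (rule that[of K'])
    show "0 \<le> K'" unfolding K'_def using K(1) \<kappa> by (intro mult_nonneg_nonneg integral_nonneg_AE AE_I2 powr_kernel_nonneg) auto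
    fix l :: real assume l: "0 < l"
    note a = scaling_pos[OF l]
    have "(\<integral>\<^sup>+\<omega>. ennreal (scaling l * volume \<omega> * min 1 (\<kappa> * (scaling l * volume \<omega>))) \<partial>M)
      \<le> (\<integral>\<^sup>+\<omega>. 4 * (\<integral>\<^sup>+y. ennreal (min 1 (\<kappa> * y)) * indicator {0<..<scaling l * volume \<omega>} y \<partial>lborel) \<partial>M)"
      using a by (intro nn_integral_mono key) simp
    also have "\<dots> = (\<integral>\<^sup>+\<omega>. \<integral>\<^sup>+y. 4 * (ennreal (min 1 (\<kappa> * y)) * indicator {0<..<scaling l * volume \<omega>} y) \<partial>lborel \<partial>M)"
      by (simp add: nn_integral_cmult)
    also have "\<dots> = (\<integral>\<^sup>+y. \<integral>\<^sup>+\<omega>. 4 * (ennreal (min 1 (\<kappa> * y)) * indicator {0<..<scaling l * volume \<omega>} y) \<partial>M \<partial>lborel)"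
      by (rule P.Fubini'[symmetric]) (simp add: split_beta' indicator_def)
    also have "\<dots> = (\<integral>\<^sup>+y. ennreal (4 * min 1 (\<kappa> * y) * volume_tail (y / scaling l)) * indicator {0<..} y \<partial>lborel)"
    proof (rule nn_integral_cong)
      fix y
      have "(\<integral>\<^sup>+\<omega>. 4 * (ennreal (min 1 (\<kappa> * y)) * indicator {0<..<scaling l * volume \<omega>} y) \<partial>M)
        = (\<integral>\<^sup>+\<omega>. (4 * ennreal (min 1 (\<kappa> * y)) * indicator {0<..} y) * indicator {\<omega> \<in> space M. y / scaling l < volume \<omega>} \<omega> \<partial>M)"
        using a by (intro nn_integral_cong) (auto simp: indicator_def field_simps)
      also have "\<dots> = (4 * ennreal (min 1 (\<kappa> * y)) * indicator {0<..} y) * ennreal (volume_tail (y / scaling l))"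
        by (subst nn_integral_cmult_indicator) (auto simp: volume_tail_def emeasure_eq_measure)
      finally show "(\<integral>\<^sup>+\<omega>. 4 * (ennreal (min 1 (\<kappa> * y)) * indicator {0<..<scaling l * volume \<omega>} y) \<partial>M)
        = ennreal (4 * min 1 (\<kappa> * y) * volume_tail (y / scaling l)) * indicator {0<..} y"
        using \<kappa> by (auto simp: indicator_def ennreal_mult volume_tail_nonneg)
    qed
    finally have "ennreal (l ^ DIM('a)) * (\<integral>\<^sup>+\<omega>. ennreal (scaling l * volume \<omega> * min 1 (\<kappa> * (scaling l * volume \<omega>))) \<partial>M)
      \<le> ennreal (l ^ DIM('a)) * (\<integral>\<^sup>+y. ennreal (4 * min 1 (\<kappa> * y) * volume_tail (y / scaling l)) * indicator {0<..} y \<partial>lborel)"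
      by (rule mult_left_mono) simp
    also have "\<dots> = (\<integral>\<^sup>+y. ennreal (l ^ DIM('a)) * (ennreal (4 * min 1 (\<kappa> * y) * volume_tail (y / scaling l)) * indicator {0<..} y) \<partial>lborel)"
      by (rule nn_integral_cmult[symmetric]) measurable
    also have "\<dots> \<le> (\<integral>\<^sup>+y. ennreal (4 * (K * (indicator {0<..} y * (min 2 (\<kappa> * y) * y powr (- \<alpha>))))) \<partial>lborel)"
    proof (rule nn_integral_mono)
      fix y :: real
      show "ennreal (l ^ DIM('a)) * (ennreal (4 * min 1 (\<kappa> * y) * volume_tail (y / scaling l)) * indicator {0<..} y)
        \<le> ennreal (4 * (K * (indicator {0<..} y * (min 2 (\<kappa> * y) * y powr (- \<alpha>)))))"
      proof (cases "0 < y")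
        case True
        have "l ^ DIM('a) * (4 * min 1 (\<kappa> * y) * volume_tail (y / scaling l)) = 4 * (min 1 (\<kappa> * y) * (l ^ DIM('a) * volume_tail (y / scaling l)))" by simp
        also have "\<dots> \<le> 4 * (min 2 (\<kappa> * y) * (K * y powr (- \<alpha>)))"
        proof (rule mult_left_mono)
          have "min 1 (\<kappa> * y) \<le> min 2 (\<kappa> * y)" by auto
          then show "min 1 (\<kappa> * y) * (l ^ DIM('a) * volume_tail (y / scaling l)) \<le> min 2 (\<kappa> * y) * (K * y powr (- \<alpha>))"
            by (rule mult_mono[OF _ K(2)[OF l True]]) (use \<kappa> l True in \<open>auto simp: volume_tail_nonneg\<close>)
        qed simp
        finally have "l ^ DIM('a) * (4 * min 1 (\<kappa> * y) * volume_tail (y / scaling l)) \<le> 4 * (K * (min 2 (\<kappa> * y) * y powr (- \<alpha>)))" by (simp add: mult_ac)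
        moreover have "0 \<le> 4 * min 1 (\<kappa> * y) * volume_tail (y / scaling l)" using \<kappa> True by (simp add: volume_tail_nonneg)
        ultimately show ?thesis using True l by (simp add: ennreal_mult[symmetric] ennreal_leI)
      qed simp
    qed
    also have "\<dots> = ennreal K'"
    proof (subst nn_integral_eq_integral)
      show "integrable lborel (\<lambda>y. 4 * (K * (indicator {0<..} y * (min 2 (\<kappa> * y) * y powr (- \<alpha>)))))"
        by (intro integrable_mult_right integrable_powr_kernel alpha \<kappa>)
      have "0 \<le> 4 * (K * (indicator {0<..} y * (min 2 (\<kappa> * y) * y powr (- \<alpha>))))" for y
        by (rule mult_nonneg_nonneg, simp, rule mult_nonneg_nonneg, simp add: K(1) less_imp_le, rule powr_kernel_nonneg[OF \<kappa>])
      then show "AE y in lborel. 0 \<le> 4 * (K * (indicator {0<..} y * (min 2 (\<kappa> * y) * y powr (- \<alpha>))))"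
        by (intro AE_I2)
    qed (simp add: K'_def)
    finally show "ennreal (l ^ DIM('a)) * (\<integral>\<^sup>+\<omega>. ennreal (scaling l * volume \<omega> * min 1 (\<kappa> * (scaling l * volume \<omega>))) \<partial>M) \<le> ennreal K'" .
  qed
qed

end

section \<open>Replacing a large grain by its volume\<close>

context heavy_tailed_grain
begin

context
  fixes \<phi> :: "'a \<Rightarrow> real" and C :: real
  assumes phi: "integrable lborel \<phi>" and C: "\<And>v. \<bar>\<phi> v\<bar> \<le> C"
begin

text \<open>The \<open>\<phi>\<close>-weighted mass, in the window of scale \<open>l\<close>, of a grain attached to the germ \<open>l *\<^sub>R v\<close>.\<close>

definition window_mass :: "real \<Rightarrow> 'a \<Rightarrow> 'w \<Rightarrow> real" where
  "window_mass l v \<omega> = (\<integral>s. \<phi> (v + s /\<^sub>R l) * indicator (\<Xi> \<omega>) s \<partial>lborel)"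

lemma phi_measurable [measurable]: "\<phi> \<in> borel_measurable borel"
  using phi by auto

lemma C_nonneg: "0 \<le> C" using C[of undefined] by simp

lemma window_mass_measurable [measurable]: "(\<lambda>p. window_mass l (fst p) (snd p)) \<in> borel_measurable (borel \<Otimes>\<^sub>M M)"
  unfolding window_mass_def
  by (rule lborel.borel_measurable_lebesgue_integral) (simp add: split_beta')

text \<open>Freezing \<open>\<phi>\<close> at the germ costs an integrated increment of \<open>\<phi>\<close> over the grain.\<close>

lemma window_mass_compare:
  assumes w: "\<omega> \<in> space M" and fin: "emeasure lborel (\<Xi> \<omega>) = ennreal (volume \<omega>)"
  shows "\<bar>window_mass l v \<omega>\<bar> \<le> C * volume \<omega>"
    and "ennreal \<bar>window_mass l v \<omega> - \<phi> v * volume \<omega>\<bar> \<le> (\<integral>\<^sup>+s. ennreal \<bar>\<phi> (v + s /\<^sub>R l) - \<phi> v\<bar> * indicator (\<Xi> \<omega>) s \<partial>lborel)"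
proof -
  have [measurable]: "\<Xi> \<omega> \<in> sets borel" using w by (rule Xi_borel)
  have iX: "integrable lborel (indicat_real (\<Xi> \<omega>))" using fin by simp
  have vol: "(\<integral>s. indicat_real (\<Xi> \<omega>) s \<partial>lborel) = volume \<omega>" by (simp add: volume_def)
  have i: "integrable lborel (\<lambda>s. f s * indicat_real (\<Xi> \<omega>) s)" if [measurable]: "f \<in> borel_measurable borel" and "\<And>s. \<bar>f s\<bar> \<le> B" for f B
    by (rule Bochner_Integration.integrable_bound[OF integrable_mult_right[OF iX, of B]])
       (use that(2) in \<open>auto simp: indicator_def intro!: AE_I2 order_trans[OF that(2)]\<close>)
  have i1: "integrable lborel (\<lambda>s. \<phi> (v + s /\<^sub>R l) * indicat_real (\<Xi> \<omega>) s)" by (rule i[of _ C]) (auto simp: C)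
  have i2: "integrable lborel (\<lambda>s. \<phi> v * indicat_real (\<Xi> \<omega>) s)" using iX by simp
  have "\<bar>window_mass l v \<omega>\<bar> \<le> (\<integral>s. C * indicat_real (\<Xi> \<omega>) s \<partial>lborel)"
    unfolding window_mass_def
    by (rule integral_abs_bound[THEN order_trans], rule integral_mono[OF integrable_abs[OF i1] integrable_mult_right[OF iX]])
       (auto simp: indicator_def C)
  then show "\<bar>window_mass l v \<omega>\<bar> \<le> C * volume \<omega>" by (simp add: volume_def)
  have "window_mass l v \<omega> - \<phi> v * volume \<omega> = (\<integral>s. (\<phi> (v + s /\<^sub>R l) - \<phi> v) * indicat_real (\<Xi> \<omega>) s \<partial>lborel)"
    unfolding window_mass_def vol[symmetric] using i1 i2 by (simp add: left_diff_distrib)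
  then have "ennreal \<bar>window_mass l v \<omega> - \<phi> v * volume \<omega>\<bar> \<le> (\<integral>\<^sup>+s. ennreal (norm ((\<phi> (v + s /\<^sub>R l) - \<phi> v) * indicat_real (\<Xi> \<omega>) s)) \<partial>lborel)"
    using integral_norm_bound_ennreal[of lborel "\<lambda>s. (\<phi> (v + s /\<^sub>R l) - \<phi> v) * indicat_real (\<Xi> \<omega>) s"] i1 i2
    by (simp add: left_diff_distrib)
  also have "\<dots> = (\<integral>\<^sup>+s. ennreal \<bar>\<phi> (v + s /\<^sub>R l) - \<phi> v\<bar> * indicator (\<Xi> \<omega>) s \<partial>lborel)"
    by (intro nn_integral_cong) (auto simp: indicator_def)
  finally show "ennreal \<bar>window_mass l v \<omega> - \<phi> v * volume \<omega>\<bar> \<le> (\<integral>\<^sup>+s. ennreal \<bar>\<phi> (v + s /\<^sub>R l) - \<phi> v\<bar> * indicator (\<Xi> \<omega>) s \<partial>lborel)" .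
qed

text \<open>After exchanging the order of integration the inner integral is an \<open>L\<^sup>1\<close> modulus of continuity of
  \<open>\<phi>\<close> at \<open>s /\<^sub>R l\<close>: it is small for \<open>norm s \<le> e * l\<close>, and at most twice the norm otherwise.\<close>

lemma translation_mass_bound:
  assumes l: "0 < l" and e: "\<And>h. norm h \<le> e \<Longrightarrow> (\<integral>v. \<bar>\<phi> (v + h) - \<phi> v\<bar> \<partial>lborel) \<le> d"
    and d: "0 \<le> d" and w: "\<omega> \<in> space M" and fin: "emeasure lborel (\<Xi> \<omega>) = ennreal (volume \<omega>)"
  shows "(\<integral>\<^sup>+v. \<integral>\<^sup>+s. ennreal \<bar>\<phi> (v + s /\<^sub>R l) - \<phi> v\<bar> * indicator (\<Xi> \<omega>) s \<partial>lborel \<partial>lborel)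
    \<le> ennreal (d * volume \<omega>) + ennreal (2 * (\<integral>v. \<bar>\<phi> v\<bar> \<partial>lborel)) * emeasure lborel (\<Xi> \<omega> \<inter> {s. norm s > e * l})"
proof -
  have [measurable]: "\<Xi> \<omega> \<in> sets borel" using w by (rule Xi_borel)
  let ?n = "\<integral>v. \<bar>\<phi> v\<bar> \<partial>lborel"
  have om: "(\<integral>\<^sup>+v. ennreal \<bar>\<phi> (v + h) - \<phi> v\<bar> \<partial>lborel) = ennreal (\<integral>v. \<bar>\<phi> (v + h) - \<phi> v\<bar> \<partial>lborel)" for h
    using phi integrable_lborel_shift[OF phi] by (intro nn_integral_eq_integral) auto
  have om2: "(\<integral>v. \<bar>\<phi> (v + h) - \<phi> v\<bar> \<partial>lborel) \<le> 2 * ?n" for h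
    using L1_triangle[OF phi, of "\<lambda>_. 0" h] by simp
  have "(\<integral>\<^sup>+v. \<integral>\<^sup>+s. ennreal \<bar>\<phi> (v + s /\<^sub>R l) - \<phi> v\<bar> * indicator (\<Xi> \<omega>) s \<partial>lborel \<partial>lborel)
    = (\<integral>\<^sup>+s. \<integral>\<^sup>+v. ennreal \<bar>\<phi> (v + s /\<^sub>R l) - \<phi> v\<bar> * indicator (\<Xi> \<omega>) s \<partial>lborel \<partial>lborel)"
    by (rule lborel_pair.Fubini'[symmetric]) (simp add: split_beta')
  also have "\<dots> = (\<integral>\<^sup>+s. ennreal (\<integral>v. \<bar>\<phi> (v + s /\<^sub>R l) - \<phi> v\<bar> \<partial>lborel) * indicator (\<Xi> \<omega>) s \<partial>lborel)"
    by (simp add: nn_integral_multc om)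
  also have "\<dots> \<le> (\<integral>\<^sup>+s. ennreal d * indicator (\<Xi> \<omega>) s + ennreal (2 * ?n) * indicator (\<Xi> \<omega> \<inter> {s. norm s > e * l}) s \<partial>lborel)"
  proof (rule nn_integral_mono)
    fix s :: 'a
    show "ennreal (\<integral>v. \<bar>\<phi> (v + s /\<^sub>R l) - \<phi> v\<bar> \<partial>lborel) * indicator (\<Xi> \<omega>) s
      \<le> ennreal d * indicator (\<Xi> \<omega>) s + ennreal (2 * ?n) * indicator (\<Xi> \<omega> \<inter> {s. norm s > e * l}) s"
    proof (cases "norm s > e * l")
      case True
      then show ?thesis using om2[of "s /\<^sub>R l"] by (auto simp: indicator_def intro: order_trans[OF ennreal_leI] add_increasing)
    next
      case False
      then have "norm (s /\<^sub>R l) \<le> e" using l by (simp add: field_simps)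
      from e[OF this] show ?thesis by (auto simp: indicator_def intro: order_trans[OF ennreal_leI] add_increasing2)
    qed
  qed
  also have "\<dots> = ennreal d * emeasure lborel (\<Xi> \<omega>) + ennreal (2 * ?n) * emeasure lborel (\<Xi> \<omega> \<inter> {s. norm s > e * l})"
    by (subst nn_integral_add) (auto simp: nn_integral_cmult_indicator)
  finally show ?thesis using d by (simp add: fin ennreal_mult)
qed

lemma exponent_compare_pointwise:
  assumes l: "0 < l" and e: "\<And>h. norm h \<le> e \<Longrightarrow> (\<integral>v. \<bar>\<phi> (v + h) - \<phi> v\<bar> \<partial>lborel) \<le> d"
    and d: "0 \<le> d" and w: "\<omega> \<in> space M" and fin: "emeasure lborel (\<Xi> \<omega>) = ennreal (volume \<omega>)"
  shows "(\<integral>\<^sup>+v. ennreal (norm (compensated_exp (\<theta> * (scaling l * window_mass l v \<omega>)) - compensated_exp (\<theta> * \<phi> v * (scaling l * volume \<omega>)))) \<partial>lborel)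
    \<le> ennreal (2 * \<bar>\<theta>\<bar> * d) * ennreal (scaling l * volume \<omega> * min 1 (\<bar>\<theta>\<bar> * C * (scaling l * volume \<omega>)))
      + ennreal (4 * \<bar>\<theta>\<bar> * (\<integral>v. \<bar>\<phi> v\<bar> \<partial>lborel) * scaling l) * emeasure lborel (\<Xi> \<omega> \<inter> {s. norm s > e * l})"
proof -
  note a = scaling_pos[OF l]
  have [measurable]: "\<Xi> \<omega> \<in> sets borel" using w by (rule Xi_borel)
  let ?n = "\<integral>v. \<bar>\<phi> v\<bar> \<partial>lborel"
  define q where "q = min 1 (\<bar>\<theta>\<bar> * C * (scaling l * volume \<omega>))"
  have q: "0 \<le> q" "q \<le> 1" using C_nonneg a by (auto simp: q_def)
  have "ennreal (norm (compensated_exp (\<theta> * (scaling l * window_mass l v \<omega>)) - compensated_exp (\<theta> * \<phi> v * (scaling l * volume \<omega>))))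
    \<le> ennreal (2 * \<bar>\<theta>\<bar> * scaling l * q) * (\<integral>\<^sup>+s. ennreal \<bar>\<phi> (v + s /\<^sub>R l) - \<phi> v\<bar> * indicator (\<Xi> \<omega>) s \<partial>lborel)" for v
  proof -
    have b1: "\<bar>\<theta> * (scaling l * window_mass l v \<omega>)\<bar> \<le> \<bar>\<theta>\<bar> * C * (scaling l * volume \<omega>)"
      using mult_left_mono[OF window_mass_compare(1)[OF w fin, of l v], of "\<bar>\<theta>\<bar> * scaling l"] a by (simp add: abs_mult mult_ac)
    have b2: "\<bar>\<theta> * \<phi> v * (scaling l * volume \<omega>)\<bar> \<le> \<bar>\<theta>\<bar> * C * (scaling l * volume \<omega>)"
      using a C[of v] by (auto simp: abs_mult intro!: mult_right_mono mult_left_mono)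
    have "norm (compensated_exp (\<theta> * (scaling l * window_mass l v \<omega>)) - compensated_exp (\<theta> * \<phi> v * (scaling l * volume \<omega>)))
      \<le> 2 * \<bar>\<theta> * (scaling l * window_mass l v \<omega>) - \<theta> * \<phi> v * (scaling l * volume \<omega>)\<bar> * q"
      unfolding q_def by (rule compensated_exp_diff[OF b1 b2])
    also have "\<theta> * (scaling l * window_mass l v \<omega>) - \<theta> * \<phi> v * (scaling l * volume \<omega>) = \<theta> * scaling l * (window_mass l v \<omega> - \<phi> v * volume \<omega>)"
      by (simp add: algebra_simps)
    also have "2 * \<bar>\<theta> * scaling l * (window_mass l v \<omega> - \<phi> v * volume \<omega>)\<bar> * q = (2 * \<bar>\<theta>\<bar> * scaling l * q) * \<bar>window_mass l v \<omega> - \<phi> v * volume \<omega>\<bar>"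
      using a by (simp add: abs_mult mult_ac)
    finally have "ennreal (norm (compensated_exp (\<theta> * (scaling l * window_mass l v \<omega>)) - compensated_exp (\<theta> * \<phi> v * (scaling l * volume \<omega>))))
      \<le> ennreal ((2 * \<bar>\<theta>\<bar> * scaling l * q) * \<bar>window_mass l v \<omega> - \<phi> v * volume \<omega>\<bar>)"
      by (rule ennreal_leI)
    also have "\<dots> = ennreal (2 * \<bar>\<theta>\<bar> * scaling l * q) * ennreal \<bar>window_mass l v \<omega> - \<phi> v * volume \<omega>\<bar>"
      using a q by (intro ennreal_mult) auto
    also have "\<dots> \<le> ennreal (2 * \<bar>\<theta>\<bar> * scaling l * q) * (\<integral>\<^sup>+s. ennreal \<bar>\<phi> (v + s /\<^sub>R l) - \<phi> v\<bar> * indicator (\<Xi> \<omega>) s \<partial>lborel)"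
      by (intro mult_left_mono window_mass_compare(2)[OF w fin]) simp
    finally show ?thesis .
  qed
  then have "(\<integral>\<^sup>+v. ennreal (norm (compensated_exp (\<theta> * (scaling l * window_mass l v \<omega>)) - compensated_exp (\<theta> * \<phi> v * (scaling l * volume \<omega>)))) \<partial>lborel)
    \<le> (\<integral>\<^sup>+v. ennreal (2 * \<bar>\<theta>\<bar> * scaling l * q) * (\<integral>\<^sup>+s. ennreal \<bar>\<phi> (v + s /\<^sub>R l) - \<phi> v\<bar> * indicator (\<Xi> \<omega>) s \<partial>lborel) \<partial>lborel)"
    by (intro nn_integral_mono)
  also have "\<dots> = ennreal (2 * \<bar>\<theta>\<bar> * scaling l * q) * (\<integral>\<^sup>+v. \<integral>\<^sup>+s. ennreal \<bar>\<phi> (v + s /\<^sub>R l) - \<phi> v\<bar> * indicator (\<Xi> \<omega>) s \<partial>lborel \<partial>lborel)"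
    by (intro nn_integral_cmult lborel.borel_measurable_nn_integral) (simp add: split_beta')
  also have "\<dots> \<le> ennreal (2 * \<bar>\<theta>\<bar> * scaling l * q) * (ennreal (d * volume \<omega>) + ennreal (2 * ?n) * emeasure lborel (\<Xi> \<omega> \<inter> {s. norm s > e * l}))"
    by (intro mult_left_mono translation_mass_bound[OF l e d w fin]) auto
  also have "\<dots> = ennreal ((2 * \<bar>\<theta>\<bar> * d) * (scaling l * volume \<omega> * q)) + ennreal ((2 * \<bar>\<theta>\<bar> * scaling l * q) * (2 * ?n)) * emeasure lborel (\<Xi> \<omega> \<inter> {s. norm s > e * l})"
    using a q d by (simp add: distrib_left ennreal_mult[symmetric] mult.assoc[symmetric])
  also have "ennreal ((2 * \<bar>\<theta>\<bar> * d) * (scaling l * volume \<omega> * q)) = ennreal (2 * \<bar>\<theta>\<bar> * d) * ennreal (scaling l * volume \<omega> * q)"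
    using a q d by (intro ennreal_mult) auto
  also have "ennreal ((2 * \<bar>\<theta>\<bar> * scaling l * q) * (2 * ?n)) \<le> ennreal (4 * \<bar>\<theta>\<bar> * ?n * scaling l)"
  proof (rule ennreal_leI)
    have "(4 * \<bar>\<theta>\<bar> * ?n * scaling l) * q \<le> (4 * \<bar>\<theta>\<bar> * ?n * scaling l) * 1"
      using a q by (intro mult_left_mono) auto
    then show "(2 * \<bar>\<theta>\<bar> * scaling l * q) * (2 * ?n) \<le> 4 * \<bar>\<theta>\<bar> * ?n * scaling l" by (simp add: mult_ac)
  qed
  finally show ?thesis by (simp add: q_def add_left_mono mult_right_mono)
qed

text \<open>The near part is small by the choice of \<open>e\<close>, uniformly in the scale by \<open>truncated_moment_bound\<close>.
  The far part tends to 0 because the localization hypothesis has exactly the rate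
  \<open>1 / (l ^ DIM('a) * scaling l)\<close>.\<close>

lemma exponent_compare:
  "((\<lambda>l. ennreal (l ^ DIM('a)) * (\<integral>\<^sup>+\<omega>. \<integral>\<^sup>+v. ennreal (norm (compensated_exp (\<theta> * (scaling l * window_mass l v \<omega>)) - compensated_exp (\<theta> * \<phi> v * (scaling l * volume \<omega>)))) \<partial>lborel \<partial>M)) \<longlongrightarrow> 0) at_top"
    (is "(?D \<longlongrightarrow> 0) at_top")
proof -
  let ?n = "\<integral>v. \<bar>\<phi> v\<bar> \<partial>lborel"
  obtain K where K: "0 \<le> K" "\<And>l. 0 < l \<Longrightarrow>
    ennreal (l ^ DIM('a)) * (\<integral>\<^sup>+\<omega>. ennreal (scaling l * volume \<omega> * min 1 (\<bar>\<theta>\<bar> * C * (scaling l * volume \<omega>))) \<partial>M) \<le> ennreal K"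
    using truncated_moment_bound[of "\<bar>\<theta>\<bar> * C"] C_nonneg by auto
  have mass: "((\<lambda>l. l ^ DIM('a) * scaling l * enn2real (mass_outside (e * l))) \<longlongrightarrow> 0) at_top" if e: "0 < e" for e
  proof -
    let ?p = "(\<alpha> - 1) * real DIM('a) / \<alpha>"
    have "filterlim (\<lambda>l. e * l) at_top at_top"
      using e by (intro filterlim_tendsto_pos_mult_at_top[OF tendsto_const] filterlim_ident)
    from filterlim_compose[OF localization_tendsto this]
    have "((\<lambda>l. e powr (- ?p) * ((e * l) powr ?p * enn2real (mass_outside (e * l)))) \<longlongrightarrow> 0) at_top"
      by (rule tendsto_mult_right_zero)
    then show ?thesis
    proof (rule Lim_transform_eventually[OF _ eventually_mono[OF eventually_gt_at_top[of 0]]])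
      fix l :: real assume l: "0 < l"
      have "real DIM('a) + - real DIM('a) / \<alpha> = ?p" using alpha by (simp add: field_simps)
      then have "l ^ DIM('a) * scaling l = l powr ?p"
        using l by (simp add: scaling_def powr_realpow[symmetric] powr_add[symmetric])
      moreover have "e powr (- ?p) * (e * l) powr ?p = l powr ?p"
        using e l by (simp add: powr_mult powr_minus field_simps)
      ultimately show "e powr (- ?p) * ((e * l) powr ?p * enn2real (mass_outside (e * l))) = l ^ DIM('a) * scaling l * enn2real (mass_outside (e * l))"
        by (simp add: mult.assoc[symmetric])
    qed
  qed
  have bound: "?D l \<le> ennreal (2 * \<bar>\<theta>\<bar> * d * K + 4 * \<bar>\<theta>\<bar> * ?n * (l ^ DIM('a) * scaling l * enn2real (mass_outside (e * l))))"
    if l: "0 < l" and d: "0 \<le> d" and e: "\<And>h. norm h \<le> e \<Longrightarrow> (\<integral>v. \<bar>\<phi> (v + h) - \<phi> v\<bar> \<partial>lborel) \<le> d" for l d e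
  proof -
    note a = scaling_pos[OF l]
    let ?m = "\<lambda>\<omega>. scaling l * volume \<omega> * min 1 (\<bar>\<theta>\<bar> * C * (scaling l * volume \<omega>))"
    have "(\<integral>\<^sup>+\<omega>. \<integral>\<^sup>+v. ennreal (norm (compensated_exp (\<theta> * (scaling l * window_mass l v \<omega>)) - compensated_exp (\<theta> * \<phi> v * (scaling l * volume \<omega>)))) \<partial>lborel \<partial>M)
      \<le> (\<integral>\<^sup>+\<omega>. ennreal (2 * \<bar>\<theta>\<bar> * d) * ennreal (?m \<omega>) + ennreal (4 * \<bar>\<theta>\<bar> * ?n * scaling l) * emeasure lborel (\<Xi> \<omega> \<inter> {s. norm s > e * l}) \<partial>M)"
      using AE_volume AE_space
      by (intro nn_integral_mono_AE, eventually_elim) (rule exponent_compare_pointwise[OF l e d])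
    also have "\<dots> = ennreal (2 * \<bar>\<theta>\<bar> * d) * (\<integral>\<^sup>+\<omega>. ennreal (?m \<omega>) \<partial>M) + ennreal (4 * \<bar>\<theta>\<bar> * ?n * scaling l) * mass_outside (e * l)"
      unfolding mass_outside_def by (subst nn_integral_add) (simp_all add: nn_integral_cmult)
    finally have "?D l \<le> ennreal (l ^ DIM('a)) * (ennreal (2 * \<bar>\<theta>\<bar> * d) * (\<integral>\<^sup>+\<omega>. ennreal (?m \<omega>) \<partial>M) + ennreal (4 * \<bar>\<theta>\<bar> * ?n * scaling l) * mass_outside (e * l))"
      by (rule mult_left_mono) simp
    also have "\<dots> = ennreal (2 * \<bar>\<theta>\<bar> * d) * (ennreal (l ^ DIM('a)) * (\<integral>\<^sup>+\<omega>. ennreal (?m \<omega>) \<partial>M)) + ennreal (l ^ DIM('a)) * (ennreal (4 * \<bar>\<theta>\<bar> * ?n * scaling l) * mass_outside (e * l))"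
      by (simp add: distrib_left mult_ac)
    also have "\<dots> \<le> ennreal (2 * \<bar>\<theta>\<bar> * d) * ennreal K + ennreal (l ^ DIM('a)) * (ennreal (4 * \<bar>\<theta>\<bar> * ?n * scaling l) * ennreal (enn2real (mass_outside (e * l))))"
      using K(2)[OF l] mass_outside_finite[of "e * l"] by (intro add_mono mult_left_mono) (auto simp: less_top)
    also have "\<dots> = ennreal (2 * \<bar>\<theta>\<bar> * d * K + 4 * \<bar>\<theta>\<bar> * ?n * (l ^ DIM('a) * scaling l * enn2real (mass_outside (e * l))))"
      using l a d K(1) by (simp add: ennreal_mult[symmetric] ennreal_plus[symmetric] mult_ac del: ennreal_plus)
    finally show ?thesis .
  qed
  show ?thesis
  proof (rule tendsto_zero_ennreal)
    fix r :: real assume r: "0 < r"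
    \<comment> \<open>the near part of the error then stays below \<open>r / 2\<close>, also for \<open>\<theta> * K = 0\<close>\<close>
    define d where "d = r / (4 * (\<bar>\<theta>\<bar> * K + 1))"
    have d: "0 < d" "2 * \<bar>\<theta>\<bar> * d * K < r / 2"
    proof -
      have p: "0 < \<bar>\<theta>\<bar> * K + 1" using K(1) by (simp add: add_nonneg_pos)
      then show "0 < d" using r by (simp add: d_def)
      have "2 * \<bar>\<theta>\<bar> * d * K = (r / 2) * (\<bar>\<theta>\<bar> * K / (\<bar>\<theta>\<bar> * K + 1))"
        using p by (simp add: d_def field_simps)
      also have "\<dots> < (r / 2) * 1" using p r by (intro mult_strict_left_mono) auto
      finally show "2 * \<bar>\<theta>\<bar> * d * K < r / 2" by simp
    qed
    obtain e where e: "0 < e" "\<And>h. norm h \<le> e \<Longrightarrow> (\<integral>v. \<bar>\<phi> (v + h) - \<phi> v\<bar> \<partial>lborel) \<le> d"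
      using L1_translation_small[OF phi d(1)] by blast
    have "((\<lambda>l. 4 * \<bar>\<theta>\<bar> * ?n * (l ^ DIM('a) * scaling l * enn2real (mass_outside (e * l)))) \<longlongrightarrow> 0) at_top"
      by (rule tendsto_mult_right_zero[OF mass[OF e(1)]])
    then have "\<forall>\<^sub>F l in at_top. 4 * \<bar>\<theta>\<bar> * ?n * (l ^ DIM('a) * scaling l * enn2real (mass_outside (e * l))) < r / 2"
      using r by (intro order_tendstoD(2)) auto
    then show "\<forall>\<^sub>F l in at_top. ?D l < ennreal r"
      using eventually_gt_at_top[of 0]
    proof eventually_elim
      case (elim l)
      have "?D l \<le> ennreal (2 * \<bar>\<theta>\<bar> * d * K + 4 * \<bar>\<theta>\<bar> * ?n * (l ^ DIM('a) * scaling l * enn2real (mass_outside (e * l))))"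
        using d(1) by (intro bound[OF elim(2)] e(2)) auto
      also have "\<dots> < ennreal r"
        using elim(1) d(2) r by (intro ennreal_lessI) auto
      finally show ?case .
    qed
  qed
qed

text \<open>The integrand is replaced by \<open>compensated_exp (\<theta> * \<phi> v * (scaling l * volume \<omega>))\<close>, for which the limit
  is known. Integrability of the original integrand is a by-product of the comparison.\<close>

theorem exponent_limit:
  "((\<lambda>l. l ^ DIM('a) *\<^sub>R (\<integral>p. compensated_exp (\<theta> * (scaling l * window_mass l (fst p) (snd p))) \<partial>(lborel \<Otimes>\<^sub>M M)))
    \<longlongrightarrow> (\<integral>v. stable_exponent (\<theta> * \<phi> v) \<partial>lborel)) at_top"
proof -
  interpret P: pair_sigma_finite "lborel :: 'a measure" M ..
  define A where "A l p = compensated_exp (\<theta> * (scaling l * window_mass l (fst p) (snd p)))" for l p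
  define B where "B l p = compensated_exp (\<theta> * \<phi> (fst p) * (scaling l * volume (snd p)))" for l p
  have Am [measurable]: "A l \<in> borel_measurable (lborel \<Otimes>\<^sub>M M)" for l
    unfolding A_def by measurable
  have Bm [measurable]: "B l \<in> borel_measurable (lborel \<Otimes>\<^sub>M M)" for l
    unfolding B_def by measurable
  have Bi: "integrable (lborel \<Otimes>\<^sub>M M) (B l)" for l
  proof (rule Bochner_Integration.integrable_bound)
    show "integrable (lborel \<Otimes>\<^sub>M M) (\<lambda>(v, \<omega>). (2 * \<bar>\<theta>\<bar> * \<bar>scaling l\<bar> * \<bar>\<phi> v\<bar>) * volume \<omega>)"
      using phi by (intro integrable_pair_mult integrable_volume sigma_finite_measure_axioms) auto
    show "AE p in lborel \<Otimes>\<^sub>M M. norm (B l p) \<le> norm (case p of (v, \<omega>) \<Rightarrow> (2 * \<bar>\<theta>\<bar> * \<bar>scaling l\<bar> * \<bar>\<phi> v\<bar>) * volume \<omega>)"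
      using norm_compensated_exp_le by (intro AE_I2) (auto simp: B_def abs_mult split_beta' mult_ac intro!: order_trans[OF norm_compensated_exp_le])
  qed simp
  have diff: "(\<integral>\<^sup>+p. ennreal (norm (A l p - B l p)) \<partial>(lborel \<Otimes>\<^sub>M M))
     = (\<integral>\<^sup>+\<omega>. \<integral>\<^sup>+v. ennreal (norm (compensated_exp (\<theta> * (scaling l * window_mass l v \<omega>)) - compensated_exp (\<theta> * \<phi> v * (scaling l * volume \<omega>)))) \<partial>lborel \<partial>M)" for l
    by (subst P.nn_integral_snd[symmetric]) (simp_all add: A_def B_def)
  have D: "((\<lambda>l. ennreal (l ^ DIM('a)) * (\<integral>\<^sup>+p. ennreal (norm (A l p - B l p)) \<partial>(lborel \<Otimes>\<^sub>M M))) \<longlongrightarrow> 0) at_top"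
    unfolding diff by (rule exponent_compare)
  have "((\<lambda>l. l ^ DIM('a) *\<^sub>R (\<integral>p. A l p \<partial>(lborel \<Otimes>\<^sub>M M)) - l ^ DIM('a) *\<^sub>R (\<integral>p. B l p \<partial>(lborel \<Otimes>\<^sub>M M))) \<longlongrightarrow> 0) at_top"
  proof (rule tendstoI)
    fix r :: real assume r: "0 < r"
    have "\<forall>\<^sub>F l in at_top. ennreal (l ^ DIM('a)) * (\<integral>\<^sup>+p. ennreal (norm (A l p - B l p)) \<partial>(lborel \<Otimes>\<^sub>M M)) < ennreal r"
      using r by (intro order_tendstoD(2)[OF D]) auto
    then show "\<forall>\<^sub>F l in at_top. dist (l ^ DIM('a) *\<^sub>R (\<integral>p. A l p \<partial>(lborel \<Otimes>\<^sub>M M)) - l ^ DIM('a) *\<^sub>R (\<integral>p. B l p \<partial>(lborel \<Otimes>\<^sub>M M))) 0 < r"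
      using eventually_gt_at_top[of 0]
    proof eventually_elim
      case (elim l)
      have "(\<integral>\<^sup>+p. ennreal (norm (A l p - B l p)) \<partial>(lborel \<Otimes>\<^sub>M M)) < \<infinity>"
        using elim by (auto simp: less_top[symmetric] ennreal_mult_eq_top_iff)
      then have i: "integrable (lborel \<Otimes>\<^sub>M M) (\<lambda>p. A l p - B l p)" by (intro integrableI_bounded) auto
      have Ai: "integrable (lborel \<Otimes>\<^sub>M M) (A l)" using Bochner_Integration.integrable_add[OF i Bi[of l]] by simp
      have "ennreal (norm (l ^ DIM('a) *\<^sub>R ((\<integral>p. A l p \<partial>(lborel \<Otimes>\<^sub>M M)) - (\<integral>p. B l p \<partial>(lborel \<Otimes>\<^sub>M M)))))
        = ennreal (l ^ DIM('a)) * ennreal (norm (\<integral>p. A l p - B l p \<partial>(lborel \<Otimes>\<^sub>M M)))"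
        using elim(2) Ai Bi[of l] by (simp add: ennreal_mult)
      also have "\<dots> \<le> ennreal (l ^ DIM('a)) * (\<integral>\<^sup>+p. ennreal (norm (A l p - B l p)) \<partial>(lborel \<Otimes>\<^sub>M M))"
        by (intro mult_left_mono integral_norm_bound_ennreal i) simp
      also have "\<dots> < ennreal r" by (rule elim(1))
      finally show ?case by (simp add: scaleR_diff_right ennreal_less_iff)
    qed
  qed
  moreover have "((\<lambda>l. l ^ DIM('a) *\<^sub>R (\<integral>p. B l p \<partial>(lborel \<Otimes>\<^sub>M M))) \<longlongrightarrow> (\<integral>v. stable_exponent (\<theta> * \<phi> v) \<partial>lborel)) at_top"
  proof -
    have "(\<integral>p. B l p \<partial>(lborel \<Otimes>\<^sub>M M)) = (\<integral>v. expectation (\<lambda>\<omega>. compensated_exp (\<theta> * \<phi> v * (scaling l * volume \<omega>))) \<partial>lborel)" for l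
      unfolding P.integral_fst'[OF Bi[of l], symmetric] by (simp add: B_def)
    then show ?thesis using stable_exponent_limit[OF phi C, of \<theta>] by simp
  qed
  ultimately have "((\<lambda>l. (l ^ DIM('a) *\<^sub>R (\<integral>p. A l p \<partial>(lborel \<Otimes>\<^sub>M M)) - l ^ DIM('a) *\<^sub>R (\<integral>p. B l p \<partial>(lborel \<Otimes>\<^sub>M M)))
      + l ^ DIM('a) *\<^sub>R (\<integral>p. B l p \<partial>(lborel \<Otimes>\<^sub>M M))) \<longlongrightarrow> 0 + (\<integral>v. stable_exponent (\<theta> * \<phi> v) \<partial>lborel)) at_top"
    by (rule tendsto_add)
  then show ?thesis by (simp add: A_def)
qed

end
end

section \<open>Convergence in distribution from characteristic functions\<close>

text \<open>Averaging a characteristic function against a Gaussian is, by Fubini's theorem, the same as integrating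
  the Gaussian transform. It gives a smooth substitute for the truncation of tails.\<close>

lemma gaussian_average_char:
  assumes "real_distribution \<mu>"
  shows "(\<integral>x. 1 - exp (- ((\<delta> * x)\<^sup>2) / 2) \<partial>\<mu>) = (\<integral>z. 1 - Re (char \<mu> (\<delta> * z)) \<partial>std_normal_distribution)"
proof -
  interpret \<mu>: real_distribution \<mu> by fact
  interpret N: real_distribution std_normal_distribution by (rule real_dist_normal_dist)
  interpret P: pair_prob_space \<mu> std_normal_distribution ..
  have [measurable]: "(\<lambda>p. iexp (\<delta> * snd p * fst p)) \<in> borel_measurable (\<mu> \<Otimes>\<^sub>M std_normal_distribution)"
    by measurable
  have int: "integrable (\<mu> \<Otimes>\<^sub>M std_normal_distribution) (\<lambda>(x, z). iexp (\<delta> * z * x))"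
    by (rule P.integrable_const_bound[where B=1]) (auto simp: split_beta')
  have 1: "(\<integral>z. iexp (\<delta> * z * x) \<partial>std_normal_distribution) = of_real (exp (- ((\<delta> * x)\<^sup>2) / 2))" for x
    using fun_cong[OF char_std_normal_distribution, of "\<delta> * x"] by (simp add: char_def mult_ac)
  have 2: "(\<integral>x. iexp (\<delta> * z * x) \<partial>\<mu>) = char \<mu> (\<delta> * z)" for z
    by (simp add: char_def)
  have "of_real (\<integral>x. exp (- ((\<delta> * x)\<^sup>2) / 2) \<partial>\<mu>) = (\<integral>x. \<integral>z. iexp (\<delta> * z * x) \<partial>std_normal_distribution \<partial>\<mu>)"
    by (simp only: 1 integral_complex_of_real)
  also have "\<dots> = (\<integral>z. \<integral>x. iexp (\<delta> * z * x) \<partial>\<mu> \<partial>std_normal_distribution)"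
    using P.Fubini_integral[OF int] by simp
  also have "\<dots> = (\<integral>z. char \<mu> (\<delta> * z) \<partial>std_normal_distribution)" by (simp only: 2)
  finally have "(\<integral>x. exp (- ((\<delta> * x)\<^sup>2) / 2) \<partial>\<mu>) = Re (\<integral>z. char \<mu> (\<delta> * z) \<partial>std_normal_distribution)"
    by (metis Re_complex_of_real)
  also have "\<dots> = (\<integral>z. Re (char \<mu> (\<delta> * z)) \<partial>std_normal_distribution)"
    by (rule integral_Re[symmetric], rule N.integrable_const_bound[where B=1]) (auto simp: \<mu>.cmod_char_le_1)
  finally have e: "(\<integral>x. exp (- ((\<delta> * x)\<^sup>2) / 2) \<partial>\<mu>) = (\<integral>z. Re (char \<mu> (\<delta> * z)) \<partial>std_normal_distribution)" .
  have i1: "integrable \<mu> (\<lambda>x. exp (- ((\<delta> * x)\<^sup>2) / 2))"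
    by (rule \<mu>.integrable_const_bound[where B=1]) auto
  have i2: "integrable std_normal_distribution (\<lambda>z. Re (char \<mu> (\<delta> * z)))"
    by (rule N.integrable_const_bound[where B=1]) (auto intro!: AE_I2 order_trans[OF abs_Re_le_cmod] \<mu>.cmod_char_le_1)
  show ?thesis
    using e i1 i2 \<mu>.prob_space N.prob_space by simp
qed

lemma tail_le_gaussian_average:
  assumes "real_distribution \<mu>" and \<delta>: "0 < \<delta>"
  shows "(1 - exp (- 1 / 2 :: real)) * measure \<mu> {x. 1 / \<delta> \<le> \<bar>x\<bar>} \<le> (\<integral>z. 1 - Re (char \<mu> (\<delta> * z)) \<partial>std_normal_distribution)"
proof -
  interpret \<mu>: real_distribution \<mu> by fact
  have "(1 - exp (- 1 / 2 :: real)) * measure \<mu> {x. 1 / \<delta> \<le> \<bar>x\<bar>} = (\<integral>x. (1 - exp (- 1 / 2 :: real)) * indicator {x. 1 / \<delta> \<le> \<bar>x\<bar>} x \<partial>\<mu>)"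
    by simp
  also have "\<dots> \<le> (\<integral>x. 1 - exp (- ((\<delta> * x)\<^sup>2) / 2) \<partial>\<mu>)"
  proof (rule integral_mono)
    show "integrable \<mu> (\<lambda>x. (1 - exp (- 1 / 2 :: real)) * indicator {x. 1 / \<delta> \<le> \<bar>x\<bar>} x)"
      by (intro integrable_mult_right integrable_real_indicator) (auto simp: \<mu>.emeasure_eq_measure)
    show "integrable \<mu> (\<lambda>x. 1 - exp (- ((\<delta> * x)\<^sup>2) / 2))"
      by (rule \<mu>.integrable_const_bound[where B=1]) auto
    fix x
    show "(1 - exp (- 1 / 2 :: real)) * indicator {x. 1 / \<delta> \<le> \<bar>x\<bar>} x \<le> 1 - exp (- ((\<delta> * x)\<^sup>2) / 2)"
    proof (cases "1 / \<delta> \<le> \<bar>x\<bar>")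
      case True
      then have "1 \<le> \<bar>\<delta> * x\<bar>" using \<delta> by (simp add: abs_mult field_simps)
      then have "1 \<le> (\<delta> * x)\<^sup>2" by (metis abs_le_square_iff abs_1 power_one)
      then show ?thesis using True by simp
    qed simp
  qed
  also have "\<dots> = (\<integral>z. 1 - Re (char \<mu> (\<delta> * z)) \<partial>std_normal_distribution)"
    by (rule gaussian_average_char) fact
  finally show ?thesis .
qed

lemma gaussian_average_small:
  fixes \<psi> :: "real \<Rightarrow> complex"
  assumes [measurable]: "\<psi> \<in> borel_measurable borel" and le1: "\<And>t. norm (\<psi> t) \<le> 1"
    and cont: "isCont \<psi> 0" and one: "\<psi> 0 = 1" and \<eta>: "0 < \<eta>"
  obtains \<delta> where "0 < \<delta>" "(\<integral>z. 1 - Re (\<psi> (\<delta> * z)) \<partial>std_normal_distribution) < \<eta>"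
proof -
  interpret N: real_distribution std_normal_distribution by (rule real_dist_normal_dist)
  have re: "\<bar>Re (\<psi> t)\<bar> \<le> 1" for t using abs_Re_le_cmod[of "\<psi> t"] le1[of t] by linarith
  have "(\<lambda>m. \<integral>z. 1 - Re (\<psi> (inverse (real (Suc m)) * z)) \<partial>std_normal_distribution) \<longlonglongrightarrow> (\<integral>z. 0 \<partial>std_normal_distribution)"
  proof (rule integral_dominated_convergence[where w="\<lambda>_. 2"])
    show "AE z in std_normal_distribution. (\<lambda>m. 1 - Re (\<psi> (inverse (real (Suc m)) * z))) \<longlonglongrightarrow> 0"
    proof (rule AE_I2)
      fix z :: real
      have "(\<lambda>m. inverse (real (Suc m)) * z) \<longlonglongrightarrow> 0"
        by (rule tendsto_mult_left_zero[OF LIMSEQ_inverse_real_of_nat])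
      from isCont_tendsto_compose[OF cont this] have "(\<lambda>m. \<psi> (inverse (real (Suc m)) * z)) \<longlonglongrightarrow> 1"
        by (simp only: one)
      from tendsto_diff[OF tendsto_const[of 1] tendsto_Re[OF this]]
      show "(\<lambda>m. 1 - Re (\<psi> (inverse (real (Suc m)) * z))) \<longlonglongrightarrow> 0" by simp
    qed
    show "AE z in std_normal_distribution. norm (1 - Re (\<psi> (inverse (real (Suc m)) * z))) \<le> 2" for m
    proof (rule AE_I2)
      fix z :: real
      show "norm (1 - Re (\<psi> (inverse (real (Suc m)) * z))) \<le> 2" using re[of "inverse (real (Suc m)) * z"] by (simp add: abs_le_iff)
    qed
  qed auto
  then have "\<forall>\<^sub>F m in sequentially. (\<integral>z. 1 - Re (\<psi> (inverse (real (Suc m)) * z)) \<partial>std_normal_distribution) < \<eta>"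
    using \<eta> by (intro order_tendstoD(2)) simp_all
  then obtain m where "(\<integral>z. 1 - Re (\<psi> (inverse (real (Suc m)) * z)) \<partial>std_normal_distribution) < \<eta>"
    using eventually_happens'[OF sequentially_bot] by blast
  then show thesis by (intro that[of "inverse (real (Suc m))"]) auto
qed

text \<open>The Gaussian average of the limit is small near 0 by continuity, hence so are those of all but
  finitely many laws, and these averages dominate the tails. The remaining laws are tight
  individually.\<close>

lemma tight_if_char_converges:
  fixes \<mu> :: "nat \<Rightarrow> real measure" and \<psi> :: "real \<Rightarrow> complex"
  assumes rd: "\<And>n. real_distribution (\<mu> n)" and conv: "\<And>t. (\<lambda>n. char (\<mu> n) t) \<longlonglongrightarrow> \<psi> t"
    and cont: "isCont \<psi> 0"
  shows "tight \<mu>"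
  unfolding tight_def
proof (intro conjI allI impI rd)
  fix \<epsilon> :: real assume \<epsilon>: "0 < \<epsilon>"
  interpret N: real_distribution std_normal_distribution by (rule real_dist_normal_dist)
  define c0 :: real where "c0 = 1 - exp (- 1 / 2)"
  have c0: "0 < c0" by (simp add: c0_def)
  have char_m [measurable]: "char (\<mu> n) \<in> borel_measurable borel" for n
  proof -
    interpret real_distribution "\<mu> n" by (rule rd)
    show ?thesis by (rule char_measurable)
  qed
  have char_le: "norm (char (\<mu> n) t) \<le> 1" for n t
    using real_distribution.cmod_char_le_1[OF rd] .
  have psi_m [measurable]: "\<psi> \<in> borel_measurable borel"
    by (rule borel_measurable_LIMSEQ_metric[OF char_m conv])
  have psi_le: "norm (\<psi> t) \<le> 1" for t
    by (rule LIMSEQ_le_const2[OF tendsto_norm[OF conv]]) (auto simp: char_le)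
  have psi_0: "\<psi> 0 = 1"
    using conv[of 0] real_distribution.char_zero[OF rd] by (simp add: LIMSEQ_const_iff)
  have le: "measure (\<mu> n) {x. 1 / \<delta> \<le> \<bar>x\<bar>} < \<epsilon>" if "0 < \<delta>" "(\<integral>z. 1 - Re (char (\<mu> n) (\<delta> * z)) \<partial>std_normal_distribution) < c0 * \<epsilon>" for n \<delta>
  proof -
    have "c0 * measure (\<mu> n) {x. 1 / \<delta> \<le> \<bar>x\<bar>} < c0 * \<epsilon>"
      by (rule le_less_trans[OF tail_le_gaussian_average[OF rd[of n] that(1), folded c0_def] that(2)])
    then show ?thesis using c0 by simp
  qed
  obtain \<delta> where \<delta>: "0 < \<delta>" "(\<integral>z. 1 - Re (\<psi> (\<delta> * z)) \<partial>std_normal_distribution) < c0 * \<epsilon>"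
    using gaussian_average_small[OF psi_m psi_le cont psi_0, of "c0 * \<epsilon>"] c0 \<epsilon> by auto
  have "(\<lambda>n. \<integral>z. 1 - Re (char (\<mu> n) (\<delta> * z)) \<partial>std_normal_distribution) \<longlonglongrightarrow> (\<integral>z. 1 - Re (\<psi> (\<delta> * z)) \<partial>std_normal_distribution)"
  proof (rule integral_dominated_convergence[where w="\<lambda>_. 2"])
    show "AE z in std_normal_distribution. (\<lambda>n. 1 - Re (char (\<mu> n) (\<delta> * z))) \<longlonglongrightarrow> 1 - Re (\<psi> (\<delta> * z))"
      by (intro AE_I2 tendsto_intros conv)
    show "AE z in std_normal_distribution. norm (1 - Re (char (\<mu> n) (\<delta> * z))) \<le> 2" for n
    proof (rule AE_I2)
      fix z :: real
      show "norm (1 - Re (char (\<mu> n) (\<delta> * z))) \<le> 2"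
        using abs_Re_le_cmod[of "char (\<mu> n) (\<delta> * z)"] char_le[of n "\<delta> * z"] by (simp add: abs_le_iff)
    qed
  qed auto
  then have "\<forall>\<^sub>F n in sequentially. (\<integral>z. 1 - Re (char (\<mu> n) (\<delta> * z)) \<partial>std_normal_distribution) < c0 * \<epsilon>"
    using \<delta>(2) by (rule order_tendstoD(2))
  then obtain n0 where n0: "\<And>n. n0 \<le> n \<Longrightarrow> measure (\<mu> n) {x. 1 / \<delta> \<le> \<bar>x\<bar>} < \<epsilon>"
    using le[OF \<delta>(1)] by (auto simp: eventually_sequentially)
  have "\<exists>R. measure (\<mu> n) {x. R \<le> \<bar>x\<bar>} < \<epsilon>" for n
  proof -
    obtain d where d: "0 < d" "(\<integral>z. 1 - Re (char (\<mu> n) (d * z)) \<partial>std_normal_distribution) < c0 * \<epsilon>"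
      using gaussian_average_small[OF char_m char_le real_distribution.isCont_char[OF rd] real_distribution.char_zero[OF rd], of "c0 * \<epsilon>" n] c0 \<epsilon>
      by auto
    show ?thesis by (rule exI[of _ "1 / d"]) (rule le[OF d])
  qed
  then obtain R where R: "\<And>n. measure (\<mu> n) {x. R n \<le> \<bar>x\<bar>} < \<epsilon>" by metis
  define R0 where "R0 = Max (insert (1 / \<delta>) (R ` {..<n0})) "
  have R0: "1 / \<delta> \<le> R0" "\<And>n. n < n0 \<Longrightarrow> R n \<le> R0" by (auto simp: R0_def)
  have "1 - \<epsilon> < measure (\<mu> n) {- R0 <.. R0}" for n
  proof -
    interpret real_distribution "\<mu> n" by (rule rd)
    have "measure (\<mu> n) {x. R0 \<le> \<bar>x\<bar>} < \<epsilon>"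
    proof (cases "n < n0")
      case True
      have "measure (\<mu> n) {x. R0 \<le> \<bar>x\<bar>} \<le> measure (\<mu> n) {x. R n \<le> \<bar>x\<bar>}"
        using R0(2)[OF True] by (intro finite_measure_mono) auto
      then show ?thesis using R[of n] by simp
    next
      case False
      have "measure (\<mu> n) {x. R0 \<le> \<bar>x\<bar>} \<le> measure (\<mu> n) {x. 1 / \<delta> \<le> \<bar>x\<bar>}"
        using R0(1) by (intro finite_measure_mono) auto
      then show ?thesis using n0[of n] False by simp
    qed
    moreover have "1 - measure (\<mu> n) {x. R0 \<le> \<bar>x\<bar>} = measure (\<mu> n) (UNIV - {x. R0 \<le> \<bar>x\<bar>})"
      using prob_compl[of "{x. R0 \<le> \<bar>x\<bar>}"] by simp
    moreover have "\<dots> \<le> measure (\<mu> n) {- R0 <.. R0}"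
      by (intro finite_measure_mono) auto
    ultimately show ?thesis by linarith
  qed
  moreover have "- R0 < R0" using R0(1) divide_pos_pos[OF zero_less_one \<delta>(1)] by linarith
  ultimately show "\<exists>a b. a < b \<and> (\<forall>n. 1 - \<epsilon> < measure (\<mu> n) {a<..b})" by blast
qed

text \<open>The full continuity theorem of Levy, in which the limit is not assumed to be a characteristic
  function: tightness yields a weakly convergent subsequence, and the limit of that has the
  required transform.\<close>

theorem char_limit_is_char:
  fixes \<mu> :: "nat \<Rightarrow> real measure" and \<psi> :: "real \<Rightarrow> complex"
  assumes rd: "\<And>n. real_distribution (\<mu> n)" and conv: "\<And>t. (\<lambda>n. char (\<mu> n) t) \<longlonglongrightarrow> \<psi> t"
    and cont: "isCont \<psi> 0"
  obtains \<nu> where "real_distribution \<nu>" "char \<nu> = \<psi>"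
proof -
  have "strict_mono (id :: nat \<Rightarrow> nat)" by (rule strict_mono_id)
  from tight_imp_convergent_subsubsequence[OF tight_if_char_converges[OF assms] this]
  obtain r \<nu> where r: "strict_mono (r :: nat \<Rightarrow> nat)" and \<nu>: "real_distribution \<nu>" and w: "weak_conv_m (\<mu> \<circ> r) \<nu>" by auto
  have "char \<nu> t = \<psi> t" for t
  proof (rule LIMSEQ_unique)
    show "(\<lambda>n. char ((\<mu> \<circ> r) n) t) \<longlonglongrightarrow> char \<nu> t"
      by (rule levy_continuity1[OF _ \<nu> w]) (simp add: rd)
    show "(\<lambda>n. char ((\<mu> \<circ> r) n) t) \<longlonglongrightarrow> \<psi> t"
      using LIMSEQ_subseq_LIMSEQ[OF conv r, of t] by (simp add: comp_def)
  qed
  then show thesis using that \<nu> by blast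
qed

lemma borel_of_euclidean [simp]: "borel_of (euclidean :: 'a::topological_space topology) = borel"
  by (simp add: borel_of_def borel_def open_openin[symmetric])

text \<open>The limit law is found along the integers; every other sequence of scales has the same limit of
  characteristic functions, hence the same limit law.\<close>

theorem converges_in_distribution_of_char:
  fixes Y :: "real \<Rightarrow> 'w \<Rightarrow> real"
  assumes M: "prob_space M" and rv: "\<And>l. 0 < l \<Longrightarrow> Y l \<in> borel_measurable M"
    and conv: "\<And>t. ((\<lambda>l. char (distr M borel (Y l)) t) \<longlongrightarrow> \<psi> t) at_top" and cont: "isCont \<psi> 0"
  obtains \<nu> where "real_distribution \<nu>" "char \<nu> = \<psi>"
    "converges_in_distribution at_top euclideanreal M Y \<nu> (\<lambda>x. x)"
proof -
  interpret prob_space M by fact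
  define X where "X n = real (Suc n)" for n
  have seq: "(\<lambda>n. char (distr M borel (Y (X n))) t) \<longlonglongrightarrow> \<psi> t" if "filterlim X at_top sequentially" for X t
    using filterlim_compose[OF conv that] .
  have "filterlim (\<lambda>n. real (Suc n)) at_top sequentially"
    by (rule filterlim_compose[OF filterlim_real_sequentially filterlim_Suc])
  from char_limit_is_char[of "\<lambda>n. distr M borel (Y (real (Suc n)))", OF _ seq[OF this] cont]
  obtain \<nu> where \<nu>: "real_distribution \<nu>" "char \<nu> = \<psi>" using rv by auto
  interpret \<nu>: real_distribution \<nu> by fact
  have lim: "((\<lambda>l. \<integral>\<omega>. f (Y l \<omega>) \<partial>M) \<longlongrightarrow> (\<integral>v. f v \<partial>\<nu>)) at_top"
    if f: "continuous_on UNIV f" and bd: "bounded (f ` UNIV)" for f :: "real \<Rightarrow> real"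
  proof (rule tendsto_at_topI_sequentially)
    fix X :: "nat \<Rightarrow> real" assume X: "filterlim X at_top sequentially"
    obtain B where B: "\<And>x. norm (f x) \<le> B" using bd by (auto simp: bounded_iff)
    have [measurable]: "f \<in> borel_measurable borel" using f by (rule borel_measurable_continuous_onI)
    have "\<forall>\<^sub>F n in sequentially. 0 < X n" using X by (auto simp: filterlim_at_top_dense)
    then obtain n0 where n0: "\<And>n. n0 \<le> n \<Longrightarrow> 0 < X n" by (auto simp: eventually_sequentially)
    have X': "filterlim (\<lambda>n. X (n + n0)) at_top sequentially"
      using filterlim_compose[OF X filterlim_add_const_nat_at_top] .
    have rvX [measurable]: "Y (X (n + n0)) \<in> borel_measurable M" for n using rv[OF n0[of "n + n0"]] by simp
    have "weak_conv_m (\<lambda>n. distr M borel (Y (X (n + n0)))) \<nu>"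
      using seq[OF X'] \<nu> by (intro levy_continuity) auto
    then have "(\<lambda>n. integral\<^sup>L (distr M borel (Y (X (n + n0)))) f) \<longlonglongrightarrow> integral\<^sup>L \<nu> f"
      using \<nu>(1) f B by (intro weak_conv_imp_integral_bdd_continuous_conv[where B=B]) (auto simp: continuous_on_eq_continuous_at)
    then have "(\<lambda>n. \<integral>\<omega>. f (Y (X (n + n0)) \<omega>) \<partial>M) \<longlonglongrightarrow> integral\<^sup>L \<nu> f"
      by (simp add: integral_distr)
    then show "(\<lambda>n. \<integral>\<omega>. f (Y (X n) \<omega>) \<partial>M) \<longlonglongrightarrow> integral\<^sup>L \<nu> f"
      by (rule LIMSEQ_offset)
  qed
  have "converges_in_distribution at_top euclideanreal M Y \<nu> (\<lambda>x. x)"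
    unfolding converges_in_distribution_def
    using lim rv eventually_mono[OF eventually_gt_at_top[of "0::real"]] by auto
  then show thesis using that \<nu> by blast
qed

section \<open>Joint limits of nearly proportional variables\<close>

lemma fdd_measurable:
  fixes W :: "nat \<Rightarrow> 'w \<Rightarrow> real"
  assumes W: "\<And>k. k \<in> K \<Longrightarrow> W k \<in> borel_measurable M"
  shows "(\<lambda>\<omega>. \<lambda>k\<in>K. W k \<omega>) \<in> measurable M (borel_of (powertop_real K))"
  unfolding borel_of_def
proof (rule measurable_sigma_sets)
  let ?T = "powertop_real K"
  show "sets (sigma (topspace ?T) {U. openin ?T U}) = sigma_sets (topspace ?T) {U. openin ?T U}"
    by (rule sets_measure_of) (use openin_subset in blast)
  show "{U. openin ?T U} \<subseteq> Pow (topspace ?T)" using openin_subset by blast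
  show "(\<lambda>\<omega>. \<lambda>k\<in>K. W k \<omega>) \<in> space M \<rightarrow> topspace ?T" by auto
  fix U assume "U \<in> {U. openin ?T U}"
  then have U: "openin ?T U" by simp
  have "continuous_map (powertop_real UNIV) ?T (\<lambda>x. restrict x K)"
    by (auto simp: continuous_map_componentwise intro: continuous_map_product_projection)
  from openin_continuous_map_preimage[OF this U]
  have "openin (powertop_real UNIV) {x \<in> topspace (powertop_real UNIV). restrict x K \<in> U}" .
  moreover have "powertop_real UNIV = (euclidean :: (nat \<Rightarrow> real) topology)" by (rule euclidean_product_topology)
  ultimately have "openin (euclidean :: (nat \<Rightarrow> real) topology) {x. restrict x K \<in> U}" by simp
  then have "open {x. restrict x K \<in> U}" by (simp only: open_openin)
  then have B: "{x. restrict x K \<in> U} \<in> sets (borel :: (nat \<Rightarrow> real) measure)" by simp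
  have "(\<lambda>\<omega>. \<lambda>k. if k \<in> K then W k \<omega> else 0) \<in> borel_measurable M"
  proof (rule measurable_coordinatewise_then_product)
    show "(\<lambda>\<omega>. if k \<in> K then W k \<omega> else 0) \<in> borel_measurable M" for k
      using W[of k] by (cases "k \<in> K") simp_all
  qed
  from measurable_sets[OF this B]
  have "(\<lambda>\<omega>. \<lambda>k. if k \<in> K then W k \<omega> else 0) -` {x. restrict x K \<in> U} \<inter> space M \<in> sets M" .
  also have "(\<lambda>\<omega>. \<lambda>k. if k \<in> K then W k \<omega> else 0) -` {x. restrict x K \<in> U} = (\<lambda>\<omega>. \<lambda>k\<in>K. W k \<omega>) -` U"
    by (auto simp: restrict_def fun_eq_iff cong: if_cong)
  finally show "(\<lambda>\<omega>. \<lambda>k\<in>K. W k \<omega>) -` U \<inter> space M \<in> sets M" .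
qed

text \<open>Bounded sets of a finite power of the line are relatively compact, so a continuous function is
  uniformly continuous there; the proof extracts a convergent subsequence of counterexamples.\<close>

lemma powertop_uniform_continuity:
  fixes f :: "(nat \<Rightarrow> real) \<Rightarrow> real" and c :: "nat \<Rightarrow> real"
  assumes f: "continuous_map (powertop_real K) euclideanreal f" and e: "0 < e"
  obtains d where "0 < d"
    "\<And>y z. \<bar>y\<bar> \<le> R \<Longrightarrow> (\<And>k. k \<in> K \<Longrightarrow> \<bar>z k\<bar> \<le> d) \<Longrightarrow> \<bar>f (\<lambda>k\<in>K. c k * y + z k) - f (\<lambda>k\<in>K. c k * y)\<bar> \<le> e"
proof (rule ccontr)
  assume no: "\<not> thesis"
  define P where "P n y z \<longleftrightarrow> \<bar>y\<bar> \<le> R \<and> (\<forall>k\<in>K. \<bar>z k\<bar> \<le> inverse (real (Suc n))) \<and>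
    e < \<bar>f (\<lambda>k\<in>K. c k * y + z k) - f (\<lambda>k\<in>K. c k * y)\<bar>" for n y z
  have "\<exists>y z. P n y z" for n
  proof (rule ccontr)
    assume none: "\<not> ?thesis"
    have "thesis"
    proof (rule that[of "inverse (real (Suc n))"])
      fix y z assume "\<bar>y\<bar> \<le> R" "\<And>k. k \<in> K \<Longrightarrow> \<bar>z k\<bar> \<le> inverse (real (Suc n))"
      then show "\<bar>f (\<lambda>k\<in>K. c k * y + z k) - f (\<lambda>k\<in>K. c k * y)\<bar> \<le> e"
        using none by (force simp: P_def not_less)
    qed simp
    then show False using no by simp
  qed
  then obtain y z where P: "\<And>n. P n (y n) (z n)" by metis
  then have y: "\<And>n. \<bar>y n\<bar> \<le> R" and z: "\<And>n k. k \<in> K \<Longrightarrow> \<bar>z n k\<bar> \<le> inverse (real (Suc n))"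
    and far: "\<And>n. e < \<bar>f (\<lambda>k\<in>K. c k * y n + z n k) - f (\<lambda>k\<in>K. c k * y n)\<bar>" by (simp_all add: P_def)
  have "y n \<in> {- R..R}" for n using y[of n] by (auto simp: abs_le_iff)
  then obtain y0 r where r: "strict_mono (r :: nat \<Rightarrow> nat)" and lim: "(y \<circ> r) \<longlonglongrightarrow> y0"
    using compact_imp_seq_compact[OF compact_Icc] unfolding seq_compact_def by metis
  have z0: "(\<lambda>n. z n k) \<longlonglongrightarrow> 0" if "k \<in> K" for k
    by (rule Lim_null_comparison[OF _ LIMSEQ_inverse_real_of_nat]) (use z[OF that] in auto)
  have zr: "(\<lambda>n. z (r n) k) \<longlonglongrightarrow> 0" if "k \<in> K" for k
    using LIMSEQ_subseq_LIMSEQ[OF z0[OF that] r] by (simp add: comp_def)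
  have "limitin (powertop_real K) (\<lambda>n. \<lambda>k\<in>K. c k * y (r n) + z (r n) k) (\<lambda>k\<in>K. c k * y0) sequentially"
    using tendsto_add[OF tendsto_mult[OF tendsto_const lim[unfolded comp_def]] zr] by (auto simp: limitin_componentwise)
  from continuous_map_limit[OF f this] have 1: "(\<lambda>n. f (\<lambda>k\<in>K. c k * y (r n) + z (r n) k)) \<longlonglongrightarrow> f (\<lambda>k\<in>K. c k * y0)"
    by (simp add: comp_def)
  have "limitin (powertop_real K) (\<lambda>n. \<lambda>k\<in>K. c k * y (r n)) (\<lambda>k\<in>K. c k * y0) sequentially"
    using tendsto_mult[OF tendsto_const lim[unfolded comp_def]] by (auto simp: limitin_componentwise)
  from continuous_map_limit[OF f this] have 2: "(\<lambda>n. f (\<lambda>k\<in>K. c k * y (r n))) \<longlonglongrightarrow> f (\<lambda>k\<in>K. c k * y0)"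
    by (simp add: comp_def)
  from tendsto_rabs[OF tendsto_diff[OF 1 2]]
  have "(\<lambda>n. \<bar>f (\<lambda>k\<in>K. c k * y (r n) + z (r n) k) - f (\<lambda>k\<in>K. c k * y (r n))\<bar>) \<longlonglongrightarrow> 0" by simp
  then have "\<forall>\<^sub>F n in sequentially. \<bar>f (\<lambda>k\<in>K. c k * y (r n) + z (r n) k) - f (\<lambda>k\<in>K. c k * y (r n))\<bar> < e"
    using e by (rule order_tendstoD(2))
  then obtain n where "\<bar>f (\<lambda>k\<in>K. c k * y (r n) + z (r n) k) - f (\<lambda>k\<in>K. c k * y (r n))\<bar> < e"
    using eventually_happens'[OF sequentially_bot] by blast
  then show False using far[of "r n"] by simp
qed

text \<open>On the event that \<open>Y\<close> is bounded and all remainders are small, uniform continuity compares the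
  test function at \<open>W\<close> with its value at \<open>c * Y\<close>. The complementary event has small probability,
  because the convergence of \<open>Y\<close> makes it tight.\<close>

theorem fdd_converges_slutsky:
  fixes Y :: "real \<Rightarrow> 'w \<Rightarrow> real" and Z :: "real \<Rightarrow> nat \<Rightarrow> 'w \<Rightarrow> real" and c :: "nat \<Rightarrow> real"
  assumes M: "prob_space M" and \<nu>: "real_distribution \<nu>"
    and Y: "\<And>l. 0 < l \<Longrightarrow> Y l \<in> borel_measurable M"
    and Z: "\<And>l k. 0 < l \<Longrightarrow> k \<in> I \<Longrightarrow> Z l k \<in> borel_measurable M"
    and conv: "converges_in_distribution at_top euclideanreal M Y \<nu> (\<lambda>x. x)"
    and Z0: "\<And>k d. k \<in> I \<Longrightarrow> 0 < d \<Longrightarrow> ((\<lambda>l. measure M {\<omega> \<in> space M. d < \<bar>Z l k \<omega>\<bar>}) \<longlongrightarrow> 0) at_top"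
    and W: "\<And>l k \<omega>. 0 < l \<Longrightarrow> k \<in> I \<Longrightarrow> \<omega> \<in> space M \<Longrightarrow> W l k \<omega> = c k * Y l \<omega> + Z l k \<omega>"
  shows "fdd_converges at_top I M W \<nu> (\<lambda>k v. c k * v)"
  unfolding fdd_converges_def converges_in_distribution_def
proof (intro allI impI conjI)
  interpret prob_space M by fact
  interpret \<nu>: real_distribution \<nu> by fact
  fix K assume K: "finite K \<and> K \<subseteq> I"
  have Wm: "W l k \<in> borel_measurable M" if "0 < l" "k \<in> K" for l k
  proof -
    have "k \<in> I" using K that by auto
    then have "(\<lambda>\<omega>. c k * Y l \<omega> + Z l k \<omega>) \<in> borel_measurable M" using Y Z that by auto
    then show ?thesis using W[OF that(1) \<open>k \<in> I\<close>] by (subst measurable_cong) auto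
  qed
  then show "\<forall>\<^sub>F l in at_top. (\<lambda>\<omega>. \<lambda>k\<in>K. W l k \<omega>) \<in> M \<rightarrow>\<^sub>M borel_of (powertop_real K)"
    by (intro eventually_mono[OF eventually_gt_at_top[of 0]] fdd_measurable) auto
  show "(\<lambda>v. \<lambda>k\<in>K. c k * v) \<in> \<nu> \<rightarrow>\<^sub>M borel_of (powertop_real K)"
    by (rule fdd_measurable) simp
  fix f assume "continuous_map (powertop_real K) euclideanreal f \<and> bounded (f ` topspace (powertop_real K))"
  then have f: "continuous_map (powertop_real K) euclideanreal f" and bf: "bounded (f ` topspace (powertop_real K))" by auto
  from bf obtain B where "\<And>x. x \<in> topspace (powertop_real K) \<Longrightarrow> norm (f x) \<le> B" by (auto simp: bounded_iff)
  then have B: "\<bar>f (\<lambda>k\<in>K. x k)\<bar> \<le> B" for x :: "nat \<Rightarrow> real" by auto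
  have B0: "0 \<le> B" using B[of "\<lambda>_. 0"] by simp
  have fm: "f \<in> borel_measurable (borel_of (powertop_real K))"
  proof (rule borel_measurableI)
    fix S :: "real set" assume "open S"
    then have "openin (powertop_real K) {x \<in> topspace (powertop_real K). f x \<in> S}"
      using openin_continuous_map_preimage[OF f, of S] by simp
    moreover have "space (borel_of (powertop_real K)) = topspace (powertop_real K)"
      and "sets (borel_of (powertop_real K)) = sigma_sets (topspace (powertop_real K)) {U. openin (powertop_real K) U}"
      unfolding borel_of_def using openin_subset[of "powertop_real K"]
      by (intro space_measure_of sets_measure_of; blast)+
    ultimately show "f -` S \<inter> space (borel_of (powertop_real K)) \<in> sets (borel_of (powertop_real K))"
      by (auto simp: vimage_def Int_def conj_commute intro: sigma_sets.Basic)
  qed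
  define g where "g y = f (\<lambda>k\<in>K. c k * y)" for y
  have gc: "continuous_on UNIV g"
  proof -
    have "continuous_map euclideanreal (powertop_real K) (\<lambda>y. \<lambda>k\<in>K. c k * y)"
      by (auto simp: continuous_map_componentwise intro!: continuous_intros)
    from continuous_map_compose[OF this f] show ?thesis by (simp add: g_def[abs_def] comp_def)
  qed
  have gm [measurable]: "g \<in> borel_measurable borel" using gc by (rule borel_measurable_continuous_onI)
  have gb: "\<bar>g y\<bar> \<le> B" for y unfolding g_def by (rule B)
  have g_lim: "((\<lambda>l. \<integral>\<omega>. g (Y l \<omega>) \<partial>M) \<longlongrightarrow> (\<integral>v. g v \<partial>\<nu>)) at_top"
    using conv gc gb unfolding converges_in_distribution_def by (auto simp: bounded_iff)
  have "((\<lambda>l. (\<integral>\<omega>. f (\<lambda>k\<in>K. W l k \<omega>) \<partial>M) - (\<integral>\<omega>. g (Y l \<omega>) \<partial>M)) \<longlongrightarrow> 0) at_top"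
  proof (rule tendstoI)
    fix e :: real assume e: "0 < e"
    define \<eta> where "\<eta> = e / (3 * (2 * B + 1))"
    have \<eta>: "0 < \<eta>" "2 * B * \<eta> < e / 3"
    proof -
      show "0 < \<eta>" using e B0 by (simp add: \<eta>_def)
      have "2 * B * \<eta> = (e / 3) * (2 * B / (2 * B + 1))" using B0 by (simp add: \<eta>_def field_simps)
      also have "\<dots> < (e / 3) * 1" using e B0 by (intro mult_strict_left_mono) auto
      finally show "2 * B * \<eta> < e / 3" by simp
    qed
    \<comment> \<open>a continuous substitute for the indicator of \<open>\<bar>v\<bar> > R\<close>, so that the convergence of \<open>Y\<close> applies to it\<close>
    obtain R where R: "(\<integral>v. min 1 (max 0 (\<bar>v\<bar> - R)) \<partial>\<nu>) < \<eta>"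
    proof -
      have "(\<lambda>n. \<integral>v. min 1 (max 0 (\<bar>v\<bar> - real n)) \<partial>\<nu>) \<longlonglongrightarrow> (\<integral>v. 0 \<partial>\<nu>)"
      proof (rule integral_dominated_convergence[where w="\<lambda>_. 1"])
        show "AE v in \<nu>. (\<lambda>n. min 1 (max 0 (\<bar>v\<bar> - real n))) \<longlonglongrightarrow> 0"
        proof (rule AE_I2)
          fix v :: real
          obtain n0 where "\<bar>v\<bar> \<le> real n0" using real_arch_simple by blast
          then have "min 1 (max 0 (\<bar>v\<bar> - real n)) = 0" if "n0 \<le> n" for n using that by simp
          then show "(\<lambda>n. min 1 (max 0 (\<bar>v\<bar> - real n))) \<longlonglongrightarrow> 0"
            by (intro tendsto_eventually) (auto simp: eventually_sequentially)
        qed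
      qed auto
      then have "\<forall>\<^sub>F n in sequentially. (\<integral>v. min 1 (max 0 (\<bar>v\<bar> - real n)) \<partial>\<nu>) < \<eta>"
        using \<eta>(1) by (intro order_tendstoD(2)) auto
      then show thesis using that eventually_happens'[OF sequentially_bot] by blast
    qed
    have "((\<lambda>l. \<integral>\<omega>. min 1 (max 0 (\<bar>Y l \<omega>\<bar> - R)) \<partial>M) \<longlongrightarrow> (\<integral>v. min 1 (max 0 (\<bar>v\<bar> - R)) \<partial>\<nu>)) at_top"
    proof -
      have "continuous_map euclideanreal euclideanreal (\<lambda>v. min 1 (max 0 (\<bar>v\<bar> - R)))"
        by (auto intro!: continuous_intros)
      moreover have "bounded ((\<lambda>v. min 1 (max 0 (\<bar>v\<bar> - R))) ` topspace euclideanreal)"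
        by (auto simp: bounded_iff intro!: exI[of _ 1])
      ultimately show ?thesis using conv unfolding converges_in_distribution_def by blast
    qed
    then have ev1: "\<forall>\<^sub>F l in at_top. (\<integral>\<omega>. min 1 (max 0 (\<bar>Y l \<omega>\<bar> - R)) \<partial>M) < \<eta>"
      using R by (rule order_tendstoD(2))
    obtain d where d: "0 < d" "\<And>y z. \<bar>y\<bar> \<le> R + 1 \<Longrightarrow> (\<And>k. k \<in> K \<Longrightarrow> \<bar>z k\<bar> \<le> d) \<Longrightarrow> \<bar>f (\<lambda>k\<in>K. c k * y + z k) - f (\<lambda>k\<in>K. c k * y)\<bar> \<le> e / 3"
      using powertop_uniform_continuity[OF f, of "e / 3" "R + 1" c] e by auto
    have "((\<lambda>l. 2 * B * (\<Sum>k\<in>K. prob {\<omega> \<in> space M. d < \<bar>Z l k \<omega>\<bar>})) \<longlongrightarrow> 2 * B * (\<Sum>k\<in>K. 0)) at_top"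
      using K d(1) by (intro tendsto_intros Z0) auto
    then have ev2: "\<forall>\<^sub>F l in at_top. 2 * B * (\<Sum>k\<in>K. prob {\<omega> \<in> space M. d < \<bar>Z l k \<omega>\<bar>}) < e / 3"
      using e by (intro order_tendstoD(2)) auto
    show "\<forall>\<^sub>F l in at_top. dist ((\<integral>\<omega>. f (\<lambda>k\<in>K. W l k \<omega>) \<partial>M) - (\<integral>\<omega>. g (Y l \<omega>) \<partial>M)) 0 < e"
      using ev1 ev2 eventually_gt_at_top[of 0]
    proof eventually_elim
      case (elim l)
      have [measurable]: "Y l \<in> borel_measurable M" "\<And>k. k \<in> K \<Longrightarrow> Z l k \<in> borel_measurable M"
        using Y Z K elim(3) by auto
      have m1: "(\<lambda>\<omega>. f (\<lambda>k\<in>K. W l k \<omega>)) \<in> borel_measurable M"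
        by (rule measurable_compose[OF fdd_measurable fm]) (rule Wm[OF elim(3)])
      have i1: "integrable M (\<lambda>\<omega>. f (\<lambda>k\<in>K. W l k \<omega>))"
        by (rule integrable_const_bound[where B=B]) (auto simp: B m1)
      have i2: "integrable M (\<lambda>\<omega>. g (Y l \<omega>))"
        by (rule integrable_const_bound[where B=B]) (auto simp: gb)
      let ?h = "\<lambda>\<omega>. e / 3 + 2 * B * (min 1 (max 0 (\<bar>Y l \<omega>\<bar> - R)) + (\<Sum>k\<in>K. indicator {\<omega> \<in> space M. d < \<bar>Z l k \<omega>\<bar>} \<omega>))"
      have iZ: "integrable M (\<lambda>\<omega>. \<Sum>k\<in>K. indicat_real {\<omega> \<in> space M. d < \<bar>Z l k \<omega>\<bar>} \<omega>)"
        by (intro Bochner_Integration.integrable_sum integrable_real_indicator) (auto simp: emeasure_eq_measure)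
      have iY: "integrable M (\<lambda>\<omega>. min 1 (max 0 (\<bar>Y l \<omega>\<bar> - R)))"
        by (rule integrable_const_bound[where B=1]) auto
      have pt: "\<bar>f (\<lambda>k\<in>K. W l k \<omega>) - g (Y l \<omega>)\<bar> \<le> ?h \<omega>" if w: "\<omega> \<in> space M" for \<omega>
      proof -
        have eq: "(\<lambda>k\<in>K. W l k \<omega>) = (\<lambda>k\<in>K. c k * Y l \<omega> + Z l k \<omega>)"
          using W[OF elim(3) _ w] K by (intro restrict_ext) auto
        have nonneg: "0 \<le> min 1 (max 0 (\<bar>Y l \<omega>\<bar> - R))" "0 \<le> (\<Sum>k\<in>K. indicat_real {\<omega> \<in> space M. d < \<bar>Z l k \<omega>\<bar>} \<omega>)"
          by (auto intro: sum_nonneg)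
        show ?thesis
        proof (cases "\<bar>Y l \<omega>\<bar> \<le> R + 1 \<and> (\<forall>k\<in>K. \<bar>Z l k \<omega>\<bar> \<le> d)")
          case True
          then have "\<bar>f (\<lambda>k\<in>K. W l k \<omega>) - g (Y l \<omega>)\<bar> \<le> e / 3"
            unfolding eq g_def by (intro d(2)) auto
          also have "\<dots> \<le> ?h \<omega>" using B0 nonneg by simp
          finally show ?thesis .
        next
          case False
          have "1 \<le> min 1 (max 0 (\<bar>Y l \<omega>\<bar> - R)) + (\<Sum>k\<in>K. indicat_real {\<omega> \<in> space M. d < \<bar>Z l k \<omega>\<bar>} \<omega>)"
          proof (cases "\<bar>Y l \<omega>\<bar> \<le> R + 1")
            case True
            then obtain k where k: "k \<in> K" "d < \<bar>Z l k \<omega>\<bar>" using False by (auto simp: not_le)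
            then have "1 \<le> (\<Sum>k\<in>K. indicat_real {\<omega> \<in> space M. d < \<bar>Z l k \<omega>\<bar>} \<omega>)"
              using member_le_sum[of k K "\<lambda>k. indicat_real {\<omega> \<in> space M. d < \<bar>Z l k \<omega>\<bar>} \<omega>"] K w by auto
            then show ?thesis using nonneg by linarith
          qed (use nonneg in auto)
          then have "2 * B * 1 \<le> 2 * B * (min 1 (max 0 (\<bar>Y l \<omega>\<bar> - R)) + (\<Sum>k\<in>K. indicat_real {\<omega> \<in> space M. d < \<bar>Z l k \<omega>\<bar>} \<omega>))"
            using B0 by (intro mult_left_mono) auto
          moreover have "\<bar>f (\<lambda>k\<in>K. W l k \<omega>) - g (Y l \<omega>)\<bar> \<le> 2 * B" using B[of "\<lambda>k. W l k \<omega>"] gb[of "Y l \<omega>"] by linarith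
          ultimately show ?thesis using e by linarith
        qed
      qed
      have "\<bar>(\<integral>\<omega>. f (\<lambda>k\<in>K. W l k \<omega>) \<partial>M) - (\<integral>\<omega>. g (Y l \<omega>) \<partial>M)\<bar> = \<bar>\<integral>\<omega>. f (\<lambda>k\<in>K. W l k \<omega>) - g (Y l \<omega>) \<partial>M\<bar>"
        using i1 i2 by simp
      also have "\<dots> \<le> (\<integral>\<omega>. \<bar>f (\<lambda>k\<in>K. W l k \<omega>) - g (Y l \<omega>)\<bar> \<partial>M)" by (rule integral_abs_bound)
      also have "\<dots> \<le> (\<integral>\<omega>. ?h \<omega> \<partial>M)"
        using i1 i2 iY iZ by (intro integral_mono) (auto intro!: pt)
      also have "\<dots> = e / 3 + 2 * B * ((\<integral>\<omega>. min 1 (max 0 (\<bar>Y l \<omega>\<bar> - R)) \<partial>M) + (\<Sum>k\<in>K. prob {\<omega> \<in> space M. d < \<bar>Z l k \<omega>\<bar>}))"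
      proof -
        have "(\<integral>\<omega>. (\<Sum>k\<in>K. indicat_real {\<omega> \<in> space M. d < \<bar>Z l k \<omega>\<bar>} \<omega>) \<partial>M) = (\<Sum>k\<in>K. prob {\<omega> \<in> space M. d < \<bar>Z l k \<omega>\<bar>})"
          by (subst Bochner_Integration.integral_sum) (auto intro!: integrable_real_indicator simp: emeasure_eq_measure)
        then show ?thesis using iY iZ by (simp add: prob_space)
      qed
      also have "\<dots> < e"
      proof -
        have "2 * B * (\<integral>\<omega>. min 1 (max 0 (\<bar>Y l \<omega>\<bar> - R)) \<partial>M) \<le> 2 * B * \<eta>" using elim(1) B0 by (intro mult_left_mono) auto
        then show ?thesis using elim(2) \<eta>(2) by (simp add: distrib_left)
      qed
      finally show ?case by simp
    qed
  qed
  from tendsto_add[OF this g_lim] show "((\<lambda>l. \<integral>\<omega>. f (\<lambda>k\<in>K. W l k \<omega>) \<partial>M) \<longlongrightarrow> (\<integral>v. f (\<lambda>k\<in>K. c k * v) \<partial>\<nu>)) at_top"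
    by (simp add: g_def)
qed

section \<open>Stability of the limit law\<close>

lemma char_linear_combination:
  assumes P: "real_distribution P"
  shows "char (distr (P \<Otimes>\<^sub>M P) borel (\<lambda>(x, y). a * x + b * y)) t = char P (a * t) * char P (b * t)"
proof -
  interpret P: real_distribution P by fact
  interpret PP: pair_prob_space P P ..
  have [measurable]: "(\<lambda>p. iexp (a * t * fst p) * iexp (b * t * snd p)) \<in> borel_measurable (P \<Otimes>\<^sub>M P)" by measurable
  have int: "integrable (P \<Otimes>\<^sub>M P) (\<lambda>(x, y). iexp (a * t * x) * iexp (b * t * y))"
    by (rule PP.integrable_const_bound[where B=1]) (auto simp: split_beta' norm_mult)
  have "char (distr (P \<Otimes>\<^sub>M P) borel (\<lambda>(x, y). a * x + b * y)) t = (\<integral>p. iexp (t * (case p of (x, y) \<Rightarrow> a * x + b * y)) \<partial>(P \<Otimes>\<^sub>M P))"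
    unfolding char_def by (subst integral_distr) (auto simp: split_beta')
  also have "\<dots> = (\<integral>p. (\<lambda>(x, y). iexp (a * t * x) * iexp (b * t * y)) p \<partial>(P \<Otimes>\<^sub>M P))"
    by (intro Bochner_Integration.integral_cong) (auto simp: exp_add[symmetric] algebra_simps)
  also have "\<dots> = (\<integral>x. \<integral>y. iexp (a * t * x) * iexp (b * t * y) \<partial>P \<partial>P)"
    using PP.integral_fst'[OF int] by simp
  also have "\<dots> = char P (a * t) * char P (b * t)"
    by (simp add: char_def)
  finally show ?thesis .
qed

text \<open>Homogeneity of degree \<open>\<alpha>\<close> turns the product of the characteristic functions at \<open>a * t\<close> and \<open>b * t\<close> into the one at
  \<open>(a powr \<alpha> + b powr \<alpha>) powr (1 / \<alpha>) * t\<close>; no shift arises.\<close>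

lemma stable_law_of_char:
  assumes P: "real_distribution P" and ch: "char P = (\<lambda>t. exp (\<psi> t))"
    and scale: "\<And>s t. 0 < s \<Longrightarrow> \<psi> (s * t) = of_real (s powr \<alpha>) * \<psi> t" and \<alpha>: "0 < \<alpha>"
  shows "stable_law \<alpha> P"
  unfolding stable_law_def
proof (intro allI impI exI[of _ 0])
  interpret P: real_distribution P by fact
  interpret PP: pair_prob_space P P ..
  fix a b :: real assume a: "0 < a" and b: "0 < b"
  let ?s = "(a powr \<alpha> + b powr \<alpha>) powr (1 / \<alpha>)"
  have s: "0 < ?s" "?s powr \<alpha> = a powr \<alpha> + b powr \<alpha>"
  proof -
    have pos: "0 < a powr \<alpha> + b powr \<alpha>" using a b by (intro add_pos_pos) auto
    then show "0 < ?s" by simp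
    show "?s powr \<alpha> = a powr \<alpha> + b powr \<alpha>" using pos \<alpha> by (simp add: powr_powr)
  qed
  show "distr (P \<Otimes>\<^sub>M P) borel (\<lambda>(x, y). a * x + b * y) = distr P borel (\<lambda>x. ?s * x + 0)"
  proof (rule Levy_uniqueness)
    show "real_distribution (distr (P \<Otimes>\<^sub>M P) borel (\<lambda>(x, y). a * x + b * y))"
      by (rule PP.real_distribution_distr) (simp add: split_beta')
    show "real_distribution (distr P borel (\<lambda>x. ?s * x + 0))"
      by (rule P.real_distribution_distr) simp
    show "char (distr (P \<Otimes>\<^sub>M P) borel (\<lambda>(x, y). a * x + b * y)) = char (distr P borel (\<lambda>x. ?s * x + 0))"
    proof
      fix t
      have "char (distr P borel (\<lambda>x. ?s * x + 0)) t = char P (?s * t)"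
        unfolding char_def by (subst integral_distr) (auto simp: mult_ac)
      also have "\<dots> = exp (of_real (a powr \<alpha> + b powr \<alpha>) * \<psi> t)"
        unfolding ch scale[OF s(1)] s(2) ..
      also have "\<dots> = char P (a * t) * char P (b * t)"
        by (simp add: ch scale[OF a] scale[OF b] exp_add[symmetric] distrib_right)
      finally show "char (distr (P \<Otimes>\<^sub>M P) borel (\<lambda>(x, y). a * x + b * y)) t = char (distr P borel (\<lambda>x. ?s * x + 0)) t"
        unfolding char_linear_combination[OF P] by simp
    qed
  qed
qed

context heavy_tailed_grain
begin

lemma stable_exponent_scale:
  assumes s: "0 < s"
  shows "stable_exponent (s * w) = of_real (s powr \<alpha>) * stable_exponent w"
proof -
  have "stable_exponent (s * w) = \<bar>1 / s\<bar> *\<^sub>R (\<integral>x. indicator {0<..} (0 + 1 / s * x) *\<^sub>R (of_real (c * (0 + 1 / s * x) powr (- \<alpha>)) * levy_kernel (s * w) (0 + 1 / s * x)) \<partial>lborel)"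
    unfolding stable_exponent_def using s by (intro lborel_integral_real_affine) simp
  also have "\<dots> = \<bar>1 / s\<bar> *\<^sub>R (\<integral>x. of_real (s powr \<alpha> * s) * (indicator {0<..} x *\<^sub>R (of_real (c * x powr (- \<alpha>)) * levy_kernel w x)) \<partial>lborel)"
  proof (intro arg_cong[where f="\<lambda>z. \<bar>1 / s\<bar> *\<^sub>R z"] Bochner_Integration.integral_cong)
    fix x :: real
    have k: "levy_kernel (s * w) (0 + 1 / s * x) = of_real s * levy_kernel w x" using s by (simp add: levy_kernel_def)
    show "indicator {0<..} (0 + 1 / s * x) *\<^sub>R (of_real (c * (0 + 1 / s * x) powr (- \<alpha>)) * levy_kernel (s * w) (0 + 1 / s * x))
      = of_real (s powr \<alpha> * s) * (indicator {0<..} x *\<^sub>R (of_real (c * x powr (- \<alpha>)) * levy_kernel w x))"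
    proof (cases "0 < x")
      case True
      have "(0 + 1 / s * x) powr (- \<alpha>) = s powr \<alpha> * x powr (- \<alpha>)"
        using s True by (simp add: powr_divide powr_minus field_simps)
      then show ?thesis unfolding k using True s by (simp add: scaleR_conv_of_real mult_ac)
    next
      case False
      then have "\<not> 0 < 0 + 1 / s * x" using s by (simp add: zero_less_divide_iff)
      then show ?thesis using False by simp
    qed
  qed simp
  also have "\<dots> = of_real (s powr \<alpha>) * stable_exponent w"
    unfolding stable_exponent_def using s by (simp add: scaleR_conv_of_real)
  finally show ?thesis .
qed

lemma stable_exponent_0 [simp]: "stable_exponent 0 = 0"
  by (simp add: stable_exponent_def levy_kernel_def)

definition log_char :: "('a \<Rightarrow> real) \<Rightarrow> real \<Rightarrow> complex" where
  "log_char \<phi> \<theta> = (\<integral>v. stable_exponent (\<theta> * \<phi> v) \<partial>lborel)"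

lemma log_char_scale: "0 < s \<Longrightarrow> log_char \<phi> (s * \<theta>) = of_real (s powr \<alpha>) * log_char \<phi> \<theta>"
  unfolding log_char_def by (simp add: mult.assoc stable_exponent_scale)

lemma log_char_0 [simp]: "log_char \<phi> 0 = 0"
  by (simp add: log_char_def)

text \<open>By homogeneity the exponent is determined by its values at 1 and -1, and it vanishes like a
  power at 0.\<close>

lemma isCont_exp_log_char: "isCont (\<lambda>\<theta>. exp (log_char \<phi> \<theta>)) 0"
proof -
  let ?m = "max (norm (log_char \<phi> 1)) (norm (log_char \<phi> (- 1)))"
  have bd: "norm (log_char \<phi> \<theta>) \<le> \<bar>\<theta>\<bar> powr \<alpha> * ?m" for \<theta>
  proof -
    consider "\<theta> = 0" | "0 < \<theta>" | "\<theta> < 0" by linarith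
    then show ?thesis
    proof cases
      case 2
      then show ?thesis using log_char_scale[of \<theta> \<phi> 1] by (auto simp: norm_mult intro!: mult_left_mono)
    next
      case 3
      then show ?thesis using log_char_scale[of "- \<theta>" \<phi> "- 1"] by (auto simp: norm_mult intro!: mult_left_mono)
    qed simp
  qed
  have "((\<lambda>\<theta>. \<bar>\<theta>\<bar> powr \<alpha> * ?m) \<longlongrightarrow> \<bar>0\<bar> powr \<alpha> * ?m) (at 0)"
    using alpha by (intro tendsto_intros tendsto_powr') auto
  then have "((\<lambda>\<theta>. \<bar>\<theta>\<bar> powr \<alpha> * ?m) \<longlongrightarrow> 0) (at 0)" by simp
  then have "(log_char \<phi> \<longlongrightarrow> 0) (at 0)"
    by (rule Lim_null_comparison[OF always_eventually, rotated]) (use bd in auto)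
  then have "isCont (log_char \<phi>) 0" by (simp add: isCont_def)
  then show ?thesis by (intro continuous_intros)
qed

text \<open>The exponent as a double Lebesgue integral, evaluated through a Borel version of the test function.\<close>

lemma log_char_limit_eq:
  fixes \<phi>0 \<phi> :: "'a \<Rightarrow> real"
  assumes [measurable]: "\<phi> \<in> borel_measurable borel" and ae: "AE s in lebesgue. \<phi>0 s = \<phi> s"
    and m0: "\<phi>0 \<in> borel_measurable lebesgue"
  shows "log_char_limit \<alpha> c \<phi>0 \<theta> = log_char \<phi> \<theta>"
proof -
  define h where "h w = of_real w * (LINT x:{0<..}|lebesgue. (iexp (w * x) - 1) * of_real (x powr (- \<alpha>)))" for w :: real
  have h: "\<i> * of_real c * h w = stable_exponent w" for w
  proof -
    have [measurable]: "(\<lambda>x. indicator {0<..} x *\<^sub>R ((iexp (w * x) - 1) * of_real (x powr (- \<alpha>)))) \<in> borel_measurable borel"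
      by measurable
    have "(LINT x:{0<..}|lebesgue. (iexp (w * x) - 1) * of_real (x powr (- \<alpha>)))
      = (\<integral>x. indicator {0<..} x *\<^sub>R ((iexp (w * x) - 1) * of_real (x powr (- \<alpha>))) \<partial>lborel)"
      unfolding set_lebesgue_integral_def by (rule integral_completion) measurable
    then have "\<i> * of_real c * h w = (\<integral>x. (\<i> * of_real c * of_real w) * (indicator {0<..} x *\<^sub>R ((iexp (w * x) - 1) * of_real (x powr (- \<alpha>)))) \<partial>lborel)"
      unfolding h_def by (simp only: integral_mult_right_zero mult.assoc)
    also have "\<dots> = stable_exponent w"
      unfolding stable_exponent_def levy_kernel_def
      by (intro Bochner_Integration.integral_cong) (simp_all add: scaleR_conv_of_real mult_ac)
    finally show ?thesis .
  qed
  have hm [measurable]: "h \<in> borel_measurable borel"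
  proof -
    have "h = (\<lambda>w. stable_exponent w / (\<i> * of_real c))" using h c_pos by (simp add: fun_eq_iff field_simps)
    then show ?thesis using stable_exponent_measurable by simp
  qed
  have "log_char_limit \<alpha> c \<phi>0 \<theta> = \<i> * of_real c * (\<integral>s. h (\<theta> * \<phi>0 s) \<partial>lebesgue)"
    by (simp add: log_char_limit_def h_def)
  also have "(\<integral>s. h (\<theta> * \<phi>0 s) \<partial>lebesgue) = (\<integral>s. h (\<theta> * \<phi> s) \<partial>lebesgue)"
  proof (rule integral_cong_AE)
    show "(\<lambda>s. h (\<theta> * \<phi>0 s)) \<in> borel_measurable lebesgue"
      by (rule measurable_compose[OF _ hm]) (use m0 in measurable)
    show "(\<lambda>s. h (\<theta> * \<phi> s)) \<in> borel_measurable lebesgue"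
      by (rule measurable_completion) measurable
    show "AE s in lebesgue. h (\<theta> * \<phi>0 s) = h (\<theta> * \<phi> s)" using ae by eventually_elim simp
  qed
  also have "\<dots> = (\<integral>s. h (\<theta> * \<phi> s) \<partial>lborel)"
    by (rule integral_completion) measurable
  also have "\<i> * of_real c * (\<integral>s. h (\<theta> * \<phi> s) \<partial>lborel) = (\<integral>s. \<i> * of_real c * h (\<theta> * \<phi> s) \<partial>lborel)"
    by (simp only: integral_mult_right_zero)
  also have "\<dots> = log_char \<phi> \<theta>" by (simp only: h log_char_def)
  finally show ?thesis .
qed

end

section \<open>Covariance of the residual field\<close>

context random_grain_model
begin

lemma mem_grain_measurable [measurable (raw)]:
  "f \<in> borel_measurable N \<Longrightarrow> g \<in> measurable N M \<Longrightarrow> Measurable.pred N (\<lambda>x. f x \<in> \<Xi> (g x))"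
  "f \<in> borel_measurable N \<Longrightarrow> g \<in> measurable N M \<Longrightarrow> Measurable.pred N (\<lambda>x. f x \<in> \<Xi>s j (g x))"
  using measurable_mem_fell[OF _ measurable_compose[OF _ grain_measurable(1)]]
    measurable_mem_fell[OF _ measurable_compose[OF _ grain_measurable(2)]] by blast+

definition hitting :: "'a \<Rightarrow> ('a \<times> 'a set) set" where
  "hitting t = {p \<in> space (borel \<Otimes>\<^sub>M fell). t - fst p \<in> snd p}"

lemma hitting_sets [measurable]: "hitting t \<in> sets (borel \<Otimes>\<^sub>M fell)"
proof -
  have "Measurable.pred (borel \<Otimes>\<^sub>M fell) (\<lambda>p. t - fst p \<in> (snd p :: 'a set))"
    by (rule measurable_mem_fell) measurable
  then show ?thesis unfolding hitting_def pred_def .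
qed

lemma space_marked: "(v, F) \<in> space (borel \<Otimes>\<^sub>M (fell :: 'a set measure)) \<longleftrightarrow> closed F"
  by (simp add: space_pair_measure)

lemma hitting_point: "\<omega> \<in> space M \<Longrightarrow> (v, \<Xi>s j \<omega>) \<in> hitting t \<longleftrightarrow> t - v \<in> \<Xi>s j \<omega>"
  "\<omega> \<in> space M \<Longrightarrow> (v, \<Xi> \<omega>) \<in> hitting t \<longleftrightarrow> t - v \<in> \<Xi> \<omega>"
  by (auto simp: hitting_def space_marked grain_closed)

lemma sets_marked_intensity [measurable_cong]: "sets marked_intensity = sets (borel \<Otimes>\<^sub>M fell)"
  by (simp cong: sets_pair_measure_cong)

lemma nn_integral_marked_intensity:
  assumes [measurable]: "f \<in> borel_measurable (borel \<Otimes>\<^sub>M fell)"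
  shows "(\<integral>\<^sup>+p. f p \<partial>marked_intensity) = (\<integral>\<^sup>+\<omega>. \<integral>\<^sup>+v. f (v, \<Xi> \<omega>) \<partial>lborel \<partial>M)"
proof -
  interpret pair_sigma_finite lborel grain_law by (rule marked_pair_sigma_finite)
  have "(\<integral>\<^sup>+p. f p \<partial>marked_intensity) = (\<integral>\<^sup>+F. \<integral>\<^sup>+v. f (v, F) \<partial>lborel \<partial>grain_law)"
    by (subst nn_integral_snd[symmetric]) simp_all
  also have "\<dots> = (\<integral>\<^sup>+\<omega>. \<integral>\<^sup>+v. f (v, \<Xi> \<omega>) \<partial>lborel \<partial>M)"
    by (subst nn_integral_distr) (auto intro!: lborel.borel_measurable_nn_integral simp: split_beta')
  finally show ?thesis .
qed

lemma emeasure_hitting_outside: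
  assumes [measurable]: "S \<in> sets borel"
  shows "emeasure marked_intensity {p \<in> hitting t. t - fst p \<in> S} = (\<integral>\<^sup>+\<omega>. emeasure lborel (\<Xi> \<omega> \<inter> S) \<partial>M)"
proof -
  have m [measurable]: "{p \<in> hitting t. t - fst p \<in> S} \<in> sets (borel \<Otimes>\<^sub>M fell)"
  proof -
    have "{p \<in> hitting t. t - fst p \<in> S} = hitting t \<inter> {p \<in> space (borel \<Otimes>\<^sub>M fell). t - fst p \<in> S}"
      by (auto simp: hitting_def)
    then show ?thesis by simp
  qed
  have "emeasure marked_intensity {p \<in> hitting t. t - fst p \<in> S} = (\<integral>\<^sup>+p. indicator {p \<in> hitting t. t - fst p \<in> S} p \<partial>marked_intensity)"
    using m sets_marked_intensity by simp
  also have "\<dots> = (\<integral>\<^sup>+\<omega>. \<integral>\<^sup>+v. indicator {p \<in> hitting t. t - fst p \<in> S} (v, \<Xi> \<omega>) \<partial>lborel \<partial>M)"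
    by (rule nn_integral_marked_intensity) measurable
  also have "\<dots> = (\<integral>\<^sup>+\<omega>. emeasure lborel (\<Xi> \<omega> \<inter> S) \<partial>M)"
  proof (rule nn_integral_cong)
    fix \<omega> assume w: "\<omega> \<in> space M"
    have [measurable]: "\<Xi> \<omega> \<in> sets borel" using grain_closed(1)[OF w] by simp
    have "(\<integral>\<^sup>+v. indicator {p \<in> hitting t. t - fst p \<in> S} (v, \<Xi> \<omega>) \<partial>lborel) = (\<integral>\<^sup>+v. indicator (\<Xi> \<omega> \<inter> S) (t - v) \<partial>lborel)"
      by (intro nn_integral_cong) (auto simp: indicator_def hitting_point[OF w])
    also have "\<dots> = (\<integral>\<^sup>+v. indicator (\<Xi> \<omega> \<inter> S) v \<partial>lborel)" by (rule nn_integral_reflect) measurable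
    finally show "(\<integral>\<^sup>+v. indicator {p \<in> hitting t. t - fst p \<in> S} (v, \<Xi> \<omega>) \<partial>lborel) = emeasure lborel (\<Xi> \<omega> \<inter> S)" by simp
  qed
  finally show ?thesis .
qed

abbreviation "mean_vol \<equiv> mean_volume M \<Xi>"

lemma emeasure_hitting: "emeasure marked_intensity (hitting t) = ennreal mean_vol"
proof -
  have "emeasure marked_intensity (hitting t) = (\<integral>\<^sup>+\<omega>. emeasure lborel (\<Xi> \<omega>) \<partial>M)"
    using emeasure_hitting_outside[of UNIV t] by simp
  then show ?thesis using generic_grain by (simp add: mean_volume_def random_grain_def)
qed

lemma mean_vol_nonneg: "0 \<le> mean_vol" by (simp add: mean_volume_def)

text \<open>The mean number of grains that cover both points.\<close>

definition overlap :: "'a \<Rightarrow> 'a \<Rightarrow> real" where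
  "overlap t s = measure marked_intensity (hitting t \<inter> hitting s)"

lemma emeasure_overlap: "emeasure marked_intensity (hitting t \<inter> hitting s) = ennreal (overlap t s)"
proof -
  have "emeasure marked_intensity (hitting t \<inter> hitting s) \<le> emeasure marked_intensity (hitting t)"
    by (intro emeasure_mono) (auto simp: sets_marked_intensity)
  also have "\<dots> < \<infinity>" by (simp add: emeasure_hitting)
  finally show ?thesis by (simp add: overlap_def emeasure_eq_ennreal_measure)
qed

lemma overlap_nonneg: "0 \<le> overlap t s" by (simp add: overlap_def)

lemma emeasure_hitting_diff: "emeasure marked_intensity (hitting t - hitting s) = ennreal (mean_vol - overlap t s)"
proof -
  have "emeasure marked_intensity (hitting t - hitting t \<inter> hitting s) = ennreal mean_vol - ennreal (overlap t s)"
    by (subst emeasure_Diff) (auto simp: sets_marked_intensity emeasure_hitting emeasure_overlap)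
  moreover have "hitting t - hitting t \<inter> hitting s = hitting t - hitting s" by auto
  ultimately show ?thesis by (simp add: ennreal_minus overlap_nonneg)
qed

lemma overlap_le: "overlap t s \<le> mean_vol"
proof -
  have "ennreal (overlap t s) \<le> ennreal mean_vol"
    unfolding emeasure_overlap[symmetric] emeasure_hitting[of t, symmetric] by (intro emeasure_mono) (auto simp: sets_marked_intensity)
  then show ?thesis by (simp add: mean_vol_nonneg)
qed

lemma overlap_same: "overlap t t = mean_vol"
  using emeasure_overlap[of t t] emeasure_hitting[of t] by (simp add: overlap_nonneg mean_vol_nonneg)

text \<open>A grain that covers both points has a point at distance at least half of \<open>norm (t - s)\<close> from its
  germ, so one of its two points lies in the far part of the grain. The constant 3 in place of 2
  gives the strict inequality.\<close>

lemma overlap_outside: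
  assumes "t \<noteq> s"
  shows "ennreal (overlap t s) \<le> 2 * (\<integral>\<^sup>+ \<omega>. emeasure lborel (\<Xi> \<omega> \<inter> {x. norm x > norm (t - s) / 3}) \<partial>M)"
proof -
  let ?S = "{x::'a. norm x > norm (t - s) / 3}"
  have sub: "hitting t \<inter> hitting s \<subseteq> {p \<in> hitting t. t - fst p \<in> ?S} \<union> {p \<in> hitting s. s - fst p \<in> ?S}"
  proof
    fix p assume p: "p \<in> hitting t \<inter> hitting s"
    have "norm (t - s) \<le> norm (t - fst p) + norm (s - fst p)"
      using norm_triangle_ineq4[of "t - fst p" "s - fst p"] by simp
    moreover have "0 < norm (t - s)" using assms by simp
    ultimately have "norm (t - s) / 3 < norm (t - fst p) \<or> norm (t - s) / 3 < norm (s - fst p)" by argo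
    then show "p \<in> {p \<in> hitting t. t - fst p \<in> ?S} \<union> {p \<in> hitting s. s - fst p \<in> ?S}" using p by auto
  qed
  have m: "{p \<in> hitting x. x - fst p \<in> ?S} \<in> sets marked_intensity" for x
  proof -
    have "{p \<in> hitting x. x - fst p \<in> ?S} = hitting x \<inter> {p \<in> space (borel \<Otimes>\<^sub>M fell). x - fst p \<in> ?S}"
      by (auto simp: hitting_def)
    then show ?thesis unfolding sets_marked_intensity by simp
  qed
  have "ennreal (overlap t s) \<le> emeasure marked_intensity ({p \<in> hitting t. t - fst p \<in> ?S} \<union> {p \<in> hitting s. s - fst p \<in> ?S})"
    unfolding emeasure_overlap[symmetric] using m sub by (intro emeasure_mono) auto
  also have "\<dots> \<le> emeasure marked_intensity {p \<in> hitting t. t - fst p \<in> ?S} + emeasure marked_intensity {p \<in> hitting s. s - fst p \<in> ?S}"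
    by (rule emeasure_subadditive[OF m m])
  also have "\<dots> = (\<integral>\<^sup>+ \<omega>. emeasure lborel (\<Xi> \<omega> \<inter> ?S) \<partial>M) + (\<integral>\<^sup>+ \<omega>. emeasure lborel (\<Xi> \<omega> \<inter> ?S) \<partial>M)"
    by (subst (1 2) emeasure_hitting_outside) simp_all
  finally show ?thesis by (simp only: mult_2)
qed

lemma overlap_measurable [measurable]: "(\<lambda>p. overlap (fst p) (snd p)) \<in> borel_measurable (borel \<Otimes>\<^sub>M borel)"
proof -
  interpret Q: prob_space grain_law by (rule prob_space_grain_law)
  interpret pair_sigma_finite lborel grain_law by (rule marked_pair_sigma_finite)
  have ev: "indicator (hitting (fst p) \<inter> hitting (snd p)) (v, \<Xi> \<omega>) = (of_bool (fst p - v \<in> \<Xi> \<omega>) * of_bool (snd p - v \<in> \<Xi> \<omega>) :: ennreal)"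
    if "\<omega> \<in> space M" for p v \<omega>
    by (auto simp: indicator_def hitting_point[OF that])
  have "emeasure marked_intensity (hitting (fst p) \<inter> hitting (snd p)) = (\<integral>\<^sup>+\<omega>. \<integral>\<^sup>+v. of_bool (fst p - v \<in> \<Xi> \<omega>) * of_bool (snd p - v \<in> \<Xi> \<omega>) \<partial>lborel \<partial>M)" for p
  proof -
    have "emeasure marked_intensity (hitting (fst p) \<inter> hitting (snd p)) = (\<integral>\<^sup>+q. indicator (hitting (fst p) \<inter> hitting (snd p)) q \<partial>marked_intensity)"
      by (simp add: sets_marked_intensity)
    also have "\<dots> = (\<integral>\<^sup>+\<omega>. \<integral>\<^sup>+v. indicator (hitting (fst p) \<inter> hitting (snd p)) (v, \<Xi> \<omega>) \<partial>lborel \<partial>M)"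
      by (rule nn_integral_marked_intensity) measurable
    also have "\<dots> = (\<integral>\<^sup>+\<omega>. \<integral>\<^sup>+v. of_bool (fst p - v \<in> \<Xi> \<omega>) * of_bool (snd p - v \<in> \<Xi> \<omega>) \<partial>lborel \<partial>M)"
      by (intro nn_integral_cong) (simp add: ev)
    finally show ?thesis .
  qed
  moreover have "(\<lambda>p. \<integral>\<^sup>+\<omega>. \<integral>\<^sup>+v. of_bool (fst p - v \<in> \<Xi> \<omega>) * of_bool (snd p - v \<in> \<Xi> \<omega>) \<partial>lborel \<partial>M) \<in> borel_measurable (borel \<Otimes>\<^sub>M borel)"
    by measurable
  ultimately show ?thesis unfolding overlap_def measure_def by simp
qed

text \<open>The field to which \<open>poisson_residual\<close> gives rise. Its slope is the same at every point by
  stationarity.\<close>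

definition residual :: "nat \<Rightarrow> 'a \<Rightarrow> 'w \<Rightarrow> real" where
  "residual k t \<omega> = excess_field u \<Xi>s k \<omega> t - poisson_weight mean_vol (k - 1) * enn2real (grain_field u \<Xi>s \<omega> t)"

lemma grain_field_eq: "grain_field u \<Xi>s \<omega> t = (\<Sum>j. of_bool (t - u j \<omega> \<in> \<Xi>s j \<omega>))"
proof -
  have "t \<in> (+) (u j \<omega>) ` \<Xi>s j \<omega> \<longleftrightarrow> t - u j \<omega> \<in> \<Xi>s j \<omega>" for j
    by (auto intro: image_eqI[of _ _ "t - u j \<omega>"])
  then show ?thesis by (simp add: grain_field_def indicator_def of_bool_def)
qed

lemma grain_field_measurable [measurable]: "(\<lambda>p. grain_field u \<Xi>s (snd p) (fst p)) \<in> borel_measurable (borel \<Otimes>\<^sub>M M)"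
  unfolding grain_field_eq by measurable

lemma grain_field_measurable' [measurable]: "(\<lambda>\<omega>. grain_field u \<Xi>s \<omega> t) \<in> borel_measurable M"
  unfolding grain_field_eq by measurable

lemma excess_field_measurable [measurable]: "(\<lambda>p. excess_field u \<Xi>s k (snd p) (fst p)) \<in> borel_measurable (borel \<Otimes>\<^sub>M M)"
  unfolding excess_field_def by measurable

lemma residual_measurable [measurable]: "(\<lambda>p. residual k (fst p) (snd p)) \<in> borel_measurable (borel \<Otimes>\<^sub>M M)"
  unfolding residual_def by measurable

text \<open>The grains over \<open>t\<close>, split according to whether they also cover \<open>s\<close>. The equation holds only
  almost surely, as the field may be infinite on a null set.\<close>

lemma grain_field_AE:
  "AE \<omega> in M. grain_field u \<Xi>s \<omega> t = of_nat (marked_card (hitting t \<inter> hitting s) \<omega> + marked_card (hitting t - hitting s) \<omega>)"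
proof -
  have C: "hitting t \<inter> hitting s \<in> sets (borel \<Otimes>\<^sub>M fell)" and A: "hitting t - hitting s \<in> sets (borel \<Otimes>\<^sub>M fell)" by measurable
  have fin: "emeasure marked_intensity (hitting t \<inter> hitting s) < \<infinity>" "emeasure marked_intensity (hitting t - hitting s) < \<infinity>"
    by (simp_all add: emeasure_overlap emeasure_hitting_diff)
  show ?thesis
    using marked_AE_finite[OF C fin(1)] marked_AE_finite[OF A fin(2)] AE_space
  proof eventually_elim
    case (elim \<omega>)
    let ?C = "{j. (u j \<omega>, \<Xi>s j \<omega>) \<in> hitting t \<inter> hitting s}" and ?A = "{j. (u j \<omega>, \<Xi>s j \<omega>) \<in> hitting t - hitting s}"
    have "grain_field u \<Xi>s \<omega> t = (\<Sum>j. indicator (?C \<union> ?A) j)"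
      unfolding grain_field_eq
      by (intro suminf_cong) (auto simp: indicator_def hitting_point[OF elim(3)])
    also have "\<dots> = of_nat (card (?C \<union> ?A))"
      using elim unfolding suminf_indicator_eq_card by simp
    also have "card (?C \<union> ?A) = card ?C + card ?A"
      using elim by (intro card_Un_disjoint) auto
    finally show ?case by (simp add: marked_card_def)
  qed
qed

lemma residual_AE:
  "AE \<omega> in M. residual k t \<omega> = poisson_residual mean_vol k (marked_card (hitting t \<inter> hitting s) \<omega> + marked_card (hitting t - hitting s) \<omega>)"
  using grain_field_AE[of t s]
proof eventually_elim
  case (elim \<omega>)
  then have "grain_field u \<Xi>s \<omega> t = ennreal (real (marked_card (hitting t \<inter> hitting s) \<omega> + marked_card (hitting t - hitting s) \<omega>))"
    by (simp add: ennreal_of_nat_eq_real_of_nat)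
  then show ?case
    unfolding residual_def excess_field_def poisson_residual_def
    by (simp add: ennreal_of_nat_eq_real_of_nat del: ennreal_plus)
qed

text \<open>The counts of the grains that cover both points, only \<open>t\<close>, and only \<open>s\<close> are independent Poisson
  variables, which transfers the estimate for two overlapping sums to the field.\<close>

theorem residual_covariance:
  assumes k: "1 \<le> k"
  shows "integrable M (residual k t)" "expectation (residual k s) = expectation (residual k t)"
    and "integrable M (\<lambda>\<omega>. residual k t \<omega> * residual k s \<omega>)"
    and "\<bar>expectation (\<lambda>\<omega>. residual k t \<omega> * residual k s \<omega>) - (expectation (residual k t))\<^sup>2\<bar> \<le> (overlap t s + 2) * (overlap t s)\<^sup>2"
proof -
  let ?r = "overlap t s"
  let ?m = "mean_vol - ?r"
  let ?C = "hitting t \<inter> hitting s" and ?A = "hitting t - hitting s" and ?B = "hitting s - hitting t"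
  let ?P = "poisson_law ?r \<Otimes>\<^sub>M (poisson_law ?m \<Otimes>\<^sub>M poisson_law ?m)"
  let ?K = "\<lambda>\<omega>. (marked_card ?C \<omega>, marked_card ?A \<omega>, marked_card ?B \<omega>)"
  let ?N = "count_space (UNIV :: nat set) \<Otimes>\<^sub>M (count_space (UNIV :: nat set) \<Otimes>\<^sub>M count_space (UNIV :: nat set))"
  have m: "0 \<le> ?m" using overlap_le[of t s] by simp
  have sym: "overlap s t = ?r" by (simp add: overlap_def Int_commute)
  have mA: "measure marked_intensity ?A = ?m" using m by (simp add: measure_def emeasure_hitting_diff)
  have mB: "measure marked_intensity ?B = ?m" using m by (simp add: measure_def emeasure_hitting_diff sym)
  have mC: "measure marked_intensity ?C = ?r" by (simp add: overlap_def)
  have law: "distr M ?N ?K = ?P"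
    using marked_card_joint_law[of ?A ?B ?C] unfolding mA mB mC
    by (auto simp: emeasure_hitting_diff emeasure_overlap)
  have K [measurable]: "?K \<in> measurable M ?N" by measurable
  have N: "?N = count_space UNIV" by (simp add: pair_measure_countable)
  have meas: "f \<in> borel_measurable ?N" for f :: "_ \<Rightarrow> real" unfolding N by simp
  let ?g = "poisson_residual mean_vol k"
  have gt: "AE \<omega> in M. residual k t \<omega> = (case ?K \<omega> of (c, a, b) \<Rightarrow> ?g (c + a))"
    using residual_AE[of k t s] by eventually_elim simp
  have gs: "AE \<omega> in M. residual k s \<omega> = (case ?K \<omega> of (c, a, b) \<Rightarrow> ?g (c + b))"
    using residual_AE[of k s t] by eventually_elim (simp add: Int_commute)
  have gts: "AE \<omega> in M. residual k t \<omega> * residual k s \<omega> = (case ?K \<omega> of (c, a, b) \<Rightarrow> ?g (c + a) * ?g (c + b))"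
    using gt gs by eventually_elim simp
  have rm [measurable]: "residual k x \<in> borel_measurable M" for x
    unfolding residual_def excess_field_def by measurable
  have tr: "integrable M f \<longleftrightarrow> integrable ?P F" "expectation f = integral\<^sup>L ?P F"
    if f: "AE \<omega> in M. f \<omega> = F (?K \<omega>)" and [measurable]: "f \<in> borel_measurable M"
    for f :: "'w \<Rightarrow> real" and F :: "nat \<times> nat \<times> nat \<Rightarrow> real"
  proof -
    have [measurable]: "F \<in> borel_measurable ?N" by (rule meas)
    have "integrable M f \<longleftrightarrow> integrable M (\<lambda>\<omega>. F (?K \<omega>))"
      by (rule integrable_cong_AE) (use f in auto)
    also have "\<dots> \<longleftrightarrow> integrable ?P F" unfolding law[symmetric] by (rule integrable_distr_eq[symmetric]) measurable
    finally show "integrable M f \<longleftrightarrow> integrable ?P F" .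
    have "expectation f = expectation (\<lambda>\<omega>. F (?K \<omega>))"
      by (rule integral_cong_AE) (use f in auto)
    also have "\<dots> = integral\<^sup>L ?P F" unfolding law[symmetric] by (rule integral_distr[symmetric]) measurable
    finally show "expectation f = integral\<^sup>L ?P F" .
  qed
  have mr: "?m + ?r = mean_vol" by simp
  note pr = poisson_residual_integrable[OF m overlap_nonneg k, of t s, unfolded mr]
    poisson_residual_mean[OF m overlap_nonneg k, of t s, unfolded mr]
    poisson_residual_product_integrable[OF m overlap_nonneg k, of t s, unfolded mr]
    poisson_residual_covariance[OF m overlap_nonneg k, of t s, unfolded mr]
  show "integrable M (residual k t)" using tr(1)[OF gt rm] pr(1) by simp
  show "expectation (residual k s) = expectation (residual k t)"
    using tr(2)[OF gt rm] tr(2)[OF gs rm] pr(2) by simp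
  show "integrable M (\<lambda>\<omega>. residual k t \<omega> * residual k s \<omega>)" using tr(1)[OF gts] pr(3) by simp
  show "\<bar>expectation (\<lambda>\<omega>. residual k t \<omega> * residual k s \<omega>) - (expectation (residual k t))\<^sup>2\<bar> \<le> (overlap t s + 2) * (overlap t s)\<^sup>2"
    using tr(2)[OF gt rm] tr(2)[OF gts] pr(4) by simp
qed

end

section \<open>Second moments of spatial integrals\<close>

text \<open>Fubini's theorem for the square of the integral, written as a double integral. The uniform
  bound on the second moments provides the integrability.\<close>

lemma (in prob_space) second_moment_of_integral:
  fixes S :: "'b::euclidean_space \<Rightarrow> 'a \<Rightarrow> real" and f :: "'b \<Rightarrow> real"
  assumes S [measurable]: "(\<lambda>p. S (fst p) (snd p)) \<in> borel_measurable (borel \<Otimes>\<^sub>M M)"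
    and f: "integrable lborel f"
    and int: "\<And>t. integrable M (\<lambda>\<omega>. (S t \<omega>)\<^sup>2)" and V: "\<And>t. expectation (\<lambda>\<omega>. (S t \<omega>)\<^sup>2) \<le> V"
  shows "AE \<omega> in M. integrable lborel (\<lambda>t. f t * S t \<omega>)"
    and "(\<integral>\<^sup>+\<omega>. ennreal ((\<integral>t. f t * S t \<omega> \<partial>lborel)\<^sup>2) \<partial>M)
      \<le> (\<integral>\<^sup>+t. \<integral>\<^sup>+s. ennreal (\<bar>f t\<bar> * \<bar>f s\<bar> * \<bar>expectation (\<lambda>\<omega>. S t \<omega> * S s \<omega>)\<bar>) \<partial>lborel \<partial>lborel)"
proof -
  interpret L: pair_sigma_finite "lborel :: 'b measure" M ..
  interpret P: pair_sigma_finite "lborel \<Otimes>\<^sub>M lborel :: ('b \<times> 'b) measure" M ..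
  have [measurable]: "f \<in> borel_measurable borel" using f by auto
  have S1 [measurable]: "S t \<in> borel_measurable M" for t
    using measurable_compose[OF measurable_Pair1' S, of t] by simp
  have S2 [measurable]: "(\<lambda>t. S t \<omega>) \<in> borel_measurable borel" if "\<omega> \<in> space M" for \<omega>
    using measurable_compose[OF measurable_Pair2'[OF that] S] by simp
  have S3 [measurable]: "(\<lambda>x. S (g x) (h x)) \<in> borel_measurable N" if "g \<in> borel_measurable N" "h \<in> measurable N M" for g h and N :: "'z measure"
    using measurable_compose[OF measurable_Pair[OF that] S] by simp
  have V0: "0 \<le> V" by (rule order_trans[OF _ V[of undefined]]) simp
  have nnsq: "(\<integral>\<^sup>+\<omega>. ennreal ((S t \<omega>)\<^sup>2) \<partial>M) \<le> ennreal V" for t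
    using V[of t] nn_integral_eq_integral[OF int[of t]] by (simp add: ennreal_leI)
  have ab: "ennreal (\<bar>a\<bar> * \<bar>b\<bar>) \<le> ennreal (a\<^sup>2) + ennreal (b\<^sup>2)" for a b :: real
  proof -
    have "\<bar>a\<bar> * \<bar>b\<bar> \<le> a\<^sup>2 + b\<^sup>2"
    proof -
      have "2 * (\<bar>a\<bar> * \<bar>b\<bar>) \<le> a\<^sup>2 + b\<^sup>2" using sum_squares_bound[of "\<bar>a\<bar>" "\<bar>b\<bar>"] by simp
      moreover have "0 \<le> \<bar>a\<bar> * \<bar>b\<bar>" by simp
      ultimately show ?thesis by linarith
    qed
    then show ?thesis by (simp add: ennreal_plus[symmetric] ennreal_leI del: ennreal_plus)
  qed
  have nnprod: "(\<integral>\<^sup>+\<omega>. ennreal (\<bar>S t \<omega>\<bar> * \<bar>S s \<omega>\<bar>) \<partial>M) \<le> ennreal (2 * V)" for t s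
  proof -
    have "(\<integral>\<^sup>+\<omega>. ennreal (\<bar>S t \<omega>\<bar> * \<bar>S s \<omega>\<bar>) \<partial>M) \<le> (\<integral>\<^sup>+\<omega>. ennreal ((S t \<omega>)\<^sup>2) + ennreal ((S s \<omega>)\<^sup>2) \<partial>M)"
      by (intro nn_integral_mono ab)
    also have "\<dots> \<le> ennreal V + ennreal V"
      by (subst nn_integral_add) (auto intro!: add_mono nnsq)
    finally show ?thesis using V0 by (simp add: ennreal_plus[symmetric] del: ennreal_plus)
  qed
  have fn: "(\<integral>\<^sup>+t. ennreal \<bar>f t\<bar> \<partial>lborel) < \<infinity>" using f by (simp add: integrable_iff_bounded)
  show 1: "AE \<omega> in M. integrable lborel (\<lambda>t. f t * S t \<omega>)"
  proof -
    have "(\<integral>\<^sup>+\<omega>. \<integral>\<^sup>+t. ennreal \<bar>f t * S t \<omega>\<bar> \<partial>lborel \<partial>M) = (\<integral>\<^sup>+t. \<integral>\<^sup>+\<omega>. ennreal \<bar>f t * S t \<omega>\<bar> \<partial>M \<partial>lborel)"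
      by (rule L.Fubini'[of "\<lambda>t \<omega>. ennreal \<bar>f t * S t \<omega>\<bar>"]) (simp add: split_beta')
    also have "\<dots> \<le> (\<integral>\<^sup>+t. ennreal \<bar>f t\<bar> * ennreal (1 + V) \<partial>lborel)"
    proof (rule nn_integral_mono)
      fix t
      have "(\<integral>\<^sup>+\<omega>. ennreal \<bar>f t * S t \<omega>\<bar> \<partial>M) = ennreal \<bar>f t\<bar> * (\<integral>\<^sup>+\<omega>. ennreal \<bar>S t \<omega>\<bar> \<partial>M)"
        by (simp add: abs_mult ennreal_mult nn_integral_cmult)
      also have "(\<integral>\<^sup>+\<omega>. ennreal \<bar>S t \<omega>\<bar> \<partial>M) \<le> (\<integral>\<^sup>+\<omega>. ennreal (1\<^sup>2) + ennreal ((S t \<omega>)\<^sup>2) \<partial>M)"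
        using ab[of 1] by (intro nn_integral_mono) simp
      also have "\<dots> \<le> ennreal (1 + V)"
        using nnsq[of t] V0 by (subst nn_integral_add) (auto simp: emeasure_space_1 ennreal_plus intro!: add_left_mono)
      finally show "(\<integral>\<^sup>+\<omega>. ennreal \<bar>f t * S t \<omega>\<bar> \<partial>M) \<le> ennreal \<bar>f t\<bar> * ennreal (1 + V)" by (simp add: mult_left_mono)
    qed
    also have "\<dots> < \<infinity>" using fn by (simp add: nn_integral_multc ennreal_mult_less_top)
    finally have "AE \<omega> in M. (\<integral>\<^sup>+t. ennreal \<bar>f t * S t \<omega>\<bar> \<partial>lborel) \<noteq> \<infinity>"
      by (intro nn_integral_PInf_AE lborel.borel_measurable_nn_integral) (auto simp: split_beta')
    then show ?thesis using AE_space
    proof eventually_elim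
      case (elim \<omega>)
      then show ?case using S2[OF elim(2)] by (intro integrableI_bounded) (auto simp: less_top)
    qed
  qed
  define H where "H q \<omega> = f (fst q) * f (snd q) * (S (fst q) \<omega> * S (snd q) \<omega>)" for q \<omega>
  have Hm [measurable]: "(\<lambda>p. H (fst p) (snd p)) \<in> borel_measurable ((lborel \<Otimes>\<^sub>M lborel) \<Otimes>\<^sub>M M)"
    unfolding H_def by measurable
  have Hint: "integrable ((lborel \<Otimes>\<^sub>M lborel) \<Otimes>\<^sub>M M) (\<lambda>(q, \<omega>). H q \<omega>)"
  proof (rule integrableI_bounded)
    have "(\<integral>\<^sup>+p. ennreal (norm (case p of (q, \<omega>) \<Rightarrow> H q \<omega>)) \<partial>((lborel \<Otimes>\<^sub>M lborel) \<Otimes>\<^sub>M M)) = (\<integral>\<^sup>+q. \<integral>\<^sup>+\<omega>. ennreal \<bar>H q \<omega>\<bar> \<partial>M \<partial>(lborel \<Otimes>\<^sub>M lborel))"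
      by (subst nn_integral_fst[symmetric]) (simp_all add: split_beta')
    also have "\<dots> \<le> (\<integral>\<^sup>+q. (ennreal \<bar>f (fst q)\<bar> * ennreal \<bar>f (snd q)\<bar>) * ennreal (2 * V) \<partial>(lborel \<Otimes>\<^sub>M lborel))"
    proof (rule nn_integral_mono)
      fix q :: "'b \<times> 'b"
      have "(\<integral>\<^sup>+\<omega>. ennreal \<bar>H q \<omega>\<bar> \<partial>M) = (ennreal \<bar>f (fst q)\<bar> * ennreal \<bar>f (snd q)\<bar>) * (\<integral>\<^sup>+\<omega>. ennreal (\<bar>S (fst q) \<omega>\<bar> * \<bar>S (snd q) \<omega>\<bar>) \<partial>M)"
        by (simp add: H_def abs_mult ennreal_mult nn_integral_cmult mult.assoc)
      also have "\<dots> \<le> (ennreal \<bar>f (fst q)\<bar> * ennreal \<bar>f (snd q)\<bar>) * ennreal (2 * V)"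
        by (intro mult_left_mono nnprod) simp
      finally show "(\<integral>\<^sup>+\<omega>. ennreal \<bar>H q \<omega>\<bar> \<partial>M) \<le> (ennreal \<bar>f (fst q)\<bar> * ennreal \<bar>f (snd q)\<bar>) * ennreal (2 * V)" .
    qed
    also have "\<dots> = ((\<integral>\<^sup>+t. ennreal \<bar>f t\<bar> \<partial>lborel) * (\<integral>\<^sup>+t. ennreal \<bar>f t\<bar> \<partial>lborel)) * ennreal (2 * V)"
      by (subst nn_integral_multc, simp, subst lborel.nn_integral_fst[symmetric]) (simp_all add: nn_integral_cmult nn_integral_multc)
    also have "\<dots> < \<infinity>" using fn by (simp add: ennreal_mult_less_top)
    finally show "(\<integral>\<^sup>+p. ennreal (norm (case p of (q, \<omega>) \<Rightarrow> H q \<omega>)) \<partial>((lborel \<Otimes>\<^sub>M lborel) \<Otimes>\<^sub>M M)) < \<infinity>" .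
  qed (simp add: split_beta')
  have sq: "AE \<omega> in M. (\<integral>t. f t * S t \<omega> \<partial>lborel)\<^sup>2 = (\<integral>q. H q \<omega> \<partial>(lborel \<Otimes>\<^sub>M lborel))"
    using 1
  proof eventually_elim
    case (elim \<omega>)
    have "integrable (lborel \<Otimes>\<^sub>M lborel) (\<lambda>(t, s). (f t * S t \<omega>) * (f s * S s \<omega>))"
      by (rule integrable_pair_mult[OF lborel.sigma_finite_measure_axioms elim elim])
    from lborel_pair.integral_fst'[OF this]
    have "(\<integral>q. H q \<omega> \<partial>(lborel \<Otimes>\<^sub>M lborel)) = (\<integral>t. \<integral>s. (f t * S t \<omega>) * (f s * S s \<omega>) \<partial>lborel \<partial>lborel)"
      by (simp add: H_def split_beta' mult_ac)
    also have "\<dots> = (\<integral>t. f t * S t \<omega> \<partial>lborel) * (\<integral>s. f s * S s \<omega> \<partial>lborel)" by simp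
    finally show ?case by (simp add: power2_eq_square)
  qed
  have Hq: "integrable M (\<lambda>\<omega>. \<integral>q. H q \<omega> \<partial>(lborel \<Otimes>\<^sub>M lborel))"
    using P.integrable_snd[OF Hint] by simp
  have eq: "(\<integral>\<omega>. \<integral>q. H q \<omega> \<partial>(lborel \<Otimes>\<^sub>M lborel) \<partial>M) = (\<integral>q. \<integral>\<omega>. H q \<omega> \<partial>M \<partial>(lborel \<Otimes>\<^sub>M lborel))"
    using P.Fubini_integral[OF Hint] by simp
  have inner: "(\<integral>\<omega>. H q \<omega> \<partial>M) = f (fst q) * f (snd q) * expectation (\<lambda>\<omega>. S (fst q) \<omega> * S (snd q) \<omega>)" for q
    by (simp add: H_def)
  have "(\<integral>\<^sup>+\<omega>. ennreal ((\<integral>t. f t * S t \<omega> \<partial>lborel)\<^sup>2) \<partial>M) = (\<integral>\<^sup>+\<omega>. ennreal (\<integral>q. H q \<omega> \<partial>(lborel \<Otimes>\<^sub>M lborel)) \<partial>M)"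
    by (rule nn_integral_cong_AE) (use sq in auto)
  also have "\<dots> = ennreal (\<integral>\<omega>. \<integral>q. H q \<omega> \<partial>(lborel \<Otimes>\<^sub>M lborel) \<partial>M)"
  proof (rule nn_integral_eq_integral[OF Hq])
    show "AE \<omega> in M. 0 \<le> (\<integral>q. H q \<omega> \<partial>(lborel \<Otimes>\<^sub>M lborel))"
      using sq by eventually_elim (metis zero_le_power2)
  qed
  also have "\<dots> \<le> ennreal (norm (\<integral>q. \<integral>\<omega>. H q \<omega> \<partial>M \<partial>(lborel \<Otimes>\<^sub>M lborel)))"
    unfolding eq by (intro ennreal_leI) simp
  also have "\<dots> \<le> (\<integral>\<^sup>+q. ennreal (norm (\<integral>\<omega>. H q \<omega> \<partial>M)) \<partial>(lborel \<Otimes>\<^sub>M lborel))"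
    using P.integrable_fst[OF Hint] by (intro integral_norm_bound_ennreal) simp
  also have "\<dots> = (\<integral>\<^sup>+t. \<integral>\<^sup>+s. ennreal (norm (\<integral>\<omega>. H (t, s) \<omega> \<partial>M)) \<partial>lborel \<partial>lborel)"
    by (rule lborel.nn_integral_fst[symmetric]) measurable
  also have "\<dots> = (\<integral>\<^sup>+t. \<integral>\<^sup>+s. ennreal (\<bar>f t\<bar> * \<bar>f s\<bar> * \<bar>expectation (\<lambda>\<omega>. S t \<omega> * S s \<omega>)\<bar>) \<partial>lborel \<partial>lborel)"
    unfolding inner by (simp add: abs_mult)
  finally show "(\<integral>\<^sup>+\<omega>. ennreal ((\<integral>t. f t * S t \<omega> \<partial>lborel)\<^sup>2) \<partial>M)
      \<le> (\<integral>\<^sup>+t. \<integral>\<^sup>+s. ennreal (\<bar>f t\<bar> * \<bar>f s\<bar> * \<bar>expectation (\<lambda>\<omega>. S t \<omega> * S s \<omega>)\<bar>) \<partial>lborel \<partial>lborel)" .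
qed

text \<open>On the dyadic shell around radius \<open>(1/2) ^ k\<close> the kernel is at most a multiple of \<open>2 powr (k * p)\<close>, and the
  ball has volume \<open>2 powr (- k * d)\<close> up to a constant. The resulting geometric series converges as
  \<open>p < d\<close>.\<close>

lemma riesz_kernel_locally_integrable:
  assumes p: "0 \<le> p" "p < real DIM('a)"
  shows "(\<integral>\<^sup>+h. ennreal (norm h powr (- p)) * indicator (cball 0 1) h \<partial>(lborel :: 'a::euclidean_space measure)) < \<infinity>"
proof -
  let ?d = "DIM('a)"
  \<comment> \<open>the ratio of the geometric series over dyadic shells\<close>
  define \<rho> :: real where "\<rho> = 2 powr (p - real ?d)"
  have \<rho>: "0 < \<rho>" "\<rho> < 1" using p powr_less_mono[of "p - real ?d" 0 2] by (auto simp: \<rho>_def)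
  have pt: "ennreal (norm h powr (- p)) * indicator (cball 0 1) h
      \<le> (\<Sum>k. ennreal (2 powr (real (Suc k) * p)) * indicator (cball 0 ((1/2) ^ k)) h)" for h :: 'a
  proof (cases "h = 0 \<or> 1 < norm h")
    case True
    then have "ennreal (norm h powr (- p)) * indicator (cball 0 1) h = 0" by auto
    then show ?thesis by (simp only: zero_le)
  next
    case False
    then have h: "0 < norm h" "norm h \<le> 1" by auto
    obtain n where "(1/2 :: real) ^ n < norm h" using real_arch_pow_inv[OF h(1), of "1/2"] by auto
    then have ex: "\<exists>n. (1/2 :: real) ^ n < norm h" by blast
    \<comment> \<open>\<open>h\<close> lies in the dyadic shell between the radii \<open>(1/2) ^ Suc k\<close> and \<open>(1/2) ^ k\<close>\<close>
    define n where "n = (LEAST n. (1/2 :: real) ^ n < norm h)"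
    have n: "(1/2 :: real) ^ n < norm h" unfolding n_def by (rule LeastI_ex[OF ex])
    have "n \<noteq> 0" using n h by (cases n) auto
    then obtain k where k: "n = Suc k" by (cases n) auto
    define g where "g j = ennreal (2 powr (real (Suc j) * p)) * indicator (cball 0 ((1/2) ^ j)) h" for j
    have hk: "norm h \<le> (1/2) ^ k"
      using not_less_Least[of k "\<lambda>n. (1/2 :: real) ^ n < norm h"] k by (auto simp: n_def not_less)
    have "norm h powr (- p) \<le> ((1/2) ^ Suc k) powr (- p)"
      using n k p h by (intro powr_mono2') auto
    also have "((1/2 :: real) ^ Suc k) powr (- p) = 2 powr (real (Suc k) * p)"
    proof -
      have "(1/2 :: real) ^ Suc k = 2 powr (- real (Suc k))" by (subst powr_minus) (simp add: powr_realpow power_one_over field_simps del: power_Suc of_nat_Suc)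
      then show ?thesis by (simp only: powr_powr) (simp add: algebra_simps)
    qed
    finally have "ennreal (norm h powr (- p)) * indicator (cball 0 1) h \<le> ennreal (2 powr (real (Suc k) * p)) * indicator (cball 0 ((1/2) ^ k)) h"
      using h hk by (simp add: ennreal_leI indicator_def)
    also have "\<dots> = g k" by (simp only: g_def)
    also have "\<dots> = sum g {k}" by simp
    also have "\<dots> \<le> suminf g" by (rule sum_le_suminf) auto
    finally show ?thesis by (simp only: g_def[abs_def])
  qed
  have "(\<integral>\<^sup>+h. ennreal (norm h powr (- p)) * indicator (cball 0 1) h \<partial>(lborel :: 'a measure))
    \<le> (\<integral>\<^sup>+h. (\<Sum>k. ennreal (2 powr (real (Suc k) * p)) * indicator (cball 0 ((1/2) ^ k)) h) \<partial>(lborel :: 'a measure))"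
    by (rule nn_integral_mono) (rule pt)
  also have "\<dots> = (\<Sum>k. ennreal (2 powr (real (Suc k) * p)) * emeasure lborel (cball (0::'a) ((1/2) ^ k)))"
  proof -
    define H where "H k h = ennreal (2 powr (real (Suc k) * p)) * indicator (cball (0::'a) ((1/2) ^ k)) h" for k h
    have Hm: "H k \<in> borel_measurable lborel" for k
      unfolding H_def[abs_def] by (intro borel_measurable_times_ennreal borel_measurable_const borel_measurable_indicator) simp
    have "(\<integral>\<^sup>+h. (\<Sum>k. H k h) \<partial>lborel) = (\<Sum>k. \<integral>\<^sup>+h. H k h \<partial>lborel)"
      by (rule nn_integral_suminf[OF Hm])
    also have "\<dots> = (\<Sum>k. ennreal (2 powr (real (Suc k) * p)) * emeasure lborel (cball (0::'a) ((1/2) ^ k)))"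
      unfolding H_def by (intro suminf_cong nn_integral_cmult_indicator) simp
    finally show ?thesis unfolding H_def .
  qed
  also have "\<dots> = (\<Sum>k. ennreal (2 powr p * unit_ball_vol (real ?d) * \<rho> ^ k))"
  proof (intro suminf_cong)
    fix k
    have "2 powr (real (Suc k) * p) * ((1/2) ^ k) ^ ?d = 2 powr p * \<rho> ^ k"
    proof -
      have "((1/2 :: real) ^ k) ^ ?d = 2 powr (- (real k * real ?d))"
        by (simp add: powr_minus powr_realpow[symmetric] power_mult[symmetric] power_one_over inverse_eq_divide powr_powr)
      moreover have "\<rho> ^ k = 2 powr ((p - real ?d) * real k)"
        by (simp add: \<rho>_def powr_realpow[symmetric] powr_powr)
      ultimately show ?thesis by (simp add: powr_add[symmetric] algebra_simps)
    qed
    then have e: "2 powr (real (Suc k) * p) * (unit_ball_vol (real ?d) * ((1/2) ^ k) ^ ?d) = 2 powr p * unit_ball_vol (real ?d) * \<rho> ^ k"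
      by (simp only: mult_ac)
    have "emeasure lborel (cball (0::'a) ((1/2) ^ k)) = ennreal (unit_ball_vol (real ?d) * ((1/2) ^ k) ^ ?d)"
      by (rule emeasure_cball) simp
    then show "ennreal (2 powr (real (Suc k) * p)) * emeasure lborel (cball (0::'a) ((1/2) ^ k)) = ennreal (2 powr p * unit_ball_vol (real ?d) * \<rho> ^ k)"
      by (simp only: ennreal_mult'[symmetric] powr_ge_zero e)
  qed
  also have "\<dots> < \<infinity>"
  proof -
    have "summable (\<lambda>k. 2 powr p * unit_ball_vol (real ?d) * \<rho> ^ k)"
      using \<rho> by (intro summable_mult summable_geometric) simp
    moreover have "0 \<le> 2 powr p * unit_ball_vol (real ?d) * \<rho> ^ k" for k using \<rho> by simp
    ultimately have "(\<Sum>k. ennreal (2 powr p * unit_ball_vol (real ?d) * \<rho> ^ k)) \<noteq> top"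
      by (intro ennreal_suminf_neq_top)
    then show ?thesis by (simp add: less_top)
  qed
  finally show ?thesis .
qed

text \<open>Near the diagonal the boundedness of \<open>\<phi>\<close> and local integrability of the kernel are used; away
  from it the kernel is at most 1.\<close>

lemma integrable_riesz_energy:
  fixes \<phi> :: "'a::euclidean_space \<Rightarrow> real"
  assumes phi: "integrable lborel \<phi>" and C: "\<And>v. \<bar>\<phi> v\<bar> \<le> C" and p: "0 \<le> p" "p < real DIM('a)"
  shows "integrable (lborel \<Otimes>\<^sub>M lborel) (\<lambda>q. \<bar>\<phi> (fst q)\<bar> * \<bar>\<phi> (snd q)\<bar> * norm (fst q - snd q) powr (- p))"
proof (rule integrableI_bounded)
  have [measurable]: "\<phi> \<in> borel_measurable borel" using phi by auto
  show m: "(\<lambda>q. \<bar>\<phi> (fst q)\<bar> * \<bar>\<phi> (snd q)\<bar> * norm (fst q - snd q) powr (- p)) \<in> borel_measurable (lborel \<Otimes>\<^sub>M lborel)"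
    by measurable
  have C0: "0 \<le> C" using C[of undefined] by simp
  define N where "N = (\<integral>\<^sup>+t. ennreal \<bar>\<phi> t\<bar> \<partial>lborel)"
  define J where "J = (\<integral>\<^sup>+h. ennreal (norm h powr (- p)) * indicator (cball 0 1) h \<partial>(lborel :: 'a measure))"
  have N: "N < \<infinity>" using phi by (simp add: N_def integrable_iff_bounded)
  have J: "J < \<infinity>" unfolding J_def by (rule riesz_kernel_locally_integrable[OF p])
  have ball_m [measurable]: "(\<lambda>s. indicator (cball (0::'a) 1) (t - s) :: ennreal) \<in> borel_measurable borel" for t
  proof -
    have "(indicator (cball (0::'a) 1) :: 'a \<Rightarrow> ennreal) \<in> borel_measurable borel"
      by (rule borel_measurable_indicator) simp
    from measurable_compose[OF _ this, of "\<lambda>s. t - s" borel] show ?thesis by simp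
  qed
  have inner: "(\<integral>\<^sup>+s. ennreal (\<bar>\<phi> s\<bar> * norm (t - s) powr (- p)) \<partial>lborel) \<le> ennreal C * J + N" for t
  proof -
    have "(\<integral>\<^sup>+s. ennreal (\<bar>\<phi> s\<bar> * norm (t - s) powr (- p)) \<partial>lborel)
      \<le> (\<integral>\<^sup>+s. ennreal C * (ennreal (norm (t - s) powr (- p)) * indicator (cball 0 1) (t - s)) + ennreal \<bar>\<phi> s\<bar> \<partial>lborel)"
    proof (rule nn_integral_mono)
      fix s
      show "ennreal (\<bar>\<phi> s\<bar> * norm (t - s) powr (- p)) \<le> ennreal C * (ennreal (norm (t - s) powr (- p)) * indicator (cball 0 1) (t - s)) + ennreal \<bar>\<phi> s\<bar>"
      proof (cases "norm (t - s) \<le> 1")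
        case True
        have "ennreal (\<bar>\<phi> s\<bar> * norm (t - s) powr (- p)) \<le> ennreal (C * norm (t - s) powr (- p))"
          by (intro ennreal_leI mult_right_mono C) simp
        then show ?thesis using True C0 by (simp add: ennreal_mult add_increasing2)
      next
        case False
        then have "norm (t - s) powr (- p) \<le> 1"
          using p powr_mono2'[of "- p" 1 "norm (t - s)"] by simp
        then have "\<bar>\<phi> s\<bar> * norm (t - s) powr (- p) \<le> \<bar>\<phi> s\<bar>" by (rule mult_left_le) simp
        then show ?thesis by (intro add_increasing ennreal_leI) auto
      qed
    qed
    also have "\<dots> = ennreal C * (\<integral>\<^sup>+s. ennreal (norm (t - s) powr (- p)) * indicator (cball 0 1) (t - s) \<partial>lborel) + N"
      unfolding N_def by (subst nn_integral_add) (simp_all add: nn_integral_cmult)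
    also have "(\<integral>\<^sup>+s. ennreal (norm (t - s) powr (- p)) * indicator (cball 0 1) (t - s) \<partial>lborel) = J"
    proof -
      have [measurable]: "cball (0::'a) 1 \<in> sets borel" by simp
      have "(\<lambda>h. ennreal (norm h powr (- p)) * indicator (cball (0::'a) 1) h) \<in> borel_measurable borel" by measurable
      then show ?thesis unfolding J_def by (rule nn_integral_reflect)
    qed
    finally show ?thesis .
  qed
  have "(\<integral>\<^sup>+q. ennreal (norm (\<bar>\<phi> (fst q)\<bar> * \<bar>\<phi> (snd q)\<bar> * norm (fst q - snd q) powr (- p))) \<partial>(lborel \<Otimes>\<^sub>M lborel))
    = (\<integral>\<^sup>+t. \<integral>\<^sup>+s. ennreal (norm (\<bar>\<phi> t\<bar> * \<bar>\<phi> s\<bar> * norm (t - s) powr (- p))) \<partial>lborel \<partial>lborel)"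
    by (subst lborel.nn_integral_fst[symmetric]) simp_all
  also have "\<dots> = (\<integral>\<^sup>+t. ennreal \<bar>\<phi> t\<bar> * (\<integral>\<^sup>+s. ennreal (\<bar>\<phi> s\<bar> * norm (t - s) powr (- p)) \<partial>lborel) \<partial>lborel)"
    by (subst nn_integral_cmult[symmetric]) (simp_all add: ennreal_mult[symmetric] abs_mult mult.assoc)
  also have "\<dots> \<le> (\<integral>\<^sup>+t. ennreal \<bar>\<phi> t\<bar> * (ennreal C * J + N) \<partial>lborel)"
    by (intro nn_integral_mono mult_left_mono inner) simp
  also have "\<dots> = N * (ennreal C * J + N)" unfolding N_def by (rule nn_integral_multc) simp
  also have "\<dots> < \<infinity>" using N J by (simp add: ennreal_mult_less_top)
  finally show "(\<integral>\<^sup>+q. ennreal (norm (\<bar>\<phi> (fst q)\<bar> * \<bar>\<phi> (snd q)\<bar> * norm (fst q - snd q) powr (- p))) \<partial>(lborel \<Otimes>\<^sub>M lborel)) < \<infinity>" .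
qed

section \<open>Negligibility of the residual\<close>

locale heavy_tailed_grain_model = random_grain_model M u \<Xi> \<Xi>s + heavy_tailed_grain M \<Xi> \<alpha> c
  for M :: "'w measure" and u :: "nat \<Rightarrow> 'w \<Rightarrow> 'a::euclidean_space"
    and \<Xi> :: "'w \<Rightarrow> 'a set" and \<Xi>s :: "nat \<Rightarrow> 'w \<Rightarrow> 'a set" and \<alpha> c :: real
begin

definition decay_exponent :: real where
  "decay_exponent = (\<alpha> - 1) * real DIM('a) / \<alpha>"

lemma decay_exponent_pos: "0 < decay_exponent" using alpha by (simp add: decay_exponent_def)

lemma localization_decay: "((\<lambda>l. l powr decay_exponent * enn2real (mass_outside l)) \<longlongrightarrow> 0) at_top"
  using localization_tendsto unfolding decay_exponent_def .

text \<open>This is where \<open>\<alpha> < 2\<close> makes the square of the overlap integrable near the diagonal.\<close>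

lemma decay_exponent_less: "2 * decay_exponent < real DIM('a)"
proof -
  have "2 * (\<alpha> - 1) < \<alpha>" using alpha by simp
  then have "2 * (\<alpha> - 1) * real DIM('a) < \<alpha> * real DIM('a)" by (intro mult_strict_right_mono) auto
  then show ?thesis using alpha by (simp add: decay_exponent_def field_simps)
qed

lemma scaling_volume: "0 < l \<Longrightarrow> l ^ DIM('a) * scaling l = l powr decay_exponent"
proof -
  assume l: "0 < l"
  have "real DIM('a) + - real DIM('a) / \<alpha> = decay_exponent" using alpha by (simp add: decay_exponent_def field_simps)
  then show ?thesis using l by (simp add: scaling_def powr_realpow[symmetric] powr_add[symmetric])
qed

lemma overlap_mass_outside: "t \<noteq> s \<Longrightarrow> overlap t s \<le> 2 * enn2real (mass_outside (norm (t - s) / 3))"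
proof -
  assume "t \<noteq> s"
  have eq: "ennreal (enn2real (mass_outside x)) = mass_outside x" for x
    using mass_outside_finite[of x] by simp
  have "ennreal (overlap t s) \<le> 2 * ennreal (enn2real (mass_outside (norm (t - s) / 3)))"
    unfolding eq unfolding mass_outside_def by (rule overlap_outside) fact
  then have "ennreal (overlap t s) \<le> ennreal (2 * enn2real (mass_outside (norm (t - s) / 3)))"
    by (simp add: ennreal_mult)
  then show ?thesis by (subst (asm) ennreal_le_iff) auto
qed

lemma mass_outside_le: "enn2real (mass_outside x) \<le> mean_vol"
proof -
  have "mass_outside x \<le> (\<integral>\<^sup>+\<omega>. emeasure lborel (\<Xi> \<omega>) \<partial>M)"
    unfolding mass_outside_def by (intro nn_integral_mono emeasure_mono) (auto simp: Xi_borel)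
  then show ?thesis unfolding mean_volume_def using mean_finite by (intro enn2real_mono) auto
qed

lemma decay_bound:
  obtains K where "0 \<le> K" "\<And>x. 0 < x \<Longrightarrow> x powr decay_exponent * enn2real (mass_outside x) \<le> K"
proof -
  have "\<forall>\<^sub>F x in at_top. x powr decay_exponent * enn2real (mass_outside x) < 1"
    using localization_decay by (rule order_tendstoD(2)) simp
  then obtain x0 where x0: "\<And>x. x0 \<le> x \<Longrightarrow> x powr decay_exponent * enn2real (mass_outside x) < 1"
    by (auto simp: eventually_at_top_linorder)
  show thesis
  proof (rule that[of "max 1 (x0 powr decay_exponent * mean_vol)"])
    fix x :: real assume x: "0 < x"
    show "x powr decay_exponent * enn2real (mass_outside x) \<le> max 1 (x0 powr decay_exponent * mean_vol)"
    proof (cases "x0 \<le> x")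
      case True
      then show ?thesis using x0[OF True] by simp
    next
      case False
      have "x powr decay_exponent * enn2real (mass_outside x) \<le> x0 powr decay_exponent * mean_vol"
        using False x decay_exponent_pos by (intro mult_mono powr_mono2 mass_outside_le) auto
      then show ?thesis by simp
    qed
  qed simp
qed

text \<open>For fixed distinct \<open>t\<close> and \<open>s\<close> the rescaled overlap tends to 0 by localization. It is
  dominated by a Riesz kernel of order \<open>2 * decay_exponent\<close>, whose energy is finite.\<close>

lemma overlap_energy_limit:
  fixes \<phi> :: "'a \<Rightarrow> real"
  assumes phi: "integrable lborel \<phi>" and C: "\<And>v. \<bar>\<phi> v\<bar> \<le> C"
  shows "((\<lambda>l. \<integral>\<^sup>+t. \<integral>\<^sup>+s. ennreal (\<bar>\<phi> t\<bar> * \<bar>\<phi> s\<bar> * (l powr decay_exponent * overlap (l *\<^sub>R t) (l *\<^sub>R s))\<^sup>2) \<partial>lborel \<partial>lborel) \<longlongrightarrow> 0) at_top"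
proof -
  let ?q = "decay_exponent"
  have [measurable]: "\<phi> \<in> borel_measurable borel" using phi by auto
  obtain K where K: "0 \<le> K" "\<And>x. 0 < x \<Longrightarrow> x powr ?q * enn2real (mass_outside x) \<le> K"
    using decay_bound by blast
  define G where "G l p = \<bar>\<phi> (fst p)\<bar> * \<bar>\<phi> (snd p)\<bar> * (l powr ?q * overlap (l *\<^sub>R fst p) (l *\<^sub>R snd p))\<^sup>2" for l and p :: "'a \<times> 'a"
  have ovm [measurable]: "(\<lambda>p. overlap (l *\<^sub>R fst p) (l *\<^sub>R snd p)) \<in> borel_measurable (borel \<Otimes>\<^sub>M borel)" for l
  proof -
    have "(\<lambda>p :: 'a \<times> 'a. (l *\<^sub>R fst p, l *\<^sub>R snd p)) \<in> measurable (borel \<Otimes>\<^sub>M borel) (borel \<Otimes>\<^sub>M borel)" by measurable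
    from measurable_compose[OF this overlap_measurable] show ?thesis by simp
  qed
  have Gm [measurable]: "G l \<in> borel_measurable (lborel \<Otimes>\<^sub>M lborel)" for l
    unfolding G_def by measurable
  have key: "l powr ?q * overlap (l *\<^sub>R t) (l *\<^sub>R s)
      \<le> 2 * ((norm (t - s) / 3) powr (- ?q) * ((l * (norm (t - s) / 3)) powr ?q * enn2real (mass_outside (l * (norm (t - s) / 3)))))"
    if l: "0 < l" and ts: "t \<noteq> s" for l t s
  proof -
    have n: "norm (l *\<^sub>R t - l *\<^sub>R s) / 3 = l * (norm (t - s) / 3)"
      using l by (simp add: scaleR_diff_right[symmetric])
    have "overlap (l *\<^sub>R t) (l *\<^sub>R s) \<le> 2 * enn2real (mass_outside (l * (norm (t - s) / 3)))"
      using overlap_mass_outside[of "l *\<^sub>R t" "l *\<^sub>R s"] l ts unfolding n by simp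
    then have "l powr ?q * overlap (l *\<^sub>R t) (l *\<^sub>R s) \<le> l powr ?q * (2 * enn2real (mass_outside (l * (norm (t - s) / 3))))"
      by (rule mult_left_mono) simp
    moreover have "l powr ?q = (norm (t - s) / 3) powr (- ?q) * (l * (norm (t - s) / 3)) powr ?q"
      using l ts by (simp add: powr_mult powr_divide powr_minus field_simps)
    ultimately show ?thesis by (simp only: mult_ac)
  qed
  have AEne: "AE p in lborel \<Otimes>\<^sub>M lborel. fst p \<noteq> (snd p :: 'a)"
  proof (rule lborel_pair.AE_pair_measure)
    show "{p \<in> space (lborel \<Otimes>\<^sub>M lborel). fst p \<noteq> (snd p :: 'a)} \<in> sets (lborel \<Otimes>\<^sub>M lborel)" by measurable
    have "AE y in lborel. x \<noteq> y" for x :: 'a using AE_lborel_singleton[of x] by eventually_elim simp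
    then show "AE x in lborel. AE y in lborel. fst (x, y) \<noteq> (snd (x, y) :: 'a)" by simp
  qed
  have Gle: "G l p \<le> (2 * (3 powr ?q * K))\<^sup>2 * (\<bar>\<phi> (fst p)\<bar> * \<bar>\<phi> (snd p)\<bar> * norm (fst p - snd p) powr (- (2 * ?q)))"
    if l: "0 < l" and ne: "fst p \<noteq> snd p" for l p
  proof -
    let ?h = "norm (fst p - snd p)"
    have h: "0 < ?h" using ne by simp
    have "l powr ?q * overlap (l *\<^sub>R fst p) (l *\<^sub>R snd p) \<le> 2 * ((?h / 3) powr (- ?q) * K)"
      by (rule order_trans[OF key[OF l ne]]) (use K(2)[of "l * (?h / 3)"] l h in \<open>auto intro!: mult_left_mono\<close>)
    also have "(?h / 3) powr (- ?q) = 3 powr ?q * ?h powr (- ?q)" using h by (simp add: powr_divide powr_minus field_simps)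
    finally have "l powr ?q * overlap (l *\<^sub>R fst p) (l *\<^sub>R snd p) \<le> 2 * (3 powr ?q * K) * ?h powr (- ?q)" by (simp add: mult_ac)
    then have "(l powr ?q * overlap (l *\<^sub>R fst p) (l *\<^sub>R snd p))\<^sup>2 \<le> (2 * (3 powr ?q * K) * ?h powr (- ?q))\<^sup>2"
      by (rule power_mono) (simp add: overlap_nonneg)
    also have "\<dots> = (2 * (3 powr ?q * K))\<^sup>2 * ?h powr (- (2 * ?q))"
      using h by (simp add: power_mult_distrib power2_eq_square[of "?h powr _"] powr_add[symmetric])
    finally have "\<bar>\<phi> (fst p)\<bar> * \<bar>\<phi> (snd p)\<bar> * (l powr ?q * overlap (l *\<^sub>R fst p) (l *\<^sub>R snd p))\<^sup>2
      \<le> \<bar>\<phi> (fst p)\<bar> * \<bar>\<phi> (snd p)\<bar> * ((2 * (3 powr ?q * K))\<^sup>2 * ?h powr (- (2 * ?q)))"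
      by (rule mult_left_mono) simp
    then show ?thesis by (simp add: G_def mult_ac)
  qed
  have G0: "0 \<le> G l p" for l p by (simp add: G_def)
  have bound_int: "integrable (lborel \<Otimes>\<^sub>M lborel) (\<lambda>p. (2 * (3 powr ?q * K))\<^sup>2 * (\<bar>\<phi> (fst p)\<bar> * \<bar>\<phi> (snd p)\<bar> * norm (fst p - snd p) powr (- (2 * ?q))))"
    using decay_exponent_pos decay_exponent_less by (intro integrable_mult_right integrable_riesz_energy[OF phi C]) auto
  have "((\<lambda>l. integral\<^sup>L (lborel \<Otimes>\<^sub>M lborel) (G l)) \<longlongrightarrow> (\<integral>p. 0 \<partial>(lborel \<Otimes>\<^sub>M lborel :: ('a \<times> 'a) measure))) at_top"
  proof (rule integral_dominated_convergence_at_top[OF _ _ bound_int])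
    show "\<forall>\<^sub>F l in at_top. AE p in lborel \<Otimes>\<^sub>M lborel. norm (G l p) \<le> (2 * (3 powr ?q * K))\<^sup>2 * (\<bar>\<phi> (fst p)\<bar> * \<bar>\<phi> (snd p)\<bar> * norm (fst p - snd p) powr (- (2 * ?q)))"
      using eventually_gt_at_top[of 0]
    proof eventually_elim
      case (elim l)
      show ?case using AEne by eventually_elim (use Gle[OF elim] G0 in auto)
    qed
    show "AE p in lborel \<Otimes>\<^sub>M lborel. ((\<lambda>l. G l p) \<longlongrightarrow> 0) at_top"
      using AEne
    proof eventually_elim
      case (elim p)
      let ?h = "norm (fst p - snd p) / 3"
      have h: "0 < ?h" using elim by simp
      have "filterlim (\<lambda>l. l * ?h) at_top at_top"
        using h by (intro filterlim_at_top_mult_tendsto_pos[OF tendsto_const] filterlim_ident) auto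
      from filterlim_compose[OF localization_decay this]
      have lim: "((\<lambda>l. 2 * (?h powr (- ?q) * ((l * ?h) powr ?q * enn2real (mass_outside (l * ?h))))) \<longlongrightarrow> 0) at_top"
        by (intro tendsto_mult_right_zero)
      have "((\<lambda>l. l powr ?q * overlap (l *\<^sub>R fst p) (l *\<^sub>R snd p)) \<longlongrightarrow> 0) at_top"
      proof (rule tendsto_sandwich[OF _ _ tendsto_const lim])
        show "\<forall>\<^sub>F l in at_top. 0 \<le> l powr ?q * overlap (l *\<^sub>R fst p) (l *\<^sub>R snd p)"
          by (simp add: overlap_nonneg)
        show "\<forall>\<^sub>F l in at_top. l powr ?q * overlap (l *\<^sub>R fst p) (l *\<^sub>R snd p) \<le> 2 * (?h powr (- ?q) * ((l * ?h) powr ?q * enn2real (mass_outside (l * ?h))))"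
          using eventually_gt_at_top[of 0] by eventually_elim (rule key[OF _ elim])
      qed
      from tendsto_mult_right_zero[OF tendsto_mult_zero[OF this this], of "\<bar>\<phi> (fst p)\<bar> * \<bar>\<phi> (snd p)\<bar>"]
      show ?case by (simp add: G_def power2_eq_square)
    qed
  qed measurable
  then have lim: "((\<lambda>l. ennreal (integral\<^sup>L (lborel \<Otimes>\<^sub>M lborel) (G l))) \<longlongrightarrow> 0) at_top"
    using tendsto_ennrealI by fastforce
  show ?thesis
  proof (rule Lim_transform_eventually[OF lim eventually_mono[OF eventually_gt_at_top[of 0]]])
    fix l :: real assume l: "0 < l"
    have Gi: "integrable (lborel \<Otimes>\<^sub>M lborel) (G l)"
    proof (rule Bochner_Integration.integrable_bound[OF bound_int Gm])
      show "AE p in lborel \<Otimes>\<^sub>M lborel. norm (G l p) \<le> norm ((2 * (3 powr ?q * K))\<^sup>2 * (\<bar>\<phi> (fst p)\<bar> * \<bar>\<phi> (snd p)\<bar> * norm (fst p - snd p) powr (- (2 * ?q))))"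
        using AEne by eventually_elim (use Gle[OF l] G0 in auto)
    qed
    have "ennreal (integral\<^sup>L (lborel \<Otimes>\<^sub>M lborel) (G l)) = (\<integral>\<^sup>+p. ennreal (G l p) \<partial>(lborel \<Otimes>\<^sub>M lborel))"
      using Gi by (intro nn_integral_eq_integral[symmetric]) (auto simp: G0)
    also have "\<dots> = (\<integral>\<^sup>+t. \<integral>\<^sup>+s. ennreal (G l (t, s)) \<partial>lborel \<partial>lborel)"
      by (rule lborel.nn_integral_fst[symmetric]) measurable
    finally show "ennreal (integral\<^sup>L (lborel \<Otimes>\<^sub>M lborel) (G l)) = (\<integral>\<^sup>+t. \<integral>\<^sup>+s. ennreal (\<bar>\<phi> t\<bar> * \<bar>\<phi> s\<bar> * (l powr ?q * overlap (l *\<^sub>R t) (l *\<^sub>R s))\<^sup>2) \<partial>lborel \<partial>lborel)"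
      by (simp add: G_def)
  qed
qed

definition centred_residual :: "nat \<Rightarrow> 'a \<Rightarrow> 'w \<Rightarrow> real" where
  "centred_residual k t \<omega> = residual k t \<omega> - expectation (residual k t)"

lemma expectation_residual_const: "1 \<le> k \<Longrightarrow> expectation (residual k t) = expectation (residual k 0)"
  by (rule residual_covariance(2))

lemma centred_residual_measurable:
  assumes k: "1 \<le> k"
  shows "(\<lambda>p. centred_residual k (fst p) (snd p)) \<in> borel_measurable (borel \<Otimes>\<^sub>M M)"
proof -
  define m where "m = expectation (residual k 0)"
  have "(\<lambda>p. centred_residual k (fst p) (snd p)) = (\<lambda>p. residual k (fst p) (snd p) - m)"
    using expectation_residual_const[OF k] by (auto simp: centred_residual_def m_def)
  then show ?thesis by simp
qed

lemma centred_residual_covariance: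
  assumes k: "1 \<le> k"
  shows "integrable M (\<lambda>\<omega>. centred_residual k t \<omega> * centred_residual k s \<omega>)"
    and "\<bar>expectation (\<lambda>\<omega>. centred_residual k t \<omega> * centred_residual k s \<omega>)\<bar> \<le> (mean_vol + 2) * (overlap t s)\<^sup>2"
proof -
  let ?\<rho> = "expectation (residual k 0)"
  note e = expectation_residual_const[OF k]
  have eq: "centred_residual k t \<omega> * centred_residual k s \<omega>
    = residual k t \<omega> * residual k s \<omega> - ?\<rho> * residual k t \<omega> - ?\<rho> * residual k s \<omega> + ?\<rho> * ?\<rho>" for \<omega>
    by (simp add: centred_residual_def e[of t] e[of s] algebra_simps)
  note i = residual_covariance(1)[OF k] residual_covariance(3)[OF k]
  show "integrable M (\<lambda>\<omega>. centred_residual k t \<omega> * centred_residual k s \<omega>)"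
    unfolding eq using i by simp
  have "expectation (\<lambda>\<omega>. centred_residual k t \<omega> * centred_residual k s \<omega>)
    = expectation (\<lambda>\<omega>. residual k t \<omega> * residual k s \<omega>) - (expectation (residual k t))\<^sup>2"
    unfolding eq using i by (simp add: e[of t] e[of s] prob_space power2_eq_square)
  then have "\<bar>expectation (\<lambda>\<omega>. centred_residual k t \<omega> * centred_residual k s \<omega>)\<bar> \<le> (overlap t s + 2) * (overlap t s)\<^sup>2"
    using residual_covariance(4)[OF k, of t s] by simp
  also have "\<dots> \<le> (mean_vol + 2) * (overlap t s)\<^sup>2"
    using overlap_le[of t s] by (intro mult_right_mono) auto
  finally show "\<bar>expectation (\<lambda>\<omega>. centred_residual k t \<omega> * centred_residual k s \<omega>)\<bar> \<le> (mean_vol + 2) * (overlap t s)\<^sup>2" .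
qed

text \<open>The second moment is a double integral of covariances. In the coordinates of the window the factors
  \<open>(l ^ DIM('a) * scaling l)\<^sup>2 = (l powr decay_exponent)\<^sup>2\<close> are absorbed by the square of the
  overlap.\<close>

theorem residual_integral_negligible:
  fixes \<phi> :: "'a \<Rightarrow> real"
  assumes k: "1 \<le> k" and phi: "integrable lborel \<phi>" and C: "\<And>v. \<bar>\<phi> v\<bar> \<le> C"
  shows "((\<lambda>l. \<integral>\<^sup>+\<omega>. ennreal ((scaling l * (\<integral>t. \<phi> (t /\<^sub>R l) * centred_residual k t \<omega> \<partial>lborel))\<^sup>2) \<partial>M) \<longlongrightarrow> 0) at_top"
    and "0 < l \<Longrightarrow> AE \<omega> in M. integrable lborel (\<lambda>t. \<phi> (t /\<^sub>R l) * centred_residual k t \<omega>)"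
proof -
  let ?q = "decay_exponent"
  have [measurable]: "\<phi> \<in> borel_measurable borel" using phi by auto
  have phil: "integrable lborel (\<lambda>t. \<phi> (t /\<^sub>R l))" if "0 < l" for l
    using integrable_lborel_affine[OF phi, of "inverse l" 0] that by simp
  have sq: "integrable M (\<lambda>\<omega>. (centred_residual k t \<omega>)\<^sup>2)" "expectation (\<lambda>\<omega>. (centred_residual k t \<omega>)\<^sup>2) \<le> (mean_vol + 2) * mean_vol\<^sup>2" for t
    using centred_residual_covariance[OF k, of t t] by (simp_all add: power2_eq_square overlap_same)
  note sm = second_moment_of_integral[OF centred_residual_measurable[OF k] phil sq]
  show "0 < l \<Longrightarrow> AE \<omega> in M. integrable lborel (\<lambda>t. \<phi> (t /\<^sub>R l) * centred_residual k t \<omega>)"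
    by (rule sm(1))
  have ovm [measurable]: "(\<lambda>x. overlap (f x) (g x)) \<in> borel_measurable N" if "f \<in> borel_measurable N" "g \<in> borel_measurable N" for f g and N :: "'z measure"
    using measurable_compose[OF measurable_Pair[OF that] overlap_measurable] by simp
  have bound: "(\<integral>\<^sup>+\<omega>. ennreal ((scaling l * (\<integral>t. \<phi> (t /\<^sub>R l) * centred_residual k t \<omega> \<partial>lborel))\<^sup>2) \<partial>M)
    \<le> ennreal (mean_vol + 2) * (\<integral>\<^sup>+t. \<integral>\<^sup>+s. ennreal (\<bar>\<phi> t\<bar> * \<bar>\<phi> s\<bar> * (l powr ?q * overlap (l *\<^sub>R t) (l *\<^sub>R s))\<^sup>2) \<partial>lborel \<partial>lborel)"
    if l: "0 < l" for l
  proof -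
    have cm: "(\<lambda>\<omega>. \<integral>t. \<phi> (t /\<^sub>R l) * centred_residual k t \<omega> \<partial>lborel) \<in> borel_measurable M"
    proof (rule lborel.borel_measurable_lebesgue_integral)
      have "(\<lambda>p. centred_residual k (snd p) (fst p)) \<in> borel_measurable (M \<Otimes>\<^sub>M borel)"
        using measurable_compose[OF measurable_pair_swap' centred_residual_measurable[OF k]] by (simp add: split_beta')
      then show "(\<lambda>(\<omega>, t). \<phi> (t /\<^sub>R l) * centred_residual k t \<omega>) \<in> borel_measurable (M \<Otimes>\<^sub>M lborel)"
        by (simp add: split_beta')
    qed
    have "(\<integral>\<^sup>+\<omega>. ennreal ((scaling l * (\<integral>t. \<phi> (t /\<^sub>R l) * centred_residual k t \<omega> \<partial>lborel))\<^sup>2) \<partial>M)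
      = ennreal ((scaling l)\<^sup>2) * (\<integral>\<^sup>+\<omega>. ennreal ((\<integral>t. \<phi> (t /\<^sub>R l) * centred_residual k t \<omega> \<partial>lborel)\<^sup>2) \<partial>M)"
      using cm by (simp add: power_mult_distrib ennreal_mult nn_integral_cmult)
    also have "\<dots> \<le> ennreal ((scaling l)\<^sup>2) * (\<integral>\<^sup>+t. \<integral>\<^sup>+s. ennreal (\<bar>\<phi> (t /\<^sub>R l)\<bar> * \<bar>\<phi> (s /\<^sub>R l)\<bar> * \<bar>expectation (\<lambda>\<omega>. centred_residual k t \<omega> * centred_residual k s \<omega>)\<bar>) \<partial>lborel \<partial>lborel)"
      by (intro mult_left_mono sm(2)[OF l]) simp
    also have "\<dots> \<le> ennreal ((scaling l)\<^sup>2) * (\<integral>\<^sup>+t. \<integral>\<^sup>+s. ennreal (\<bar>\<phi> (t /\<^sub>R l)\<bar> * \<bar>\<phi> (s /\<^sub>R l)\<bar> * ((mean_vol + 2) * (overlap t s)\<^sup>2)) \<partial>lborel \<partial>lborel)"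
      by (intro mult_left_mono nn_integral_mono ennreal_leI centred_residual_covariance(2)[OF k]) auto
    also have "(\<integral>\<^sup>+t. \<integral>\<^sup>+s. ennreal (\<bar>\<phi> (t /\<^sub>R l)\<bar> * \<bar>\<phi> (s /\<^sub>R l)\<bar> * ((mean_vol + 2) * (overlap t s)\<^sup>2)) \<partial>lborel \<partial>lborel)
      = (\<integral>\<^sup>+t. ennreal (l ^ DIM('a)) * (\<integral>\<^sup>+s. ennreal (\<bar>\<phi> (t /\<^sub>R l)\<bar> * \<bar>\<phi> s\<bar> * ((mean_vol + 2) * (overlap t (l *\<^sub>R s))\<^sup>2)) \<partial>lborel) \<partial>lborel)"
      using l by (intro nn_integral_cong, subst nn_integral_lborel_affine[where c=l and t=0]) auto
    also have "\<dots> = ennreal (l ^ DIM('a)) * (\<integral>\<^sup>+t. ennreal (l ^ DIM('a)) * (\<integral>\<^sup>+s. ennreal (\<bar>\<phi> t\<bar> * \<bar>\<phi> s\<bar> * ((mean_vol + 2) * (overlap (l *\<^sub>R t) (l *\<^sub>R s))\<^sup>2)) \<partial>lborel) \<partial>lborel)"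
      using l by (subst nn_integral_lborel_affine[where c=l and t=0]) auto
    also have "ennreal ((scaling l)\<^sup>2) * \<dots> = (\<integral>\<^sup>+t. \<integral>\<^sup>+s. ennreal ((scaling l)\<^sup>2 * (l ^ DIM('a) * (l ^ DIM('a) * (\<bar>\<phi> t\<bar> * \<bar>\<phi> s\<bar> * ((mean_vol + 2) * (overlap (l *\<^sub>R t) (l *\<^sub>R s))\<^sup>2))))) \<partial>lborel \<partial>lborel)"
      using l mean_vol_nonneg by (simp add: ennreal_mult' nn_integral_cmult)
    also have "\<dots> = (\<integral>\<^sup>+t. \<integral>\<^sup>+s. ennreal (mean_vol + 2) * ennreal (\<bar>\<phi> t\<bar> * \<bar>\<phi> s\<bar> * (l powr ?q * overlap (l *\<^sub>R t) (l *\<^sub>R s))\<^sup>2) \<partial>lborel \<partial>lborel)"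
    proof -
      have "(scaling l)\<^sup>2 * (l ^ DIM('a) * (l ^ DIM('a) * (A * (B * r\<^sup>2)))) = B * (A * (l powr ?q * r)\<^sup>2)" for A B r
        unfolding scaling_volume[OF l, symmetric] by (simp add: power2_eq_square mult_ac)
      moreover have "0 \<le> mean_vol + 2" using mean_vol_nonneg by simp
      ultimately show ?thesis by (simp only: ennreal_mult')
    qed
    also have "\<dots> = ennreal (mean_vol + 2) * (\<integral>\<^sup>+t. \<integral>\<^sup>+s. ennreal (\<bar>\<phi> t\<bar> * \<bar>\<phi> s\<bar> * (l powr ?q * overlap (l *\<^sub>R t) (l *\<^sub>R s))\<^sup>2) \<partial>lborel \<partial>lborel)"
      by (simp add: nn_integral_cmult)
    finally show ?thesis .
  qed
  have "((\<lambda>l. ennreal (mean_vol + 2) * (\<integral>\<^sup>+t. \<integral>\<^sup>+s. ennreal (\<bar>\<phi> t\<bar> * \<bar>\<phi> s\<bar> * (l powr ?q * overlap (l *\<^sub>R t) (l *\<^sub>R s))\<^sup>2) \<partial>lborel \<partial>lborel)) \<longlongrightarrow> ennreal (mean_vol + 2) * 0) at_top"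
    by (intro ennreal_tendsto_cmult overlap_energy_limit[OF phi C]) simp
  then have up: "((\<lambda>l. ennreal (mean_vol + 2) * (\<integral>\<^sup>+t. \<integral>\<^sup>+s. ennreal (\<bar>\<phi> t\<bar> * \<bar>\<phi> s\<bar> * (l powr ?q * overlap (l *\<^sub>R t) (l *\<^sub>R s))\<^sup>2) \<partial>lborel \<partial>lborel)) \<longlongrightarrow> 0) at_top" by simp
  show "((\<lambda>l. \<integral>\<^sup>+\<omega>. ennreal ((scaling l * (\<integral>t. \<phi> (t /\<^sub>R l) * centred_residual k t \<omega> \<partial>lborel))\<^sup>2) \<partial>M) \<longlongrightarrow> 0) at_top"
  proof (rule tendsto_sandwich[OF _ _ tendsto_const up])
    show "\<forall>\<^sub>F l in at_top. 0 \<le> (\<integral>\<^sup>+\<omega>. ennreal ((scaling l * (\<integral>t. \<phi> (t /\<^sub>R l) * centred_residual k t \<omega> \<partial>lborel))\<^sup>2) \<partial>M)"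
      by (rule always_eventually) simp
    show "\<forall>\<^sub>F l in at_top. (\<integral>\<^sup>+\<omega>. ennreal ((scaling l * (\<integral>t. \<phi> (t /\<^sub>R l) * centred_residual k t \<omega> \<partial>lborel))\<^sup>2) \<partial>M)
      \<le> ennreal (mean_vol + 2) * (\<integral>\<^sup>+t. \<integral>\<^sup>+s. ennreal (\<bar>\<phi> t\<bar> * \<bar>\<phi> s\<bar> * (l powr ?q * overlap (l *\<^sub>R t) (l *\<^sub>R s))\<^sup>2) \<partial>lborel \<partial>lborel)"
      using eventually_gt_at_top[of "0::real"] by (rule eventually_mono) (rule bound)
  qed
qed

end

section \<open>The characteristic function of the integrated field\<close>

text \<open>For a nonnegative field with constant mean nothing else enters. The lemma serves both for fields on the probability
  space and for the indicator fields on the space of germs and grains.\<close>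

lemma integral_random_field:
  fixes f :: "'a::euclidean_space \<Rightarrow> real" and S :: "'a \<Rightarrow> 'b \<Rightarrow> real"
  assumes N: "sigma_finite_measure N"
    and Sm: "(\<lambda>p. S (fst p) (snd p)) \<in> borel_measurable (lborel \<Otimes>\<^sub>M N)"
    and f: "integrable lborel f"
    and S: "\<And>t. integrable N (S t)" "\<And>t y. 0 \<le> S t y" "\<And>t. (\<integral>y. S t y \<partial>N) = m"
  shows "AE y in N. integrable lborel (\<lambda>t. f t * S t y)"
    and "integrable N (\<lambda>y. \<integral>t. f t * S t y \<partial>lborel)"
    and "(\<integral>y. (\<integral>t. f t * S t y \<partial>lborel) \<partial>N) = m * (\<integral>t. f t \<partial>lborel)"
proof -
  interpret N: sigma_finite_measure N by fact
  interpret P: pair_sigma_finite "lborel :: 'a measure" N ..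
  have [measurable]: "f \<in> borel_measurable borel" using f by auto
  define H where "H p = f (fst p) * S (fst p) (snd p)" for p
  have Hm: "H \<in> borel_measurable (lborel \<Otimes>\<^sub>M N)" unfolding H_def[abs_def] using Sm by measurable
  have Hint: "integrable (lborel \<Otimes>\<^sub>M N) H"
  proof (rule P.Fubini_integrable[OF Hm])
    have "(\<integral>y. norm (H (t, y)) \<partial>N) = \<bar>f t\<bar> * m" for t
      using S(3)[of t] by (simp add: H_def abs_mult S(2))
    then show "integrable lborel (\<lambda>t. \<integral>y. norm (H (t, y)) \<partial>N)" using f by simp
    show "AE t in lborel. integrable N (\<lambda>y. H (t, y))" using S(1) by (simp add: H_def)
  qed
  show "AE y in N. integrable lborel (\<lambda>t. f t * S t y)"
    using P.AE_integrable_snd[of "\<lambda>t y. H (t, y)"] Hint by (simp add: H_def[abs_def] split_beta')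
  show "integrable N (\<lambda>y. \<integral>t. f t * S t y \<partial>lborel)"
    using P.integrable_snd[of "\<lambda>t y. H (t, y)"] Hint by (simp add: H_def[abs_def] split_beta')
  have "(\<integral>y. (\<integral>t. f t * S t y \<partial>lborel) \<partial>N) = (\<integral>t. (\<integral>y. f t * S t y \<partial>N) \<partial>lborel)"
    using P.Fubini_integral[of "\<lambda>t y. H (t, y)"] Hint by (simp add: H_def[abs_def] split_beta')
  also have "\<dots> = m * (\<integral>t. f t \<partial>lborel)" by (simp add: S(3))
  finally show "(\<integral>y. (\<integral>t. f t * S t y \<partial>lborel) \<partial>N) = m * (\<integral>t. f t \<partial>lborel)" .
qed

context random_grain_model
begin

lemma grain_field_mean:
  "integrable M (\<lambda>\<omega>. enn2real (grain_field u \<Xi>s \<omega> t))"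
  "expectation (\<lambda>\<omega>. enn2real (grain_field u \<Xi>s \<omega> t)) = mean_vol"
  "AE \<omega> in M. grain_field u \<Xi>s \<omega> t < \<infinity>"
proof -
  have "(\<integral>\<^sup>+\<omega>. grain_field u \<Xi>s \<omega> t \<partial>M) = (\<Sum>j. \<integral>\<^sup>+\<omega>. of_bool (t - u j \<omega> \<in> \<Xi>s j \<omega>) \<partial>M)"
    unfolding grain_field_eq by (rule nn_integral_suminf) measurable
  also have "\<dots> = (\<Sum>j. \<integral>\<^sup>+\<omega>. indicator (hitting t) (u j \<omega>, \<Xi>s j \<omega>) \<partial>M)"
    by (intro suminf_cong nn_integral_cong) (simp add: indicator_def hitting_point)
  also have "\<dots> = (\<integral>\<^sup>+p. indicator (hitting t) p \<partial>marked_intensity)"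
    by (rule marked_campbell) measurable
  also have "\<dots> = ennreal mean_vol" by (simp add: sets_marked_intensity emeasure_hitting)
  finally have nn: "(\<integral>\<^sup>+\<omega>. grain_field u \<Xi>s \<omega> t \<partial>M) = ennreal mean_vol" .
  show fin: "AE \<omega> in M. grain_field u \<Xi>s \<omega> t < \<infinity>"
    using nn_integral_PInf_AE[of "\<lambda>\<omega>. grain_field u \<Xi>s \<omega> t" M] nn by (simp add: less_top)
  have nn2: "(\<integral>\<^sup>+\<omega>. ennreal (enn2real (grain_field u \<Xi>s \<omega> t)) \<partial>M) = ennreal mean_vol"
    unfolding nn[symmetric] by (rule nn_integral_cong_AE) (use fin in eventually_elim, simp)
  show i: "integrable M (\<lambda>\<omega>. enn2real (grain_field u \<Xi>s \<omega> t))"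
    by (rule integrableI_nonneg) (simp_all add: nn2)
  show "expectation (\<lambda>\<omega>. enn2real (grain_field u \<Xi>s \<omega> t)) = mean_vol"
    by (subst integral_eq_nn_integral) (simp_all add: nn2 mean_vol_nonneg)
qed

text \<open>The contribution of one germ with its grain to the integral of \<open>f\<close> against the field.\<close>

definition grain_mass :: "('a \<Rightarrow> real) \<Rightarrow> 'a \<times> 'a set \<Rightarrow> real" where
  "grain_mass f p = (\<integral>t. f t * of_bool (t - fst p \<in> snd p) \<partial>lborel)"

lemma marked_mem_measurable: "Measurable.pred (lborel \<Otimes>\<^sub>M marked_intensity) (\<lambda>q. fst q - fst (snd q) \<in> snd (snd q))"
  by (rule measurable_mem_fell) measurable

lemma grain_mass_measurable [measurable]:
  assumes [measurable]: "f \<in> borel_measurable borel"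
  shows "grain_mass f \<in> borel_measurable (borel \<Otimes>\<^sub>M fell)"
proof -
  have [measurable]: "Measurable.pred ((borel \<Otimes>\<^sub>M fell) \<Otimes>\<^sub>M lborel) (\<lambda>q :: ('a \<times> 'a set) \<times> 'a. snd q - fst (fst q) \<in> snd (fst q))"
    by (rule measurable_mem_fell) measurable
  show ?thesis unfolding grain_mass_def[abs_def]
    by (rule lborel.borel_measurable_lebesgue_integral) (simp add: split_beta')
qed

lemma grain_mass_integral:
  assumes f: "integrable lborel f"
  shows "integrable marked_intensity (grain_mass f)"
    and "(\<integral>p. grain_mass f p \<partial>marked_intensity) = mean_vol * (\<integral>t. f t \<partial>lborel)"
proof -
  interpret pair_sigma_finite lborel grain_law by (rule marked_pair_sigma_finite)
  have Sm: "(\<lambda>q. of_bool (fst q - fst (snd q) \<in> snd (snd q)) :: real) \<in> borel_measurable (lborel \<Otimes>\<^sub>M marked_intensity)"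
    using marked_mem_measurable by measurable
  have eq: "of_bool (t - fst p \<in> snd p) = indicat_real (hitting t) p" if "p \<in> space marked_intensity" for t and p :: "'a \<times> 'a set"
    using that by (simp add: hitting_def indicator_def space_pair_measure)
  have i: "integrable marked_intensity (\<lambda>p. of_bool (t - fst p \<in> snd p) :: real)"
    "(\<integral>p. of_bool (t - fst p \<in> snd p) \<partial>marked_intensity) = mean_vol" for t
  proof -
    have "integrable marked_intensity (indicat_real (hitting t))"
      by (simp add: sets_marked_intensity emeasure_hitting)
    then show "integrable marked_intensity (\<lambda>p. of_bool (t - fst p \<in> snd p) :: real)"
      by (subst Bochner_Integration.integrable_cong[OF refl eq]) auto
    have "(\<integral>p. of_bool (t - fst p \<in> snd p) \<partial>marked_intensity) = (\<integral>p. indicat_real (hitting t) p \<partial>marked_intensity)"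
      by (rule Bochner_Integration.integral_cong[OF refl eq])
    also have "\<dots> = measure marked_intensity (hitting t)"
      by (simp add: sets_marked_intensity sets.Int_space_eq2)
    finally show "(\<integral>p. of_bool (t - fst p \<in> snd p) \<partial>marked_intensity) = mean_vol"
      by (simp add: measure_def emeasure_hitting mean_vol_nonneg)
  qed
  note F = integral_random_field[OF sigma_finite_measure_axioms Sm f i(1) _ i(2)]
  show "integrable marked_intensity (grain_mass f)"
    unfolding grain_mass_def[abs_def] by (rule F(2)) simp
  show "(\<integral>p. grain_mass f p \<partial>marked_intensity) = mean_vol * (\<integral>t. f t \<partial>lborel)"
    unfolding grain_mass_def by (rule F(3)) simp
qed

lemma field_integral:
  assumes f: "integrable lborel f"
  shows "AE \<omega> in M. integrable lborel (\<lambda>t. f t * enn2real (grain_field u \<Xi>s \<omega> t))"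
    and "integrable M (\<lambda>\<omega>. \<integral>t. f t * enn2real (grain_field u \<Xi>s \<omega> t) \<partial>lborel)"
    and "expectation (\<lambda>\<omega>. \<integral>t. f t * enn2real (grain_field u \<Xi>s \<omega> t) \<partial>lborel) = mean_vol * (\<integral>t. f t \<partial>lborel)"
proof -
  have Sm: "(\<lambda>p. enn2real (grain_field u \<Xi>s (snd p) (fst p))) \<in> borel_measurable (lborel \<Otimes>\<^sub>M M)" by measurable
  note F = integral_random_field[OF sigma_finite_measure_axioms Sm f grain_field_mean(1) _ grain_field_mean(2)]
  show "AE \<omega> in M. integrable lborel (\<lambda>t. f t * enn2real (grain_field u \<Xi>s \<omega> t))" by (rule F(1)) simp
  show "integrable M (\<lambda>\<omega>. \<integral>t. f t * enn2real (grain_field u \<Xi>s \<omega> t) \<partial>lborel)" by (rule F(2)) simp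
  show "expectation (\<lambda>\<omega>. \<integral>t. f t * enn2real (grain_field u \<Xi>s \<omega> t) \<partial>lborel) = mean_vol * (\<integral>t. f t \<partial>lborel)" by (rule F(3)) simp
qed

text \<open>Partial sums over the germs converge by dominated convergence, with the integrand of the whole field as
  dominating function.\<close>

lemma field_integral_as_series:
  assumes f: "integrable lborel f"
  shows "AE \<omega> in M. (\<lambda>n. \<Sum>j<n. grain_mass f (u j \<omega>, \<Xi>s j \<omega>)) \<longlonglongrightarrow> (\<integral>t. f t * enn2real (grain_field u \<Xi>s \<omega> t) \<partial>lborel)"
proof -
  interpret P: pair_sigma_finite "lborel :: 'a measure" M ..
  have fm [measurable]: "f \<in> borel_measurable borel" using f by auto
  have "AE t in lborel. AE \<omega> in M. grain_field u \<Xi>s \<omega> t < \<infinity>" using grain_field_mean(3) by simp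
  moreover have "{p \<in> space (lborel \<Otimes>\<^sub>M M). grain_field u \<Xi>s (snd p) (fst p) < \<infinity>} \<in> sets (lborel \<Otimes>\<^sub>M M)"
    by measurable
  ultimately have fin: "AE \<omega> in M. AE t in lborel. grain_field u \<Xi>s \<omega> t < \<infinity>"
    by (subst (asm) P.AE_commute)
  show ?thesis
    using fin field_integral(1)[OF f] AE_space
  proof eventually_elim
    case (elim \<omega>)
    have mem [measurable]: "Measurable.pred borel (\<lambda>t. t - u j \<omega> \<in> \<Xi>s j \<omega>)" for j
    proof -
      have [measurable]: "\<Xi>s j \<omega> \<in> sets borel" using grain_closed(2)[OF elim(3)] by simp
      show ?thesis by measurable
    qed
    have fj: "integrable lborel (\<lambda>t. f t * of_bool (t - u j \<omega> \<in> \<Xi>s j \<omega>))" for j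
      by (rule Bochner_Integration.integrable_bound[OF f]) auto
    have sum: "(\<Sum>j<n. grain_mass f (u j \<omega>, \<Xi>s j \<omega>)) = (\<integral>t. f t * (\<Sum>j<n. of_bool (t - u j \<omega> \<in> \<Xi>s j \<omega>)) \<partial>lborel)" for n
      unfolding grain_mass_def fst_conv snd_conv sum_distrib_left by (rule Bochner_Integration.integral_sum[symmetric]) (rule fj)
    have Gm: "(\<lambda>t. grain_field u \<Xi>s \<omega> t) \<in> borel_measurable borel"
      unfolding grain_field_eq by measurable
    show ?case unfolding sum
    proof (rule integral_dominated_convergence[where w="\<lambda>t. norm (f t * enn2real (grain_field u \<Xi>s \<omega> t))"])
      show "(\<lambda>t. f t * enn2real (grain_field u \<Xi>s \<omega> t)) \<in> borel_measurable lborel" using Gm by measurable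
      show "(\<lambda>t. f t * (\<Sum>j<n. of_bool (t - u j \<omega> \<in> \<Xi>s j \<omega>))) \<in> borel_measurable lborel" for n by measurable
      show "integrable lborel (\<lambda>t. norm (f t * enn2real (grain_field u \<Xi>s \<omega> t)))" using elim(2) by simp
      have le: "(\<Sum>j<n. of_bool (t - u j \<omega> \<in> \<Xi>s j \<omega>)) \<le> enn2real (grain_field u \<Xi>s \<omega> t)"
        and lim: "(\<lambda>n. \<Sum>j<n. of_bool (t - u j \<omega> \<in> \<Xi>s j \<omega>) :: real) \<longlonglongrightarrow> enn2real (grain_field u \<Xi>s \<omega> t)"
        if t: "grain_field u \<Xi>s \<omega> t < \<infinity>" for t n
      proof -
        let ?b = "\<lambda>j. of_bool (t - u j \<omega> \<in> \<Xi>s j \<omega>) :: ennreal"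
        have r: "(\<Sum>j<n. of_bool (t - u j \<omega> \<in> \<Xi>s j \<omega>) :: real) = enn2real (sum ?b {..<n})" for n
        proof -
          have "sum ?b {..<n} = (\<Sum>j<n. ennreal (of_bool (t - u j \<omega> \<in> \<Xi>s j \<omega>)))"
            by (intro sum.cong) auto
          also have "\<dots> = ennreal (\<Sum>j<n. of_bool (t - u j \<omega> \<in> \<Xi>s j \<omega>))" by (rule sum_ennreal) simp
          finally show ?thesis by (simp add: sum_nonneg)
        qed
        have "sum ?b {..<n} \<le> grain_field u \<Xi>s \<omega> t"
          unfolding grain_field_eq by (rule sum_le_suminf) auto
        then show "(\<Sum>j<n. of_bool (t - u j \<omega> \<in> \<Xi>s j \<omega>)) \<le> enn2real (grain_field u \<Xi>s \<omega> t)"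
          unfolding r using t by (intro enn2real_mono) auto
        have "(\<lambda>n. sum ?b {..<n}) \<longlonglongrightarrow> grain_field u \<Xi>s \<omega> t"
          unfolding grain_field_eq by (rule summable_LIMSEQ) simp
        then show "(\<lambda>n. \<Sum>j<n. of_bool (t - u j \<omega> \<in> \<Xi>s j \<omega>) :: real) \<longlonglongrightarrow> enn2real (grain_field u \<Xi>s \<omega> t)"
          unfolding r using t by (intro tendsto_enn2real) auto
      qed
      show "AE t in lborel. (\<lambda>n. f t * (\<Sum>j<n. of_bool (t - u j \<omega> \<in> \<Xi>s j \<omega>))) \<longlonglongrightarrow> f t * enn2real (grain_field u \<Xi>s \<omega> t)"
        using elim(1) by eventually_elim (intro tendsto_mult tendsto_const lim)
      show "AE t in lborel. norm (f t * (\<Sum>j<n. of_bool (t - u j \<omega> \<in> \<Xi>s j \<omega>))) \<le> norm (f t * enn2real (grain_field u \<Xi>s \<omega> t))" for n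
        using elim(1)
      proof eventually_elim
        case (elim t)
        have "0 \<le> (\<Sum>j<n. of_bool (t - u j \<omega> \<in> \<Xi>s j \<omega>) :: real)" by (rule sum_nonneg) simp
        with le[OF elim, of n] show ?case unfolding norm_mult by (intro mult_left_mono) auto
      qed
    qed
  qed
qed

text \<open>The exponential of the sum over the germs is the limit of the partial products in \<open>marked_pgfl\<close>.\<close>

theorem char_field_integral:
  assumes f: "integrable lborel f"
  shows "expectation (\<lambda>\<omega>. iexp (\<tau> * (\<integral>t. f t * enn2real (grain_field u \<Xi>s \<omega> t) \<partial>lborel)))
    = exp (\<integral>p. iexp (\<tau> * grain_mass f p) - 1 \<partial>marked_intensity)"
proof -
  have fm [measurable]: "f \<in> borel_measurable borel" using f by auto
  define D where "D p = iexp (\<tau> * grain_mass f p)" for p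
  have Dm: "D \<in> borel_measurable (borel \<Otimes>\<^sub>M fell)" unfolding D_def by measurable
  have Di: "integrable marked_intensity (\<lambda>p. D p - 1)"
  proof (rule Bochner_Integration.integrable_bound[OF integrable_mult_right[OF grain_mass_integral(1)[OF f], of \<tau>]])
    show "(\<lambda>p. D p - 1) \<in> borel_measurable marked_intensity"
      using Dm by (simp add: measurable_cong_sets[OF sets_marked_intensity refl])
    show "AE p in marked_intensity. norm (D p - 1) \<le> norm (\<tau> * grain_mass f p)"
      unfolding D_def real_norm_def by (intro AE_I2 norm_iexp_minus_1)
  qed
  have 1: "(\<lambda>n. expectation (\<lambda>\<omega>. \<Prod>j<n. D (u j \<omega>, \<Xi>s j \<omega>))) \<longlonglongrightarrow> exp (\<integral>p. D p - 1 \<partial>marked_intensity)"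
    by (rule marked_pgfl[OF Dm _ Di]) (simp add: D_def)
  have prod: "(\<Prod>j<n. D (u j \<omega>, \<Xi>s j \<omega>)) = iexp (\<tau> * (\<Sum>j<n. grain_mass f (u j \<omega>, \<Xi>s j \<omega>)))" for n \<omega>
    by (simp add: D_def exp_sum[symmetric] sum_distrib_left)
  have 2: "(\<lambda>n. expectation (\<lambda>\<omega>. \<Prod>j<n. D (u j \<omega>, \<Xi>s j \<omega>)))
    \<longlonglongrightarrow> expectation (\<lambda>\<omega>. iexp (\<tau> * (\<integral>t. f t * enn2real (grain_field u \<Xi>s \<omega> t) \<partial>lborel)))"
  proof (rule integral_dominated_convergence[where w="\<lambda>_. 1"])
    show "(\<lambda>\<omega>. iexp (\<tau> * (\<integral>t. f t * enn2real (grain_field u \<Xi>s \<omega> t) \<partial>lborel))) \<in> borel_measurable M"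
      using borel_measurable_integrable[OF field_integral(2)[OF f]] by measurable
    show "(\<lambda>\<omega>. \<Prod>j<n. D (u j \<omega>, \<Xi>s j \<omega>)) \<in> borel_measurable M" for n
      using Dm by measurable
    show "AE \<omega> in M. (\<lambda>n. \<Prod>j<n. D (u j \<omega>, \<Xi>s j \<omega>)) \<longlonglongrightarrow> iexp (\<tau> * (\<integral>t. f t * enn2real (grain_field u \<Xi>s \<omega> t) \<partial>lborel))"
      using field_integral_as_series[OF f] unfolding prod
    proof eventually_elim
      case (elim \<omega>)
      show ?case by (intro tendsto_exp tendsto_mult tendsto_const tendsto_of_real elim)
    qed
    show "AE \<omega> in M. norm (\<Prod>j<n. D (u j \<omega>, \<Xi>s j \<omega>)) \<le> 1" for n unfolding prod by simp
  qed simp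
  show ?thesis using LIMSEQ_unique[OF 2 1] by (simp add: D_def)
qed

text \<open>The mean of the integrated field is the integral of the mass over the intensity. Subtracting it
  produces the linear compensation in the exponent.\<close>

theorem char_centred_field_integral:
  assumes f: "integrable lborel f"
  defines "X \<equiv> \<lambda>\<omega>. \<integral>t. f t * enn2real (grain_field u \<Xi>s \<omega> t) \<partial>lborel"
  shows "expectation (\<lambda>\<omega>. iexp (\<tau> * (X \<omega> - expectation X))) = exp (\<integral>p. compensated_exp (\<tau> * grain_mass f p) \<partial>marked_intensity)"
    and "integrable marked_intensity (\<lambda>p. compensated_exp (\<tau> * grain_mass f p))"
proof -
  have fm [measurable]: "f \<in> borel_measurable borel" using f by auto
  have gm: "grain_mass f \<in> borel_measurable marked_intensity" by (simp add: measurable_cong_sets[OF sets_marked_intensity refl])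
  note gi = grain_mass_integral(1)[OF f]
  have i1: "integrable marked_intensity (\<lambda>p. iexp (\<tau> * grain_mass f p) - 1)"
    by (rule Bochner_Integration.integrable_bound[OF integrable_mult_right[OF gi, of \<tau>]])
       (use gm in measurable, unfold real_norm_def, intro AE_I2 norm_iexp_minus_1)
  have i2: "integrable marked_intensity (\<lambda>p. \<i> * complex_of_real (\<tau> * grain_mass f p))"
    using gi by (intro integrable_mult_right integrable_of_real) 
  show "integrable marked_intensity (\<lambda>p. compensated_exp (\<tau> * grain_mass f p))"
    unfolding compensated_exp_def using i1 i2 by (rule Bochner_Integration.integrable_diff)
  have "(\<integral>p. compensated_exp (\<tau> * grain_mass f p) \<partial>marked_intensity)
    = (\<integral>p. iexp (\<tau> * grain_mass f p) - 1 \<partial>marked_intensity) - (\<integral>p. \<i> * complex_of_real (\<tau> * grain_mass f p) \<partial>marked_intensity)"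
    unfolding compensated_exp_def using i1 i2 by (rule Bochner_Integration.integral_diff)
  also have "(\<integral>p. \<i> * complex_of_real (\<tau> * grain_mass f p) \<partial>marked_intensity) = \<i> * complex_of_real (\<tau> * expectation X)"
    unfolding X_def field_integral(3)[OF f] grain_mass_integral(2)[OF f, symmetric] by simp
  finally have e: "(\<integral>p. compensated_exp (\<tau> * grain_mass f p) \<partial>marked_intensity)
    = (\<integral>p. iexp (\<tau> * grain_mass f p) - 1 \<partial>marked_intensity) - \<i> * complex_of_real (\<tau> * expectation X)" .
  have "iexp (\<tau> * (X \<omega> - expectation X)) = iexp (\<tau> * X \<omega>) / iexp (\<tau> * expectation X)" for \<omega>
    by (simp add: exp_diff[symmetric] algebra_simps)
  then have "expectation (\<lambda>\<omega>. iexp (\<tau> * (X \<omega> - expectation X))) = expectation (\<lambda>\<omega>. iexp (\<tau> * X \<omega>)) / iexp (\<tau> * expectation X)"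
    by simp
  also have "\<dots> = exp (\<integral>p. compensated_exp (\<tau> * grain_mass f p) \<partial>marked_intensity)"
    unfolding e exp_diff using char_field_integral[OF f, of \<tau>] by (simp add: X_def)
  finally show "expectation (\<lambda>\<omega>. iexp (\<tau> * (X \<omega> - expectation X))) = exp (\<integral>p. compensated_exp (\<tau> * grain_mass f p) \<partial>marked_intensity)" .
qed

lemma marked_intensity_as_distr:
  "marked_intensity = distr (lborel \<Otimes>\<^sub>M M) (borel \<Otimes>\<^sub>M fell) (\<lambda>(v, \<omega>). (v, \<Xi> \<omega>))"
proof -
  interpret Q: prob_space grain_law by (rule prob_space_grain_law)
  have "distr (lborel :: 'a measure) borel (\<lambda>x. x) \<Otimes>\<^sub>M distr M fell \<Xi> = distr (lborel \<Otimes>\<^sub>M M) (borel \<Otimes>\<^sub>M fell) (\<lambda>(x, y). (x, \<Xi> y))"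
    by (rule pair_measure_distr) (auto intro: Q.sigma_finite_measure_axioms)
  moreover have "distr lborel borel (\<lambda>x. x) = (lborel :: 'a measure)" by (rule distr_id2) simp
  ultimately show ?thesis by simp
qed

end

lemma integral_scale_first_coordinate:
  fixes g :: "'a::euclidean_space \<times> 'b \<Rightarrow> 'c::{banach, second_countable_topology}"
  assumes N: "sigma_finite_measure N" and g: "integrable (lborel \<Otimes>\<^sub>M N) g" and l: "0 < l"
  shows "(\<integral>p. g p \<partial>(lborel \<Otimes>\<^sub>M N)) = l ^ DIM('a) *\<^sub>R (\<integral>p. g (l *\<^sub>R fst p, snd p) \<partial>(lborel \<Otimes>\<^sub>M N))"
proof -
  interpret N: sigma_finite_measure N by fact
  interpret P: pair_sigma_finite "lborel :: 'a measure" N ..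
  have gm [measurable]: "g \<in> borel_measurable (borel \<Otimes>\<^sub>M N)" using g by (simp cong: measurable_cong_sets sets_pair_measure_cong)
  have gs: "(\<lambda>p. g (l *\<^sub>R fst p, snd p)) \<in> borel_measurable (lborel \<Otimes>\<^sub>M N)" by measurable
  have "ennreal (l ^ DIM('a)) * (\<integral>\<^sup>+v. \<integral>\<^sup>+y. ennreal (norm (g (l *\<^sub>R v, y))) \<partial>N \<partial>lborel) = (\<integral>\<^sup>+v. \<integral>\<^sup>+y. ennreal (norm (g (v, y))) \<partial>N \<partial>lborel)"
    using nn_integral_lborel_affine[of "\<lambda>v. \<integral>\<^sup>+y. ennreal (norm (g (v, y))) \<partial>N" l 0] l by simp
  also have "\<dots> = (\<integral>\<^sup>+p. ennreal (norm (g p)) \<partial>(lborel \<Otimes>\<^sub>M N))" by (rule N.nn_integral_fst) simp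
  also have "\<dots> < \<infinity>" using g by (simp add: integrable_iff_bounded)
  finally have "(\<integral>\<^sup>+v. \<integral>\<^sup>+y. ennreal (norm (g (l *\<^sub>R v, y))) \<partial>N \<partial>lborel) < \<infinity>"
    using l by (auto simp: ennreal_mult_less_top)
  also have "(\<integral>\<^sup>+v. \<integral>\<^sup>+y. ennreal (norm (g (l *\<^sub>R v, y))) \<partial>N \<partial>lborel) = (\<integral>\<^sup>+p. ennreal (norm (g (l *\<^sub>R fst p, snd p))) \<partial>(lborel \<Otimes>\<^sub>M N))"
    by (subst N.nn_integral_fst[symmetric]) (use gs in simp_all)
  finally have gi: "integrable (lborel \<Otimes>\<^sub>M N) (\<lambda>p. g (l *\<^sub>R fst p, snd p))"
    using gs by (intro integrableI_bounded)
  have "(\<integral>p. g p \<partial>(lborel \<Otimes>\<^sub>M N)) = (\<integral>v. \<integral>y. g (v, y) \<partial>N \<partial>lborel)"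
    by (rule P.integral_fst'[OF g, symmetric])
  also have "\<dots> = l ^ DIM('a) *\<^sub>R (\<integral>v. \<integral>y. g (l *\<^sub>R v, y) \<partial>N \<partial>lborel)"
    using integral_lborel_affine[of "\<lambda>v. \<integral>y. g (v, y) \<partial>N" l 0] l by simp
  also have "(\<integral>v. \<integral>y. g (l *\<^sub>R v, y) \<partial>N \<partial>lborel) = (\<integral>p. g (l *\<^sub>R fst p, snd p) \<partial>(lborel \<Otimes>\<^sub>M N))"
    using P.integral_fst'[OF gi] by simp
  finally show ?thesis .
qed

section \<open>The limit theorems for Borel test functions\<close>

context heavy_tailed_grain_model
begin

context
  fixes \<phi> :: "'a \<Rightarrow> real" and C :: real
  assumes phi: "integrable lborel \<phi>" and C: "\<And>v. \<bar>\<phi> v\<bar> \<le> C"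
begin

lemma phi_borel [measurable]: "\<phi> \<in> borel_measurable borel" using phi by auto

lemma phi_dilated: "0 < l \<Longrightarrow> integrable lborel (\<lambda>t. \<phi> (t /\<^sub>R l))"
  using integrable_lborel_affine[OF phi, of "inverse l" 0] by simp

definition field_sum :: "real \<Rightarrow> 'w \<Rightarrow> real" where
  "field_sum l \<omega> = (\<integral>t. \<phi> (t /\<^sub>R l) * enn2real (grain_field u \<Xi>s \<omega> t) \<partial>lborel)"

definition excess_sum :: "real \<Rightarrow> nat \<Rightarrow> 'w \<Rightarrow> real" where
  "excess_sum l k \<omega> = (\<integral>t. \<phi> (t /\<^sub>R l) * excess_field u \<Xi>s k \<omega> t \<partial>lborel)"

definition fluctuation :: "real \<Rightarrow> 'w \<Rightarrow> real" where
  "fluctuation l \<omega> = scaling l * (field_sum l \<omega> - expectation (field_sum l))"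

definition excess_fluctuation :: "real \<Rightarrow> nat \<Rightarrow> 'w \<Rightarrow> real" where
  "excess_fluctuation l k \<omega> = scaling l * (excess_sum l k \<omega> - expectation (excess_sum l k))"

text \<open>The change of variables to the frame of the germ, which identifies the exponent with the one
  whose limit was computed.\<close>

lemma grain_mass_window:
  assumes l: "0 < l" and w: "\<omega> \<in> space M"
  shows "grain_mass (\<lambda>t. \<phi> (t /\<^sub>R l)) (l *\<^sub>R v, \<Xi> \<omega>) = window_mass \<phi> l v \<omega>"
proof -
  have [measurable]: "\<Xi> \<omega> \<in> sets borel" using Xi_borel[OF w] .
  have "grain_mass (\<lambda>t. \<phi> (t /\<^sub>R l)) (l *\<^sub>R v, \<Xi> \<omega>) = (\<integral>t. \<phi> (t /\<^sub>R l) * of_bool (t - l *\<^sub>R v \<in> \<Xi> \<omega>) \<partial>lborel)"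
    by (simp add: grain_mass_def)
  also have "\<dots> = (\<integral>s. \<phi> ((l *\<^sub>R v + s) /\<^sub>R l) * of_bool (s \<in> \<Xi> \<omega>) \<partial>lborel)"
    by (subst integral_lborel_affine[where c=1 and t="l *\<^sub>R v"]) simp_all
  also have "\<dots> = window_mass \<phi> l v \<omega>"
    using l by (simp add: window_mass_def[OF phi C] scaleR_add_right indicator_def of_bool_def)
  finally show ?thesis .
qed

lemma field_sum_integrable: "0 < l \<Longrightarrow> integrable M (field_sum l)"
  unfolding field_sum_def[abs_def] by (rule field_integral(2)[OF phi_dilated])

lemma fluctuation_measurable: "0 < l \<Longrightarrow> fluctuation l \<in> borel_measurable M"
  unfolding fluctuation_def[abs_def] using borel_measurable_integrable[OF field_sum_integrable] by measurable

lemma char_fluctuation: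
  assumes l: "0 < l"
  shows "char (distr M borel (fluctuation l)) \<theta>
    = exp (l ^ DIM('a) *\<^sub>R (\<integral>p. compensated_exp (\<theta> * (scaling l * window_mass \<phi> l (fst p) (snd p))) \<partial>(lborel \<Otimes>\<^sub>M M)))"
proof -
  let ?f = "\<lambda>t. \<phi> (t /\<^sub>R l)"
  let ?\<tau> = "\<theta> * scaling l"
  have [measurable]: "fluctuation l \<in> borel_measurable M" using l by (rule fluctuation_measurable)
  note f = phi_dilated[OF l]
  have T [measurable]: "(\<lambda>(v, \<omega>). (v, \<Xi> \<omega>)) \<in> measurable (lborel \<Otimes>\<^sub>M M) (borel \<Otimes>\<^sub>M fell)" by measurable
  have cm: "(\<lambda>p. compensated_exp (?\<tau> * grain_mass ?f p)) \<in> borel_measurable (borel \<Otimes>\<^sub>M fell)" by measurable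
  have ci: "integrable (lborel \<Otimes>\<^sub>M M) (\<lambda>p. compensated_exp (?\<tau> * grain_mass ?f (fst p, \<Xi> (snd p))))"
    using char_centred_field_integral(2)[OF f, of ?\<tau>] unfolding marked_intensity_as_distr
    by (subst (asm) integrable_distr_eq[OF T cm]) (simp add: split_beta')
  have "char (distr M borel (fluctuation l)) \<theta> = expectation (\<lambda>\<omega>. iexp (\<theta> * fluctuation l \<omega>))"
    unfolding char_def by (rule integral_distr) measurable
  also have "\<dots> = expectation (\<lambda>\<omega>. iexp (?\<tau> * (field_sum l \<omega> - expectation (field_sum l))))"
    unfolding fluctuation_def by (simp only: mult.assoc)
  also have "\<dots> = exp (\<integral>p. compensated_exp (?\<tau> * grain_mass ?f p) \<partial>marked_intensity)"
    unfolding field_sum_def[abs_def] by (rule char_centred_field_integral(1)[OF f])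
  also have "(\<integral>p. compensated_exp (?\<tau> * grain_mass ?f p) \<partial>marked_intensity)
    = (\<integral>p. compensated_exp (?\<tau> * grain_mass ?f (fst p, \<Xi> (snd p))) \<partial>(lborel \<Otimes>\<^sub>M M))"
    unfolding marked_intensity_as_distr by (subst integral_distr[OF T cm]) (simp add: split_beta')
  also have "\<dots> = l ^ DIM('a) *\<^sub>R (\<integral>p. compensated_exp (?\<tau> * grain_mass ?f (l *\<^sub>R fst p, \<Xi> (snd p))) \<partial>(lborel \<Otimes>\<^sub>M M))"
    using integral_scale_first_coordinate[OF sigma_finite_measure_axioms ci l] by simp
  also have "(\<integral>p. compensated_exp (?\<tau> * grain_mass ?f (l *\<^sub>R fst p, \<Xi> (snd p))) \<partial>(lborel \<Otimes>\<^sub>M M))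
    = (\<integral>p. compensated_exp (\<theta> * (scaling l * window_mass \<phi> l (fst p) (snd p))) \<partial>(lborel \<Otimes>\<^sub>M M))"
    by (intro Bochner_Integration.integral_cong refl) (simp add: space_pair_measure grain_mass_window[OF l] mult.assoc mem_Times_iff)
  finally show ?thesis .
qed

theorem char_fluctuation_tendsto:
  "((\<lambda>l. char (distr M borel (fluctuation l)) \<theta>) \<longlongrightarrow> exp (log_char \<phi> \<theta>)) at_top"
proof (rule Lim_transform_eventually)
  show "((\<lambda>l. exp (l ^ DIM('a) *\<^sub>R (\<integral>p. compensated_exp (\<theta> * (scaling l * window_mass \<phi> l (fst p) (snd p))) \<partial>(lborel \<Otimes>\<^sub>M M)))) \<longlongrightarrow> exp (log_char \<phi> \<theta>)) at_top"
    unfolding log_char_def by (intro tendsto_exp exponent_limit[OF phi C])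
  show "\<forall>\<^sub>F l in at_top. exp (l ^ DIM('a) *\<^sub>R (\<integral>p. compensated_exp (\<theta> * (scaling l * window_mass \<phi> l (fst p) (snd p))) \<partial>(lborel \<Otimes>\<^sub>M M))) = char (distr M borel (fluctuation l)) \<theta>"
    using eventually_gt_at_top[of "0::real"] by (rule eventually_mono) (rule char_fluctuation[symmetric])
qed

lemma excess_field_range: "0 \<le> excess_field u \<Xi>s k \<omega> t" "excess_field u \<Xi>s k \<omega> t \<le> 1"
  by (simp_all add: excess_field_def)

lemma excess_field_mean:
  assumes k: "1 \<le> k"
  shows "integrable M (\<lambda>\<omega>. excess_field u \<Xi>s k \<omega> t)"
    and "expectation (\<lambda>\<omega>. excess_field u \<Xi>s k \<omega> t) = expectation (residual k 0) + poisson_weight mean_vol (k - 1) * mean_vol"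
proof -
  have em: "(\<lambda>\<omega>. excess_field u \<Xi>s k \<omega> t) \<in> borel_measurable M"
    unfolding excess_field_def by measurable
  show i: "integrable M (\<lambda>\<omega>. excess_field u \<Xi>s k \<omega> t)"
    by (rule integrable_const_bound[where B=1]) (use em excess_field_range in auto)
  have "expectation (residual k 0) = expectation (residual k t)"
    by (rule residual_covariance(2)[OF k])
  also have "\<dots> = expectation (\<lambda>\<omega>. excess_field u \<Xi>s k \<omega> t) - poisson_weight mean_vol (k - 1) * mean_vol"
    unfolding residual_def[abs_def] using i grain_field_mean(1,2)[of t] by simp
  finally show "expectation (\<lambda>\<omega>. excess_field u \<Xi>s k \<omega> t) = expectation (residual k 0) + poisson_weight mean_vol (k - 1) * mean_vol"
    by simp
qed

lemma excess_sum_mean: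
  assumes k: "1 \<le> k" and l: "0 < l"
  shows "AE \<omega> in M. integrable lborel (\<lambda>t. \<phi> (t /\<^sub>R l) * excess_field u \<Xi>s k \<omega> t)"
    and "integrable M (excess_sum l k)"
    and "expectation (excess_sum l k) = (expectation (residual k 0) + poisson_weight mean_vol (k - 1) * mean_vol) * (\<integral>t. \<phi> (t /\<^sub>R l) \<partial>lborel)"
proof -
  have Sm: "(\<lambda>p. excess_field u \<Xi>s k (snd p) (fst p)) \<in> borel_measurable (lborel \<Otimes>\<^sub>M M)" by measurable
  note F = integral_random_field[OF sigma_finite_measure_axioms Sm phi_dilated[OF l] excess_field_mean(1)[OF k] excess_field_range(1) excess_field_mean(2)[OF k]]
  show "AE \<omega> in M. integrable lborel (\<lambda>t. \<phi> (t /\<^sub>R l) * excess_field u \<Xi>s k \<omega> t)" by (rule F(1))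
  show "integrable M (excess_sum l k)" unfolding excess_sum_def[abs_def] by (rule F(2))
  show "expectation (excess_sum l k) = (expectation (residual k 0) + poisson_weight mean_vol (k - 1) * mean_vol) * (\<integral>t. \<phi> (t /\<^sub>R l) \<partial>lborel)"
    unfolding excess_sum_def[abs_def] by (rule F(3))
qed

lemma excess_fluctuation_measurable: "1 \<le> k \<Longrightarrow> 0 < l \<Longrightarrow> excess_fluctuation l k \<in> borel_measurable M"
  unfolding excess_fluctuation_def[abs_def] using borel_measurable_integrable[OF excess_sum_mean(2)] by measurable

text \<open>Both centrings are constants, and the constant in the centred residual matches their difference.\<close>

lemma excess_fluctuation_decomposition:
  assumes k: "1 \<le> k" and l: "0 < l"
  shows "AE \<omega> in M. excess_fluctuation l k \<omega> - poisson_weight mean_vol (k - 1) * fluctuation l \<omega>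
    = scaling l * (\<integral>t. \<phi> (t /\<^sub>R l) * centred_residual k t \<omega> \<partial>lborel)"
  using excess_sum_mean(1)[OF k l] field_integral(1)[OF phi_dilated[OF l]]
proof eventually_elim
  case (elim \<omega>)
  let ?c = "poisson_weight mean_vol (k - 1)" and ?\<rho> = "expectation (residual k 0)" and ?I = "\<integral>t. \<phi> (t /\<^sub>R l) \<partial>lborel"
  define \<rho> where "\<rho> = ?\<rho>"
  have "\<phi> (t /\<^sub>R l) * centred_residual k t \<omega>
    = \<phi> (t /\<^sub>R l) * excess_field u \<Xi>s k \<omega> t - ?c * (\<phi> (t /\<^sub>R l) * enn2real (grain_field u \<Xi>s \<omega> t)) - \<rho> * \<phi> (t /\<^sub>R l)" for t
    using expectation_residual_const[OF k, of t] by (simp add: centred_residual_def residual_def[of k t \<omega>] \<rho>_def algebra_simps)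
  then have e1: "(\<integral>t. \<phi> (t /\<^sub>R l) * centred_residual k t \<omega> \<partial>lborel) = excess_sum l k \<omega> - ?c * field_sum l \<omega> - \<rho> * ?I"
    using elim phi_dilated[OF l] by (simp add: excess_sum_def field_sum_def)
  have e2: "expectation (field_sum l) = mean_vol * ?I"
    unfolding field_sum_def[abs_def] by (rule field_integral(3)[OF phi_dilated[OF l]])
  have e3: "expectation (excess_sum l k) = (\<rho> + ?c * mean_vol) * ?I"
    unfolding \<rho>_def by (rule excess_sum_mean(3)[OF k l])
  show ?case
    unfolding excess_fluctuation_def fluctuation_def e1 e2 e3 by (simp add: algebra_simps)
qed

text \<open>Chebyshev's inequality for the second moment of the remainder.\<close>

lemma excess_remainder_negligible:
  assumes k: "1 \<le> k" and d: "0 < d"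
  shows "((\<lambda>l. prob {\<omega> \<in> space M. d < \<bar>excess_fluctuation l k \<omega> - poisson_weight mean_vol (k - 1) * fluctuation l \<omega>\<bar>}) \<longlongrightarrow> 0) at_top"
proof -
  define Z where "Z l \<omega> = excess_fluctuation l k \<omega> - poisson_weight mean_vol (k - 1) * fluctuation l \<omega>" for l \<omega>
  define E where "E l = (\<integral>\<^sup>+\<omega>. ennreal ((scaling l * (\<integral>t. \<phi> (t /\<^sub>R l) * centred_residual k t \<omega> \<partial>lborel))\<^sup>2) \<partial>M)" for l
  have E0: "(E \<longlongrightarrow> 0) at_top" unfolding E_def[abs_def] by (rule residual_integral_negligible(1)[OF k phi C])
  have bound: "ennreal (prob {\<omega> \<in> space M. d < \<bar>Z l \<omega>\<bar>}) \<le> ennreal (1 / d\<^sup>2) * E l" if l: "0 < l" for l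
  proof -
    have Zm [measurable]: "Z l \<in> borel_measurable M"
      unfolding Z_def[abs_def] using fluctuation_measurable[OF l] excess_fluctuation_measurable[OF k l] by measurable
    have e: "(\<integral>\<^sup>+\<omega>. ennreal ((Z l \<omega>)\<^sup>2) \<partial>M) = E l"
      unfolding E_def by (rule nn_integral_cong_AE) (use excess_fluctuation_decomposition[OF k l] in eventually_elim, simp add: Z_def)
    have markov: "emeasure M {\<omega> \<in> space M. 1 \<le> ennreal (1 / d\<^sup>2) * ennreal ((Z l \<omega>)\<^sup>2)} \<le> ennreal (1 / d\<^sup>2) * (\<integral>\<^sup>+\<omega>. ennreal ((Z l \<omega>)\<^sup>2) * indicator (space M) \<omega> \<partial>M)"
      by (rule nn_integral_Markov_inequality) auto
    have e2: "(\<integral>\<^sup>+\<omega>. ennreal ((Z l \<omega>)\<^sup>2) * indicator (space M) \<omega> \<partial>M) = (\<integral>\<^sup>+\<omega>. ennreal ((Z l \<omega>)\<^sup>2) \<partial>M)"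
      by (intro nn_integral_cong) simp
    have sub: "emeasure M {\<omega> \<in> space M. d < \<bar>Z l \<omega>\<bar>} \<le> emeasure M {\<omega> \<in> space M. 1 \<le> ennreal (1 / d\<^sup>2) * ennreal ((Z l \<omega>)\<^sup>2)}"
    proof (rule emeasure_mono)
      show "{\<omega> \<in> space M. d < \<bar>Z l \<omega>\<bar>} \<subseteq> {\<omega> \<in> space M. 1 \<le> ennreal (1 / d\<^sup>2) * ennreal ((Z l \<omega>)\<^sup>2)}"
      proof clarify
        fix \<omega> assume "d < \<bar>Z l \<omega>\<bar>"
        then have "d\<^sup>2 \<le> (Z l \<omega>)\<^sup>2" using d by (intro abs_le_square_iff[THEN iffD1]) auto
        then have "1 \<le> 1 / d\<^sup>2 * (Z l \<omega>)\<^sup>2" using d by (simp add: field_simps)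
        then show "1 \<le> ennreal (1 / d\<^sup>2) * ennreal ((Z l \<omega>)\<^sup>2)"
          by (simp add: ennreal_mult[symmetric] del: ennreal_1 flip: ennreal_1)
      qed
    qed measurable
    show ?thesis using order_trans[OF sub markov] unfolding e e2 by (simp only: emeasure_eq_measure)
  qed
  have up: "((\<lambda>l. ennreal (1 / d\<^sup>2) * E l) \<longlongrightarrow> 0) at_top"
    using ennreal_tendsto_cmult[OF _ E0, of "ennreal (1 / d\<^sup>2)"] by simp
  have "((\<lambda>l. ennreal (prob {\<omega> \<in> space M. d < \<bar>Z l \<omega>\<bar>})) \<longlongrightarrow> 0) at_top"
  proof (rule tendsto_sandwich[OF _ _ tendsto_const up])
    show "\<forall>\<^sub>F l in at_top. 0 \<le> ennreal (prob {\<omega> \<in> space M. d < \<bar>Z l \<omega>\<bar>})" by simp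
    show "\<forall>\<^sub>F l in at_top. ennreal (prob {\<omega> \<in> space M. d < \<bar>Z l \<omega>\<bar>}) \<le> ennreal (1 / d\<^sup>2) * E l"
      using eventually_gt_at_top[of "0::real"] by (rule eventually_mono) (rule bound)
  qed
  from tendsto_enn2real[of _ 0, unfolded ennreal_0, OF this]
  have "((\<lambda>l. prob {\<omega> \<in> space M. d < \<bar>Z l \<omega>\<bar>}) \<longlongrightarrow> 0) at_top" by simp
  then show ?thesis by (simp add: Z_def)
qed

theorem fluctuation_limits:
  obtains \<nu> where "real_distribution \<nu>" "char \<nu> = (\<lambda>\<theta>. exp (log_char \<phi> \<theta>))" "stable_law \<alpha> \<nu>"
    "converges_in_distribution at_top euclideanreal M fluctuation \<nu> (\<lambda>x. x)"
    "fdd_converges at_top {1..} M excess_fluctuation \<nu> (\<lambda>k v. poisson_weight mean_vol (k - 1) * v)"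
proof -
  obtain \<nu> where \<nu>: "real_distribution \<nu>" "char \<nu> = (\<lambda>\<theta>. exp (log_char \<phi> \<theta>))"
    "converges_in_distribution at_top euclideanreal M fluctuation \<nu> (\<lambda>x. x)"
    using converges_in_distribution_of_char[OF prob_space_axioms fluctuation_measurable char_fluctuation_tendsto isCont_exp_log_char]
    by blast
  have st: "stable_law \<alpha> \<nu>"
    using stable_law_of_char[OF \<nu>(1,2) log_char_scale] alpha by simp
  have "fdd_converges at_top {1..} M excess_fluctuation \<nu> (\<lambda>k v. poisson_weight mean_vol (k - 1) * v)"
  proof (rule fdd_converges_slutsky[OF prob_space_axioms \<nu>(1) fluctuation_measurable _ \<nu>(3) excess_remainder_negligible])
    show "(\<lambda>\<omega>. excess_fluctuation l k \<omega> - poisson_weight mean_vol (k - 1) * fluctuation l \<omega>) \<in> borel_measurable M"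
      if "0 < l" "k \<in> {1..}" for l k
      using that by (intro borel_measurable_diff borel_measurable_times borel_measurable_const fluctuation_measurable excess_fluctuation_measurable) auto
  qed auto
  then show thesis using that \<nu> st by blast
qed

end
end

section \<open>Test functions defined up to null sets\<close>

text \<open>Test functions that agree almost everywhere give the same integrals for positive scales only,
  hence the equality is required only eventually.\<close>

lemma converges_in_distribution_cong:
  assumes conv: "converges_in_distribution F T M Y N L"
    and eq: "\<forall>\<^sub>F l in F. \<forall>\<omega>\<in>space M. Y' l \<omega> = Y l \<omega>"
  shows "converges_in_distribution F T M Y' N L"
  unfolding converges_in_distribution_def
proof (intro conjI allI impI)
  have Ym: "\<forall>\<^sub>F l in F. Y l \<in> measurable M (borel_of T)" and lim: "continuous_map T euclideanreal f \<and> bounded (f ` topspace T) \<Longrightarrow>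
      ((\<lambda>l. \<integral>\<omega>. f (Y l \<omega>) \<partial>M) \<longlongrightarrow> (\<integral>v. f (L v) \<partial>N)) F" for f
    using conv by (auto simp: converges_in_distribution_def)
  show "L \<in> measurable N (borel_of T)" using conv by (simp add: converges_in_distribution_def)
  show "\<forall>\<^sub>F l in F. Y' l \<in> measurable M (borel_of T)"
    using Ym eq
  proof eventually_elim
    case (elim l)
    then show ?case by (subst measurable_cong[where g="Y l"]) auto
  qed
  fix f assume "continuous_map T euclideanreal f \<and> bounded (f ` topspace T)"
  from lim[OF this] show "((\<lambda>l. \<integral>\<omega>. f (Y' l \<omega>) \<partial>M) \<longlongrightarrow> (\<integral>v. f (L v) \<partial>N)) F"
  proof (rule Lim_transform_eventually)
    show "\<forall>\<^sub>F l in F. (\<integral>\<omega>. f (Y l \<omega>) \<partial>M) = (\<integral>\<omega>. f (Y' l \<omega>) \<partial>M)"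
      using eq
    proof eventually_elim
      case (elim l)
      then show ?case by (intro Bochner_Integration.integral_cong) auto
    qed
  qed
qed

lemma fdd_converges_cong:
  assumes conv: "fdd_converges F I M Y N L"
    and eq: "\<forall>\<^sub>F l in F. \<forall>k\<in>I. \<forall>\<omega>\<in>space M. Y' l k \<omega> = Y l k \<omega>"
  shows "fdd_converges F I M Y' N L"
  unfolding fdd_converges_def
proof (intro allI impI)
  fix K assume K: "finite K \<and> K \<subseteq> I"
  show "converges_in_distribution F (powertop_real K) M (\<lambda>l \<omega>. \<lambda>k\<in>K. Y' l k \<omega>) N (\<lambda>v. \<lambda>k\<in>K. L k v)"
  proof (rule converges_in_distribution_cong)
    show "converges_in_distribution F (powertop_real K) M (\<lambda>l \<omega>. \<lambda>k\<in>K. Y l k \<omega>) N (\<lambda>v. \<lambda>k\<in>K. L k v)"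
      using conv K by (simp add: fdd_converges_def)
    show "\<forall>\<^sub>F l in F. \<forall>\<omega>\<in>space M. (\<lambda>k\<in>K. Y' l k \<omega>) = (\<lambda>k\<in>K. Y l k \<omega>)"
      using eq
    proof eventually_elim
      case (elim l)
      show ?case
      proof
        fix \<omega> assume "\<omega> \<in> space M"
        then show "(\<lambda>k\<in>K. Y' l k \<omega>) = (\<lambda>k\<in>K. Y l k \<omega>)"
          using elim K by (intro restrict_ext) auto
      qed
    qed
  qed
qed

text \<open>The exceptional set is enclosed in a Borel null set, and dilations map Borel null sets to null
  sets.\<close>

lemma AE_lebesgue_dilation:
  fixes P :: "'a::euclidean_space \<Rightarrow> bool"
  assumes ae: "AE t in lebesgue. P t" and l: "0 < l"
  shows "AE t in lebesgue. P (t /\<^sub>R l)"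
proof -
  from ae have "AE t in lborel. P t" by (simp add: AE_completion_iff)
  then obtain N where N: "{t. \<not> P t} \<subseteq> N" "N \<in> null_sets lborel"
    by (auto simp: eventually_ae_filter)
  have Nm [measurable]: "N \<in> sets borel" and N0: "emeasure lborel N = 0" using N(2) by auto
  have "ennreal (\<bar>inverse l\<bar> ^ DIM('a)) * (\<integral>\<^sup>+x. indicator N (0 + inverse l *\<^sub>R x) \<partial>(lborel :: 'a measure)) = 0"
    by (subst nn_integral_lborel_affine[symmetric]) (use l N0 in simp_all)
  then have "(\<integral>\<^sup>+x. indicator N (x /\<^sub>R l) \<partial>(lborel :: 'a measure)) = 0"
    using l zero_less_power[of "inverse l" "DIM('a)"] by (auto simp: ennreal_eq_0_iff simp del: zero_less_power)
  then have "AE x in lborel. indicator N (x /\<^sub>R l) = (0 :: ennreal)"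
    by (subst (asm) nn_integral_0_iff_AE) (auto intro: borel_measurable_indicator)
  then have "AE x in lborel. P (x /\<^sub>R l)"
    by eventually_elim (use N(1) in \<open>auto simp: indicator_def split: if_splits\<close>)
  then show ?thesis by (simp add: AE_completion_iff)
qed

text \<open>A Borel version, truncated so that the essential bound holds everywhere.\<close>

lemma L1_Linf_borel_version:
  assumes "\<phi>0 \<in> L1_Linf"
  obtains \<phi> C where "integrable lborel (\<phi> :: 'a::euclidean_space \<Rightarrow> real)" "\<And>v. \<bar>\<phi> v\<bar> \<le> C" "AE t in lebesgue. \<phi>0 t = \<phi> t"
proof -
  from assms obtain C0 where i: "integrable lebesgue \<phi>0" and C0: "AE t in lebesgue. \<bar>\<phi>0 t\<bar> \<le> C0"
    by (auto simp: L1_Linf_def)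
  obtain g where g [measurable]: "g \<in> borel_measurable lborel" and ae: "AE x in lborel. \<phi>0 x = g x"
    using completion_ex_borel_measurable_real[OF borel_measurable_integrable[OF i]] by blast
  define C where "C = max C0 0"
  define \<phi> where "\<phi> t = max (- C) (min C (g t))" for t
  have [measurable]: "\<phi> \<in> borel_measurable borel" unfolding \<phi>_def[abs_def] using g by measurable
  have "AE t in lebesgue. \<phi>0 t = g t" using ae by (simp add: AE_completion_iff)
  then have eq: "AE t in lebesgue. \<phi>0 t = \<phi> t"
    using C0 by eventually_elim (auto simp: \<phi>_def C_def)
  have "\<phi> \<in> borel_measurable lebesgue" by (rule measurable_completion) simp
  from integrable_cong_AE_imp[OF i this] eq have "integrable lebesgue \<phi>" by (auto simp: eq_commute)
  then have "integrable lborel \<phi>" by (subst (asm) integrable_completion) simp_all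
  moreover have "\<bar>\<phi> v\<bar> \<le> C" for v by (auto simp: \<phi>_def C_def)
  ultimately show thesis using that eq by blast
qed

context random_grain_model
begin

lemma fields_borel:
  assumes w: "\<omega> \<in> space M"
  shows "(\<lambda>t. grain_field u \<Xi>s \<omega> t) \<in> borel_measurable borel"
    and "(\<lambda>t. excess_field u \<Xi>s k \<omega> t) \<in> borel_measurable borel"
  using measurable_compose[OF measurable_Pair2'[OF w, of borel] grain_field_measurable]
    measurable_compose[OF measurable_Pair2'[OF w, of borel] excess_field_measurable]
  by simp_all

lemma lebesgue_integral_borel_version:
  fixes \<phi> \<phi>0 :: "'a \<Rightarrow> real"
  assumes i: "integrable lebesgue \<phi>0" and ae: "AE t in lebesgue. \<phi>0 t = \<phi> t" and m [measurable]: "\<phi> \<in> borel_measurable borel"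
    and l: "0 < l" and h [measurable]: "h \<in> borel_measurable borel"
  shows "(\<integral>t. \<phi>0 (t /\<^sub>R l) * h t \<partial>lebesgue) = (\<integral>t. \<phi> (t /\<^sub>R l) * h t \<partial>lborel)"
proof -
  have hm: "(\<lambda>t. \<phi> (t /\<^sub>R l) * h t) \<in> borel_measurable borel" by measurable
  have ae': "AE t in lebesgue. \<phi> (t /\<^sub>R l) * h t = \<phi>0 (t /\<^sub>R l) * h t"
    using AE_lebesgue_dilation[OF ae l] by eventually_elim simp
  have complete: "f \<in> borel_measurable lebesgue" if "f \<in> borel_measurable borel" for f :: "'a \<Rightarrow> real"
    by (rule measurable_completion) (simp only: measurable_lborel2 that)
  note hl = complete[OF hm]
  have "(\<lambda>t. \<phi>0 (t /\<^sub>R l)) \<in> borel_measurable lebesgue"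
    by (rule measurable_compose[OF lebesgue_measurable_scaling borel_measurable_integrable[OF i]])
  then have "(\<lambda>t. \<phi>0 (t /\<^sub>R l) * h t) \<in> borel_measurable lebesgue"
    by (rule borel_measurable_times) (rule complete[OF h])
  with hl ae' have "(\<integral>t. \<phi>0 (t /\<^sub>R l) * h t \<partial>lebesgue) = (\<integral>t. \<phi> (t /\<^sub>R l) * h t \<partial>lebesgue)"
    by (intro integral_cong_AE) (auto elim: eventually_mono)
  also have "\<dots> = (\<integral>t. \<phi> (t /\<^sub>R l) * h t \<partial>lborel)"
    by (rule integral_completion) (simp only: measurable_lborel2 hm)
  finally show ?thesis .
qed

end

theorem theorem1:
  fixes M :: "'w measure"
    and u :: "nat \<Rightarrow> 'w \<Rightarrow> 'a::euclidean_space"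
    and \<Xi> :: "'w \<Rightarrow> 'a set"
    and \<Xi>s :: "nat \<Rightarrow> 'w \<Rightarrow> 'a set"
    and \<alpha> c :: real
    and \<phi> :: "'a \<Rightarrow> real"
  assumes model: "random_grain_model M u \<Xi> \<Xi>s"
    and alpha: "1 < \<alpha>" "\<alpha> < 2"
    and c_pos: "0 < c"
    and tail: "(\<lambda>x. measure M {\<omega> \<in> space M. emeasure lborel (\<Xi> \<omega>) > ennreal x})
                 \<sim>[at_top] (\<lambda>x. c * x powr (- \<alpha>))"
    and localization:
      "(\<lambda>l. enn2real (\<integral>\<^sup>+ \<omega>. emeasure lborel (\<Xi> \<omega> \<inter> {t. norm t > l}) \<partial>M))
         \<in> o[at_top](\<lambda>l. l powr ((1 - \<alpha>) * DIM('a) / \<alpha>))"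
    and phi: "\<phi> \<in> L1_Linf"
  shows "\<exists>(N :: real measure) (L :: real \<Rightarrow> real).
      prob_space N \<and> L \<in> borel_measurable N \<and>
      stable_law \<alpha> (distr N borel L) \<and>
      (\<forall>\<theta>. char (distr N borel L) \<theta> = exp (log_char_limit \<alpha> c \<phi> \<theta>)) \<and>
      converges_in_distribution at_top euclideanreal
        M (\<lambda>l \<omega>. l powr (- real DIM('a) / \<alpha>) *
             (scaled_integral u \<Xi>s l \<phi> \<omega> - (\<integral>\<omega>'. scaled_integral u \<Xi>s l \<phi> \<omega>' \<partial>M)))
        N L \<and>
      fdd_converges at_top {1..}
        M (\<lambda>l k \<omega>. l powr (- real DIM('a) / \<alpha>) *
             (scaled_excess_integral u \<Xi>s l k \<phi> \<omega>
              - (\<integral>\<omega>'. scaled_excess_integral u \<Xi>s l k \<phi> \<omega>' \<partial>M)))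
        N (\<lambda>k v. exp (- mean_volume M \<Xi>) * mean_volume M \<Xi> ^ (k - 1) / fact (k - 1) * L v)"
proof -
  interpret random_grain_model M u \<Xi> \<Xi>s by (rule model)
  interpret heavy_tailed_grain_model M u \<Xi> \<Xi>s \<alpha> c
  proof unfold_locales
    show "\<Xi> \<in> measurable M (borel_of fell_topology)" by (rule grain_measurable)
    show "(\<integral>\<^sup>+\<omega>. emeasure lborel (\<Xi> \<omega>) \<partial>M) < \<infinity>" using generic_grain by (simp add: random_grain_def)
  qed fact+
  have i: "integrable lebesgue \<phi>" using phi by (simp add: L1_Linf_def)
  obtain \<phi>' C where \<phi>': "integrable lborel \<phi>'" "\<And>v. \<bar>\<phi>' v\<bar> \<le> C" and ae: "AE t in lebesgue. \<phi> t = \<phi>' t"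
    using L1_Linf_borel_version[OF phi] by metis
  have m: "\<phi>' \<in> borel_measurable borel" using \<phi>'(1) by auto
  have field: "scaled_integral u \<Xi>s l \<phi> \<omega> = field_sum \<phi>' l \<omega>"
    and excess: "scaled_excess_integral u \<Xi>s l k \<phi> \<omega> = excess_sum \<phi>' l k \<omega>"
    if l: "0 < l" and w: "\<omega> \<in> space M" for l k \<omega>
  proof -
    note eq = lebesgue_integral_borel_version[OF i ae m l]
    show "scaled_integral u \<Xi>s l \<phi> \<omega> = field_sum \<phi>' l \<omega>"
      unfolding scaled_integral_def field_sum_def[OF \<phi>']
      by (rule eq) (rule borel_measurable_enn2real[OF fields_borel(1)[OF w]])
    show "scaled_excess_integral u \<Xi>s l k \<phi> \<omega> = excess_sum \<phi>' l k \<omega>"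
      unfolding scaled_excess_integral_def excess_sum_def[OF \<phi>']
      by (rule eq) (rule fields_borel(2)[OF w])
  qed
  obtain \<nu> where \<nu>: "real_distribution \<nu>" "char \<nu> = (\<lambda>\<theta>. exp (log_char \<phi>' \<theta>))" "stable_law \<alpha> \<nu>"
    "converges_in_distribution at_top euclideanreal M (fluctuation \<phi>') \<nu> (\<lambda>x. x)"
    "fdd_converges at_top {1..} M (excess_fluctuation \<phi>') \<nu> (\<lambda>k v. poisson_weight mean_vol (k - 1) * v)"
    using fluctuation_limits[OF \<phi>'] by blast
  interpret \<nu>: real_distribution \<nu> by (rule \<nu>(1))
  have id: "distr \<nu> borel (\<lambda>x. x) = \<nu>" by (rule distr_id2) simp
  have field_limit: "converges_in_distribution at_top euclideanreal
      M (\<lambda>l \<omega>. l powr (- real DIM('a) / \<alpha>) *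
           (scaled_integral u \<Xi>s l \<phi> \<omega> - (\<integral>\<omega>'. scaled_integral u \<Xi>s l \<phi> \<omega>' \<partial>M)))
      \<nu> (\<lambda>x. x)"
  proof (rule converges_in_distribution_cong[OF \<nu>(4) eventually_mono[OF eventually_gt_at_top[of "0::real"]]], rule ballI)
    fix l :: real and \<omega> assume l: "0 < l" and w: "\<omega> \<in> space M"
    have "(\<integral>\<omega>'. scaled_integral u \<Xi>s l \<phi> \<omega>' \<partial>M) = expectation (field_sum \<phi>' l)"
      by (rule Bochner_Integration.integral_cong[OF refl field[OF l]])
    then show "l powr (- real DIM('a) / \<alpha>) * (scaled_integral u \<Xi>s l \<phi> \<omega> - (\<integral>\<omega>'. scaled_integral u \<Xi>s l \<phi> \<omega>' \<partial>M)) = fluctuation \<phi>' l \<omega>"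
      by (simp only: fluctuation_def[OF \<phi>'] scaling_def field[OF l w])
  qed
  have excess_limit: "fdd_converges at_top {1..}
      M (\<lambda>l k \<omega>. l powr (- real DIM('a) / \<alpha>) *
           (scaled_excess_integral u \<Xi>s l k \<phi> \<omega> - (\<integral>\<omega>'. scaled_excess_integral u \<Xi>s l k \<phi> \<omega>' \<partial>M)))
      \<nu> (\<lambda>k v. poisson_weight mean_vol (k - 1) * v)"
  proof (rule fdd_converges_cong[OF \<nu>(5) eventually_mono[OF eventually_gt_at_top[of "0::real"]]], intro ballI)
    fix l :: real and k \<omega> assume l: "0 < l" and w: "\<omega> \<in> space M"
    have "(\<integral>\<omega>'. scaled_excess_integral u \<Xi>s l k \<phi> \<omega>' \<partial>M) = expectation (excess_sum \<phi>' l k)"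
      by (rule Bochner_Integration.integral_cong[OF refl excess[OF l]])
    then show "l powr (- real DIM('a) / \<alpha>) * (scaled_excess_integral u \<Xi>s l k \<phi> \<omega> - (\<integral>\<omega>'. scaled_excess_integral u \<Xi>s l k \<phi> \<omega>' \<partial>M)) = excess_fluctuation \<phi>' l k \<omega>"
      by (simp only: excess_fluctuation_def[OF \<phi>'] scaling_def excess[OF l w])
  qed
  have "char \<nu> \<theta> = exp (log_char_limit \<alpha> c \<phi> \<theta>)" for \<theta>
    by (simp add: \<nu>(2) log_char_limit_eq[OF m ae borel_measurable_integrable[OF i]])
  with \<nu>(3) field_limit excess_limit \<nu>.prob_space_axioms show ?thesis
    by (intro exI[of _ \<nu>] exI[of _ "\<lambda>x. x"]) (simp add: id poisson_weight_def)
qed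

end
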